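(* Let $3\le N\le 10$ and $h>-2(N-2)$. Define $$a_h(r):=\Bigl(1+\frac{h}{2(N-2)}r^2\Bigr)e^{\frac{h}{2N}r^2}\quad\text{and}\quad \lambda_h:=2(N-2)e^{-\frac{h}{2N}} .$$ Then $$U_h(x):=\frac{h}{2N}-2\log|x|-\frac{h}{2N}|x|^2$$ is a radial singular solution of $$-\Delta u=\lambda a(|x|)e^{u}\ \text{ in } B_1,\qquad u>0\ \text{ in } B_1,\qquad u=0\ \text{ on }\partial B_1 \tag{P}$$ for $a=a_h$ and $\lambda=\lambda_h$. Moreover, letting $H$ be the first (Dirichlet) eigenvalue of $-\Delta$ in the unit ball of $\mathbb{R}^2$: - $m(U_h)=\infty$ if $N\le 9$; - $m(U_h)=0$ and $U_h$ is stable if $N=10$ and $h\le H$; - $1\le m(U_h)<\infty$ if $N=10$ and $h>H$. As a consequence, when $N=10$ and $a=a_h$, the bifurcation diagram of (P) is of Type II if and only if $h\le H$. In particular, when $N=10$ the bifurcation structure changes at $a_H$.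
   Context: $B_1\subset\mathbb{R}^N$ is the open unit ball. Radial functions are identified with functions of $r=|x|$, and then $\Delta=\frac{d^2}{dr^2}+\frac{N-1}{r}\frac{d}{dr}$. A pair $(\lambda,U)$ with $\lambda>0$ is a radial singular solution of (P) if $U$ is radial, $U\in C^2((0,1])$ as a function of $r$, $-\Delta U=\lambda a(r)e^{U}$ and $U>0$ for $0<r<1$, $U(1)=0$, and $U(r)\to\infty$ as $r\to0$. For a solution $(\lambda,u)$ of (P) put $$Q_u(\xi):=\int_{B_1}|\nabla\xi|^2\,dx-\int_{B_1}\lambda a(|x|)e^{u}\xi^2\,dx .$$ $u$ is stable if $Q_u(\xi)\ge0$ for all $\xi\in C_0^\infty(B_1)$. The (radial) Morse index $m(u)$ is the maximal dimension of a subspace $X\subset H^1_{0,\mathrm{rad}}(B_1)$ such that $Q_u(\xi)<0$ for all $\xi\in X\setminus\{0\}$, where $H^1_{0,\mathrm{rad}}(B_1)$ is the space of radially symmetric functions in $H^1_0(B_1)$. For $U_h$ these are taken with $\lambda=\lambda_h$, $a=a_h$. For $\beta\in\mathbb{R}$, $v(\cdot,\beta)$ denotes the solution on $[0,1]$ of $-\Delta v=a(r)e^{v}$, $v(0,\beta)=\beta$, $\frac{d}{dr}v(0,\beta)=0$. Put $\lambda(\beta):=e^{v(1,\beta)}$, $u_\beta(r):=v(r,\beta)-\log\lambda(\beta)$, $\alpha(\beta):=\beta-\log\lambda(\beta)=\lVert u_\beta\rVert_{L^\infty(B_1)}$. The pairs $(\lambda(\beta),u_\beta)$, $\beta\in\mathbb{R}$,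 are exactly the classical radial solutions of (P), and $\mathcal{C}:=\{(\lambda(\beta),\alpha(\beta));\beta\in\mathbb{R}\}$ is called the bifurcation curve. Type II: the curve $\mathcal{C}$ can be parametrized by $\lambda$, with $\alpha$ increasing in $\lambda$ and blowing up at some value; i.e. there are $\lambda_*\in(0,\infty)$ and an increasing function $\lambda\mapsto\alpha(\lambda)$ on $(0,\lambda_* )$ with $\mathcal{C}=\{(\lambda,\alpha(\lambda)):0<\lambda<\lambda_*\}$ and $\alpha(\lambda)\to\infty$ as $\lambda\uparrow\lambda_*$. "The bifurcation structure changes at $a_H$" means that the diagram for $a=a_h$ is of Type II for $h\le H$ and is not of Type II for $h>H$. *)

theory Defs
  imports "HOL-Analysis.Analysis" "HOL-Library.Function_Algebras" "HOL-Library.Extended_Nat"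
begin

section \<open>Smooth functions and Dirichlet eigenvalues\<close>

definition partial_derivative :: "'a::euclidean_space \<Rightarrow> ('a \<Rightarrow> real) \<Rightarrow> 'a \<Rightarrow> real" where
  "partial_derivative b f x = frechet_derivative f (at x) b"

text \<open>The class $C^k(S)$. It is meant for open \<open>S\<close> only, since \<open>partial_derivative\<close> is two-sided.\<close>

fun Ck_on :: "nat \<Rightarrow> 'a::euclidean_space set \<Rightarrow> ('a \<Rightarrow> real) \<Rightarrow> bool" where
  "Ck_on 0 S f \<longleftrightarrow> continuous_on S f"
| "Ck_on (Suc k) S f \<longleftrightarrow>
     (\<forall>x\<in>S. f differentiable (at x)) \<and> (\<forall>b\<in>Basis. Ck_on k S (partial_derivative b f))"

definition test_function :: "'a::euclidean_space set \<Rightarrow> ('a \<Rightarrow> real) \<Rightarrow> bool" where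
  "test_function \<Omega> \<phi> \<longleftrightarrow> (\<forall>k. Ck_on k UNIV \<phi>) \<and>
     compact (closure {x. \<phi> x \<noteq> 0}) \<and> closure {x. \<phi> x \<noteq> 0} \<subseteq> \<Omega>"

definition gradient :: "('a::euclidean_space \<Rightarrow> real) \<Rightarrow> 'a \<Rightarrow> 'a" where
  "gradient f x = (\<Sum>b\<in>Basis. partial_derivative b f x *\<^sub>R b)"

definition laplacian :: "('a::euclidean_space \<Rightarrow> real) \<Rightarrow> 'a \<Rightarrow> real" where
  "laplacian f x = (\<Sum>b\<in>Basis. partial_derivative b (partial_derivative b f) x)"

definition dirichlet_eigenvalue :: "'a::euclidean_space set \<Rightarrow> real \<Rightarrow> bool" where
  "dirichlet_eigenvalue \<Omega> \<mu> \<longleftrightarrow>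
     (\<exists>\<phi>. Ck_on 2 \<Omega> \<phi> \<and> continuous_on (closure \<Omega>) \<phi> \<and>
        (\<forall>x\<in>\<Omega>. - laplacian \<phi> x = \<mu> * \<phi> x) \<and>
        (\<forall>x\<in>frontier \<Omega>. \<phi> x = 0) \<and> (\<exists>x\<in>\<Omega>. \<phi> x \<noteq> 0))"

definition first_dirichlet_eigenvalue :: "'a::euclidean_space set \<Rightarrow> real" where
  "first_dirichlet_eigenvalue \<Omega> = (LEAST \<mu>. dirichlet_eigenvalue \<Omega> \<mu>)"


section \<open>The Sobolev space $H^1_0$ and its radial part\<close>

text \<open>Elements of $L^2$ and $H^1$ are represented by Lebesgue measurable functions, not by
  classes modulo null sets; their values outside \<open>\<Omega>\<close> are irrelevant.\<close>

definition L2_on :: "'a::euclidean_space set \<Rightarrow> ('a \<Rightarrow> 'b::euclidean_space) \<Rightarrow> bool" where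
  "L2_on \<Omega> f \<longleftrightarrow> f \<in> borel_measurable (lebesgue_on \<Omega>) \<and>
     integrable (lebesgue_on \<Omega>) (\<lambda>x. (norm (f x))\<^sup>2)"

definition is_weak_gradient ::
    "'a::euclidean_space set \<Rightarrow> ('a \<Rightarrow> real) \<Rightarrow> ('a \<Rightarrow> 'a) \<Rightarrow> bool" where
  "is_weak_gradient \<Omega> f g \<longleftrightarrow> L2_on \<Omega> f \<and> L2_on \<Omega> g \<and>
     (\<forall>\<phi>. test_function \<Omega> \<phi> \<longrightarrow> (\<forall>b\<in>Basis.
        (\<integral>x. f x * partial_derivative b \<phi> x \<partial>lebesgue_on \<Omega>) =
        - (\<integral>x. (g x \<bullet> b) * \<phi> x \<partial>lebesgue_on \<Omega>)))"

text \<open>On open \<open>\<Omega>\<close> a weak gradient is unique up to a null set, so the choice does not affect integrals.\<close>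

definition weak_gradient :: "'a::euclidean_space set \<Rightarrow> ('a \<Rightarrow> real) \<Rightarrow> 'a \<Rightarrow> 'a" where
  "weak_gradient \<Omega> f = (SOME g. is_weak_gradient \<Omega> f g)"

definition H1 :: "'a::euclidean_space set \<Rightarrow> ('a \<Rightarrow> real) set" where
  "H1 \<Omega> = {f. \<exists>g. is_weak_gradient \<Omega> f g}"

definition H10 :: "'a::euclidean_space set \<Rightarrow> ('a \<Rightarrow> real) set" where
  "H10 \<Omega> = {f \<in> H1 \<Omega>. \<exists>\<phi>. (\<forall>n::nat. test_function \<Omega> (\<phi> n)) \<and>
     (\<lambda>n. (\<integral>x. (\<phi> n x - f x)\<^sup>2 \<partial>lebesgue_on \<Omega>) +
          (\<integral>x. (norm (gradient (\<phi> n) x - weak_gradient \<Omega> f x))\<^sup>2 \<partial>lebesgue_on \<Omega>))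
       \<longlonglongrightarrow> 0}"

definition H10_rad :: "('a::euclidean_space \<Rightarrow> real) set" where
  "H10_rad = {f \<in> H10 (ball 0 1). \<exists>g. AE x in lebesgue_on (ball 0 1). f x = g (norm x)}"


section \<open>Stability and Morse index\<close>

definition Q_form ::
    "real \<Rightarrow> (real \<Rightarrow> real) \<Rightarrow> ('a::euclidean_space \<Rightarrow> real) \<Rightarrow> ('a \<Rightarrow> real) \<Rightarrow> real" where
  "Q_form l a u \<xi> =
     (\<integral>x. (norm (weak_gradient (ball 0 1) \<xi> x))\<^sup>2 \<partial>lebesgue_on (ball 0 1)) -
     (\<integral>x. l * a (norm x) * exp (u x) * (\<xi> x)\<^sup>2 \<partial>lebesgue_on (ball 0 1))"

definition stable_solution :: "real \<Rightarrow> (real \<Rightarrow> real) \<Rightarrow> ('a::euclidean_space \<Rightarrow> real) \<Rightarrow> bool" where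
  "stable_solution l a u \<longleftrightarrow> (\<forall>\<xi>. test_function (ball 0 1) \<xi> \<longrightarrow> Q_form l a u \<xi> \<ge> 0)"

definition fun_scale :: "real \<Rightarrow> ('a \<Rightarrow> real) \<Rightarrow> 'a \<Rightarrow> real" where
  "fun_scale c f = (\<lambda>x. c * f x)"

definition fun_edim :: "('a \<Rightarrow> real) set \<Rightarrow> enat" where
  "fun_edim X = (if \<exists>B. finite B \<and> module.span fun_scale B = X
     then enat (vector_space.dim fun_scale X) else \<infinity>)"

text \<open>Here \<open>X\<close> is a space of representatives. A representative vanishing almost everywhere on the
  ball has \<open>Q_form\<close> equal to 0, so negativity on all of \<open>X - {0}\<close> makes the passage from \<open>X\<close> to
  almost-everywhere classes injective; hence the dimension of \<open>X\<close> is that of its image in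
  $H^1_{0,rad}$, and each subspace of classes arises from representatives of a basis.\<close>

definition morse_index :: "real \<Rightarrow> (real \<Rightarrow> real) \<Rightarrow> ('a::euclidean_space \<Rightarrow> real) \<Rightarrow> enat" where
  "morse_index l a u = Sup {fun_edim X | X.
     module.subspace fun_scale X \<and> X \<subseteq> H10_rad \<and> (\<forall>\<xi>\<in>X - {0}. Q_form l a u \<xi> < 0)}"


section \<open>Radial solutions and the bifurcation curve\<close>

text \<open>Radial $C^2$ solutions of $-\Delta u = l\,a(r)e^u$ in dimension \<open>N\<close>, as functions of $r$ on an
  interval \<open>S\<close> from 0 to 1; derivatives at end points belonging to \<open>S\<close> are one-sided.\<close>

definition radial_equation ::
    "nat \<Rightarrow> real \<Rightarrow> (real \<Rightarrow> real) \<Rightarrow> real set \<Rightarrow> (real \<Rightarrow> real) \<Rightarrow> bool" where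
  "radial_equation N l a S u \<longleftrightarrow> (\<exists>u' u''.
     (\<forall>r\<in>S. (u has_real_derivative u' r) (at r within S)) \<and>
     (\<forall>r\<in>S. (u' has_real_derivative u'' r) (at r within S)) \<and>
     continuous_on S u'' \<and>
     (\<forall>r\<in>{0<..<1}. - (u'' r + (real N - 1) / r * u' r) = l * a r * exp (u r)))"

definition radial_singular_solution ::
    "(real \<Rightarrow> real) \<Rightarrow> real \<Rightarrow> ('a::euclidean_space \<Rightarrow> real) \<Rightarrow> bool" where
  "radial_singular_solution a l U \<longleftrightarrow> l > 0 \<and>
     (\<exists>u. (\<forall>x\<in>cball 0 1 - {0}. U x = u (norm x)) \<and>
        radial_equation DIM('a) l a {0<..1} u \<and>
        (\<forall>r\<in>{0<..<1}. u r > 0) \<and> u 1 = 0 \<and> filterlim u at_top (at_right 0))"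

definition is_shooting_solution ::
    "nat \<Rightarrow> (real \<Rightarrow> real) \<Rightarrow> real \<Rightarrow> (real \<Rightarrow> real) \<Rightarrow> bool" where
  "is_shooting_solution N a \<beta> v \<longleftrightarrow> radial_equation N 1 a {0..1} v \<and> v 0 = \<beta> \<and>
     (v has_real_derivative 0) (at 0 within {0..1})"

text \<open>\<open>v(r, \<beta>)\<close>; only its values for $0 \le r \le 1$ are meaningful.\<close>

definition shooting_solution :: "nat \<Rightarrow> (real \<Rightarrow> real) \<Rightarrow> real \<Rightarrow> real \<Rightarrow> real" where
  "shooting_solution N a \<beta> = (SOME v. is_shooting_solution N a \<beta> v)"

definition bif_lambda :: "nat \<Rightarrow> (real \<Rightarrow> real) \<Rightarrow> real \<Rightarrow> real" where
  "bif_lambda N a \<beta> = exp (shooting_solution N a \<beta> 1)"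

definition bif_alpha :: "nat \<Rightarrow> (real \<Rightarrow> real) \<Rightarrow> real \<Rightarrow> real" where
  "bif_alpha N a \<beta> = \<beta> - ln (bif_lambda N a \<beta>)"

definition bifurcation_curve :: "nat \<Rightarrow> (real \<Rightarrow> real) \<Rightarrow> (real \<times> real) set" where
  "bifurcation_curve N a = range (\<lambda>\<beta>. (bif_lambda N a \<beta>, bif_alpha N a \<beta>))"

definition type_II :: "nat \<Rightarrow> (real \<Rightarrow> real) \<Rightarrow> bool" where
  "type_II N a \<longleftrightarrow> (\<exists>l0 > 0. \<exists>\<alpha>. strict_mono_on {0<..<l0} \<alpha> \<and>
     bifurcation_curve N a = {(l, \<alpha> l) | l. 0 < l \<and> l < l0} \<and>
     filterlim \<alpha> at_top (at_left l0))"

definition structure_changes_at ::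
    "nat \<Rightarrow> (real \<Rightarrow> real \<Rightarrow> real) \<Rightarrow> real set \<Rightarrow> real \<Rightarrow> bool" where
  "structure_changes_at N a I H \<longleftrightarrow> H \<in> I \<and>
     (\<forall>h\<in>I. h \<le> H \<longrightarrow> type_II N (a h)) \<and> (\<forall>h\<in>I. h > H \<longrightarrow> \<not> type_II N (a h))"


section \<open>The explicit family\<close>

definition a_coef :: "nat \<Rightarrow> real \<Rightarrow> real \<Rightarrow> real" where
  "a_coef N h r = (1 + h / (2 * (real N - 2)) * r\<^sup>2) * exp (h / (2 * real N) * r\<^sup>2)"

definition lambda_sing :: "nat \<Rightarrow> real \<Rightarrow> real" where
  "lambda_sing N h = 2 * (real N - 2) * exp (- (h / (2 * real N)))"

definition U_sing :: "real \<Rightarrow> 'a::euclidean_space \<Rightarrow> real" where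
  "U_sing h x = h / (2 * real DIM('a)) - 2 * ln (norm x) - h / (2 * real DIM('a)) * (norm x)\<^sup>2"

end

theory Submission
  imports Defs "HOL-Computational_Algebra.Polynomial"
begin

text \<open>At the singular solution the potential is \<open>\<lambda> a exp U = 2(N - 2)/r\<^sup>2 + h\<close>. Writing a radial
  function as \<open>r\<^bsup>-(N-2)/2\<^esup> F\<close> turns the quadratic form into the integral of
  \<open>r F'\<^sup>2 - ((N - 2)(10 - N)/4) F\<^sup>2 / r - h r F\<^sup>2\<close>. For \<open>N \<le> 9\<close> the Hardy part is negative, and bumps
  spread out on a logarithmic scale give arbitrarily many disjoint negative directions. For \<open>N = 10\<close> it
  vanishes, and what remains is the form of \<open>-\<Delta> - h\<close> on the unit disc: it is nonnegative iff \<open>h \<le> H\<close>, by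
  Picone's identity with the ground state \<open>J\<^sub>0(\<surd>H r)\<close> (here \<open>bes (H r\<^sup>2)\<close>), and a Poincare inequality on
  finitely many thin shells bounds the number of negative directions. For the diagram,
  the shooting solutions are compared with the singular one: if \<open>h \<le> H\<close>, Sturm comparison keeps
  them ordered in \<open>\<beta>\<close> and below the singular solution. Conversely, in a diagram of type II they are ordered and
  converge to it from below, which forces the linearised form at the singular solution to be
  nonnegative.\<close>

section \<open>Functions of class $C^k$\<close>

text \<open>Dimension 10 is critical because there 2 (N - 2) = 16 = (N - 2)^2/4: the potential
  carries exactly the best Hardy constant, so the sign of the form is decided by the two-dimensional
  remainder. Three obstacles shape the proof. The form lives on \<open>H10\<close>, whose elements
  are only limits of test functions, and stability tests non-radial functions; both are handled by
  one-dimensional inequalities along rays, integrated in polar coordinates and carried to the limit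
  by Fatou's lemma. Type II, in turn, speaks only about values at r = 0 and r = 1; the order of the
  whole solutions is recovered by lowering both initial values together until they are trivially
  ordered, a contact in between being excluded by unique continuation. Finally, convergence to the
  singular solution is needed also for h > H, where the comparison fails on the unit ball; it still
  works on a small ball, and an energy estimate carries the convergence out to r = 1.\<close>

lemma partial_derivative_eq:
  assumes "(f has_derivative f') (at x)"
  shows "partial_derivative b f x = f' b"
  using frechet_derivative_at[OF assms] by (simp add: partial_derivative_def)

lemma partial_derivative_real:
  assumes "(f has_real_derivative d) (at x)"
  shows "partial_derivative 1 f x = d"
  using partial_derivative_eq[of f "(*) d" x 1] assms by (simp add: has_field_derivative_def)

lemma partial_derivative_cong_open:
  assumes "open S" "x \<in> S" "\<And>y. y \<in> S \<Longrightarrow> f y = g y"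
  shows "partial_derivative b f x = partial_derivative b g x"
proof -
  have "(f has_derivative f') (at x) \<longleftrightarrow> (g has_derivative f') (at x)" for f'
    using has_derivative_transform_within_open[of f f' x UNIV S g] has_derivative_transform_within_open[of g f' x UNIV S f]
      assms by auto
  then show ?thesis by (simp add: partial_derivative_def frechet_derivative_def)
qed

lemma Ck_on_cong:
  assumes "open S" "\<And>y. y \<in> S \<Longrightarrow> f y = g y"
  shows "Ck_on k S f \<longleftrightarrow> Ck_on k S g"
  using assms
proof (induction k arbitrary: f g)
  case 0
  then show ?case using continuous_on_cong[of S S f g] by simp
next
  case (Suc k)
  have "f differentiable (at x) \<longleftrightarrow> g differentiable (at x)" if "x \<in> S" for x
    using has_derivative_transform_within_open[of f _ x UNIV S g] has_derivative_transform_within_open[of g _ x UNIV S f]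
      Suc.prems that unfolding differentiable_def by (metis UNIV_I)
  moreover have "Ck_on k S (partial_derivative b f) \<longleftrightarrow> Ck_on k S (partial_derivative b g)" for b
    using Suc.prems by (intro Suc.IH partial_derivative_cong_open) auto
  ultimately show ?case by simp
qed

lemma Ck_on_subset: "Ck_on k S f \<Longrightarrow> T \<subseteq> S \<Longrightarrow> Ck_on k T f"
  by (induction k arbitrary: f) (auto intro: continuous_on_subset)

lemma Ck_on_continuous: "Ck_on k S f \<Longrightarrow> continuous_on S f"
  by (cases k) (auto intro!: continuous_at_imp_continuous_on differentiable_imp_continuous_within)

lemma Ck_on_SucD: "Ck_on (Suc k) S f \<Longrightarrow> Ck_on k S f"
proof (induction k arbitrary: f)
  case 0
  then show ?case using Ck_on_continuous[OF 0] by simp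
next
  case (Suc k)
  then show ?case by (metis Ck_on.simps(2))
qed

lemma Ck_on_SucI:
  assumes "open S" "\<And>x. x \<in> S \<Longrightarrow> (f has_derivative f' x) (at x)"
    and "\<And>b. b \<in> Basis \<Longrightarrow> Ck_on k S (\<lambda>x. f' x b)"
  shows "Ck_on (Suc k) S f"
proof -
  have "Ck_on k S (partial_derivative b f)" if "b \<in> Basis" for b
    using Ck_on_cong[OF assms(1), of "partial_derivative b f" "\<lambda>x. f' x b" k] assms(2,3) that
    by (simp add: partial_derivative_eq)
  then show ?thesis using assms by (auto simp: differentiable_def)
qed

lemma Ck_on_real_SucI:
  fixes f :: "real \<Rightarrow> real"
  assumes "open S" "\<And>x. x \<in> S \<Longrightarrow> (f has_real_derivative f' x) (at x)"
    and "Ck_on k S f'"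
  shows "Ck_on (Suc k) S f"
  using assms by (intro Ck_on_SucI[where f'="\<lambda>x. (*) (f' x)"]) (auto simp: has_field_derivative_def)

lemma Ck_on_real_deriv:
  fixes f :: "real \<Rightarrow> real"
  assumes "Ck_on (Suc k) S f" "open S"
  shows "Ck_on k S (deriv f)" "\<And>x. x \<in> S \<Longrightarrow> (f has_real_derivative deriv f x) (at x)"
proof -
  show *: "(f has_real_derivative deriv f x) (at x)" if "x \<in> S" for x
    using assms that by (auto simp: DERIV_deriv_iff_real_differentiable)
  have "Ck_on k S (partial_derivative 1 f)" using assms by simp
  then show "Ck_on k S (deriv f)"
    using Ck_on_cong[OF assms(2), of "partial_derivative 1 f" "deriv f" k] partial_derivative_real[OF *] by simp
qed

lemma Ck_on_const [simp]:
  assumes "open S" shows "Ck_on k S (\<lambda>_. c)"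
proof (induction k arbitrary: c)
  case (Suc k)
  then show ?case by (intro Ck_on_SucI[where f'="\<lambda>x h. 0"] assms) auto
qed auto

lemma Ck_on_has_derivative:
  assumes "Ck_on (Suc k) S f" "x \<in> S"
  shows "(f has_derivative frechet_derivative f (at x)) (at x)"
  using assms by (simp add: frechet_derivative_works)

lemma Ck_on_frechet:
  assumes "Ck_on (Suc k) S f" "b \<in> Basis"
  shows "Ck_on k S (\<lambda>x. frechet_derivative f (at x) b)"
  using assms by (simp add: partial_derivative_def[abs_def])

lemma Ck_on_add:
  assumes "open S" "Ck_on k S f" "Ck_on k S g"
  shows "Ck_on k S (\<lambda>x. f x + g x)"
  using assms
proof (induction k arbitrary: f g)
  case 0 then show ?case by (auto intro: continuous_intros)
next
  case (Suc k)
  show ?case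
  proof (rule Ck_on_SucI[OF Suc.prems(1)])
    show "((\<lambda>x. f x + g x) has_derivative (\<lambda>h. frechet_derivative f (at x) h + frechet_derivative g (at x) h)) (at x)"
      if "x \<in> S" for x
      using Suc.prems that by (intro has_derivative_add Ck_on_has_derivative)
    show "Ck_on k S (\<lambda>x. frechet_derivative f (at x) b + frechet_derivative g (at x) b)" if "b \<in> Basis" for b
      using Suc.IH[OF Suc.prems(1) Ck_on_frechet[OF Suc.prems(2) that] Ck_on_frechet[OF Suc.prems(3) that]] .
  qed
qed

lemma Ck_on_mult:
  assumes "open S" "Ck_on k S f" "Ck_on k S g"
  shows "Ck_on k S (\<lambda>x. f x * g x)"
  using assms
proof (induction k arbitrary: f g)
  case 0 then show ?case by (auto intro: continuous_intros)
next
  case (Suc k)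
  show ?case
  proof (rule Ck_on_SucI[OF Suc.prems(1)])
    show "((\<lambda>x. f x * g x) has_derivative (\<lambda>h. f x * frechet_derivative g (at x) h + frechet_derivative f (at x) h * g x)) (at x)"
      if "x \<in> S" for x
      using Suc.prems that by (intro has_derivative_mult Ck_on_has_derivative)
    show "Ck_on k S (\<lambda>x. f x * frechet_derivative g (at x) b + frechet_derivative f (at x) b * g x)" if "b \<in> Basis" for b
      by (intro Ck_on_add Suc.IH Suc.prems(1) Ck_on_frechet[OF Suc.prems(2) that]
          Ck_on_frechet[OF Suc.prems(3) that] Ck_on_SucD[OF Suc.prems(2)] Ck_on_SucD[OF Suc.prems(3)])
  qed
qed

text \<open>The derivative is \<open>deriv g (f x)\<close> times that of \<open>f\<close>, so the
  induction keeps \<open>f\<close> fixed and ranges over the outer function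
  \<open>g\<close>.\<close>

lemma Ck_on_compose:
  fixes g :: "real \<Rightarrow> real"
  assumes "open S" "open T" "Ck_on k S f" "Ck_on k T g" "\<And>x. x \<in> S \<Longrightarrow> f x \<in> T"
  shows "Ck_on k S (\<lambda>x. g (f x))"
  using assms
proof (induction k arbitrary: g)
  case 0 then show ?case using continuous_on_compose2[of T g S f] by auto
next
  case (Suc k)
  note g = Ck_on_real_deriv[OF Suc.prems(4,2)]
  show ?case
  proof (rule Ck_on_SucI[OF Suc.prems(1)])
    show "((\<lambda>x. g (f x)) has_derivative (\<lambda>h. deriv g (f x) * frechet_derivative f (at x) h)) (at x)"
      if "x \<in> S" for x
      using has_derivative_compose[OF Ck_on_has_derivative[OF Suc.prems(3) that] g(2)[OF Suc.prems(5)[OF that], unfolded has_field_derivative_def]] .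
    show "Ck_on k S (\<lambda>x. deriv g (f x) * frechet_derivative f (at x) b)" if "b \<in> Basis" for b
      by (rule Ck_on_mult[OF Suc.prems(1) Suc.IH[OF Suc.prems(1,2) Ck_on_SucD[OF Suc.prems(3)] g(1) Suc.prems(5)]
            Ck_on_frechet[OF Suc.prems(3) that]])
  qed
qed

lemma Ck_on_inner [simp]:
  assumes "open S" shows "Ck_on k S (\<lambda>x. x \<bullet> b)"
proof (cases k)
  case (Suc k')
  show ?thesis unfolding Suc
    by (rule Ck_on_SucI[OF assms, where f'="\<lambda>x h. h \<bullet> b"])
       (auto intro!: derivative_eq_intros Ck_on_const[OF assms])
qed (auto intro: continuous_intros)

lemma Ck_on_id [simp]:
  assumes "open S" shows "Ck_on k S (\<lambda>x::real. x)"
  using Ck_on_inner[OF assms, of k 1] by simp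

lemma Ck_on_minus:
  assumes "open S" "Ck_on k S f" shows "Ck_on k S (\<lambda>x. - f x)"
  using Ck_on_mult[OF assms(1) Ck_on_const[OF assms(1), of k "-1"] assms(2)] by simp

lemma Ck_on_diff:
  assumes "open S" "Ck_on k S f" "Ck_on k S g" shows "Ck_on k S (\<lambda>x. f x - g x)"
  using Ck_on_add[OF assms(1,2) Ck_on_minus[OF assms(1,3)]] by simp

lemma Ck_on_sum:
  assumes "open S" "\<And>i. i \<in> I \<Longrightarrow> Ck_on k S (f i)"
  shows "Ck_on k S (\<lambda>x. \<Sum>i\<in>I. f i x)"
  using assms(2) by (induction I rule: infinite_finite_induct) (auto intro: Ck_on_add assms(1) simp: assms(1))

lemma Ck_on_prod:
  assumes "open S" "\<And>i. i \<in> I \<Longrightarrow> Ck_on k S (f i)"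
  shows "Ck_on k S (\<lambda>x. \<Prod>i\<in>I. f i x)"
  using assms(2) by (induction I rule: infinite_finite_induct) (auto intro: Ck_on_mult assms(1) simp: assms(1))

lemma Ck_on_norm_sq [simp]:
  assumes "open S" shows "Ck_on k S (\<lambda>x. x \<bullet> x)"
proof -
  have "Ck_on k S (\<lambda>x. \<Sum>b\<in>Basis. (x \<bullet> b) * (x \<bullet> b))"
    by (intro Ck_on_sum Ck_on_mult assms) (auto simp: assms)
  then show ?thesis by (simp flip: euclidean_inner)
qed

lemma Ck_on_inverse:
  "Ck_on k {x::real. x \<noteq> 0} inverse"
proof (induction k)
  case 0 then show ?case by (auto intro!: continuous_intros)
next
  case (Suc k)
  have o: "open {x::real. x \<noteq> 0}" by (intro open_Collect_neq continuous_intros)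
  show ?case
  proof (rule Ck_on_real_SucI[OF o])
    show "(inverse has_real_derivative - (inverse x * inverse x)) (at x)" if "x \<in> {x. x \<noteq> 0}" for x :: real
      using DERIV_inverse[of x UNIV] that by (simp add: power2_eq_square power_inverse)
  qed (intro Ck_on_minus Ck_on_mult o Suc)
qed

lemma Ck_on_ln: "Ck_on k {0<..} (ln :: real \<Rightarrow> real)"
proof (cases k)
  case (Suc k')
  show ?thesis unfolding Suc
  proof (rule Ck_on_real_SucI)
    show "(ln has_real_derivative inverse x) (at x)" if "x \<in> {0<..}" for x :: real
      using DERIV_ln[of x] that by simp
    show "Ck_on k' {0<..} (inverse :: real \<Rightarrow> real)"
      by (rule Ck_on_subset[OF Ck_on_inverse]) auto
  qed auto
qed (auto intro!: continuous_intros)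

lemma Ck_on_exp: "Ck_on k UNIV (exp :: real \<Rightarrow> real)"
proof (induction k)
  case (Suc k)
  show ?case by (rule Ck_on_real_SucI[OF _ _ Suc]) (auto intro!: derivative_eq_intros)
qed (auto intro!: continuous_intros)

lemma Ck_on_power_series:
  fixes c :: "nat \<Rightarrow> real"
  assumes "\<And>x. summable (\<lambda>n. c n * x ^ n)"
  shows "Ck_on k UNIV (\<lambda>x. \<Sum>n. c n * x ^ n)"
  using assms
proof (induction k arbitrary: c)
  case 0
  have "isCont (\<lambda>x. \<Sum>n. c n * x ^ n) x" for x
    using termdiffs_strong_converges_everywhere[OF 0] DERIV_isCont by blast
  then show ?case by (simp add: continuous_at_imp_continuous_on)
next
  case (Suc k)
  show ?case
    by (rule Ck_on_real_SucI[OF _ termdiffs_strong_converges_everywhere[OF Suc.prems] Suc.IH])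
       (auto intro: termdiff_converges_all Suc.prems)
qed

lemma Ck_on_Un:
  assumes "open S" "open T" "Ck_on k S f" "Ck_on k T f"
  shows "Ck_on k (S \<union> T) f"
  using assms(3,4)
proof (induction k arbitrary: f)
  case 0 then show ?case using continuous_on_open_Un[OF assms(1,2)] by auto
qed auto

section \<open>The smooth flat function behind all cut-offs\<close>

definition flat :: "real \<Rightarrow> real" where
  "flat x = (if x \<le> 0 then 0 else exp (- (1 / x)))"

text \<open>Derivatives of \<open>flat\<close> are polynomials in 1/x times exp(-1/x). This family
  is closed under differentiation, which is what the induction for smoothness needs.\<close>

definition flat_poly :: "real poly \<Rightarrow> real \<Rightarrow> real" where
  "flat_poly p x = (if x \<le> 0 then 0 else poly p (1 / x) * exp (- (1 / x)))"

lemma poly_over_exp_tendsto_0: "((\<lambda>y. poly p y * exp (- y)) \<longlongrightarrow> (0::real)) at_top"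
proof -
  have "poly p y * exp (- y) = (\<Sum>i\<le>degree p. coeff p i * (y ^ i / exp y))" for y
    by (simp add: poly_altdef sum_distrib_right exp_minus divide_inverse mult.assoc)
  moreover have "((\<lambda>y. \<Sum>i\<le>degree p. coeff p i * (y ^ i / exp y)) \<longlongrightarrow> (\<Sum>i\<le>degree p. coeff p i * 0)) at_top"
    by (intro tendsto_intros tendsto_power_div_exp_0)
  ultimately show ?thesis by simp
qed

lemma flat_poly_tendsto: "(flat_poly p \<longlongrightarrow> 0) (at_right 0)"
proof -
  have "((\<lambda>x. poly p (1 / x) * exp (- (1 / x))) \<longlongrightarrow> 0) (at_right (0::real))"
    using filterlim_compose[OF poly_over_exp_tendsto_0 filterlim_inverse_at_top_right]
    by (simp add: inverse_eq_divide)
  then show ?thesis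
    by (rule Lim_transform_eventually) (auto simp: flat_poly_def eventually_at_right_less intro: eventually_at_rightI[of _ 1])
qed

text \<open>With y = 1/x one has d/dx = - y^2 d/dy, which turns p(y) exp(-y) into y^2 (p - p')
  exp(-y); \<open>[:0,0,1:]\<close> is the factor y^2.\<close>

lemma flat_poly_deriv:
  "(flat_poly p has_real_derivative flat_poly ([:0,0,1:] * (p - pderiv p)) x) (at x)"
proof -
  consider "x < 0" | "x = 0" | "x > 0" by linarith
  then show ?thesis
  proof cases
    case 1
    have "((\<lambda>_. 0) has_real_derivative 0) (at x)" by simp
    then have "(flat_poly p has_real_derivative 0) (at x)"
      by (rule DERIV_cong_ev[THEN iffD1, rotated -1, OF _ _ ])
         (auto simp: flat_poly_def intro!: eventually_nhds_in_open[of "{..<0}", THEN eventually_mono] 1)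
    then show ?thesis using 1 by (simp add: flat_poly_def)
  next
    case 3
    have "((\<lambda>x. poly p (1 / x) * exp (- (1 / x))) has_real_derivative
        (poly (pderiv p) (1/x) * (- (1 / x^2)) * exp (- (1 / x)) + poly p (1 / x) * (exp (- (1/x)) * (1/x^2)))) (at x)"
      using 3 by (auto intro!: derivative_eq_intros poly_DERIV[THEN DERIV_chain2] simp: power2_eq_square)
    then have "(flat_poly p has_real_derivative
        (poly (pderiv p) (1/x) * (- (1 / x^2)) * exp (- (1 / x)) + poly p (1 / x) * (exp (- (1/x)) * (1/x^2)))) (at x)"
      by (rule DERIV_cong_ev[THEN iffD1, rotated -1])
         (auto simp: flat_poly_def intro!: eventually_nhds_in_open[of "{0<..}", THEN eventually_mono] 3)
    then show ?thesis using 3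
      by (simp add: flat_poly_def field_simps power2_eq_square)
  next
    case 2
    \<comment> \<open>Division by h multiplies the polynomial by one more power of 1/h, so the
      difference quotient at 0 is again in the family, namely \<open>flat_poly (pCons 0 p)\<close>,
      and its limit is known.\<close>
    have r: "((\<lambda>h. flat_poly p h / h) \<longlongrightarrow> 0) (at_right 0)"
      using flat_poly_tendsto[of "pCons 0 p"]
      by (rule Lim_transform_eventually) (auto simp: flat_poly_def intro!: eventually_at_rightI[of _ 1])
    have l: "((\<lambda>h. flat_poly p h / h) \<longlongrightarrow> 0) (at_left 0)"
      by (rule Lim_transform_eventually[of "\<lambda>_. 0"]) (auto simp: flat_poly_def intro!: eventually_at_leftI[of "-1"])
    have "((\<lambda>h. flat_poly p h / h) \<longlongrightarrow> 0) (at 0)"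
      using l r by (simp add: filterlim_at_split)
    then show ?thesis using 2 by (simp add: DERIV_def flat_poly_def)
  qed
qed

lemma Ck_on_flat_poly: "Ck_on k UNIV (flat_poly p)"
proof (induction k arbitrary: p)
  case 0
  have "isCont (flat_poly p) x" for x using flat_poly_deriv DERIV_isCont by blast
  then show ?case by (simp add: continuous_at_imp_continuous_on)
next
  case (Suc k)
  show ?case by (rule Ck_on_real_SucI[OF _ flat_poly_deriv Suc]) auto
qed

lemma Ck_on_flat: "Ck_on k UNIV flat"
proof -
  have "flat_poly 1 = flat" by (auto simp: flat_poly_def flat_def)
  then show ?thesis using Ck_on_flat_poly[of k 1] by simp
qed

lemma flat_bounds: "0 \<le> flat x" "flat x \<le> 1" "0 < x \<Longrightarrow> 0 < flat x" "x \<le> 0 \<Longrightarrow> flat x = 0"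
  by (auto simp: flat_def)

section \<open>The first Dirichlet eigenvalue of the disc\<close>

text \<open>Coefficients of J_0(sqrt x), the Bessel function of order 0 in the square of its
  argument. In this variable it is entire, and x = h r^2 may have either sign, negative values
  giving the modified function I_0; as a function of |x|^2 it is smooth at the origin.\<close>

definition bes_coeff :: "nat \<Rightarrow> real" where
  "bes_coeff n = (- 1 / 4) ^ n / (fact n)\<^sup>2"

definition bes :: "real \<Rightarrow> real" where "bes x = (\<Sum>n. bes_coeff n * x ^ n)"
definition bes1 :: "real \<Rightarrow> real" where "bes1 x = (\<Sum>n. diffs bes_coeff n * x ^ n)"
definition bes2 :: "real \<Rightarrow> real" where "bes2 x = (\<Sum>n. diffs (diffs bes_coeff) n * x ^ n)"

lemma summable_bes: "summable (\<lambda>n. bes_coeff n * x ^ n)"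
proof (rule summable_comparison_test)
  have "norm (bes_coeff n * x ^ n) \<le> inverse (fact n) * (\<bar>x\<bar> / 4) ^ n" for n
  proof -
    have "norm (bes_coeff n * x ^ n) = (\<bar>x\<bar> / 4) ^ n * (inverse (fact n) * inverse (fact n))"
      by (simp add: bes_coeff_def abs_mult power_divide power_abs power2_eq_square field_simps power_mult_distrib)
    also have "\<dots> \<le> (\<bar>x\<bar> / 4) ^ n * (inverse (fact n) * 1)"
      by (intro mult_left_mono) (auto simp: inverse_le_1_iff fact_ge_1)
    finally show ?thesis by (simp add: mult.commute)
  qed
  then show "\<exists>N. \<forall>n\<ge>N. norm (bes_coeff n * x ^ n) \<le> inverse (fact n) * (\<bar>x\<bar> / 4) ^ n" by blast
  show "summable (\<lambda>n. inverse (fact n) * (\<bar>x\<bar> / 4) ^ n)" by (rule summable_exp)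
qed

lemma summable_bes1: "summable (\<lambda>n. diffs bes_coeff n * x ^ n)"
  by (rule termdiff_converges_all[OF summable_bes])

lemma summable_bes2: "summable (\<lambda>n. diffs (diffs bes_coeff) n * x ^ n)"
  by (rule termdiff_converges_all[OF summable_bes1])

lemma DERIV_bes: "(bes has_real_derivative bes1 x) (at x)"
  using termdiffs_strong_converges_everywhere[OF summable_bes] by (simp add: bes_def[abs_def] bes1_def)

lemma DERIV_bes1: "(bes1 has_real_derivative bes2 x) (at x)"
  using termdiffs_strong_converges_everywhere[OF summable_bes1] by (simp add: bes1_def[abs_def] bes2_def)

lemmas bes_derivs [derivative_intros] = DERIV_bes[THEN DERIV_chain2] DERIV_bes1[THEN DERIV_chain2]

lemma Ck_on_bes: "Ck_on k UNIV bes"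
  using Ck_on_power_series[OF summable_bes] by (simp add: bes_def[abs_def])

lemma continuous_on_bes: "continuous_on S bes"
  using Ck_on_continuous[OF Ck_on_bes] by (rule continuous_on_subset) auto

text \<open>Bessel's equation of order 0 in the squared variable; it comes down to the recursion (n
  + 1)^2 c(n + 1) = - c(n)/4 of the coefficients.\<close>

lemma bes_ode: "x * bes2 x + bes1 x + bes x / 4 = 0"
proof -
  have "(\<lambda>n. diffs (diffs bes_coeff) n * x ^ n) sums bes2 x"
    using summable_bes2 by (simp add: bes2_def summable_sums)
  then have "(\<lambda>n. x * (diffs (diffs bes_coeff) n * x ^ n)) sums (x * bes2 x)"
    by (rule sums_mult)
  then have "(\<lambda>n. real (Suc n) * (real (Suc (Suc n)) * bes_coeff (Suc (Suc n))) * x ^ Suc n) sums (x * bes2 x)"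
    by (simp add: diffs_def algebra_simps)
  \<comment> \<open>The vanishing term n = 0 is prepended so that all three series run over the same
    powers of x.\<close>
  then have "(\<lambda>n. real n * (real (Suc n) * bes_coeff (Suc n)) * x ^ n) sums (x * bes2 x + 0)"
    using sums_Suc[of "\<lambda>n. real n * (real (Suc n) * bes_coeff (Suc n)) * x ^ n" "x * bes2 x"] by simp
  moreover have "(\<lambda>n. real (Suc n) * bes_coeff (Suc n) * x ^ n) sums bes1 x"
    using summable_sums[OF summable_bes1, of x] by (simp add: bes1_def diffs_def)
  moreover have "(\<lambda>n. bes_coeff n * x ^ n / 4) sums (bes x / 4)"
    using summable_sums[OF summable_bes, of x] by (intro sums_divide) (simp add: bes_def)
  ultimately have "(\<lambda>n. real n * (real (Suc n) * bes_coeff (Suc n)) * x ^ n + real (Suc n) * bes_coeff (Suc n) * x ^ n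
      + bes_coeff n * x ^ n / 4) sums (x * bes2 x + 0 + bes1 x + bes x / 4)"
    by (intro sums_add)
  moreover have "real n * (real (Suc n) * bes_coeff (Suc n)) * x ^ n + real (Suc n) * bes_coeff (Suc n) * x ^ n
      + bes_coeff n * x ^ n / 4 = 0" for n
  proof -
    have "bes_coeff (Suc n) * (real (Suc n))\<^sup>2 = - (bes_coeff n / 4)"
    proof -
      have "(fact (Suc n) :: real) = real (Suc n) * fact n" by simp
      then show ?thesis
        unfolding bes_coeff_def power_Suc by (simp add: power_mult_distrib del: fact_Suc of_nat_Suc)
    qed
    moreover have "real n * (real (Suc n) * bes_coeff (Suc n)) * x ^ n + real (Suc n) * bes_coeff (Suc n) * x ^ n
       = bes_coeff (Suc n) * (real (Suc n))\<^sup>2 * x ^ n"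
      by (simp add: algebra_simps power2_eq_square)
    ultimately show ?thesis by simp
  qed
  ultimately have "(\<lambda>n. 0) sums (x * bes2 x + 0 + bes1 x + bes x / 4)" by simp
  from sums_unique2[OF this sums_zero] show ?thesis by simp
qed

lemma bes_0 [simp]: "bes 0 = 1"
  unfolding bes_def powser_zero by (simp add: bes_coeff_def)

lemma bes_nonpos_ge_1:
  assumes "x \<le> 0" shows "1 \<le> bes x"
proof -
  have "0 \<le> bes_coeff n * x ^ n" for n
  proof -
    have "bes_coeff n * x ^ n = ((- x) / 4) ^ n / (fact n)\<^sup>2"
      by (simp add: bes_coeff_def flip: power_mult_distrib)
    then show ?thesis using assms by simp
  qed
  then have "sum (\<lambda>n. bes_coeff n * x ^ n) {0} \<le> bes x"
    unfolding bes_def by (intro sum_le_suminf summable_bes) auto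
  then show ?thesis by (simp add: bes_coeff_def)
qed

text \<open>If \<open>bes\<close> stayed positive, x bes1(x) would decrease from 0, its derivative
  being - bes/4. Hence bes1(x) <= bes1(1)/x with bes1(1) < 0, and integration gives bes(x) <= bes(1)
  + bes1(1) ln x, which is not positive for large x.\<close>

lemma bes_exists_nonpos: "\<exists>x\<ge>0. bes x \<le> 0"
proof (rule ccontr)
  assume "\<not> ?thesis"
  then have pos: "0 < bes x" if "0 \<le> x" for x using that by force
  have d: "((\<lambda>x. x * bes1 x) has_real_derivative - (bes x / 4)) (at x)" for x
  proof -
    have "((\<lambda>x. x * bes1 x) has_real_derivative 1 * bes1 x + bes2 x * x) (at x)"
      by (rule DERIV_mult[OF DERIV_ident DERIV_bes1])
    moreover have "1 * bes1 x + bes2 x * x = - (bes x / 4)"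
      using bes_ode[of x] by (simp add: mult.commute)
    ultimately show ?thesis by simp
  qed
  have neg: "x * bes1 x \<le> 1 * bes1 1" if "1 \<le> x" for x
  proof (rule DERIV_nonpos_imp_nonincreasing[OF that])
    show "\<exists>y. ((\<lambda>x. x * bes1 x) has_real_derivative y) (at t) \<and> y \<le> 0" if "1 \<le> t" for t
      using d[of t] pos[of t] that by (intro exI[of _ "- (bes t / 4)"]) auto
  qed
  have c: "bes1 1 < 0"
  proof -
    have "1 * bes1 1 < 0 * bes1 0"
    proof (rule DERIV_neg_imp_decreasing[of 0 1 "\<lambda>x. x * bes1 x"])
      show "\<exists>y. ((\<lambda>x. x * bes1 x) has_real_derivative y) (at t) \<and> y < 0" if "0 \<le> t" for t
        using d[of t] pos[of t] that by (intro exI[of _ "- (bes t / 4)"]) auto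
    qed simp
    then show ?thesis by simp
  qed
  have "bes x - bes1 1 * ln x \<le> bes 1" if "1 \<le> x" for x
  proof -
    have "bes x - bes1 1 * ln x \<le> bes 1 - bes1 1 * ln 1"
    proof (rule DERIV_nonpos_imp_nonincreasing[of 1 x "\<lambda>x. bes x - bes1 1 * ln x"])
      fix t assume "1 \<le> t" "t \<le> x"
      then have "((\<lambda>x. bes x - bes1 1 * ln x) has_real_derivative bes1 t - bes1 1 * (1 / t)) (at t)"
        by (auto intro!: derivative_eq_intros bes_derivs)
      moreover have "bes1 t - bes1 1 * (1 / t) \<le> 0"
        using neg[of t] \<open>1 \<le> t\<close> by (simp add: field_simps)
      ultimately show "\<exists>y. ((\<lambda>x. bes x - bes1 1 * ln x) has_real_derivative y) (at t) \<and> y \<le> 0" by blast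
    qed (use that in auto)
    then show ?thesis by simp
  qed
  \<comment> \<open>At this point the logarithmic upper bound for \<open>bes\<close> is exactly
    0.\<close>
  from this[of "exp (bes 1 / - bes1 1 )"] pos[of 1] pos[of "exp (bes 1 / - bes1 1 )"] c
  show False by (simp add: field_simps)
qed

text \<open>The square of the first positive zero of J_0. It turns out to be the eigenvalue H and
  stands for it throughout.\<close>

definition bes_zero :: real where "bes_zero = Inf {x. 0 \<le> x \<and> bes x \<le> 0}"

lemma bes_zero_props:
  shows bes_zero_pos: "0 < bes_zero" and bes_bes_zero: "bes bes_zero = 0"
    and bes_pos: "\<And>x. x < bes_zero \<Longrightarrow> 0 < bes x"
proof -
  let ?S = "{x. 0 \<le> x \<and> bes x \<le> 0}"
  have ne: "?S \<noteq> {}" using bes_exists_nonpos by auto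
  have bb: "bdd_below ?S" by (auto intro: bdd_belowI[of _ 0])
  have "closed ?S"
    by (intro closed_Collect_conj closed_Collect_le continuous_intros continuous_on_bes)
  then have mem: "bes_zero \<in> ?S"
    unfolding bes_zero_def using ne bb by (intro closed_contains_Inf)
  show pos: "0 < bes_zero" using mem by (cases "bes_zero = 0") auto
  show less: "0 < bes x" if "x < bes_zero" for x
  proof (cases "x \<le> 0")
    case True then show ?thesis using bes_nonpos_ge_1[of x] by simp
  next
    case False
    then have "x \<notin> ?S" using that cInf_lower[OF _ bb, of x] by (auto simp: bes_zero_def)
    then show ?thesis using False by auto
  qed
  have "((bes \<longlongrightarrow> bes bes_zero)) (at_left bes_zero)"
    using DERIV_isCont[OF DERIV_bes] by (meson at_le isCont_def tendsto_within_subset filterlim_at_split)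
  then have "0 \<le> bes bes_zero"
    by (rule tendsto_lowerbound) (auto simp: eventually_at_left_field less_imp_le less intro!: exI[of _ "bes_zero - 1"])
  then show "bes bes_zero = 0" using mem by auto
qed

lemma bes_nonneg: "x \<le> bes_zero \<Longrightarrow> 0 \<le> bes x"
  using bes_pos[of x] bes_bes_zero by (cases "x = bes_zero") auto

section \<open>The ground state on the disc and the comparison of eigenvalues with it\<close>

lemma partial_derivative_radial:
  fixes g :: "real \<Rightarrow> real" and x :: "'a::euclidean_space"
  assumes "(g has_real_derivative g') (at (k * (x \<bullet> x)))"
  shows "((\<lambda>x. g (k * (x \<bullet> x))) has_derivative (\<lambda>h. 2 * k * g' * (x \<bullet> h))) (at x)"
proof -
  have "((\<lambda>x::'a. k * (x \<bullet> x)) has_derivative (\<lambda>h. 2 * k * (x \<bullet> h))) (at x)"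
    by (auto intro!: derivative_eq_intros simp: inner_commute algebra_simps)
  from has_derivative_compose[OF this assms[unfolded has_field_derivative_def]]
  show ?thesis by (simp add: algebra_simps)
qed

lemma laplacian_radial:
  fixes x :: "'a::euclidean_space"
  assumes "\<And>t. (g has_real_derivative g1 t) (at t)" "\<And>t. (g1 has_real_derivative g2 t) (at t)"
  shows "partial_derivative b (\<lambda>x::'a. g (k * (x \<bullet> x))) = (\<lambda>x. 2 * k * g1 (k * (x \<bullet> x)) * (x \<bullet> b))"
    and "partial_derivative b (\<lambda>x::'a. 2 * k * g1 (k * (x \<bullet> x)) * (x \<bullet> b)) x
       = 4 * k\<^sup>2 * g2 (k * (x \<bullet> x)) * (x \<bullet> b)\<^sup>2 + 2 * k * g1 (k * (x \<bullet> x)) * (b \<bullet> b)"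
    and "laplacian (\<lambda>x::'a. g (k * (x \<bullet> x))) x
       = 4 * k\<^sup>2 * (x \<bullet> x) * g2 (k * (x \<bullet> x)) + 2 * real DIM('a) * k * g1 (k * (x \<bullet> x))"
proof -
  show 1: "partial_derivative b (\<lambda>x::'a. g (k * (x \<bullet> x))) = (\<lambda>x. 2 * k * g1 (k * (x \<bullet> x)) * (x \<bullet> b))" for b
    using partial_derivative_eq[OF partial_derivative_radial[OF assms(1)]] by blast
  show 2: "partial_derivative b (\<lambda>x::'a. 2 * k * g1 (k * (x \<bullet> x)) * (x \<bullet> b)) x
       = 4 * k\<^sup>2 * g2 (k * (x \<bullet> x)) * (x \<bullet> b)\<^sup>2 + 2 * k * g1 (k * (x \<bullet> x)) * (b \<bullet> b)" for b
    by (rule partial_derivative_eq[where f'="\<lambda>h. 4 * k\<^sup>2 * g2 (k * (x \<bullet> x)) * (x \<bullet> h) * (x \<bullet> b) + 2 * k * g1 (k * (x \<bullet> x)) * (h \<bullet> b)", THEN trans])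
       (auto intro!: derivative_eq_intros partial_derivative_radial[OF assms(2)] simp: power2_eq_square algebra_simps)
  have "laplacian (\<lambda>x::'a. g (k * (x \<bullet> x))) x =
     (\<Sum>b\<in>Basis. 4 * k\<^sup>2 * g2 (k * (x \<bullet> x)) * ((x \<bullet> b) * (x \<bullet> b)) + 2 * k * g1 (k * (x \<bullet> x)))"
    by (auto simp: laplacian_def 1 2 power2_eq_square intro!: sum.cong)
  also have "\<dots> = 4 * k\<^sup>2 * g2 (k * (x \<bullet> x)) * (x \<bullet> x) + 2 * real DIM('a) * k * g1 (k * (x \<bullet> x))"
    by (simp add: sum.distrib flip: sum_distrib_left euclidean_inner)
  finally show "laplacian (\<lambda>x::'a. g (k * (x \<bullet> x))) x
       = 4 * k\<^sup>2 * (x \<bullet> x) * g2 (k * (x \<bullet> x)) + 2 * real DIM('a) * k * g1 (k * (x \<bullet> x))" by simp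
qed

text \<open>In dimension 2 the two terms of the radial Laplacian combine to 4 k (t bes2(t) +
  bes1(t)) with t = k |x|^2, which Bessel's equation evaluates.\<close>

lemma laplacian_bes_2d:
  assumes "DIM('a::euclidean_space) = 2"
  shows "laplacian (\<lambda>x::'a. bes (k * (x \<bullet> x))) x = - k * bes (k * (x \<bullet> x))"
proof -
  have "laplacian (\<lambda>x::'a. bes (k * (x \<bullet> x))) x = 4 * k * ((k * (x \<bullet> x)) * bes2 (k * (x \<bullet> x)) + bes1 (k * (x \<bullet> x)))"
    unfolding laplacian_radial(3)[OF DERIV_bes DERIV_bes1] assms by (simp add: power2_eq_square algebra_simps)
  moreover have "(k * (x \<bullet> x)) * bes2 (k * (x \<bullet> x)) + bes1 (k * (x \<bullet> x)) = - (bes (k * (x \<bullet> x)) / 4)"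
    using bes_ode[of "k * (x \<bullet> x)"] by linarith
  ultimately show ?thesis by simp
qed

lemma Ck_on_bes_radial: "open S \<Longrightarrow> Ck_on n S (\<lambda>x::'a::euclidean_space. bes (k * (x \<bullet> x)))"
  by (rule Ck_on_compose[OF _ open_UNIV _ Ck_on_bes]) (auto intro!: Ck_on_mult)

lemma dirichlet_eigenvalue_bes_zero:
  assumes "DIM('a::euclidean_space) = 2"
  shows "dirichlet_eigenvalue (ball 0 1 :: 'a set) bes_zero"
  unfolding dirichlet_eigenvalue_def
proof (intro exI[of _ "\<lambda>x. bes (bes_zero * (x \<bullet> x))"] conjI ballI)
  show "Ck_on 2 (ball 0 1) (\<lambda>x::'a. bes (bes_zero * (x \<bullet> x)))" by (rule Ck_on_bes_radial) simp
  show "continuous_on (closure (ball 0 1)) (\<lambda>x::'a. bes (bes_zero * (x \<bullet> x)))"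
    by (rule continuous_on_subset[OF Ck_on_continuous[OF Ck_on_bes_radial[OF open_UNIV]]]) simp
  show "- laplacian (\<lambda>x::'a. bes (bes_zero * (x \<bullet> x))) x = bes_zero * bes (bes_zero * (x \<bullet> x))" for x
    by (simp add: laplacian_bes_2d[OF assms])
  show "bes (bes_zero * (x \<bullet> x)) = 0" if "x \<in> frontier (ball 0 1)" for x :: 'a
    using that by (simp add: bes_bes_zero dot_square_norm)
  show "\<exists>x\<in>ball (0::'a) 1. bes (bes_zero * (x \<bullet> x)) \<noteq> 0" by (rule bexI[of _ 0]) auto
qed

lemma partial_derivative_line:
  assumes "f differentiable (at (x + t *\<^sub>R b))"
  shows "((\<lambda>t. f (x + t *\<^sub>R b)) has_real_derivative partial_derivative b f (x + t *\<^sub>R b)) (at t)"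
proof -
  let ?D = "frechet_derivative f (at (x + t *\<^sub>R b))"
  have f: "(f has_derivative ?D) (at (x + t *\<^sub>R b))" using assms by (simp add: frechet_derivative_works)
  have "((\<lambda>t. x + t *\<^sub>R b) has_derivative (\<lambda>h. h *\<^sub>R b)) (at t)"
    by (auto intro!: derivative_eq_intros)
  from has_derivative_compose[OF this f]
  have "((\<lambda>t. f (x + t *\<^sub>R b)) has_derivative (\<lambda>h. ?D (h *\<^sub>R b))) (at t)" .
  moreover have "?D (h *\<^sub>R b) = partial_derivative b f (x + t *\<^sub>R b) * h" for h
    using linear_scale[OF has_derivative_linear[OF f]] by (simp add: partial_derivative_def)
  ultimately show ?thesis by (simp add: has_field_derivative_def mult.commute[of _ "partial_derivative b f (x + t *\<^sub>R b)"])
qed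

lemma second_derivative_at_max:
  fixes p :: "real \<Rightarrow> real"
  assumes "e > 0" and p: "\<And>t. \<bar>t\<bar> < e \<Longrightarrow> (p has_real_derivative p' t) (at t)"
    and p': "(p' has_real_derivative p'') (at 0)" and max: "\<And>t. \<bar>t\<bar> < e \<Longrightarrow> p t \<le> p 0"
  shows "p'' \<le> 0"
proof (rule ccontr)
  assume "\<not> p'' \<le> 0"
  then have "p'' > 0" by simp
  have "p' 0 = 0" using DERIV_local_max[OF p[of 0], of e] assms(1) max by auto
  obtain d where d: "d > 0" "\<And>h. 0 < h \<Longrightarrow> h < d \<Longrightarrow> p' 0 < p' (0 + h)"
    using DERIV_pos_inc_right[OF p' \<open>p'' > 0\<close>] by blast
  define s where "s = min d e / 2"
  have s: "0 < s" "s < d" "s < e" using d(1) assms(1) by (auto simp: s_def)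
  have "p 0 < p s"
  proof (rule DERIV_pos_imp_increasing_open[of 0 s p])
    show "\<exists>y. (p has_real_derivative y) (at t) \<and> 0 < y" if "0 < t" "t < s" for t
      using that s p[of t] d(2)[of t] \<open>p' 0 = 0\<close> by auto
    show "continuous_on {0..s} p"
      using s by (intro continuous_at_imp_continuous_on ballI DERIV_isCont[OF p]) auto
  qed (use s in auto)
  then show False using max[of s] s by auto
qed

text \<open>A maximum principle in the manner of Barta. If \<mu> were below \<open>bes_zero\<close>,
  the function w = bes(k |x|^2) with \<mu> < k < \<open>bes_zero\<close> would be positive on the
  closed ball, with Laplacian - k w. At a maximum point z of \<phi>/w, with value M > 0, the
  function \<phi> - M w attains its maximum 0, so its Laplacian is at most 0 there; this reads (k -
  \<mu>) M w(z) <= 0. The boundary condition makes z an interior point.\<close>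

lemma dirichlet_eigenvalue_positive_part:
  fixes \<phi> :: "'a::euclidean_space \<Rightarrow> real"
  assumes dim: "DIM('a) = 2" and C2: "Ck_on 2 (ball 0 1) \<phi>" and cont: "continuous_on (cball 0 1) \<phi>"
    and eq: "\<And>x. x \<in> ball 0 1 \<Longrightarrow> - laplacian \<phi> x = \<mu> * \<phi> x"
    and bd: "\<And>x. norm x = 1 \<Longrightarrow> \<phi> x = 0" and pos: "y \<in> ball 0 1" "\<phi> y > 0"
  shows "bes_zero \<le> \<mu>"
proof (rule ccontr)
  assume "\<not> ?thesis"
  then have "max 0 \<mu> < bes_zero" using bes_zero_pos by simp
  \<comment> \<open>k is taken positive as well, so that k |x|^2 <= k < \<open>bes_zero\<close> on
    the closed ball.\<close>
  then obtain k where k: "max 0 \<mu> < k" "k < bes_zero" using dense by blast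
  define w where "w = (\<lambda>x::'a. bes (k * (x \<bullet> x)))"
  have wpos: "0 < w x" if "x \<in> cball 0 1" for x
  proof -
    have "x \<bullet> x \<le> 1" using that by (simp add: dot_square_norm power_le_one)
    then have "k * (x \<bullet> x) \<le> k * 1" using k by (intro mult_left_mono) auto
    then show ?thesis unfolding w_def using k by (intro bes_pos) linarith
  qed
  have wC: "Ck_on n UNIV w" for n unfolding w_def by (rule Ck_on_bes_radial) simp
  have "continuous_on (cball 0 1) (\<lambda>x. \<phi> x / w x)"
    by (intro continuous_intros cont continuous_on_subset[OF Ck_on_continuous[OF wC]]) (use wpos in force)+
  then obtain z where z: "z \<in> cball 0 1" "\<And>x. x \<in> cball 0 1 \<Longrightarrow> \<phi> x / w x \<le> \<phi> z / w z"
    using continuous_attains_sup[of "cball (0::'a) 1" "\<lambda>x. \<phi> x / w x"] by auto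
  define M where "M = \<phi> z / w z"
  have "0 < \<phi> y / w y" using pos wpos[of y] by auto
  also have "\<dots> \<le> M" unfolding M_def using pos z(2)[of y] by auto
  finally have M: "0 < M" .
  have zb: "z \<in> ball 0 1" using bd[of z] z(1) M by (cases "norm z = 1") (auto simp: M_def)
  have le: "\<phi> x - M * w x \<le> 0" if "x \<in> cball 0 1" for x
    using z(2)[OF that] wpos[OF that] by (simp add: M_def[symmetric] field_simps)
  have eqz: "\<phi> z - M * w z = 0" using wpos[OF z(1)] by (simp add: M_def)
  have "partial_derivative b (partial_derivative b \<phi>) z - M * partial_derivative b (partial_derivative b w) z \<le> 0"
    if b: "b \<in> Basis" for b
  proof -
    obtain e where e: "e > 0" "ball z e \<subseteq> ball 0 1" using zb open_ball open_contains_ball by metis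
    have in_ball: "z + t *\<^sub>R b \<in> ball 0 1" if "\<bar>t\<bar> < e" for t
    proof -
      have "z + t *\<^sub>R b \<in> ball z e" using that b by (simp add: dist_norm)
      then show ?thesis using e(2) by blast
    qed
    have dphi: "\<phi> differentiable (at x)" "partial_derivative b \<phi> differentiable (at x)" if "x \<in> ball 0 1" for x
      using C2 that b by (auto simp: numeral_2_eq_2)
    have dw: "w differentiable (at x)" "partial_derivative b w differentiable (at x)" for x
      using wC[of 2] b by (auto simp: numeral_2_eq_2)
    show ?thesis
    proof (rule second_derivative_at_max[OF e(1),
          where p="\<lambda>t. \<phi> (z + t *\<^sub>R b) - M * w (z + t *\<^sub>R b)" and
           p'="\<lambda>t. partial_derivative b \<phi> (z + t *\<^sub>R b) - M * partial_derivative b w (z + t *\<^sub>R b)"])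
      show "((\<lambda>t. \<phi> (z + t *\<^sub>R b) - M * w (z + t *\<^sub>R b)) has_real_derivative
         partial_derivative b \<phi> (z + t *\<^sub>R b) - M * partial_derivative b w (z + t *\<^sub>R b)) (at t)" if "\<bar>t\<bar> < e" for t
        using in_ball[OF that] by (intro DERIV_diff DERIV_cmult partial_derivative_line dphi dw)
      have z0: "z + 0 *\<^sub>R b \<in> ball 0 1" using zb by simp
      show "((\<lambda>t. partial_derivative b \<phi> (z + t *\<^sub>R b) - M * partial_derivative b w (z + t *\<^sub>R b)) has_real_derivative
         partial_derivative b (partial_derivative b \<phi>) z - M * partial_derivative b (partial_derivative b w) z) (at 0)"
        using DERIV_diff[OF partial_derivative_line[OF dphi(2)[OF z0]] DERIV_cmult[OF partial_derivative_line[OF dw(2)]]]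
        by simp
      show "\<phi> (z + t *\<^sub>R b) - M * w (z + t *\<^sub>R b) \<le> \<phi> (z + 0 *\<^sub>R b) - M * w (z + 0 *\<^sub>R b)" if "\<bar>t\<bar> < e" for t
        using le[of "z + t *\<^sub>R b"] in_ball[OF that] eqz by simp
    qed
  qed
  then have "(\<Sum>b\<in>Basis. partial_derivative b (partial_derivative b \<phi>) z - M * partial_derivative b (partial_derivative b w) z) \<le> 0"
    by (rule sum_nonpos)
  then have "laplacian \<phi> z - M * laplacian w z \<le> 0"
    by (simp add: laplacian_def sum_subtractf sum_distrib_left)
  moreover have "laplacian w z = - k * w z" unfolding w_def by (rule laplacian_bes_2d[OF dim])
  moreover have "laplacian \<phi> z = - \<mu> * (M * w z)" using eq[OF zb] eqz by simp
  ultimately have "(M * w z) * (k - \<mu>) \<le> 0" by (simp add: algebra_simps)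
  moreover have "(M * w z) * (k - \<mu>) > 0" using M wpos[OF z(1)] k by simp
  ultimately show False by simp
qed

lemma laplacian_minus:
  assumes "Ck_on 2 S f" "open S" "x \<in> S"
  shows "laplacian (\<lambda>x. - f x) x = - laplacian f x"
proof -
  have m: "partial_derivative b (\<lambda>x. - g x) y = - partial_derivative b g y" if "g differentiable (at y)" for b y and g :: "'a \<Rightarrow> real"
    using that partial_derivative_eq[OF has_derivative_minus[of g "frechet_derivative g (at y)" "at y"]]
    by (simp add: frechet_derivative_works partial_derivative_def)
  have "partial_derivative b (partial_derivative b (\<lambda>x. - f x)) x = - partial_derivative b (partial_derivative b f) x" if "b \<in> Basis" for b
    using assms that partial_derivative_cong_open[OF assms(2,3), of "partial_derivative b (\<lambda>x. - f x)" "\<lambda>x. - partial_derivative b f x" b] m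
    by (auto simp: numeral_2_eq_2)
  then show ?thesis by (simp add: laplacian_def sum_negf)
qed

text \<open>No spectral theory is involved: the explicit ground state shows that the value is
  attained, and any eigenfunction or its negative is positive somewhere, which is all that the
  comparison asks for.\<close>

theorem first_dirichlet_eigenvalue_disc:
  assumes "DIM('a::euclidean_space) = 2"
  shows "first_dirichlet_eigenvalue (ball 0 1 :: 'a set) = bes_zero"
  unfolding first_dirichlet_eigenvalue_def
proof (rule Least_equality)
  show "dirichlet_eigenvalue (ball 0 1 :: 'a set) bes_zero" by (rule dirichlet_eigenvalue_bes_zero[OF assms])
  fix \<mu> assume "dirichlet_eigenvalue (ball 0 1 :: 'a set) \<mu>"
  then obtain \<phi> :: "'a \<Rightarrow> real" and x where p: "Ck_on 2 (ball 0 1) \<phi>" "continuous_on (cball 0 1) \<phi>"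
    "\<And>x. x \<in> ball 0 1 \<Longrightarrow> - laplacian \<phi> x = \<mu> * \<phi> x" "\<And>x. norm x = 1 \<Longrightarrow> \<phi> x = 0" "x \<in> ball 0 1" "\<phi> x \<noteq> 0"
    unfolding dirichlet_eigenvalue_def by auto
  show "bes_zero \<le> \<mu>"
  proof (cases "\<phi> x > 0")
    case True
    then show ?thesis using dirichlet_eigenvalue_positive_part[OF assms p(1-5)] by blast
  next
    case False
    have "bes_zero \<le> \<mu>"
    proof (rule dirichlet_eigenvalue_positive_part[OF assms, of "\<lambda>x. - \<phi> x" \<mu> x])
      show "Ck_on 2 (ball 0 1) (\<lambda>x. - \<phi> x)" using p(1) by (intro Ck_on_minus) auto
      show "continuous_on (cball 0 1) (\<lambda>x. - \<phi> x)" using p(2) by (intro continuous_intros)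
      show "- laplacian (\<lambda>x. - \<phi> x) y = \<mu> * - \<phi> y" if "y \<in> ball 0 1" for y
        using laplacian_minus[OF p(1) open_ball that] p(3)[OF that] by simp
    qed (use p False in auto)
    then show ?thesis .
  qed
qed

section \<open>The shooting problem\<close>

text \<open>This is s^(-N) times the integral of t^(N-1) f(t) over [0, s], rescaled to the fixed
  interval [0, 1] so that it is meaningful and continuous at s = 0. For a solution v and f = a exp
  v, the product s \<open>radial_mean\<close> is - v'.\<close>

definition radial_mean :: "nat \<Rightarrow> (real \<Rightarrow> real) \<Rightarrow> real \<Rightarrow> real" where
  "radial_mean N f s = integral {0..1} (\<lambda>\<tau>. \<tau> ^ (N - 1) * f (s * \<tau>))"

lemma mult_unit_interval: "s \<in> {0..1} \<Longrightarrow> \<tau> \<in> {0..1} \<Longrightarrow> s * \<tau> \<in> {0..1::real}"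
  by (auto simp: mult_le_one)

lemma continuous_on_radial_integrand:
  assumes "continuous_on {0..1::real} f" "s \<in> {0..1}"
  shows "continuous_on {0..1} (\<lambda>\<tau>. \<tau> ^ n * (f (s * \<tau>) :: real))"
  by (intro continuous_intros continuous_on_compose2[OF assms(1)]) (use assms(2) mult_unit_interval in auto)

lemma continuous_on_radial_mean:
  assumes "continuous_on {0..1} f"
  shows "continuous_on {0..1} (radial_mean N f)"
proof -
  have "continuous_on ({0..1} \<times> cbox 0 1) (\<lambda>(s, \<tau>). \<tau> ^ (N - 1) * f (s * \<tau>))"
    unfolding split_beta
    by (intro continuous_intros continuous_on_compose2[OF assms]) (use mult_unit_interval in force)
  then have "continuous_on {0..1} (\<lambda>s. integral (cbox 0 1) (\<lambda>\<tau>. \<tau> ^ (N - 1) * f (s * \<tau>)))"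
    by (rule integral_continuous_on_param)
  then show ?thesis by (simp add: radial_mean_def[abs_def])
qed

lemma radial_mean_bound:
  assumes "continuous_on {0..1} f" "s \<in> {0..1}" "\<And>t. t \<in> {0..s} \<Longrightarrow> \<bar>f t\<bar> \<le> c"
  shows "\<bar>radial_mean N f s\<bar> \<le> c"
proof -
  have c: "\<tau> ^ (N - 1) * \<bar>f (s * \<tau>)\<bar> \<le> c" if "\<tau> \<in> {0..1}" for \<tau>
  proof -
    have "s * \<tau> \<in> {0..s}" using assms(2) that by (auto simp: mult_left_le)
    from assms(3)[OF this] have "\<bar>f (s * \<tau>)\<bar> \<le> c" .
    moreover have "\<tau> ^ (N - 1) \<le> 1" "0 \<le> \<tau> ^ (N - 1)" using that by (auto intro: power_le_one)
    ultimately show ?thesis using mult_mono[of "\<tau> ^ (N - 1)" 1 "\<bar>f (s * \<tau>)\<bar>" c] by simp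
  qed
  have "norm (radial_mean N f s) \<le> integral {0..1} (\<lambda>_::real. c)"
    unfolding radial_mean_def
    using c by (intro integral_norm_bound_integral integrable_continuous_interval continuous_on_radial_integrand assms)
      (auto simp: abs_mult)
  then show ?thesis by simp
qed

lemma radial_mean_diff:
  assumes "continuous_on {0..1} f" "continuous_on {0..1} g" "s \<in> {0..1}"
  shows "radial_mean N f s - radial_mean N g s = radial_mean N (\<lambda>t. f t - g t) s"
  unfolding radial_mean_def right_diff_distrib
  by (rule integral_diff[symmetric]) (intro integrable_continuous_interval continuous_on_radial_integrand assms)+

lemma radial_mean_0:
  assumes "0 < N" shows "radial_mean N f 0 = f 0 / real N"
proof -
  have "((\<lambda>\<tau>::real. \<tau> ^ (N - 1)) has_integral (1 ^ N / N - 0 ^ N / N)) {0..1}"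
    using assms by (intro fundamental_theorem_of_calculus)
      (auto intro!: derivative_eq_intros simp flip: has_real_derivative_iff_has_vector_derivative)
  then have "((\<lambda>\<tau>::real. \<tau> ^ (N - 1) * f 0) has_integral (1 / N * f 0)) {0..1}"
    using assms by (intro has_integral_mult_left) (simp add: power_0_left)
  from integral_unique[OF this] show ?thesis by (simp add: radial_mean_def)
qed

lemma radial_mean_integral:
  assumes "continuous_on {0..1} f" "s \<in> {0<..1}" "0 < N"
  shows "s ^ N * radial_mean N f s = integral {0..s} (\<lambda>t. t ^ (N - 1) * f t)"
proof -
  let ?g = "\<lambda>t. t ^ (N - 1) * f t"
  have "continuous_on {0..s} ?g"
    by (intro continuous_intros continuous_on_subset[OF assms(1)]) (use assms(2) in auto)
  then have "(?g has_integral integral {0..s} ?g) {0..s}"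
    by (simp add: integrable_continuous_interval integrable_integral)
  then have "((\<lambda>x. ?g (s * x)) has_integral (1 / \<bar>s\<bar>) *\<^sub>R integral {0..s} ?g) ((\<lambda>x. x / s) ` {0..s})"
    using assms(2) by (intro has_integral_stretch_real) auto
  moreover have "(\<lambda>x. x / s) ` {0..s} = {0..1}"
    using assms(2) by (auto simp: image_divide_atLeastAtMost)
  ultimately have "((\<lambda>x. s ^ (N - 1) * (x ^ (N - 1) * f (s * x))) has_integral (1 / s) * integral {0..s} ?g) {0..1}"
    using assms(2) by (simp add: power_mult_distrib mult.assoc)
  then have "s ^ (N - 1) * radial_mean N f s = (1 / s) * integral {0..s} ?g"
    unfolding radial_mean_def by (metis integral_mult_right integral_unique)
  then have "s * (s ^ (N - 1) * radial_mean N f s) = integral {0..s} ?g"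
    using assms(2) by simp
  then show ?thesis using assms(3) by (simp add: power_eq_if)
qed

text \<open>Away from 0 this is the quotient rule for s^(1-N) times the integral of t^(N-1) f; at 0
  the difference quotient is the mean itself, and f(0) - (N - 1) f(0)/N = f(0)/N. Thus w = s
  \<open>radial_mean\<close> solves w' + (N - 1) w/s = f, with its derivative continued to the end
  point 0.\<close>

lemma radial_potential_derivs:
  assumes f: "continuous_on {0..1} f" and N: "0 < N" and s: "s \<in> {0..1}"
  shows "((\<lambda>s. s * radial_mean N f s) has_real_derivative f s - (real N - 1) * radial_mean N f s) (at s within {0..1})"
proof (cases "s = 0")
  case True
  have "((\<lambda>h. radial_mean N f h) \<longlongrightarrow> radial_mean N f 0) (at 0 within {0..1})"
    using continuous_on_radial_mean[OF f] by (auto simp: continuous_on_def)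
  then have "((\<lambda>h. (h * radial_mean N f h - 0 * radial_mean N f 0) / (h - 0)) \<longlongrightarrow> radial_mean N f 0) (at 0 within {0..1})"
    by (rule Lim_transform_eventually) (auto simp: eventually_at_filter)
  then have "((\<lambda>s. s * radial_mean N f s) has_real_derivative radial_mean N f 0) (at 0 within {0..1})"
    by (simp add: has_field_derivative_iff)
  moreover have "f 0 - (real N - 1) * radial_mean N f 0 = radial_mean N f 0"
    using N by (simp add: radial_mean_0 field_simps)
  ultimately show ?thesis using True by simp
next
  case False
  then have s0: "s > 0" using s by auto
  let ?g = "\<lambda>t. t ^ (N - 1) * f t"
  let ?I = "\<lambda>s. integral {0..s} ?g"
  have I: "(?I has_real_derivative ?g s) (at s within {0..1})"
    using s by (intro integral_has_real_derivative continuous_intros f)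
  have Is: "?I s = s ^ N * radial_mean N f s"
    using radial_mean_integral[OF f _ N, of s] s s0 by simp
  have "((\<lambda>s. ?I s / s ^ (N - 1)) has_real_derivative
      (?g s * s ^ (N - 1) - ?I s * (real (N - 1) * s ^ (N - 1 - 1))) / (s ^ (N - 1) * s ^ (N - 1))) (at s within {0..1})"
    using s0 by (intro DERIV_divide I) (auto intro!: derivative_eq_intros)
  moreover have "(?g s * s ^ (N - 1) - ?I s * (real (N - 1) * s ^ (N - 1 - 1))) / (s ^ (N - 1) * s ^ (N - 1))
      = f s - (real N - 1) * radial_mean N f s"
  proof (cases "N = 1")
    case False
    then have "s ^ N * s ^ (N - 1 - 1) = s ^ (N - 1) * s ^ (N - 1)"
      using N by (simp flip: power_add)
    moreover have "real (N - 1) = real N - 1" using N by simp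
    moreover have "?I s * (real (N - 1) * s ^ (N - 1 - 1)) = real (N - 1) * radial_mean N f s * (s ^ N * s ^ (N - 1 - 1))"
      unfolding Is by (simp only: mult_ac)
    ultimately have "?I s * (real (N - 1) * s ^ (N - 1 - 1)) = (real N - 1) * radial_mean N f s * (s ^ (N - 1) * s ^ (N - 1))"
      by (simp only:)
    moreover have "?g s * s ^ (N - 1) = f s * (s ^ (N - 1) * s ^ (N - 1))" by simp
    ultimately have "(?g s * s ^ (N - 1) - ?I s * (real (N - 1) * s ^ (N - 1 - 1)))
       = (f s - (real N - 1) * radial_mean N f s) * (s ^ (N - 1) * s ^ (N - 1))"
      by (simp add: left_diff_distrib)
    then show ?thesis using s0 by simp
  qed simp
  ultimately have "((\<lambda>s. ?I s / s ^ (N - 1)) has_real_derivative f s - (real N - 1) * radial_mean N f s) (at s within {0..1})"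
    by simp
  then show ?thesis
  proof (rule has_field_derivative_transform_within[OF _ s0 s])
    fix t assume t: "t \<in> {0..1}" "dist t s < s"
    then have "t > 0" by (auto simp: dist_real_def)
    then have "?I t = t ^ N * radial_mean N f t" using radial_mean_integral[OF f _ N, of t] t by simp
    also have "\<dots> = t ^ (N - 1) * (t * radial_mean N f t)" using N by (simp add: power_eq_if)
    finally show "?I t / t ^ (N - 1) = t * radial_mean N f t" using \<open>t > 0\<close> by simp
  qed
qed

lemma exp_diff_le:
  fixes u w :: real
  assumes "u \<le> b" "w \<le> b"
  shows "\<bar>exp u - exp w\<bar> \<le> exp b * \<bar>u - w\<bar>"
proof -
  have *: "exp y - exp x \<le> exp b * (y - x)" if "x \<le> y" "y \<le> b" for x y :: real
  proof -
    have "exp y - exp x = exp y * (1 - exp (x - y))" by (simp add: exp_diff right_diff_distrib)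
    also have "\<dots> \<le> exp y * (y - x)"
    proof (rule mult_left_mono)
      show "1 - exp (x - y) \<le> y - x" using exp_ge_add_one_self[of "x - y"] by linarith
    qed simp
    also have "\<dots> \<le> exp b * (y - x)" using that by (intro mult_right_mono) auto
    finally show ?thesis .
  qed
  show ?thesis using *[of u w] *[of w u] assms by (cases "u \<le> w") auto
qed

text \<open>The equation (r^(N-1) v')' = - r^(N-1) a exp v, integrated twice with v(0) = \<beta> and
  v'(0) = 0; the singular coefficient (N - 1)/r has disappeared.\<close>

definition picard :: "nat \<Rightarrow> (real \<Rightarrow> real) \<Rightarrow> real \<Rightarrow> (real \<Rightarrow> real) \<Rightarrow> real \<Rightarrow> real" where
  "picard N a \<beta> v r = \<beta> - integral {0..r} (\<lambda>s. s * radial_mean N (\<lambda>t. a t * exp (v t)) s)"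

context
  fixes N :: nat and a :: "real \<Rightarrow> real" and \<beta> A :: real
  assumes N: "0 < N" and a: "continuous_on {0..1} a" and a_bound: "\<And>r. r \<in> {0..1} \<Longrightarrow> 0 \<le> a r \<and> a r \<le> A"
begin

lemma picard_integrand:
  assumes "continuous_on {0..1} v"
  shows "continuous_on {0..1} (\<lambda>s. s * radial_mean N (\<lambda>t. a t * exp (v t)) s)"
  by (intro continuous_intros continuous_on_radial_mean a assms)

lemma picard_deriv:
  assumes "continuous_on {0..1} v" "r \<in> {0..1}"
  shows "(picard N a \<beta> v has_real_derivative - (r * radial_mean N (\<lambda>t. a t * exp (v t)) r)) (at r within {0..1})"
  unfolding picard_def
  using integral_has_real_derivative[OF picard_integrand[OF assms(1)] assms(2)]
  by (auto intro!: derivative_eq_intros)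

lemma picard_cont:
  assumes "continuous_on {0..1} v" shows "continuous_on {0..1} (picard N a \<beta> v)"
  by (rule DERIV_continuous_on[OF picard_deriv[OF assms]])

lemma picard_le:
  assumes "continuous_on {0..1} v" "r \<in> {0..1}" shows "picard N a \<beta> v r \<le> \<beta>"
proof -
  have "0 \<le> integral {0..r} (\<lambda>s. s * radial_mean N (\<lambda>t. a t * exp (v t)) s)"
  proof (rule integral_nonneg)
    show "(\<lambda>s. s * radial_mean N (\<lambda>t. a t * exp (v t)) s) integrable_on {0..r}"
      using assms by (intro integrable_continuous_interval continuous_on_subset[OF picard_integrand]) auto
    fix s assume "s \<in> {0..r}"
    then have s: "s \<in> {0..1}" using assms by auto
    have "0 \<le> radial_mean N (\<lambda>t. a t * exp (v t)) s"
      unfolding radial_mean_def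
      using a_bound mult_unit_interval[OF s]
      by (intro integral_nonneg integrable_continuous_interval continuous_on_radial_integrand s continuous_intros a assms(1)) auto
    then show "0 \<le> s * radial_mean N (\<lambda>t. a t * exp (v t)) s" using s by simp
  qed
  then show ?thesis by (simp add: picard_def)
qed

text \<open>Functions below \<beta> see the exponential with Lipschitz constant exp \<beta>, and the
  outer integration raises the power of r by one and divides by n + 1. This factorial gain makes the
  iteration converge on all of [0, 1] without any smallness.\<close>

lemma picard_diff:
  assumes v: "continuous_on {0..1} v" "\<And>r. r \<in> {0..1} \<Longrightarrow> v r \<le> \<beta>"
    and w: "continuous_on {0..1} w" "\<And>r. r \<in> {0..1} \<Longrightarrow> w r \<le> \<beta>"
    and c: "0 \<le> c" "\<And>r. r \<in> {0..1} \<Longrightarrow> \<bar>v r - w r\<bar> \<le> c * r ^ n" and r: "r \<in> {0..1}"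
  shows "\<bar>picard N a \<beta> v r - picard N a \<beta> w r\<bar> \<le> A * exp \<beta> * c * r ^ Suc n / real (Suc n)"
proof -
  let ?f = "\<lambda>t. a t * exp (v t)" and ?g = "\<lambda>t. a t * exp (w t)"
  have A: "0 \<le> A" using a_bound[of 0] by auto
  have fg: "continuous_on {0..1} ?f" "continuous_on {0..1} ?g" by (intro continuous_intros a v w)+
  have bound: "\<bar>s * radial_mean N ?g s - s * radial_mean N ?f s\<bar> \<le> A * exp \<beta> * c * s ^ n" if s: "s \<in> {0..1}" for s
  proof -
    have "\<bar>radial_mean N (\<lambda>t. ?g t - ?f t) s\<bar> \<le> A * exp \<beta> * (c * s ^ n)"
    proof (rule radial_mean_bound[OF _ s])
      fix t assume t: "t \<in> {0..s}"
      then have t1: "t \<in> {0..1}" using s by auto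
      have "\<bar>?g t - ?f t\<bar> = a t * \<bar>exp (w t) - exp (v t)\<bar>"
        using a_bound[OF t1] by (simp add: abs_mult flip: right_diff_distrib)
      also have "\<dots> \<le> A * (exp \<beta> * \<bar>w t - v t\<bar>)"
        using a_bound[OF t1] exp_diff_le[OF w(2)[OF t1] v(2)[OF t1]] A by (intro mult_mono) auto
      also have "\<dots> \<le> A * (exp \<beta> * (c * s ^ n))"
      proof -
        have "\<bar>w t - v t\<bar> \<le> c * t ^ n" using c(2)[OF t1] by (simp add: abs_minus_commute)
        also have "\<dots> \<le> c * s ^ n" using t c(1) by (intro mult_left_mono power_mono) auto
        finally show ?thesis using A by (intro mult_left_mono) auto
      qed
      finally show "\<bar>?g t - ?f t\<bar> \<le> A * exp \<beta> * (c * s ^ n)" by (simp add: mult.assoc)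
    qed (intro continuous_intros fg)
    then have "\<bar>radial_mean N ?g s - radial_mean N ?f s\<bar> \<le> A * exp \<beta> * (c * s ^ n)"
      by (simp add: radial_mean_diff[OF fg(2,1) s])
    then have "s * \<bar>radial_mean N ?g s - radial_mean N ?f s\<bar> \<le> 1 * (A * exp \<beta> * (c * s ^ n))"
      using s by (intro mult_mono) auto
    then show ?thesis using s by (simp add: abs_mult mult.assoc flip: right_diff_distrib)
  qed
  have ig: "(\<lambda>s. s * radial_mean N ?f s) integrable_on {0..r}" "(\<lambda>s. s * radial_mean N ?g s) integrable_on {0..r}"
    using r by (auto intro!: integrable_continuous_interval continuous_on_subset[OF picard_integrand] v w)
  have hi: "((\<lambda>s. A * exp \<beta> * c * s ^ n) has_integral
      (A * exp \<beta> * c * r ^ Suc n / real (Suc n) - A * exp \<beta> * c * 0 ^ Suc n / real (Suc n))) {0..r}"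
    using r by (intro fundamental_theorem_of_calculus)
      (auto intro!: derivative_eq_intros simp flip: has_real_derivative_iff_has_vector_derivative simp del: power_Suc of_nat_Suc)
  have "\<bar>picard N a \<beta> v r - picard N a \<beta> w r\<bar> =
      norm (integral {0..r} (\<lambda>s. s * radial_mean N ?g s - s * radial_mean N ?f s))"
    by (simp add: picard_def integral_diff[OF ig(2,1)])
  also have "\<dots> \<le> integral {0..r} (\<lambda>s. A * exp \<beta> * c * s ^ n)"
    using hi bound r by (intro integral_norm_bound_integral integrable_diff ig) auto
  finally show ?thesis using integral_unique[OF hi] by simp
qed

lemma picard_fixpoint:
  obtains v where "continuous_on {0..1} v" "\<And>r. r \<in> {0..1} \<Longrightarrow> v r = picard N a \<beta> v r"
proof -
  let ?T = "picard N a \<beta>"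
  define v where "v n = (?T ^^ n) (\<lambda>_. \<beta>)" for n
  have v0: "v 0 = (\<lambda>_. \<beta>)" and vS: "v (Suc n) = ?T (v n)" for n by (simp_all add: v_def)
  have vc: "continuous_on {0..1} (v n)" for n
    by (induction n) (auto simp: v0 vS picard_cont)
  have vle: "v n r \<le> \<beta>" if "r \<in> {0..1}" for n r
    using that by (cases n) (auto simp: v0 vS picard_le[OF vc])
  have A: "0 \<le> A" using a_bound[of 0] by auto
  define L where "L = A * exp \<beta>"
  have L: "0 \<le> L" using A by (simp add: L_def)
  obtain C where C: "0 \<le> C" "\<And>r. r \<in> {0..1} \<Longrightarrow> \<bar>v 1 r - v 0 r\<bar> \<le> C"
  proof -
    have "compact ((\<lambda>r. v 1 r - v 0 r) ` {0..1})"
      by (intro compact_continuous_image continuous_intros vc compact_Icc)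
    then obtain C where "\<forall>y\<in>(\<lambda>r. v 1 r - v 0 r) ` {0..1}. norm y \<le> C"
      using compact_imp_bounded bounded_iff by metis
    then show ?thesis by (intro that[of "max C 0"]) force+
  qed
  have step: "\<bar>v (Suc n) r - v n r\<bar> \<le> C * L ^ n / fact n * r ^ n" if "r \<in> {0..1}" for n r
    using that
  proof (induction n arbitrary: r)
    case 0 then show ?case using C by simp
  next
    case (Suc n)
    have "\<bar>?T (v (Suc n)) r - ?T (v n) r\<bar> \<le> A * exp \<beta> * (C * L ^ n / fact n) * r ^ Suc n / real (Suc n)"
      by (rule picard_diff[OF vc vle vc vle _ Suc.IH Suc.prems]) (use C L in auto)
    also have "\<dots> = C * L ^ Suc n / fact (Suc n) * r ^ Suc n"
      by (simp add: L_def mult_ac)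
    finally show ?case by (simp only: vS)
  qed
  have "uniform_limit {0..1} (\<lambda>n r. \<Sum>i<n. v (Suc i) r - v i r) (\<lambda>r. \<Sum>i. v (Suc i) r - v i r) sequentially"
  proof (rule Weierstrass_m_test)
    show "norm (v (Suc n) r - v n r) \<le> C * (inverse (fact n) * L ^ n)" if "r \<in> {0..1}" for n r
    proof -
      have "C * L ^ n / fact n * r ^ n \<le> C * L ^ n / fact n * 1"
        using that C L by (intro mult_left_mono power_le_one) auto
      then show ?thesis using step[OF that, of n] by (simp add: divide_inverse mult_ac)
    qed
    show "summable (\<lambda>n. C * (inverse (fact n) * L ^ n))" by (intro summable_mult summable_exp)
  qed
  moreover have "(\<Sum>i<n. v (Suc i) r - v i r) = v n r - \<beta>" for n r
    using sum_lessThan_telescope[of "\<lambda>i. v i r" n] by (simp add: v0)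
  ultimately have ul: "uniform_limit {0..1} (\<lambda>n r. v n r - \<beta>) (\<lambda>r. \<Sum>i. v (Suc i) r - v i r) sequentially" by simp
  define u where "u r = \<beta> + (\<Sum>i. v (Suc i) r - v i r)" for r
  have unif: "uniform_limit {0..1} v u sequentially"
  proof -
    have "uniform_limit {0..1} (\<lambda>n r. \<beta> + (v n r - \<beta>)) (\<lambda>r. \<beta> + (\<Sum>i. v (Suc i) r - v i r)) sequentially"
      by (intro uniform_limit_add uniform_limit_const ul)
    then show ?thesis by (simp add: u_def[abs_def])
  qed
  have uc: "continuous_on {0..1} u"
    by (rule uniform_limit_theorem[OF _ unif]) (auto intro!: always_eventually vc)
  have pw: "(\<lambda>n. v n r) \<longlonglongrightarrow> u r" if "r \<in> {0..1}" for r
    using tendsto_uniform_limitI[OF unif that] .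
  have ule: "u r \<le> \<beta>" if "r \<in> {0..1}" for r
    using LIMSEQ_le_const2[OF pw[OF that]] vle[OF that] by blast
  have "u r = ?T u r" if r: "r \<in> {0..1}" for r
  proof -
    have "(\<lambda>n. ?T (v n) r) \<longlonglongrightarrow> ?T u r"
    proof (rule LIMSEQ_I)
      fix e :: real assume e: "e > 0"
      define x where "x = e / (L + 1)"
      define d where "d = x / 2"
      have d: "d > 0" using e L by (simp add: d_def x_def)
      obtain n0 where n0: "\<And>n r. n \<ge> n0 \<Longrightarrow> r \<in> {0..1} \<Longrightarrow> \<bar>v n r - u r\<bar> < d"
        using uniform_limitD[OF unif d] unfolding eventually_sequentially dist_real_def by blast
      have "norm (?T (v n) r - ?T u r) < e" if "n \<ge> n0" for n
      proof -
        have "\<bar>?T (v n) r - ?T u r\<bar> \<le> A * exp \<beta> * d * r ^ Suc 0 / real (Suc 0)"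
          by (rule picard_diff[OF vc vle uc ule _ _ r]) (use d n0[OF that] less_imp_le in auto)
        also have "\<dots> \<le> L * d" using L d r by (simp add: L_def mult_left_le)
        also have "L * d < e"
        proof -
          have "(L + 1) * x = e" using L by (simp add: x_def)
          then have "2 * (L * d) + 2 * d = e" by (simp add: d_def algebra_simps)
          moreover have "0 \<le> L * d" using L d by simp
          ultimately show ?thesis using d by linarith
        qed
        finally show ?thesis by simp
      qed
      then show "\<exists>no. \<forall>n\<ge>no. norm (?T (v n) r - ?T u r) < e" by blast
    qed
    moreover have "(\<lambda>n. ?T (v n) r) \<longlonglongrightarrow> u r"
      using LIMSEQ_Suc[OF pw[OF r]] by (simp add: vS)
    ultimately show ?thesis using LIMSEQ_unique by blast
  qed
  then show ?thesis using that uc by blast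
qed

lemma shooting_solution_exists: "\<exists>v. is_shooting_solution N a \<beta> v"
proof -
  obtain v where vc: "continuous_on {0..1} v" and vT: "\<And>r. r \<in> {0..1} \<Longrightarrow> v r = picard N a \<beta> v r"
    by (rule picard_fixpoint) blast
  let ?f = "\<lambda>t. a t * exp (v t)"
  have fc: "continuous_on {0..1} ?f" by (intro continuous_intros a vc)
  have d1: "(v has_real_derivative - (r * radial_mean N ?f r)) (at r within {0..1})" if "r \<in> {0..1}" for r
    using has_field_derivative_transform_within[OF picard_deriv[OF vc that] zero_less_one that] vT by metis
  have d2: "((\<lambda>r. - (r * radial_mean N ?f r)) has_real_derivative - (?f r - (real N - 1) * radial_mean N ?f r)) (at r within {0..1})"
    if "r \<in> {0..1}" for r
    by (intro DERIV_minus radial_potential_derivs fc N that)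
  have "radial_equation N 1 a {0..1} v"
    unfolding radial_equation_def
  proof (intro exI conjI ballI)
    show "continuous_on {0..1} (\<lambda>r. - (?f r - (real N - 1) * radial_mean N ?f r))"
      by (intro continuous_intros fc continuous_on_radial_mean)
    show "- (- (?f r - (real N - 1) * radial_mean N ?f r) + (real N - 1) / r * - (r * radial_mean N ?f r)) = 1 * a r * exp (v r)"
      if "r \<in> {0<..<1}" for r
      using that by (simp add: field_simps)
  qed (use d1 d2 in auto)
  moreover have "v 0 = \<beta>" using vT[of 0] by (simp add: picard_def)
  ultimately show ?thesis using d1[of 0] by (auto simp: is_shooting_solution_def)
qed

end

section \<open>Comparison and Gronwall estimates for the radial equation\<close>

lemma first_zero:
  fixes d :: "real \<Rightarrow> real"
  assumes c: "continuous_on {0<..R} d" and ev: "eventually (\<lambda>r. 0 < d r) (at_right 0)"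
    and r: "0 < r" "r \<le> R" "d r \<le> 0"
  obtains r0 where "0 < r0" "r0 \<le> r" "d r0 = 0" "\<And>t. 0 < t \<Longrightarrow> t < r0 \<Longrightarrow> 0 < d t"
proof -
  obtain b where b: "b > 0" "\<And>y. 0 < y \<Longrightarrow> y < b \<Longrightarrow> 0 < d y"
    using ev by (auto simp: eventually_at_right_field)
  define c0 where "c0 = min b r / 2"
  have c0: "0 < c0" "c0 < b" "c0 < r" using b r by (auto simp: c0_def)
  define S where "S = {c0..r} \<inter> d -` {..0}"
  have "closed S" unfolding S_def
    by (intro continuous_closed_preimage continuous_on_subset[OF c]) (use c0 r in auto)
  moreover have "r \<in> S" using c0 r by (auto simp: S_def)
  moreover have bb: "bdd_below S" by (auto simp: S_def intro: bdd_belowI[of _ c0])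
  ultimately have mem: "Inf S \<in> S" by (intro closed_contains_Inf) auto
  have "\<exists>x\<ge>c0. x \<le> Inf S \<and> d x = 0"
    using mem b(2)[OF c0(1,2)] c0 r by (intro IVT2' continuous_on_subset[OF c]) (auto simp: S_def)
  then obtain x where x: "c0 \<le> x" "x \<le> Inf S" "d x = 0" by blast
  then have "x \<in> S" using mem by (auto simp: S_def)
  then have "x = Inf S" using cInf_lower[OF _ bb] x by force
  show ?thesis
  proof
    show "0 < x" "x \<le> r" "d x = 0" using x c0 \<open>x \<in> S\<close> by (auto simp: S_def)
    fix t assume t: "0 < t" "t < x"
    show "0 < d t"
    proof (cases "t < c0")
      case True then show ?thesis using b t c0 by auto
    next
      case False
      then have "t \<notin> S" using t \<open>x = Inf S\<close> cInf_lower[OF _ bb, of t] by auto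
      then show ?thesis using False t \<open>x \<le> r\<close> by (auto simp: S_def)
    qed
  qed
qed

text \<open>The limit at 0 from the right takes the place of an initial value, since differences
  with the singular solution have no usable value at 0.\<close>

lemma limit_le_of_deriv_nonneg:
  fixes g :: "real \<Rightarrow> real"
  assumes lim: "(g \<longlongrightarrow> L) (at_right 0)" and c: "continuous_on {0<..R} g" and r: "0 < r" "r \<le> R"
    and d: "\<And>t. 0 < t \<Longrightarrow> t < R \<Longrightarrow> (g has_real_derivative g' t) (at t)" "\<And>t. 0 < t \<Longrightarrow> t < R \<Longrightarrow> 0 \<le> g' t"
  shows "L \<le> g r"
proof (rule tendsto_upperbound[OF lim])
  have "g s \<le> g r" if "0 < s" "s < r" for s
    using that r d by (intro DERIV_nonneg_imp_increasing_open[of s r g] continuous_on_subset[OF c])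
      (auto, metis less_le_trans order_less_trans)
  then show "\<forall>\<^sub>F s in at_right 0. g s \<le> g r"
    using r by (auto simp: eventually_at_right_field)
qed auto

lemma limit_less_of_deriv_pos:
  fixes g :: "real \<Rightarrow> real"
  assumes lim: "(g \<longlongrightarrow> L) (at_right 0)" and c: "continuous_on {0<..R} g" and r: "0 < r" "r \<le> R"
    and d: "\<And>t. 0 < t \<Longrightarrow> t < R \<Longrightarrow> (g has_real_derivative g' t) (at t)" "\<And>t. 0 < t \<Longrightarrow> t < R \<Longrightarrow> 0 < g' t"
  shows "L < g r"
proof -
  have "L \<le> g (r / 2)"
    using r d(2) less_imp_le by (intro limit_le_of_deriv_nonneg[OF lim c _ _ d(1)]) auto
  also have "g (r / 2) < g r"
  proof (rule DERIV_pos_imp_increasing_open[where f=g])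
    show "\<exists>y. (g has_real_derivative y) (at t) \<and> 0 < y" if "r / 2 < t" "t < r" for t
      using that r d[of t] by (intro exI[of _ "g' t"]) auto
    show "continuous_on {r / 2..r} g" by (rule continuous_on_subset[OF c]) (use r in auto)
  qed (use r in auto)
  finally show ?thesis .
qed

lemma continuous_on_Icc_tendsto_right:
  fixes f :: "real \<Rightarrow> real"
  assumes "continuous_on {0..1} f" shows "(f \<longlongrightarrow> f 0) (at_right 0)"
  using assms by (auto simp: continuous_on_def at_within_Icc_at_right dest!: bspec[of _ _ 0])

lemma power_times_ln_tendsto_0: "((\<lambda>r::real. r ^ 4 * ln r) \<longlongrightarrow> 0) (at_right 0)"
proof (rule Lim_null_comparison)
  have "norm (r ^ 4 * ln r) \<le> r ^ 3" if "0 < r" "r < 1" for r :: real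
  proof -
    have "\<bar>ln r\<bar> \<le> 1 / r" using ln_le_minus_one[of "1 / r"] that by (simp add: ln_div)
    then have "r ^ 4 * \<bar>ln r\<bar> \<le> r ^ 4 * (1 / r)" using that by (intro mult_left_mono) auto
    then show ?thesis using that by (simp add: abs_mult power_eq_if)
  qed
  then show "\<forall>\<^sub>F r in at_right 0. norm (r ^ 4 * ln r) \<le> r ^ 3"
    by (auto simp: eventually_at_right_field intro!: exI[of _ 1])
  show "((\<lambda>r::real. r ^ 3) \<longlongrightarrow> 0) (at_right 0)" by (auto intro!: tendsto_eq_intros)
qed

lemma filterlim_minus_ln_at_top:
  "filterlim (\<lambda>r::real. c - 2 * ln r - k * r\<^sup>2) at_top (at_right 0)"
proof -
  have "filterlim (\<lambda>r::real. - ln r) at_top (at_right 0)"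
    using ln_at_0 by (simp add: filterlim_uminus_at_bot)
  then have "filterlim (\<lambda>r::real. 2 * (- ln r)) at_top (at_right 0)"
    by (intro filterlim_tendsto_pos_mult_at_top[OF tendsto_const]) auto
  moreover have "((\<lambda>r::real. c - k * r\<^sup>2) \<longlongrightarrow> c) (at_right 0)" by (auto intro!: tendsto_eq_intros)
  ultimately have "filterlim (\<lambda>r::real. (c - k * r\<^sup>2) + 2 * (- ln r)) at_top (at_right 0)"
    by (rule filterlim_tendsto_add_at_top[rotated])
  then show ?thesis by (simp add: algebra_simps)
qed

lemma DERIV_power9_mult:
  "(d has_real_derivative D) (at r) \<Longrightarrow> ((\<lambda>r. r ^ 9 * d r) has_real_derivative (r ^ 9 * D + 9 * r ^ 8 * d r)) (at r)"
  by (auto intro!: derivative_eq_intros)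

text \<open>The zero may sit at the outer end of the interval, where nothing is known to the right,
  so the sign is obtained from the left limit of \<open>d'\<close>.\<close>

lemma deriv_nonpos_of_pos_left:
  fixes d :: "real \<Rightarrow> real"
  assumes r0: "0 < r0" and d: "\<And>t. 0 < t \<Longrightarrow> t < r0 \<Longrightarrow> (d has_real_derivative d' t) (at t)"
    and c: "continuous_on {0<..r0} d" "continuous_on {0<..r0} d'"
    and pos: "\<And>t. 0 < t \<Longrightarrow> t < r0 \<Longrightarrow> 0 < d t" and z: "d r0 = 0"
  shows "d' r0 \<le> 0"
proof (rule ccontr)
  assume "\<not> ?thesis"
  then have "0 < d' r0" by simp
  have "continuous_on {r0 / 2..r0} d'" by (rule continuous_on_subset[OF c(2)]) (use r0 in auto)
  then have "(d' \<longlongrightarrow> d' r0) (at r0 within {r0 / 2..r0})" using r0 by (auto simp: continuous_on_def)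
  then have "(d' \<longlongrightarrow> d' r0) (at_left r0)" using r0 by (simp add: at_within_Icc_at_left)
  then have "\<forall>\<^sub>F t in at_left r0. 0 < d' t" using \<open>0 < d' r0\<close> by (rule order_tendstoD)
  then obtain b where b: "b < r0" "\<And>y. b < y \<Longrightarrow> y < r0 \<Longrightarrow> 0 < d' y"
    by (auto simp: eventually_at_left_field)
  define s where "s = max b (r0 / 2)"
  have s: "0 < s" "s < r0" "b \<le> s" using b r0 by (auto simp: s_def)
  have "d s < d r0"
  proof (rule DERIV_pos_imp_increasing_open[where f=d])
    show "\<exists>y. (d has_real_derivative y) (at t) \<and> 0 < y" if "s < t" "t < r0" for t
      using that s d[of t] b(2)[of t] by (intro exI[of _ "d' t"]) auto
    show "continuous_on {s..r0} d" by (rule continuous_on_subset[OF c(1)]) (use s in auto)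
  qed (use s in auto)
  then show False using pos[of s] s z by auto
qed

text \<open>In dimension 10 the linearisation at the singular solution has the positive solution
  \<open>r\<^sup>-\<^sup>4 bes (h r\<^sup>2)\<close>; below the Wronskian of \<open>d\<close> with this solution is followed.\<close>

lemma sturm_comparison:
  fixes d :: "real \<Rightarrow> real"
  assumes r0: "0 < r0" "h * r0\<^sup>2 \<le> bes_zero"
    and d: "\<And>t. 0 < t \<Longrightarrow> t < r0 \<Longrightarrow> (d has_real_derivative d' t) (at t)"
      "\<And>t. 0 < t \<Longrightarrow> t < r0 \<Longrightarrow> (d' has_real_derivative (- (9 / t * d' t) - q t)) (at t)"
    and c: "continuous_on {0<..r0} d" "continuous_on {0<..r0} d'"
    and pos: "\<And>t. 0 < t \<Longrightarrow> t < r0 \<Longrightarrow> 0 < d t"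
    and q: "\<And>t. 0 < t \<Longrightarrow> t < r0 \<Longrightarrow> q t < (16 / t\<^sup>2 + h) * d t"
    and lim: "((\<lambda>r. r ^ 4 * d r) \<longlongrightarrow> 0) (at_right 0)" "((\<lambda>r. r ^ 5 * d' r) \<longlongrightarrow> 0) (at_right 0)"
  shows "d r0 \<noteq> 0"
proof
  assume z: "d r0 = 0"
  define f where "f r = bes (h * r\<^sup>2)" for r
  define f' where "f' r = 2 * h * r * bes1 (h * r\<^sup>2)" for r
  \<comment> \<open>This is r^9 (d' y - d y') for y = r^(-4) f, multiplied out; the weight r^9
    removes the first-order terms from its derivative.\<close>
  define W where "W r = 4 * r ^ 4 * d r * f r + r ^ 5 * d' r * f r - r ^ 5 * d r * f' r" for r
  define W' where "W' r = r ^ 5 * f r * ((16 / r\<^sup>2 + h) * d r - q r)" for r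
  have f: "(f has_real_derivative f' r) (at r)" for r
    unfolding f_def f'_def by (auto intro!: derivative_eq_intros)
  have f': "(f' has_real_derivative (2 * h * bes1 (h * r\<^sup>2) + 4 * h\<^sup>2 * r\<^sup>2 * bes2 (h * r\<^sup>2))) (at r)" for r
    unfolding f'_def by (auto intro!: derivative_eq_intros simp: power2_eq_square)
  have W: "(W has_real_derivative W' t) (at t)" if t: "0 < t" "t < r0" for t
  proof -
    let ?f'' = "2 * h * bes1 (h * t\<^sup>2) + 4 * h\<^sup>2 * t\<^sup>2 * bes2 (h * t\<^sup>2)"
    have ode: "t * ?f'' + f' t + h * t * f t = 0"
    proof -
      have "t * ?f'' + f' t + h * t * f t = 4 * h * t * ((h * t\<^sup>2) * bes2 (h * t\<^sup>2) + bes1 (h * t\<^sup>2) + bes (h * t\<^sup>2) / 4)"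
        unfolding f_def f'_def by (simp add: algebra_simps power2_eq_square)
      then show ?thesis by (simp add: bes_ode)
    qed
    have "(W has_real_derivative
       4 * (4 * t ^ 3 * d t * f t + t ^ 4 * d' t * f t + t ^ 4 * d t * f' t)
       + (5 * t ^ 4 * d' t * f t + t ^ 5 * (- (9 / t * d' t) - q t) * f t + t ^ 5 * d' t * f' t)
       - (5 * t ^ 4 * d t * f' t + t ^ 5 * d' t * f' t + t ^ 5 * d t * ?f'')) (at t)"
      unfolding W_def
      by (auto intro!: derivative_eq_intros d t f f' simp: algebra_simps)
    moreover have "4 * (4 * t ^ 3 * d t * f t + t ^ 4 * d' t * f t + t ^ 4 * d t * f' t)
       + (5 * t ^ 4 * d' t * f t + t ^ 5 * (- (9 / t * d' t) - q t) * f t + t ^ 5 * d' t * f' t)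
       - (5 * t ^ 4 * d t * f' t + t ^ 5 * d' t * f' t + t ^ 5 * d t * ?f'')
       = W' t - t ^ 4 * d t * (t * ?f'' + f' t + h * t * f t)"
      using t unfolding W'_def by (simp add: field_simps power_eq_if)
    ultimately show ?thesis using ode by simp
  qed
  have fpos: "0 < f t" if "0 < t" "t < r0" for t
  proof -
    have "h * t\<^sup>2 < bes_zero"
    proof (cases "h \<le> 0")
      case True
      then have "h * t\<^sup>2 \<le> 0" by (simp add: mult_nonpos_nonneg)
      then show ?thesis using bes_zero_pos by linarith
    next
      case False
      then have "h * t\<^sup>2 < h * r0\<^sup>2" using that by (intro mult_strict_left_mono power_strict_mono) auto
      then show ?thesis using r0 by linarith
    qed
    then show ?thesis unfolding f_def by (rule bes_pos)
  qed
  have "((\<lambda>r. 4 * (r ^ 4 * d r) * f r + (r ^ 5 * d' r) * f r - r * (r ^ 4 * d r) * f' r) \<longlongrightarrow> 4 * 0 * f 0 + 0 * f 0 - 0 * 0 * f' 0) (at_right 0)"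
    using DERIV_isCont[OF f, of 0] DERIV_isCont[OF f', of 0]
    by (intro tendsto_intros lim) (auto simp: isCont_def intro: tendsto_within_subset)
  moreover have "(\<lambda>r. 4 * (r ^ 4 * d r) * f r + (r ^ 5 * d' r) * f r - r * (r ^ 4 * d r) * f' r) = W"
    by (auto simp: W_def power_eq_if algebra_simps)
  ultimately have limW: "(W \<longlongrightarrow> 0) (at_right 0)" by simp
  \<comment> \<open>W starts at 0 and increases strictly because q stays below the linearised
    potential times d. At a zero r0 of d only r0^5 d'(r0) f(r0) is left of it, which is not
    positive. Only f(r0) >= 0 is used here, so h r0^2 may equal \<open>bes_zero\<close>.\<close>
  have "0 < W r0"
  proof (rule limit_less_of_deriv_pos[OF limW _ r0(1) order.refl W])
    show "continuous_on {0<..r0} W" unfolding W_def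
      using DERIV_isCont[OF f] DERIV_isCont[OF f']
      by (intro continuous_intros c) (auto intro: continuous_at_imp_continuous_on)
    show "0 < W' t" if "0 < t" "t < r0" for t
      unfolding W'_def using that q[OF that] fpos[OF that] by (intro mult_pos_pos) auto
  qed auto
  moreover have "d' r0 \<le> 0" by (rule deriv_nonpos_of_pos_left[OF r0(1) d(1) c pos z])
  moreover have "0 \<le> f r0" unfolding f_def by (rule bes_nonneg[OF r0(2)])
  ultimately show False using r0 z by (simp add: W_def mult_le_0_iff zero_less_mult_iff)
qed

lemma energy_forward:
  assumes "0 \<le> \<rho>" "\<rho> \<le> r" "0 \<le> L"
    and d: "\<And>t. \<rho> < t \<Longrightarrow> t < r \<Longrightarrow> (d has_real_derivative d' t) (at t)"
      "\<And>t. \<rho> < t \<Longrightarrow> t < r \<Longrightarrow> (d' has_real_derivative (- (9 / t * d' t) - q t)) (at t)"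
    and c: "continuous_on {\<rho>..r} d" "continuous_on {\<rho>..r} d'"
    and q: "\<And>t. \<rho> < t \<Longrightarrow> t < r \<Longrightarrow> \<bar>q t\<bar> \<le> L * \<bar>d t\<bar>"
  shows "(d r)\<^sup>2 + (d' r)\<^sup>2 \<le> ((d \<rho>)\<^sup>2 + (d' \<rho>)\<^sup>2) * exp ((1 + L) * (r - \<rho>))"
proof -
  define g where "g t = ((d t)\<^sup>2 + (d' t)\<^sup>2) * exp (- (1 + L) * (t - \<rho>))" for t
  have "g r \<le> g \<rho>"
  proof (rule DERIV_nonpos_imp_decreasing_open[where f=g])
    fix t assume t: "\<rho> < t" "t < r"
    let ?y = "exp (- (1 + L) * (t - \<rho>)) * (2 * d t * d' t + 2 * d' t * (- (9 / t * d' t) - q t) - (1 + L) * ((d t)\<^sup>2 + (d' t)\<^sup>2))"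
    have "(g has_real_derivative ?y) (at t)"
      unfolding g_def by (auto intro!: derivative_eq_intros d t simp: algebra_simps)
    moreover have "?y \<le> 0"
    proof (rule mult_nonneg_nonpos)
      have "2 * d t * d' t \<le> (d t)\<^sup>2 + (d' t)\<^sup>2" by (rule sum_squares_bound)
      moreover have "2 * d' t * (- (9 / t * d' t) - q t) \<le> L * ((d t)\<^sup>2 + (d' t)\<^sup>2)"
      proof -
        have "2 * d' t * (- (9 / t * d' t)) = - (18 / t * (d' t)\<^sup>2)" by (simp add: power2_eq_square)
        also have "\<dots> \<le> 0" using t assms(1) by simp
        finally have "2 * d' t * (- (9 / t * d' t) - q t) \<le> - (2 * d' t * q t)" by (simp add: right_diff_distrib)
        also have "\<dots> \<le> 2 * \<bar>d' t\<bar> * \<bar>q t\<bar>" using abs_ge_minus_self[of "2 * d' t * q t"] by (simp add: abs_mult)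
        also have "\<dots> \<le> 2 * \<bar>d' t\<bar> * (L * \<bar>d t\<bar>)" by (intro mult_left_mono q t) auto
        also have "\<dots> = L * (2 * \<bar>d t\<bar> * \<bar>d' t\<bar>)" by simp
        also have "\<dots> \<le> L * ((d t)\<^sup>2 + (d' t)\<^sup>2)"
          using sum_squares_bound[of "\<bar>d t\<bar>" "\<bar>d' t\<bar>"] assms(3) by (intro mult_left_mono) auto
        finally show ?thesis .
      qed
      ultimately show "2 * d t * d' t + 2 * d' t * (- (9 / t * d' t) - q t) - (1 + L) * ((d t)\<^sup>2 + (d' t)\<^sup>2) \<le> 0"
        by (simp add: algebra_simps)
    qed simp
    ultimately show "\<exists>y. (g has_real_derivative y) (at t) \<and> y \<le> 0" by blast
  qed (use assms in \<open>auto simp: g_def intro!: continuous_intros\<close>)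
  then have "g r * exp ((1 + L) * (r - \<rho>)) \<le> g \<rho> * exp ((1 + L) * (r - \<rho>))" by (intro mult_right_mono) auto
  moreover have "exp (- (1 + L) * (r - \<rho>)) * exp ((1 + L) * (r - \<rho>)) = 1"
    by (simp add: algebra_simps flip: exp_add)
  then have "g r * exp ((1 + L) * (r - \<rho>)) = (d r)\<^sup>2 + (d' r)\<^sup>2"
    by (simp only: g_def mult.assoc mult_1_right)
  moreover have "g \<rho> = (d \<rho>)\<^sup>2 + (d' \<rho>)\<^sup>2" by (simp add: g_def)
  ultimately show ?thesis by simp
qed

text \<open>Unique continuation towards the origin. Inwards the friction term has the wrong sign and
  costs up to 18/\<rho>, hence \<rho> > 0.\<close>

lemma energy_backward:
  assumes "0 < \<rho>" "\<rho> \<le> r" "0 \<le> L"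
    and d: "\<And>t. \<rho> < t \<Longrightarrow> t < r \<Longrightarrow> (d has_real_derivative d' t) (at t)"
      "\<And>t. \<rho> < t \<Longrightarrow> t < r \<Longrightarrow> (d' has_real_derivative (- (9 / t * d' t) - q t)) (at t)"
    and c: "continuous_on {\<rho>..r} d" "continuous_on {\<rho>..r} d'"
    and q: "\<And>t. \<rho> < t \<Longrightarrow> t < r \<Longrightarrow> \<bar>q t\<bar> \<le> L * \<bar>d t\<bar>"
    and z: "d r = 0" "d' r = 0"
  shows "d \<rho> = 0"
proof -
  define K where "K = 1 + L + 18 / \<rho>"
  define g where "g t = ((d t)\<^sup>2 + (d' t)\<^sup>2) * exp (K * t)" for t
  have "g \<rho> \<le> g r"
  proof (rule DERIV_nonneg_imp_increasing_open[where f=g])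
    fix t assume t: "\<rho> < t" "t < r"
    let ?y = "exp (K * t) * (2 * d t * d' t + 2 * d' t * (- (9 / t * d' t) - q t) + K * ((d t)\<^sup>2 + (d' t)\<^sup>2))"
    have "(g has_real_derivative ?y) (at t)"
      unfolding g_def by (auto intro!: derivative_eq_intros d t simp: algebra_simps)
    moreover have "0 \<le> ?y"
    proof (rule mult_nonneg_nonneg)
      have "0 \<le> (d t)\<^sup>2 + (d' t)\<^sup>2 + 2 * d t * d' t"
        using zero_le_power2[of "d t + d' t"] by (simp add: power2_sum)
      moreover have "0 \<le> L * ((d t)\<^sup>2 + (d' t)\<^sup>2) - 2 * d' t * q t"
      proof -
        have "2 * d' t * q t \<le> 2 * \<bar>d' t\<bar> * \<bar>q t\<bar>" using abs_ge_self[of "2 * d' t * q t"] by (simp add: abs_mult)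
        also have "\<dots> \<le> 2 * \<bar>d' t\<bar> * (L * \<bar>d t\<bar>)" by (intro mult_left_mono q t) auto
        also have "\<dots> = L * (2 * \<bar>d t\<bar> * \<bar>d' t\<bar>)" by simp
        also have "\<dots> \<le> L * ((d t)\<^sup>2 + (d' t)\<^sup>2)"
          using sum_squares_bound[of "\<bar>d t\<bar>" "\<bar>d' t\<bar>"] assms(3) by (intro mult_left_mono) auto
        finally show ?thesis by simp
      qed
      moreover have "0 \<le> 18 / \<rho> * ((d t)\<^sup>2 + (d' t)\<^sup>2) - 2 * d' t * (9 / t * d' t)"
      proof -
        have "2 * d' t * (9 / t * d' t) = 18 / t * (d' t)\<^sup>2" by (simp add: power2_eq_square)
        also have "\<dots> \<le> 18 / \<rho> * ((d t)\<^sup>2 + (d' t)\<^sup>2)"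
          using t assms(1) by (intro mult_mono divide_left_mono) auto
        finally show ?thesis by simp
      qed
      ultimately show "0 \<le> 2 * d t * d' t + 2 * d' t * (- (9 / t * d' t) - q t) + K * ((d t)\<^sup>2 + (d' t)\<^sup>2)"
        unfolding K_def by (simp add: ring_distribs)
    qed simp
    ultimately show "\<exists>y. (g has_real_derivative y) (at t) \<and> 0 \<le> y" by blast
  qed (use assms in \<open>auto simp: g_def intro!: continuous_intros\<close>)
  then have "((d \<rho>)\<^sup>2 + (d' \<rho>)\<^sup>2) * exp (K * \<rho>) \<le> 0" using z by (simp add: g_def)
  then have "(d \<rho>)\<^sup>2 + (d' \<rho>)\<^sup>2 \<le> 0" by (simp add: mult_le_0_iff)
  then show ?thesis by (simp add: sum_power2_le_zero_iff)
qed

section \<open>Comparison with the singular solution\<close>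

text \<open>Dimension 10 in first-order form, with 9 = N - 1. The equation is required inside (0,
  1), and end points enter only through continuity on S. So both the regular solutions, with S =
  [0, 1], and the singular one, with S = (0, 1], are covered.\<close>

definition potential_sol :: "real \<Rightarrow> real set \<Rightarrow> (real \<Rightarrow> real) \<Rightarrow> (real \<Rightarrow> real) \<Rightarrow> bool" where
  "potential_sol h S u u' \<longleftrightarrow> continuous_on S u \<and> continuous_on S u' \<and>
     (\<forall>r\<in>{0<..<1}. (u has_real_derivative u' r) (at r) \<and>
        (u' has_real_derivative (- (9 / r * u' r) - a_coef 10 h r * exp (u r))) (at r))"

text \<open>The singular solution in the normalisation of the shooting problem:
  \<open>U_sing\<close> plus the logarithm of \<open>lambda_sing\<close>, the factor \<lambda> being
  absorbed into the exponential.\<close>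

definition V_sing :: "real \<Rightarrow> real \<Rightarrow> real" where
  "V_sing h r = ln 16 - 2 * ln r - h / 20 * r\<^sup>2"

definition V_sing' :: "real \<Rightarrow> real \<Rightarrow> real" where
  "V_sing' h r = - 2 / r - h / 10 * r"

definition a_max :: "real \<Rightarrow> real" where
  "a_max h = (1 + \<bar>h\<bar> / 16) * exp (\<bar>h\<bar> / 20)"

lemma a_coef_10: "a_coef 10 h r = (1 + h / 16 * r\<^sup>2) * exp (h / 20 * r\<^sup>2)"
  by (simp add: a_coef_def)

lemma a_coef_exp_V_sing:
  assumes "0 < r" shows "a_coef 10 h r * exp (V_sing h r) = 16 / r\<^sup>2 + h"
proof -
  have "exp (V_sing h r) = 16 / r\<^sup>2 * exp (- (h / 20 * r\<^sup>2))"
  proof -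
    have "exp (- (2 * ln r)) = 1 / r\<^sup>2" using assms by (simp only: exp_minus exp_double) (simp add: inverse_eq_divide)
    moreover have "V_sing h r = ln 16 + - (2 * ln r) + - (h / 20 * r\<^sup>2)" by (simp add: V_sing_def)
    ultimately show ?thesis by (simp only: exp_add) simp
  qed
  then have "a_coef 10 h r * exp (V_sing h r) = (1 + h / 16 * r\<^sup>2) * (16 / r\<^sup>2) * (exp (h / 20 * r\<^sup>2) * exp (- (h / 20 * r\<^sup>2)))"
    by (simp add: a_coef_10)
  also have "exp (h / 20 * r\<^sup>2) * exp (- (h / 20 * r\<^sup>2)) = 1" by (simp flip: exp_add)
  finally show ?thesis using assms by (simp add: field_simps)
qed

lemma continuous_on_a_coef: "continuous_on S (a_coef N h)"
  unfolding a_coef_def[abs_def] by (intro continuous_intros)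

lemma V_sing_sol: "potential_sol h {0<..1} (V_sing h) (V_sing' h)"
  unfolding potential_sol_def
proof (intro conjI ballI)
  show "continuous_on {0<..1} (V_sing h)" "continuous_on {0<..1} (V_sing' h)"
    unfolding V_sing_def V_sing'_def by (auto intro!: continuous_intros)
  fix r :: real assume r: "r \<in> {0<..<1}"
  then show "(V_sing h has_real_derivative V_sing' h r) (at r)"
    unfolding V_sing_def V_sing'_def by (auto intro!: derivative_eq_intros)
  have "(V_sing' h has_real_derivative 2 / r\<^sup>2 - h / 10) (at r)"
    unfolding V_sing'_def using r by (auto intro!: derivative_eq_intros simp: power2_eq_square)
  moreover have "2 / r\<^sup>2 - h / 10 = - (9 / r * V_sing' h r) - a_coef 10 h r * exp (V_sing h r)"
  proof -
    have "a_coef 10 h r * exp (V_sing h r) = 16 / r\<^sup>2 + h" using r by (intro a_coef_exp_V_sing) auto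
    then show ?thesis using r by (simp only: V_sing'_def) (simp add: field_simps power2_eq_square)
  qed
  ultimately show "(V_sing' h has_real_derivative - (9 / r * V_sing' h r) - a_coef 10 h r * exp (V_sing h r)) (at r)"
    by simp
qed

lemma potential_sol_diff:
  assumes "potential_sol h S1 u1 u1'" "potential_sol h S2 u2 u2'" "0 < t" "t < 1"
  shows "((\<lambda>r. u2 r - u1 r) has_real_derivative u2' t - u1' t) (at t)"
    "((\<lambda>r. u2' r - u1' r) has_real_derivative
       (- (9 / t * (u2' t - u1' t)) - a_coef 10 h t * (exp (u2 t) - exp (u1 t)))) (at t)"
proof -
  show "((\<lambda>r. u2 r - u1 r) has_real_derivative u2' t - u1' t) (at t)"
    using assms by (auto simp: potential_sol_def intro!: DERIV_diff)
  have "((\<lambda>r. u2' r - u1' r) has_real_derivative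
     (- (9 / t * u2' t) - a_coef 10 h t * exp (u2 t)) - (- (9 / t * u1' t) - a_coef 10 h t * exp (u1 t))) (at t)"
    using assms by (intro DERIV_diff) (auto simp: potential_sol_def)
  then show "((\<lambda>r. u2' r - u1' r) has_real_derivative
       (- (9 / t * (u2' t - u1' t)) - a_coef 10 h t * (exp (u2 t) - exp (u1 t)))) (at t)"
    by (simp add: algebra_simps diff_divide_distrib)
qed

definition shoot :: "real \<Rightarrow> real \<Rightarrow> real \<Rightarrow> real" where
  "shoot h \<beta> = shooting_solution 10 (a_coef 10 h) \<beta>"

text \<open>A continuous version of the derivative that includes the one-sided values at 0 and 1,
  where \<open>deriv\<close> is of no use.\<close>

definition shoot' :: "real \<Rightarrow> real \<Rightarrow> real \<Rightarrow> real" where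
  "shoot' h \<beta> = (SOME v'. potential_sol h {0..1} (shoot h \<beta>) v' \<and> v' 0 = 0)"

context
  fixes h :: real
  assumes h: "- 16 < h"
begin

text \<open>Here h > -16 enters: r^2 a exp V = 16 + h r^2 for V = \<open>V_sing\<close>, so this is
  the weight of all flux equations below.\<close>

lemma potential_weight_pos:
  assumes "0 \<le> r" "r \<le> 1"
  shows "0 < 16 + h * r\<^sup>2" "min 16 (16 + h) \<le> 16 + h * r\<^sup>2" "\<bar>16 + h * r\<^sup>2\<bar> \<le> 16 + \<bar>h\<bar>"
proof -
  have r: "0 \<le> r\<^sup>2" "r\<^sup>2 \<le> 1" using assms by (auto intro: power_le_one)
  show 1: "min 16 (16 + h) \<le> 16 + h * r\<^sup>2"
  proof (cases "h \<ge> 0")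
    case False
    then have "h * 1 \<le> h * r\<^sup>2" using r by (intro mult_left_mono_neg) auto
    then show ?thesis by simp
  qed (use r in auto)
  then show "0 < 16 + h * r\<^sup>2" using h by linarith
  have "\<bar>h * r\<^sup>2\<bar> \<le> \<bar>h\<bar> * 1" unfolding abs_mult using r by (intro mult_left_mono) auto
  then show "\<bar>16 + h * r\<^sup>2\<bar> \<le> 16 + \<bar>h\<bar>" by linarith
qed

lemma a_coef_bounds:
  assumes "r \<in> {0..1}"
  shows "0 < a_coef 10 h r" "a_coef 10 h r \<le> a_max h"
proof -
  have r: "0 \<le> r\<^sup>2" "r\<^sup>2 \<le> 1" using assms by (auto intro: power_le_one)
  show "0 < a_coef 10 h r"
    unfolding a_coef_10 using potential_weight_pos(1)[of r] assms by (intro mult_pos_pos) (auto simp: field_simps)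
  have "h * r\<^sup>2 \<le> \<bar>h\<bar> * 1" using r by (intro mult_mono) auto
  then show "a_coef 10 h r \<le> a_max h"
    unfolding a_coef_10 a_max_def by (intro mult_mono) auto
qed

lemma a_max_pos: "0 < a_max h"
  unfolding a_max_def by (intro mult_pos_pos) (auto intro: add_pos_nonneg)

lemma shoot_sol: "potential_sol h {0..1} (shoot h \<beta>) (shoot' h \<beta>)" and shoot'_0: "shoot' h \<beta> 0 = 0"
  and shoot_0: "shoot h \<beta> 0 = \<beta>"
proof -
  have "\<exists>v. is_shooting_solution 10 (a_coef 10 h) \<beta> v"
    by (rule shooting_solution_exists[where A="a_max h"])
       (use a_coef_bounds less_imp_le in \<open>auto intro: continuous_on_a_coef\<close>)
  then have s: "is_shooting_solution 10 (a_coef 10 h) \<beta> (shoot h \<beta>)"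
    unfolding shoot_def shooting_solution_def by (rule someI_ex)
  then show "shoot h \<beta> 0 = \<beta>" by (simp add: is_shooting_solution_def)
  obtain u' u'' where u: "\<And>r. r \<in> {0..1} \<Longrightarrow> (shoot h \<beta> has_real_derivative u' r) (at r within {0..1})"
     "\<And>r. r \<in> {0..1} \<Longrightarrow> (u' has_real_derivative u'' r) (at r within {0..1})"
     "\<And>r. r \<in> {0<..<1} \<Longrightarrow> - (u'' r + (real 10 - 1) / r * u' r) = 1 * a_coef 10 h r * exp (shoot h \<beta> r)"
    using s unfolding is_shooting_solution_def radial_equation_def by blast
  have z: "(shoot h \<beta> has_real_derivative 0) (at 0 within {0..1})"
    using s by (simp add: is_shooting_solution_def)
  have "u' 0 = 0"
    using tendsto_unique[OF trivial_limit_at_right_real] u(1)[of 0] z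
    by (auto simp: has_field_derivative_iff at_within_Icc_at_right)
  moreover have "potential_sol h {0..1} (shoot h \<beta>) u'"
    unfolding potential_sol_def
  proof (intro conjI ballI)
    show "continuous_on {0..1} (shoot h \<beta>)" by (rule DERIV_continuous_on[OF u(1)])
    show "continuous_on {0..1} u'" by (rule DERIV_continuous_on[OF u(2)])
    fix r :: real assume r: "r \<in> {0<..<1}"
    have "r \<in> interior {0..1}" using r by (simp add: interior_atLeastAtMost_real)
    then have w: "at r within {0..1} = at r" by (rule at_within_interior)
    show "(shoot h \<beta> has_real_derivative u' r) (at r)" using u(1)[of r] w r by simp
    have "u'' r = - (9 / r * u' r) - a_coef 10 h r * exp (shoot h \<beta> r)" using u(3)[OF r] by simp
    then show "(u' has_real_derivative - (9 / r * u' r) - a_coef 10 h r * exp (shoot h \<beta> r)) (at r)"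
      using u(2)[of r] w r by simp
  qed
  ultimately have "\<exists>v'. potential_sol h {0..1} (shoot h \<beta>) v' \<and> v' 0 = 0" by blast
  from someI_ex[OF this] show "potential_sol h {0..1} (shoot h \<beta>) (shoot' h \<beta>)" "shoot' h \<beta> 0 = 0"
    by (simp_all add: shoot'_def)
qed

lemma shoot_cont: "continuous_on {0..1} (shoot h \<beta>)" "continuous_on {0..1} (shoot' h \<beta>)"
  using shoot_sol by (auto simp: potential_sol_def)

lemma shoot_tendsto: "(shoot h \<beta> \<longlongrightarrow> \<beta>) (at_right 0)" "(shoot' h \<beta> \<longlongrightarrow> 0) (at_right 0)"
  using continuous_on_Icc_tendsto_right[OF shoot_cont(1)] continuous_on_Icc_tendsto_right[OF shoot_cont(2)]
  by (simp_all add: shoot_0 shoot'_0)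

text \<open>The flux r^9 v' starts at 0 and decreases, since the source a exp v is positive.\<close>

lemma shoot_antimono:
  assumes r: "0 \<le> s" "s \<le> r" "r \<le> 1"
  shows "shoot h \<beta> r \<le> shoot h \<beta> s"
proof -
  have d': "shoot' h \<beta> r \<le> 0" if r: "0 < r" "r < 1" for r
  proof -
    have "0 \<le> - (r ^ 9 * shoot' h \<beta> r)"
    proof (rule limit_le_of_deriv_nonneg[where g="\<lambda>r. - (r ^ 9 * shoot' h \<beta> r)" and
          g'="\<lambda>t. t ^ 9 * (a_coef 10 h t * exp (shoot h \<beta> t))"])
      show "((\<lambda>r. - (r ^ 9 * shoot' h \<beta> r)) \<longlongrightarrow> 0) (at_right 0)"
        by (auto intro!: tendsto_eq_intros shoot_tendsto)
      show "continuous_on {0<..1} (\<lambda>r. - (r ^ 9 * shoot' h \<beta> r))"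
        by (intro continuous_intros continuous_on_subset[OF shoot_cont(2)]) auto
      fix t :: real assume t: "0 < t" "t < 1"
      have "((\<lambda>r. - (r ^ 9 * shoot' h \<beta> r)) has_real_derivative
         - (t ^ 9 * (- (9 / t * shoot' h \<beta> t) - a_coef 10 h t * exp (shoot h \<beta> t)) + 9 * t ^ 8 * shoot' h \<beta> t)) (at t)"
        using shoot_sol t by (intro DERIV_minus DERIV_power9_mult) (auto simp: potential_sol_def)
      moreover have "- (t ^ 9 * (- (9 / t * shoot' h \<beta> t) - a_coef 10 h t * exp (shoot h \<beta> t)) + 9 * t ^ 8 * shoot' h \<beta> t)
         = t ^ 9 * (a_coef 10 h t * exp (shoot h \<beta> t))"
        using t by (simp add: field_simps power_eq_if)
      ultimately show "((\<lambda>r. - (r ^ 9 * shoot' h \<beta> r)) has_real_derivative t ^ 9 * (a_coef 10 h t * exp (shoot h \<beta> t))) (at t)"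
        by simp
      show "0 \<le> t ^ 9 * (a_coef 10 h t * exp (shoot h \<beta> t))" using a_coef_bounds(1)[of t] t by simp
    qed (use r in auto)
    then show ?thesis using r by (simp add: mult_le_0_iff)
  qed
  show ?thesis
  proof (rule DERIV_nonpos_imp_decreasing_open[where f="shoot h \<beta>"])
    show "\<exists>y. (shoot h \<beta> has_real_derivative y) (at t) \<and> y \<le> 0" if "s < t" "t < r" for t
      using shoot_sol d'[of t] that r by (intro exI[of _ "shoot' h \<beta> t"]) (auto simp: potential_sol_def)
    show "continuous_on {s..r} (shoot h \<beta>)" by (rule continuous_on_subset[OF shoot_cont(1)]) (use r in auto)
  qed (use r in auto)
qed

lemma shoot_le: "r \<in> {0..1} \<Longrightarrow> shoot h \<beta> r \<le> \<beta>"
  using shoot_antimono[of 0 r \<beta>] by (simp add: shoot_0)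

lemma shoot_lipschitz:
  assumes "\<beta>1 \<le> B" "\<beta>2 \<le> B" "r \<in> {0..1}"
  shows "\<bar>shoot h \<beta>2 r - shoot h \<beta>1 r\<bar> \<le> exp (1 + a_max h * exp B) * \<bar>\<beta>2 - \<beta>1\<bar>"
proof -
  define L where "L = a_max h * exp B"
  have L: "0 \<le> L" using a_max_pos by (simp add: L_def)
  let ?d = "\<lambda>r. shoot h \<beta>2 r - shoot h \<beta>1 r" and ?d' = "\<lambda>r. shoot' h \<beta>2 r - shoot' h \<beta>1 r"
  have "(?d r)\<^sup>2 + (?d' r)\<^sup>2 \<le> ((?d 0)\<^sup>2 + (?d' 0)\<^sup>2) * exp ((1 + L) * (r - 0))"
  proof (rule energy_forward[where q="\<lambda>t. a_coef 10 h t * (exp (shoot h \<beta>2 t) - exp (shoot h \<beta>1 t))"])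
    fix t assume t: "0 < t" "t < r"
    then have t1: "t \<in> {0..1}" "t < 1" using assms by auto
    show "(?d has_real_derivative ?d' t) (at t)"
      "(?d' has_real_derivative - (9 / t * ?d' t) - a_coef 10 h t * (exp (shoot h \<beta>2 t) - exp (shoot h \<beta>1 t))) (at t)"
      using potential_sol_diff[OF shoot_sol shoot_sol t(1) t1(2)] by blast+
    have "\<bar>a_coef 10 h t * (exp (shoot h \<beta>2 t) - exp (shoot h \<beta>1 t))\<bar> = a_coef 10 h t * \<bar>exp (shoot h \<beta>2 t) - exp (shoot h \<beta>1 t)\<bar>"
      using a_coef_bounds(1)[OF t1(1)] by (simp add: abs_mult)
    also have "\<dots> \<le> a_max h * (exp B * \<bar>?d t\<bar>)"
      using a_coef_bounds[OF t1(1)] shoot_le[OF t1(1), of \<beta>1] shoot_le[OF t1(1), of \<beta>2] assms a_max_pos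
      by (intro mult_mono exp_diff_le) auto
    finally show "\<bar>a_coef 10 h t * (exp (shoot h \<beta>2 t) - exp (shoot h \<beta>1 t))\<bar> \<le> L * \<bar>?d t\<bar>"
      by (simp add: L_def mult.assoc)
  qed (use assms L in \<open>auto intro!: continuous_intros continuous_on_subset[OF shoot_cont(1)] continuous_on_subset[OF shoot_cont(2)]\<close>)
  also have "\<dots> \<le> (\<beta>2 - \<beta>1)\<^sup>2 * exp (1 + L)"
    using assms L by (simp add: shoot_0 shoot'_0 mult_left_le mult_left_mono)
  \<comment> \<open>A generous constant that turns the bound into a perfect square.\<close>
  also have "\<dots> \<le> (\<beta>2 - \<beta>1)\<^sup>2 * (exp (1 + L))\<^sup>2"
    using L by (intro mult_left_mono) (auto simp: power2_eq_square)
  also have "(\<beta>2 - \<beta>1)\<^sup>2 * (exp (1 + L))\<^sup>2 = (exp (1 + L) * \<bar>\<beta>2 - \<beta>1\<bar>)\<^sup>2"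
    by (simp add: power_mult_distrib)
  finally have "(?d r)\<^sup>2 \<le> (exp (1 + L) * \<bar>\<beta>2 - \<beta>1\<bar>)\<^sup>2"
    using zero_le_power2[of "?d' r"] by linarith
  then have "\<bar>?d r\<bar> \<le> \<bar>exp (1 + L) * \<bar>\<beta>2 - \<beta>1\<bar>\<bar>" by (simp only: abs_le_square_iff)
  then show ?thesis by (simp add: L_def abs_mult)
qed

text \<open>By convexity exp u2 - exp u1 < exp u2 (u2 - u1) <= exp V (u2 - u1) with V =
  \<open>V_sing\<close>, so up to its first zero the difference satisfies the hypotheses of the
  Sturm comparison with the linearisation at V. The bound by V concerns only the upper function,
  which may be V itself.\<close>

lemma potential_sol_less:
  assumes u1: "potential_sol h {0<..1} u1 u1'" and u2: "potential_sol h {0<..1} u2 u2'"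
    and R: "R \<le> 1" "h * R\<^sup>2 \<le> bes_zero" and V: "\<And>r. 0 < r \<Longrightarrow> r < R \<Longrightarrow> u2 r \<le> V_sing h r"
    and ev: "\<forall>\<^sub>F r in at_right 0. u1 r < u2 r"
    and lim: "((\<lambda>r. r ^ 4 * (u2 r - u1 r)) \<longlongrightarrow> 0) (at_right 0)" "((\<lambda>r. r ^ 5 * (u2' r - u1' r)) \<longlongrightarrow> 0) (at_right 0)"
    and r: "0 < r" "r \<le> R"
  shows "u1 r < u2 r"
proof (rule ccontr)
  let ?d = "\<lambda>r. u2 r - u1 r" and ?d' = "\<lambda>r. u2' r - u1' r"
  assume "\<not> ?thesis"
  then have nr: "?d r \<le> 0" by simp
  have c: "continuous_on {0<..1} ?d" "continuous_on {0<..1} ?d'"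
    using u1 u2 by (auto simp: potential_sol_def intro!: continuous_intros)
  have ev': "\<forall>\<^sub>F r in at_right 0. 0 < ?d r" using ev by simp
  obtain r0 where r0: "0 < r0" "r0 \<le> r" "?d r0 = 0" "\<And>t. 0 < t \<Longrightarrow> t < r0 \<Longrightarrow> 0 < ?d t"
    using first_zero[OF c(1) ev' r(1) _ nr] r R by auto
  have "h * r0\<^sup>2 \<le> bes_zero"
  proof (cases "h \<le> 0")
    case True
    then have "h * r0\<^sup>2 \<le> 0" by (simp add: mult_nonpos_nonneg)
    then show ?thesis using bes_zero_pos by linarith
  next
    case False
    then have "h * r0\<^sup>2 \<le> h * R\<^sup>2" using r0 r by (intro mult_left_mono power_mono) auto
    then show ?thesis using R by linarith
  qed
  moreover have "a_coef 10 h t * (exp (u2 t) - exp (u1 t)) < (16 / t\<^sup>2 + h) * ?d t" if t: "0 < t" "t < r0" for t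
  proof -
    have d: "0 < ?d t" using r0(4) t by simp
    have a: "0 < a_coef 10 h t" using a_coef_bounds(1)[of t] t r0 r R by auto
    have "exp (u2 t) - exp (u1 t) = exp (u2 t) * (1 - exp (- ?d t))" by (simp add: right_diff_distrib flip: exp_add)
    also have "\<dots> < exp (u2 t) * ?d t"
      using exp_minus_greater[of "?d t"] d by (intro mult_strict_left_mono) auto
    also have "\<dots> \<le> exp (V_sing h t) * ?d t"
      using V[of t] t r0(1-3) r d by (intro mult_right_mono) auto
    finally have "a_coef 10 h t * (exp (u2 t) - exp (u1 t)) < a_coef 10 h t * (exp (V_sing h t) * ?d t)"
      using a by (intro mult_strict_left_mono)
    also have "\<dots> = (16 / t\<^sup>2 + h) * ?d t" using a_coef_exp_V_sing[OF t(1), of h] by (simp flip: mult.assoc)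
    finally show ?thesis .
  qed
  ultimately have "?d r0 \<noteq> 0"
    using potential_sol_diff[OF u1 u2] r0 r R lim
    by (intro sturm_comparison[where h=h and d'="?d'" and q="\<lambda>t. a_coef 10 h t * (exp (u2 t) - exp (u1 t))"]
        continuous_on_subset[OF c(1)] continuous_on_subset[OF c(2)]) auto
  then show False using r0 by simp
qed

lemma potential_sol_subset: "potential_sol h S u u' \<Longrightarrow> T \<subseteq> S \<Longrightarrow> potential_sol h T u u'"
  by (auto simp: potential_sol_def intro: continuous_on_subset)

lemma shoot_sol': "potential_sol h {0<..1} (shoot h \<beta>) (shoot' h \<beta>)"
  by (rule potential_sol_subset[OF shoot_sol]) auto

lemma eventually_less_V_sing: "\<forall>\<^sub>F r in at_right 0. shoot h \<beta> r < V_sing h r"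
proof -
  have "\<forall>\<^sub>F r in at_right 0. \<beta> < V_sing h r"
    using filterlim_minus_ln_at_top[of "ln 16" "h / 20"] by (auto simp: filterlim_at_top_dense V_sing_def)
  moreover have "\<forall>\<^sub>F r in at_right 0. r \<in> {0..1::real}" by (auto simp: eventually_at_right_field intro!: exI[of _ 1])
  ultimately show ?thesis by eventually_elim (auto intro: order.strict_trans1[OF shoot_le])
qed

lemma V_sing_limits:
  "((\<lambda>r. r ^ 4 * (V_sing h r - shoot h \<beta> r)) \<longlongrightarrow> 0) (at_right 0)"
  "n \<ge> 5 \<Longrightarrow> ((\<lambda>r. r ^ n * (V_sing' h r - shoot' h \<beta> r)) \<longlongrightarrow> 0) (at_right 0)"
proof -
  have "((\<lambda>r. (ln 16 * r ^ 4 - 2 * (r ^ 4 * ln r) - h / 20 * r ^ 6) - r ^ 4 * shoot h \<beta> r) \<longlongrightarrow> (ln 16 * 0 - 2 * 0 - h / 20 * 0) - 0 * \<beta>) (at_right 0)"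
    by (intro tendsto_intros power_times_ln_tendsto_0 shoot_tendsto) (auto intro!: tendsto_eq_intros)
  then show "((\<lambda>r. r ^ 4 * (V_sing h r - shoot h \<beta> r)) \<longlongrightarrow> 0) (at_right 0)"
    by (simp add: V_sing_def algebra_simps flip: power_add)
  assume n: "n \<ge> 5"
  have "((\<lambda>r. (- 2 * r ^ (n - 1) - h / 10 * r ^ (n + 1)) - r ^ n * shoot' h \<beta> r) \<longlongrightarrow> (- 2 * 0 - h / 10 * 0) - 0 * 0) (at_right 0)"
    using n by (intro tendsto_intros shoot_tendsto) (auto intro!: tendsto_eq_intros)
  then have "((\<lambda>r. (- 2 * r ^ (n - 1) - h / 10 * r ^ (n + 1)) - r ^ n * shoot' h \<beta> r) \<longlongrightarrow> 0) (at_right 0)" by simp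
  then show "((\<lambda>r. r ^ n * (V_sing' h r - shoot' h \<beta> r)) \<longlongrightarrow> 0) (at_right 0)"
    by (rule Lim_transform_eventually)
      (use n in \<open>auto simp: V_sing'_def eventually_at_right_field field_simps power_eq_if intro!: exI[of _ 1]\<close>)
qed

lemma shoot_less_V_sing:
  assumes "R \<le> 1" "h * R\<^sup>2 \<le> bes_zero" "0 < r" "r \<le> R"
  shows "shoot h \<beta> r < V_sing h r"
  by (rule potential_sol_less[OF shoot_sol' V_sing_sol assms(1,2) _ eventually_less_V_sing V_sing_limits assms(3,4)]) auto

lemma shoot_less_shoot:
  assumes "R \<le> 1" "h * R\<^sup>2 \<le> bes_zero" "0 < r" "r \<le> R" "\<beta>1 < \<beta>2"
  shows "shoot h \<beta>1 r < shoot h \<beta>2 r"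
proof (rule potential_sol_less[OF shoot_sol' shoot_sol' assms(1,2) _ _ _ _ assms(3,4)])
  show "shoot h \<beta>2 r \<le> V_sing h r" if "0 < r" "r < R" for r
    using shoot_less_V_sing[OF assms(1,2), of r \<beta>2] that by simp
  have "((\<lambda>r. shoot h \<beta>2 r - shoot h \<beta>1 r) \<longlongrightarrow> \<beta>2 - \<beta>1) (at_right 0)"
    by (intro tendsto_intros shoot_tendsto)
  then show "\<forall>\<^sub>F r in at_right 0. shoot h \<beta>1 r < shoot h \<beta>2 r"
    using order_tendstoD(1)[of _ "\<beta>2 - \<beta>1" _ 0] assms(5) by fastforce
qed (auto intro!: tendsto_eq_intros shoot_tendsto)

text \<open>This is what makes \<open>bif_alpha\<close> strictly increasing: for ordered solutions,
  r^9 times the derivative of the difference starts at 0 and decreases, so the difference shrinks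
  from r = 0 to r = 1.\<close>

lemma shoot_diff_less:
  assumes "\<beta>1 < \<beta>2" and less: "\<And>r. 0 < r \<Longrightarrow> r < 1 \<Longrightarrow> shoot h \<beta>1 r < shoot h \<beta>2 r"
  shows "shoot h \<beta>2 1 - shoot h \<beta>1 1 < \<beta>2 - \<beta>1"
proof -
  let ?d = "\<lambda>r. shoot h \<beta>2 r - shoot h \<beta>1 r" and ?d' = "\<lambda>r. shoot' h \<beta>2 r - shoot' h \<beta>1 r"
  let ?q = "\<lambda>t. a_coef 10 h t * (exp (shoot h \<beta>2 t) - exp (shoot h \<beta>1 t))"
  have d': "?d' r < 0" if r: "0 < r" "r < 1" for r
  proof -
    have "0 < - (r ^ 9 * ?d' r)"
    proof (rule limit_less_of_deriv_pos[where g="\<lambda>r. - (r ^ 9 * ?d' r)" and g'="\<lambda>t. t ^ 9 * ?q t"])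
      show "((\<lambda>r. - (r ^ 9 * ?d' r)) \<longlongrightarrow> 0) (at_right 0)"
        by (auto intro!: tendsto_eq_intros shoot_tendsto)
      show "continuous_on {0<..1} (\<lambda>r. - (r ^ 9 * ?d' r))"
        by (intro continuous_intros continuous_on_subset[OF shoot_cont(2)]) auto
      fix t :: real assume t: "0 < t" "t < 1"
      have "((\<lambda>r. - (r ^ 9 * ?d' r)) has_real_derivative - (t ^ 9 * (- (9 / t * ?d' t) - ?q t) + 9 * t ^ 8 * ?d' t)) (at t)"
        by (intro DERIV_minus DERIV_power9_mult potential_sol_diff(2)[OF shoot_sol shoot_sol t])
      moreover have "- (t ^ 9 * (- (9 / t * ?d' t) - ?q t) + 9 * t ^ 8 * ?d' t) = t ^ 9 * ?q t"
        using t by (simp add: field_simps power_eq_if)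
      ultimately show "((\<lambda>r. - (r ^ 9 * ?d' r)) has_real_derivative t ^ 9 * ?q t) (at t)" by simp
      show "0 < t ^ 9 * ?q t" using a_coef_bounds(1)[of t] less[OF t] t by simp
    qed (use r in auto)
    then show ?thesis using r by (simp add: mult_less_0_iff)
  qed
  have "?d 1 < ?d 0"
  proof (rule DERIV_neg_imp_decreasing_open[where f="?d"])
    show "\<exists>y. (?d has_real_derivative y) (at t) \<and> y < 0" if "0 < t" "t < 1" for t
      using potential_sol_diff(1)[OF shoot_sol shoot_sol that] d'[OF that] by blast
    show "continuous_on {0..1} ?d" by (intro continuous_intros shoot_cont)
  qed auto
  then show ?thesis by (simp add: shoot_0)
qed

end

section \<open>Convergence of the shooting solutions to the singular one\<close>

lemma powr_tendsto_0_at_right: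
  fixes c :: real
  assumes "0 < c" shows "((\<lambda>r. r powr c) \<longlongrightarrow> 0) (at_right 0)"
proof (rule tendsto_zero_powrI[OF _ tendsto_const _ assms])
  show "\<forall>\<^sub>F r in at_right 0. 0 \<le> (r::real)" by (auto simp: eventually_at_right_field intro: exI[of _ 1])
qed (auto intro!: tendsto_eq_intros)

context
  fixes h :: real
  assumes h: "- 16 < h"
begin

text \<open>The equation for z = v - V in divergence form, with V = \<open>V_sing\<close>. Because a
  exp V = 16/t^2 + h, the source depends on z alone apart from a polynomial weight.\<close>

lemma shoot_V_sing_flux:
  assumes "0 < t" "t < 1"
  shows "((\<lambda>r. r ^ 9 * (shoot' h \<beta> r - V_sing' h r)) has_real_derivative
     t ^ 7 * (16 + h * t\<^sup>2) * (1 - exp (shoot h \<beta> t - V_sing h t))) (at t)"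
proof -
  let ?e = "a_coef 10 h t * (exp (shoot h \<beta> t) - exp (V_sing h t))"
  have "exp (shoot h \<beta> t) = exp (V_sing h t) * exp (shoot h \<beta> t - V_sing h t)" by (simp flip: exp_add)
  then have "?e = (a_coef 10 h t * exp (V_sing h t)) * (exp (shoot h \<beta> t - V_sing h t) - 1)"
    by (simp add: algebra_simps)
  then have e: "?e = (16 / t\<^sup>2 + h) * (exp (shoot h \<beta> t - V_sing h t) - 1)"
    by (simp only: a_coef_exp_V_sing[OF assms(1)])
  have "((\<lambda>r. r ^ 9 * (shoot' h \<beta> r - V_sing' h r)) has_real_derivative
     t ^ 9 * (- (9 / t * (shoot' h \<beta> t - V_sing' h t)) - ?e) + 9 * t ^ 8 * (shoot' h \<beta> t - V_sing' h t)) (at t)"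
    by (intro DERIV_power9_mult potential_sol_diff(2)[OF V_sing_sol shoot_sol[OF h] assms])
  moreover have "t ^ 9 * (- (9 / t * (shoot' h \<beta> t - V_sing' h t)) - ?e) + 9 * t ^ 8 * (shoot' h \<beta> t - V_sing' h t)
     = t ^ 7 * (16 + h * t\<^sup>2) * (1 - exp (shoot h \<beta> t - V_sing h t))"
    unfolding e using assms by (simp add: field_simps power_eq_if)
  ultimately show ?thesis by simp
qed

lemma V_sing_cont: "continuous_on {0<..1} (V_sing h)" "continuous_on {0<..1} (V_sing' h)"
  using V_sing_sol[of h] by (auto simp: potential_sol_def)

lemma shoot_cont': "continuous_on {0<..1} (shoot h \<beta>)" "continuous_on {0<..1} (shoot' h \<beta>)"
  using shoot_sol'[OF h] by (auto simp: potential_sol_def)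

lemma shoot_V_sing_flux_limit: "((\<lambda>r. r ^ 9 * (shoot' h \<beta> r - V_sing' h r)) \<longlongrightarrow> 0) (at_right 0)"
  using tendsto_minus[OF V_sing_limits(2)[OF h, of 9 \<beta>]] by (simp add: algebra_simps)

lemma shoot_V_sing_deriv_nonneg:
  assumes R: "R \<le> 1" "h * R\<^sup>2 \<le> bes_zero" and r: "0 < r" "r \<le> R"
  shows "0 \<le> shoot' h \<beta> r - V_sing' h r"
proof -
  have "0 \<le> r ^ 9 * (shoot' h \<beta> r - V_sing' h r)"
  proof (rule limit_le_of_deriv_nonneg[OF shoot_V_sing_flux_limit _ r shoot_V_sing_flux])
    show "continuous_on {0<..R} (\<lambda>r. r ^ 9 * (shoot' h \<beta> r - V_sing' h r))"
      by (intro continuous_intros continuous_on_subset[OF shoot_cont'(2)] continuous_on_subset[OF V_sing_cont(2)]) (use R in auto)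
    fix t assume t: "0 < t" "t < R"
    then show "0 \<le> t ^ 7 * (16 + h * t\<^sup>2) * (1 - exp (shoot h \<beta> t - V_sing h t))"
      using shoot_less_V_sing[OF h R, of t \<beta>] potential_weight_pos(1)[OF h, of t] R
      by (intro mult_nonneg_nonneg) auto
  qed (use R in auto)
  then show ?thesis using r by (simp add: zero_le_mult_iff)
qed

lemma shoot_V_sing_mono:
  assumes R: "R \<le> 1" "h * R\<^sup>2 \<le> bes_zero" and r: "0 < s" "s \<le> r" "r \<le> R"
  shows "shoot h \<beta> s - V_sing h s \<le> shoot h \<beta> r - V_sing h r"
proof (rule DERIV_nonneg_imp_increasing_open[where f="\<lambda>r. shoot h \<beta> r - V_sing h r"])
  show "\<exists>y. ((\<lambda>r. shoot h \<beta> r - V_sing h r) has_real_derivative y) (at t) \<and> 0 \<le> y" if "s < t" "t < r" for t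
    using potential_sol_diff(1)[OF V_sing_sol shoot_sol[OF h], of t] shoot_V_sing_deriv_nonneg[OF R, of t] that r R
    by (intro exI[of _ "shoot' h \<beta> t - V_sing' h t"]) auto
  show "continuous_on {s..r} (\<lambda>r. shoot h \<beta> r - V_sing h r)"
    by (intro continuous_intros continuous_on_subset[OF shoot_cont'(1)] continuous_on_subset[OF V_sing_cont(1)]) (use r R in auto)
qed (use r in auto)

text \<open>Suppose z = v - V, with V = \<open>V_sing\<close>, is at most -\<delta> at R for a large
  \<beta>. As z increases in r, this holds on all of (0, R], and the flux equation yields z' >=
  \<kappa>/r, hence exp v <= exp V (r/R)^\<kappa>. With this gain the source is only of size
  r^(\<kappa> - 2); integrating the equation twice from 0 bounds \<beta> by v(R/2) plus a constant,
  and v(R/2) < V(R/2).\<close>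

lemma shoot_converges:
  assumes R: "R \<le> 1" "h * R\<^sup>2 \<le> bes_zero" "0 < R" and \<delta>: "0 < \<delta>"
  shows "\<exists>B. \<forall>\<beta>\<ge>B. V_sing h R - \<delta> < shoot h \<beta> R"
proof -
  \<comment> \<open>k bounds the weight 16 + h r^2 from below and c bounds 1 - exp z, so the
    derivative of the flux is at least k c r^7 >= 8 \<kappa> r^7, the derivative of \<kappa> r^8.
    \<open>K\<close> collects the constants of the improved source bound, and \<open>B\<close>
    exceeds the resulting bound for \<beta> by 1.\<close>
  define k where "k = min 16 (16 + h)"
  define c where "c = 1 - exp (- \<delta>)"
  define \<kappa> where "\<kappa> = min 1 (k * c / 8)"
  define K where "K = (16 + \<bar>h\<bar>) * R powr (- \<kappa>)"
  define B where "B = V_sing h (R / 2) + K / ((8 + \<kappa>) * \<kappa>) + 1"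
  have k: "0 < k" using h by (simp add: k_def)
  have c: "0 < c" using \<delta> by (simp add: c_def)
  have \<kappa>: "0 < \<kappa>" "8 * \<kappa> \<le> k * c" using k c by (auto simp: \<kappa>_def)
  have K: "0 \<le> K" by (simp add: K_def)
  have "V_sing h R - \<delta> < shoot h \<beta> R" if \<beta>: "\<beta> \<ge> B" for \<beta>
  proof (rule ccontr)
    assume "\<not> ?thesis"
    then have zR: "shoot h \<beta> R - V_sing h R \<le> - \<delta>" by simp
    let ?z = "\<lambda>r. shoot h \<beta> r - V_sing h r" and ?z' = "\<lambda>r. shoot' h \<beta> r - V_sing' h r"
    have z: "?z r \<le> - \<delta>" if "0 < r" "r \<le> R" for r
      using shoot_V_sing_mono[OF R(1,2) that(1,2) order.refl] zR by (rule order_trans)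
    have z': "\<kappa> / r \<le> ?z' r" if r: "0 < r" "r < R" for r
    proof -
      have "0 \<le> r ^ 9 * ?z' r - \<kappa> * r ^ 8"
      proof (rule limit_le_of_deriv_nonneg[where g="\<lambda>r. r ^ 9 * ?z' r - \<kappa> * r ^ 8" and R=R
            and g'="\<lambda>t. t ^ 7 * (16 + h * t\<^sup>2) * (1 - exp (?z t)) - \<kappa> * (8 * t ^ 7)"])
        have "((\<lambda>r. r ^ 9 * ?z' r - \<kappa> * r ^ 8) \<longlongrightarrow> 0 - \<kappa> * 0) (at_right 0)"
          by (intro tendsto_intros shoot_V_sing_flux_limit) (auto intro!: tendsto_eq_intros)
        then show "((\<lambda>r. r ^ 9 * ?z' r - \<kappa> * r ^ 8) \<longlongrightarrow> 0) (at_right 0)" by simp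
        show "continuous_on {0<..R} (\<lambda>r. r ^ 9 * ?z' r - \<kappa> * r ^ 8)"
          by (intro continuous_intros continuous_on_subset[OF shoot_cont'(2)] continuous_on_subset[OF V_sing_cont(2)]) (use R in auto)
        fix t assume t: "0 < t" "t < R"
        show "((\<lambda>r. r ^ 9 * ?z' r - \<kappa> * r ^ 8) has_real_derivative t ^ 7 * (16 + h * t\<^sup>2) * (1 - exp (?z t)) - \<kappa> * (8 * t ^ 7)) (at t)"
          using t R by (intro DERIV_diff shoot_V_sing_flux DERIV_cmult) (auto intro!: derivative_eq_intros)
        have "exp (?z t) \<le> exp (- \<delta>)" using z[of t] t by simp
        then have "k * c \<le> (16 + h * t\<^sup>2) * (1 - exp (?z t))"
          using potential_weight_pos[OF h, of t] t R k c by (intro mult_mono) (auto simp: k_def c_def)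
        then have "t ^ 7 * (8 * \<kappa>) \<le> t ^ 7 * ((16 + h * t\<^sup>2) * (1 - exp (?z t)))"
          using \<kappa>(2) t by (intro mult_left_mono) auto
        then show "0 \<le> t ^ 7 * (16 + h * t\<^sup>2) * (1 - exp (?z t)) - \<kappa> * (8 * t ^ 7)" by (simp add: algebra_simps)
      qed (use r in auto)
      then have "r ^ 8 * \<kappa> \<le> r ^ 8 * (r * ?z' r)" by (simp add: algebra_simps power_eq_if)
      then have "\<kappa> \<le> r * ?z' r" using r by (simp add: mult_le_cancel_left_pos)
      then show ?thesis using r by (simp add: pos_divide_le_eq mult.commute)
    qed
    have zln: "?z r \<le> \<kappa> * (ln r - ln R)" if r: "0 < r" "r < R" for r
    proof -
      have "?z r - \<kappa> * ln r \<le> ?z R - \<kappa> * ln R"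
      proof (rule DERIV_nonneg_imp_increasing_open[where f="\<lambda>r. ?z r - \<kappa> * ln r"])
        show "\<exists>y. ((\<lambda>r. ?z r - \<kappa> * ln r) has_real_derivative y) (at t) \<and> 0 \<le> y" if t: "r < t" "t < R" for t
        proof (intro exI conjI)
          show "((\<lambda>r. ?z r - \<kappa> * ln r) has_real_derivative ?z' t - \<kappa> * (1 / t)) (at t)"
            using t r R by (intro DERIV_diff DERIV_cmult DERIV_ln_divide potential_sol_diff(1)[OF V_sing_sol shoot_sol[OF h]]) auto
          show "0 \<le> ?z' t - \<kappa> * (1 / t)" using z'[of t] t r by simp
        qed
        show "continuous_on {r..R} (\<lambda>r. ?z r - \<kappa> * ln r)"
          by (intro continuous_intros continuous_on_subset[OF shoot_cont'(1)] continuous_on_subset[OF V_sing_cont(1)]) (use r R in auto)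
      qed (use r in auto)
      then show ?thesis using zR \<delta> by (simp add: algebra_simps)
    qed
    have src: "a_coef 10 h r * exp (shoot h \<beta> r) \<le> K * r powr \<kappa> / r\<^sup>2" if r: "0 < r" "r < R" for r
    proof -
      have "exp (shoot h \<beta> r) = exp (V_sing h r) * exp (?z r)" by (simp flip: exp_add)
      then have "a_coef 10 h r * exp (shoot h \<beta> r) = (16 / r\<^sup>2 + h) * exp (?z r)"
        using a_coef_exp_V_sing[OF r(1), of h] by (simp flip: mult.assoc)
      also have "16 / r\<^sup>2 + h = (16 + h * r\<^sup>2) / r\<^sup>2" using r by (simp add: field_simps)
      also have "(16 + h * r\<^sup>2) / r\<^sup>2 * exp (?z r) \<le> (16 + \<bar>h\<bar>) / r\<^sup>2 * exp (\<kappa> * (ln r - ln R))"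
        using potential_weight_pos[OF h, of r] r R zln[OF r] by (intro mult_mono divide_right_mono) auto
      also have "exp (\<kappa> * (ln r - ln R)) = r powr \<kappa> * R powr (- \<kappa>)"
        using r R by (simp add: powr_def algebra_simps flip: exp_add)
      finally show ?thesis by (simp add: K_def mult_ac)
    qed
    have v': "0 \<le> shoot' h \<beta> r + K / (8 + \<kappa>) * r powr (\<kappa> - 1)" if r: "0 < r" "r < R" for r
    proof -
      have "0 \<le> r ^ 9 * shoot' h \<beta> r + K / (8 + \<kappa>) * r powr (8 + \<kappa>)"
      proof (rule limit_le_of_deriv_nonneg[where g="\<lambda>r. r ^ 9 * shoot' h \<beta> r + K / (8 + \<kappa>) * r powr (8 + \<kappa>)" and R=R
            and g'="\<lambda>t. - (t ^ 9 * (a_coef 10 h t * exp (shoot h \<beta> t))) + K * t powr (7 + \<kappa>)"])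
        have "((\<lambda>r. r ^ 9 * shoot' h \<beta> r + K / (8 + \<kappa>) * r powr (8 + \<kappa>)) \<longlongrightarrow> 0 ^ 9 * 0 + K / (8 + \<kappa>) * 0) (at_right 0)"
          using \<kappa> by (intro tendsto_intros shoot_tendsto h powr_tendsto_0_at_right) auto
        then show "((\<lambda>r. r ^ 9 * shoot' h \<beta> r + K / (8 + \<kappa>) * r powr (8 + \<kappa>)) \<longlongrightarrow> 0) (at_right 0)" by simp
        show "continuous_on {0<..R} (\<lambda>r. r ^ 9 * shoot' h \<beta> r + K / (8 + \<kappa>) * r powr (8 + \<kappa>))"
          by (intro continuous_intros continuous_on_subset[OF shoot_cont'(2)]) (use R in auto)
        fix t assume t: "0 < t" "t < R"
        have "((\<lambda>r. r ^ 9 * shoot' h \<beta> r + K / (8 + \<kappa>) * r powr (8 + \<kappa>)) has_real_derivative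
            (t ^ 9 * (- (9 / t * shoot' h \<beta> t) - a_coef 10 h t * exp (shoot h \<beta> t)) + 9 * t ^ 8 * shoot' h \<beta> t)
            + K / (8 + \<kappa>) * ((8 + \<kappa>) * t powr (8 + \<kappa> - 1))) (at t)"
          using shoot_sol[OF h, of \<beta>] t R
          by (intro DERIV_add DERIV_power9_mult DERIV_cmult has_real_derivative_powr) (auto simp: potential_sol_def)
        moreover have "(t ^ 9 * (- (9 / t * shoot' h \<beta> t) - a_coef 10 h t * exp (shoot h \<beta> t)) + 9 * t ^ 8 * shoot' h \<beta> t)
            = - (t ^ 9 * (a_coef 10 h t * exp (shoot h \<beta> t)))"
          using t by (simp add: field_simps power_eq_if)
        moreover have "K / (8 + \<kappa>) * ((8 + \<kappa>) * t powr (8 + \<kappa> - 1)) = K * t powr (7 + \<kappa>)"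
        proof -
          have "8 + \<kappa> - 1 = 7 + \<kappa>" by simp
          then show ?thesis using \<kappa> by simp
        qed
        ultimately show "((\<lambda>r. r ^ 9 * shoot' h \<beta> r + K / (8 + \<kappa>) * r powr (8 + \<kappa>)) has_real_derivative
            - (t ^ 9 * (a_coef 10 h t * exp (shoot h \<beta> t))) + K * t powr (7 + \<kappa>)) (at t)" by simp
        have "t ^ 9 * (a_coef 10 h t * exp (shoot h \<beta> t)) \<le> t ^ 9 * (K * t powr \<kappa> / t\<^sup>2)"
          using src[OF t] t by (intro mult_left_mono) auto
        also have "\<dots> = K * (t ^ 7 * t powr \<kappa>)" using t by (simp add: power_eq_if)
        also have "t ^ 7 * t powr \<kappa> = t powr (7 + \<kappa>)" using t by (simp add: powr_add)
        finally show "0 \<le> - (t ^ 9 * (a_coef 10 h t * exp (shoot h \<beta> t))) + K * t powr (7 + \<kappa>)" by simp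
      qed (use r in auto)
      also have "r powr (8 + \<kappa>) = r ^ 9 * r powr (\<kappa> - 1)"
      proof -
        have "r ^ 9 = r powr 9" using r by simp
        then show ?thesis by (simp flip: powr_add)
      qed
      finally have "0 \<le> r ^ 9 * (shoot' h \<beta> r + K / (8 + \<kappa>) * r powr (\<kappa> - 1))" by (simp add: algebra_simps)
      then show ?thesis using r by (simp add: zero_le_mult_iff)
    qed
    have "\<beta> \<le> shoot h \<beta> (R / 2) + K / ((8 + \<kappa>) * \<kappa>) * (R / 2) powr \<kappa>"
    proof (rule limit_le_of_deriv_nonneg[where g="\<lambda>r. shoot h \<beta> r + K / ((8 + \<kappa>) * \<kappa>) * r powr \<kappa>" and R=R
            and g'="\<lambda>t. shoot' h \<beta> t + K / (8 + \<kappa>) * t powr (\<kappa> - 1)"])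
      have "((\<lambda>r. shoot h \<beta> r + K / ((8 + \<kappa>) * \<kappa>) * r powr \<kappa>) \<longlongrightarrow> \<beta> + K / ((8 + \<kappa>) * \<kappa>) * 0) (at_right 0)"
        using \<kappa> by (intro tendsto_intros shoot_tendsto h powr_tendsto_0_at_right) auto
      then show "((\<lambda>r. shoot h \<beta> r + K / ((8 + \<kappa>) * \<kappa>) * r powr \<kappa>) \<longlongrightarrow> \<beta>) (at_right 0)" by simp
      show "continuous_on {0<..R} (\<lambda>r. shoot h \<beta> r + K / ((8 + \<kappa>) * \<kappa>) * r powr \<kappa>)"
        by (intro continuous_intros continuous_on_subset[OF shoot_cont'(1)]) (use R in auto)
      fix t assume t: "0 < t" "t < R"
      have "((\<lambda>r. shoot h \<beta> r + K / ((8 + \<kappa>) * \<kappa>) * r powr \<kappa>) has_real_derivative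
         shoot' h \<beta> t + K / ((8 + \<kappa>) * \<kappa>) * (\<kappa> * t powr (\<kappa> - 1))) (at t)"
        using shoot_sol[OF h, of \<beta>] t R
        by (intro DERIV_add DERIV_cmult has_real_derivative_powr) (auto simp: potential_sol_def)
      then show "((\<lambda>r. shoot h \<beta> r + K / ((8 + \<kappa>) * \<kappa>) * r powr \<kappa>) has_real_derivative
         shoot' h \<beta> t + K / (8 + \<kappa>) * t powr (\<kappa> - 1)) (at t)" using \<kappa> by simp
    qed (use R v' in auto)
    also have "\<dots> \<le> V_sing h (R / 2) + K / ((8 + \<kappa>) * \<kappa>) * 1"
      using shoot_less_V_sing[OF h R(1,2), of "R / 2" \<beta>] R K \<kappa>
      by (intro add_mono mult_left_mono powr_le1) auto
    finally show False using \<beta> by (simp add: B_def)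
  qed
  then show ?thesis by blast
qed

text \<open>Here h may exceed \<open>bes_zero\<close>: the comparison is used only up to a radius R
  with h R^2 <= \<open>bes_zero\<close>. At some s < R both z = v - V and z' are small for large
  \<beta>, and from s to 1 the equation for z is regular, so the energy estimate transports the
  smallness.\<close>

lemma shoot_converges_uniformly:
  assumes \<rho>: "0 < \<rho>" "\<rho> \<le> 1" and \<epsilon>: "0 < \<epsilon>"
  shows "\<exists>B. \<forall>\<beta>\<ge>B. \<forall>r\<in>{\<rho>..1}. \<bar>shoot h \<beta> r - V_sing h r\<bar> \<le> \<epsilon>"
proof -
  \<comment> \<open>Division by \<open>max 1 h\<close> avoids a distinction by the sign of h and
    gives h R^2 <= \<open>bes_zero\<close> in all cases.\<close>
  define R where "R = min 1 (sqrt (bes_zero / max 1 h))"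
  have R: "0 < R" "R \<le> 1" "h * R\<^sup>2 \<le> bes_zero"
  proof -
    show "0 < R" "R \<le> 1" using bes_zero_pos by (auto simp: R_def)
    have "0 \<le> R" "R \<le> sqrt (bes_zero / max 1 h)" using bes_zero_pos by (auto simp: R_def)
    then have "R\<^sup>2 \<le> (sqrt (bes_zero / max 1 h))\<^sup>2" by (intro power_mono)
    then have R2: "R\<^sup>2 \<le> bes_zero / max 1 h" using bes_zero_pos by simp
    have "h * R\<^sup>2 \<le> max 1 h * R\<^sup>2" by (intro mult_right_mono) auto
    also have "\<dots> \<le> max 1 h * (bes_zero / max 1 h)" using R2 by (intro mult_left_mono) auto
    finally show "h * R\<^sup>2 \<le> bes_zero" by simp
  qed
  define s where "s = min \<rho> (R / 2)"
  have s: "0 < s" "s < R" "s \<le> \<rho>" "s \<le> 1" using \<rho> R by (auto simp: s_def)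
  have sR: "h * s\<^sup>2 \<le> bes_zero"
  proof (cases "h \<le> 0")
    case True
    then have "h * s\<^sup>2 \<le> 0" by (simp add: mult_nonpos_nonneg)
    then show ?thesis using bes_zero_pos by linarith
  next
    case False
    then have "h * s\<^sup>2 \<le> h * R\<^sup>2" using s by (intro mult_left_mono power_mono) auto
    then show ?thesis using R by linarith
  qed
  \<comment> \<open>Z dominates v and V on [s, 1], so that L is a Lipschitz constant of the source
    there. C combines the energy factor with the bound for z'(s), and \<delta> is chosen so that C
    \<delta>^2 <= \<epsilon>^2.\<close>
  define Z where "Z = V_sing h s + 2 + \<bar>h\<bar>"
  define L where "L = a_max h * exp Z"
  have L: "0 \<le> L" using less_imp_le[OF a_max_pos[OF h]] by (simp add: L_def)
  define C where "C = (1 + ((R / s) ^ 9 / (R - s))\<^sup>2) * exp (1 + L)"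
  have C: "0 < C" unfolding C_def by (intro mult_pos_pos) (auto intro: add_pos_nonneg)
  define \<delta> where "\<delta> = \<epsilon> / (1 + C)"
  have \<delta>: "0 < \<delta>" using \<epsilon> C by (simp add: \<delta>_def)
  have V_le: "V_sing h r \<le> Z" if "s \<le> r" "r \<le> 1" for r
  proof -
    have "ln s \<le> ln r" using that s by simp
    moreover have "- (h / 20 * r\<^sup>2) + h / 20 * s\<^sup>2 \<le> 2 + \<bar>h\<bar>"
    proof -
      have "\<bar>h / 20 * x\<^sup>2\<bar> \<le> \<bar>h\<bar> / 20" if "0 \<le> x" "x \<le> 1" for x
        using power_le_one[OF that, of 2] by (simp add: abs_mult mult_left_le)
      from this[of r] this[of s] that s show ?thesis by linarith
    qed
    ultimately show ?thesis by (simp add: Z_def V_sing_def)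
  qed
  obtain B where B: "\<And>\<beta>. \<beta> \<ge> B \<Longrightarrow> V_sing h s - \<delta> < shoot h \<beta> s"
    using shoot_converges[OF s(4) sR s(1) \<delta>] by blast
  have "\<bar>shoot h \<beta> r - V_sing h r\<bar> \<le> \<epsilon>" if \<beta>: "\<beta> \<ge> B" and r: "r \<in> {\<rho>..1}" for \<beta> r
  proof -
    let ?z = "\<lambda>r. shoot h \<beta> r - V_sing h r" and ?z' = "\<lambda>r. shoot' h \<beta> r - V_sing' h r"
    have zs: "- \<delta> < ?z s" "?z s < 0" using B[OF \<beta>] shoot_less_V_sing[OF h s(4) sR s(1) order.refl, of \<beta>] by auto
    have z's: "0 \<le> ?z' s" "?z' s \<le> (R / s) ^ 9 / (R - s) * \<delta>"
    proof -
      show z0: "0 \<le> ?z' s" using shoot_V_sing_deriv_nonneg[OF R(2,3), of s \<beta>] s by auto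
      \<comment> \<open>The flux increases, so z' >= (s/R)^9 z'(s) between s and R. A large z'(s)
        would lift z from above -\<delta> past 0, against z(R) < 0; this bounds z'(s) by a multiple
        of \<delta>.\<close>
      have fl: "s ^ 9 * ?z' s \<le> t ^ 9 * ?z' t" if t: "s < t" "t < R" for t
      proof (rule DERIV_nonneg_imp_increasing_open[where f="\<lambda>r. r ^ 9 * ?z' r"])
        show "\<exists>y. ((\<lambda>r. r ^ 9 * ?z' r) has_real_derivative y) (at x) \<and> 0 \<le> y" if "s < x" "x < t" for x
          using shoot_less_V_sing[OF h R(2,3), of x \<beta>] potential_weight_pos(1)[OF h, of x] that s t R
          by (intro exI[of _ "x ^ 7 * (16 + h * x\<^sup>2) * (1 - exp (?z x))"] conjI shoot_V_sing_flux mult_nonneg_nonneg) auto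
        show "continuous_on {s..t} (\<lambda>r. r ^ 9 * ?z' r)"
          by (intro continuous_intros continuous_on_subset[OF shoot_cont'(2)] continuous_on_subset[OF V_sing_cont(2)]) (use s t R in auto)
      qed (use t in auto)
      have "?z s - (s / R) ^ 9 * ?z' s * s \<le> ?z R - (s / R) ^ 9 * ?z' s * R"
      proof (rule DERIV_nonneg_imp_increasing_open[where f="\<lambda>r. ?z r - (s / R) ^ 9 * ?z' s * r"])
        show "\<exists>y. ((\<lambda>r. ?z r - (s / R) ^ 9 * ?z' s * r) has_real_derivative y) (at t) \<and> 0 \<le> y" if t: "s < t" "t < R" for t
        proof (intro exI conjI)
          show "((\<lambda>r. ?z r - (s / R) ^ 9 * ?z' s * r) has_real_derivative ?z' t - (s / R) ^ 9 * ?z' s * 1) (at t)"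
            using t s R by (intro DERIV_diff DERIV_cmult DERIV_ident potential_sol_diff(1)[OF V_sing_sol shoot_sol[OF h]]) auto
          have zt: "0 \<le> ?z' t" using shoot_V_sing_deriv_nonneg[OF R(2,3), of t \<beta>] s t by auto
          have "s ^ 9 * ?z' s \<le> R ^ 9 * ?z' t"
            using fl[OF t] mult_right_mono[OF power_mono[of t R 9] zt] t s by auto
          then show "0 \<le> ?z' t - (s / R) ^ 9 * ?z' s * 1" using R s by (simp add: power_divide field_simps)
        qed
        show "continuous_on {s..R} (\<lambda>r. ?z r - (s / R) ^ 9 * ?z' s * r)"
          by (intro continuous_intros continuous_on_subset[OF shoot_cont'(1)] continuous_on_subset[OF V_sing_cont(1)]) (use s R in auto)
      qed (use s in auto)
      moreover have "?z R < 0" using shoot_less_V_sing[OF h R(2,3,1) order.refl, of \<beta>] by simp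
      ultimately have "(s / R) ^ 9 * ?z' s * (R - s) \<le> \<delta>" using zs by (simp add: algebra_simps)
      then have "(R / s) ^ 9 / (R - s) * ((s / R) ^ 9 * ?z' s * (R - s)) \<le> (R / s) ^ 9 / (R - s) * \<delta>"
        using R s by (intro mult_left_mono) auto
      moreover have "(R / s) ^ 9 / (R - s) * ((s / R) ^ 9 * ?z' s * (R - s)) = ?z' s"
        using R s by (simp add: power_divide)
      ultimately show "?z' s \<le> (R / s) ^ 9 / (R - s) * \<delta>" by simp
    qed
    have vZ: "shoot h \<beta> t \<le> Z" if t: "s < t" "t < r" for t
      using shoot_antimono[OF h, of s t \<beta>] shoot_less_V_sing[OF h s(4) sR s(1) order.refl, of \<beta>] V_le[of s] s t r by auto
    have "(?z r)\<^sup>2 + (?z' r)\<^sup>2 \<le> ((?z s)\<^sup>2 + (?z' s)\<^sup>2) * exp ((1 + L) * (r - s))"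
    proof (rule energy_forward[where q="\<lambda>t. a_coef 10 h t * (exp (shoot h \<beta> t) - exp (V_sing h t))"])
      fix t assume t: "s < t" "t < r"
      then have t1: "t \<in> {0..1}" "0 < t" "t < 1" using s r by auto
      show "(?z has_real_derivative ?z' t) (at t)"
        "(?z' has_real_derivative - (9 / t * ?z' t) - a_coef 10 h t * (exp (shoot h \<beta> t) - exp (V_sing h t))) (at t)"
        using potential_sol_diff[OF V_sing_sol shoot_sol[OF h] t1(2,3)] by blast+
      have "\<bar>a_coef 10 h t * (exp (shoot h \<beta> t) - exp (V_sing h t))\<bar> = a_coef 10 h t * \<bar>exp (shoot h \<beta> t) - exp (V_sing h t)\<bar>"
        using a_coef_bounds(1)[OF h t1(1)] by (simp add: abs_mult)
      also have "\<dots> \<le> a_max h * (exp Z * \<bar>?z t\<bar>)"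
        using a_coef_bounds[OF h t1(1)] vZ[OF t] V_le[of t] t1 t a_max_pos[of h]
        by (intro mult_mono exp_diff_le) auto
      finally show "\<bar>a_coef 10 h t * (exp (shoot h \<beta> t) - exp (V_sing h t))\<bar> \<le> L * \<bar>?z t\<bar>"
        by (simp add: L_def mult.assoc)
    qed (use s r \<rho> L in \<open>auto intro!: continuous_intros continuous_on_subset[OF shoot_cont'(1)] continuous_on_subset[OF shoot_cont'(2)]
          continuous_on_subset[OF V_sing_cont(1)] continuous_on_subset[OF V_sing_cont(2)]\<close>)
    also have "\<dots> \<le> (\<delta>\<^sup>2 + ((R / s) ^ 9 / (R - s) * \<delta>)\<^sup>2) * exp (1 + L)"
    proof (rule mult_mono)
      have "(?z s)\<^sup>2 \<le> \<delta>\<^sup>2" using zs \<delta> by (simp add: abs_le_square_iff[symmetric])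
      moreover have "(?z' s)\<^sup>2 \<le> ((R / s) ^ 9 / (R - s) * \<delta>)\<^sup>2" using z's by (intro power_mono) auto
      ultimately show "(?z s)\<^sup>2 + (?z' s)\<^sup>2 \<le> \<delta>\<^sup>2 + ((R / s) ^ 9 / (R - s) * \<delta>)\<^sup>2" by (rule add_mono)
      show "exp ((1 + L) * (r - s)) \<le> exp (1 + L)" using L r s \<rho> by (simp add: mult_left_le)
    qed (auto intro!: add_nonneg_nonneg)
    also have "\<dots> = C * \<delta>\<^sup>2"
      unfolding C_def power_mult_distrib[of "(R / s) ^ 9 / (R - s)" \<delta> 2] by (simp only: ring_distribs mult_1_left mult_ac)
    also have "\<dots> \<le> (1 + C)\<^sup>2 * \<delta>\<^sup>2"
      using C by (intro mult_right_mono) (auto simp: power2_eq_square algebra_simps)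
    also have "\<dots> = \<epsilon>\<^sup>2" using C by (simp add: \<delta>_def power_divide)
    finally have "(?z r)\<^sup>2 \<le> \<epsilon>\<^sup>2" using zero_le_power2[of "?z' r"] by linarith
    then show ?thesis using \<epsilon> by (simp add: abs_le_square_iff[symmetric])
  qed
  then show ?thesis by blast
qed

end

section \<open>The bifurcation diagram in dimension 10\<close>

context
  fixes h :: real
  assumes h: "- 16 < h"
begin

lemma continuous_on_shoot_initial: "continuous_on S (\<lambda>\<beta>. shoot h \<beta> 1)"
proof -
  have *: "continuous_on {..B} (\<lambda>\<beta>. shoot h \<beta> 1)" for B
  proof (rule lipschitz_on_continuous_on)
    show "lipschitz_on (exp (1 + a_max h * exp B)) {..B} (\<lambda>\<beta>. shoot h \<beta> 1)"
      by (rule lipschitz_onI) (use shoot_lipschitz[OF h, of _ B _ 1] in \<open>auto simp: dist_real_def abs_minus_commute\<close>)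
  qed
  have "isCont (\<lambda>\<beta>. shoot h \<beta> 1) b" for b
    by (rule continuous_on_interior[OF *[of "b + 1"]]) simp
  then show ?thesis by (simp add: continuous_at_imp_continuous_on)
qed

lemma bif_lambda_shoot: "bif_lambda 10 (a_coef 10 h) \<beta> = exp (shoot h \<beta> 1)"
  by (simp add: bif_lambda_def shoot_def)

lemma bif_alpha_shoot: "bif_alpha 10 (a_coef 10 h) \<beta> = \<beta> - shoot h \<beta> 1"
  by (simp add: bif_alpha_def bif_lambda_shoot)

text \<open>Both coordinates of the curve increase strictly with \<beta>, so the required function
  is the second coordinate composed with the inverse of the first.\<close>

lemma type_II_if_stable:
  assumes "h \<le> bes_zero"
  shows "type_II 10 (a_coef 10 h)"
proof -
  define \<Lambda> where "\<Lambda> \<beta> = exp (shoot h \<beta> 1)" for \<beta>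
  define A where "A \<beta> = \<beta> - shoot h \<beta> 1" for \<beta>
  \<comment> \<open>The blow-up value is 16 exp(-h/20), the \<lambda> of the singular
    solution.\<close>
  define l0 where "l0 = exp (V_sing h 1)"
  define \<alpha> where "\<alpha> l = A (inv \<Lambda> l)" for l
  have less: "shoot h \<beta>1 r < shoot h \<beta>2 r" if "0 < r" "r \<le> 1" "\<beta>1 < \<beta>2" for r \<beta>1 \<beta>2
    using shoot_less_shoot[OF h, of 1] assms that by simp
  have \<Lambda>_mono: "strict_mono \<Lambda>" unfolding \<Lambda>_def by (rule strict_monoI) (simp add: less)
  have A_mono: "strict_mono A"
    unfolding A_def by (rule strict_monoI) (use shoot_diff_less[OF h] less in force)
  have V: "shoot h \<beta> 1 < V_sing h 1" for \<beta> using shoot_less_V_sing[OF h, of 1 1] assms by simp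
  \<comment> \<open>Surjectivity by intermediate values: at \<beta> = ln l the bound v(1) <= \<beta>
    serves, at a large \<beta> the convergence to \<open>V_sing\<close>.\<close>
  have \<Lambda>_range: "\<exists>\<beta>. \<Lambda> \<beta> = l" if l: "0 < l" "l < l0" for l
  proof -
    have "ln l < V_sing h 1" using l by (metis exp_less_cancel_iff exp_ln l0_def)
    then obtain B where B: "\<And>\<beta>. \<beta> \<ge> B \<Longrightarrow> ln l < shoot h \<beta> 1"
      using shoot_converges[OF h, of 1 "V_sing h 1 - ln l"] assms by auto
    have "shoot h (ln l) 1 \<le> ln l" using shoot_le[OF h, of 1 "ln l"] by simp
    moreover have "ln l \<le> shoot h (max B (ln l)) 1" using B[of "max B (ln l)"] by simp
    ultimately have "\<exists>\<beta>\<ge>ln l. \<beta> \<le> max B (ln l) \<and> shoot h \<beta> 1 = ln l"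
      by (intro IVT' continuous_on_shoot_initial) auto
    then obtain \<beta> where "shoot h \<beta> 1 = ln l" by blast
    then have "\<Lambda> \<beta> = l" using l by (simp add: \<Lambda>_def)
    then show ?thesis by blast
  qed
  have \<alpha>_\<Lambda>: "\<alpha> (\<Lambda> \<beta>) = A \<beta>" for \<beta>
    unfolding \<alpha>_def using strict_mono_imp_inj_on[OF \<Lambda>_mono] by simp
  have \<Lambda>_bounds: "0 < \<Lambda> \<beta>" "\<Lambda> \<beta> < l0" for \<beta> using V by (auto simp: \<Lambda>_def l0_def)
  show ?thesis unfolding type_II_def
  proof (intro exI[of _ l0] exI[of _ \<alpha>] conjI)
    show "0 < l0" by (simp add: l0_def)
    show "strict_mono_on {0<..<l0} \<alpha>"
    proof (rule strict_mono_onI)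
      fix l1 l2 assume l: "l1 \<in> {0<..<l0}" "l2 \<in> {0<..<l0}" "l1 < l2"
      obtain \<beta>1 \<beta>2 where "l1 = \<Lambda> \<beta>1" "l2 = \<Lambda> \<beta>2" using \<Lambda>_range[of l1] \<Lambda>_range[of l2] l by auto
      then show "\<alpha> l1 < \<alpha> l2" using l(3) \<Lambda>_mono A_mono by (simp add: \<alpha>_\<Lambda> strict_mono_less)
    qed
    show "bifurcation_curve 10 (a_coef 10 h) = {(l, \<alpha> l) |l. 0 < l \<and> l < l0}"
    proof -
      have "bifurcation_curve 10 (a_coef 10 h) = range (\<lambda>\<beta>. (\<Lambda> \<beta>, \<alpha> (\<Lambda> \<beta>)))"
        by (simp add: bifurcation_curve_def bif_lambda_shoot bif_alpha_shoot \<alpha>_\<Lambda>) (simp add: \<Lambda>_def A_def)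
      also have "\<dots> = {(l, \<alpha> l) |l. 0 < l \<and> l < l0}" using \<Lambda>_bounds \<Lambda>_range by fast
      finally show ?thesis .
    qed
    show "filterlim \<alpha> at_top (at_left l0)"
      unfolding filterlim_at_top
    proof
      fix Z
      \<comment> \<open>For \<beta> > b one has \<beta> - v(1) > b - V(1) = Z, with V =
        \<open>V_sing\<close>.\<close>
      define b where "b = Z + V_sing h 1"
      have "Z \<le> \<alpha> l" if l: "\<Lambda> b < l" "l < l0" for l
      proof -
        obtain \<beta> where \<beta>: "l = \<Lambda> \<beta>" using \<Lambda>_range[of l] l \<Lambda>_bounds[of b] by auto
        then have "b < \<beta>" using l(1) \<Lambda>_mono by (simp add: strict_mono_less)
        then show ?thesis using V[of \<beta>] by (simp add: \<beta> \<alpha>_\<Lambda> A_def b_def)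
      qed
      then show "\<forall>\<^sub>F l in at_left l0. Z \<le> \<alpha> l"
        using \<Lambda>_bounds[of b] by (auto simp: eventually_at_left_field)
    qed
  qed
qed

text \<open>Along the curve \<alpha> = \<beta> - ln \<lambda>, so a larger \<beta> whose \<lambda>
  is not larger would have a larger \<alpha>, against the monotonicity of \<alpha> in
  \<lambda>.\<close>

lemma type_II_shoot_mono:
  assumes "type_II 10 (a_coef 10 h)" "\<beta>1 < \<beta>2"
  shows "shoot h \<beta>1 1 < shoot h \<beta>2 1"
proof (rule ccontr)
  assume "\<not> ?thesis"
  then have le: "shoot h \<beta>2 1 \<le> shoot h \<beta>1 1" by simp
  obtain l0 \<alpha> where \<alpha>: "strict_mono_on {0<..<l0} \<alpha>"
    "bifurcation_curve 10 (a_coef 10 h) = {(l, \<alpha> l) | l. 0 < l \<and> l < l0}"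
    using assms(1) unfolding type_II_def by blast
  have *: "exp (shoot h \<beta> 1) \<in> {0<..<l0} \<and> \<beta> - shoot h \<beta> 1 = \<alpha> (exp (shoot h \<beta> 1))" for \<beta>
  proof -
    have "(exp (shoot h \<beta> 1), \<beta> - shoot h \<beta> 1) \<in> bifurcation_curve 10 (a_coef 10 h)"
      by (auto simp: bifurcation_curve_def bif_lambda_shoot bif_alpha_shoot)
    then show ?thesis unfolding \<alpha>(2) by auto
  qed
  have "\<alpha> (exp (shoot h \<beta>2 1)) \<le> \<alpha> (exp (shoot h \<beta>1 1))"
    using strict_mono_onD[OF \<alpha>(1), of "exp (shoot h \<beta>2 1)" "exp (shoot h \<beta>1 1)"] * le
    by (cases "shoot h \<beta>2 1 = shoot h \<beta>1 1") (auto intro: less_imp_le)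
  then show False using *[of \<beta>1] *[of \<beta>2] le assms(2) by linarith
qed

text \<open>Starting point of a continuity argument: for very negative \<beta> the source is tiny,
  and the difference loses at most a tenth of its initial value, 10 being the dimension. The
  threshold exp(-2) compensates the Lipschitz factor exp(1 + L) <= exp 2.\<close>

lemma shoot_less_shoot_small:
  assumes \<beta>: "\<beta>1 < \<beta>2" and small: "a_max h * exp \<beta>2 \<le> exp (- 2)" and r: "r \<in> {0..1}"
  shows "shoot h \<beta>1 r < shoot h \<beta>2 r"
proof -
  let ?d = "\<lambda>r. shoot h \<beta>2 r - shoot h \<beta>1 r" and ?d' = "\<lambda>r. shoot' h \<beta>2 r - shoot' h \<beta>1 r"
  let ?q = "\<lambda>t. a_coef 10 h t * (exp (shoot h \<beta>2 t) - exp (shoot h \<beta>1 t))"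
  define L where "L = a_max h * exp \<beta>2"
  define d0 where "d0 = \<beta>2 - \<beta>1"
  have d0: "0 < d0" using \<beta> by (simp add: d0_def)
  have L: "0 \<le> L" "L \<le> exp (- 2)" using less_imp_le[OF a_max_pos[OF h]] small by (simp_all add: L_def)
  have "L \<le> 1" using L(2) by (rule order_trans) simp
  have q: "?q t \<le> d0" if t: "t \<in> {0..1}" for t
  proof -
    have "?q t \<le> a_coef 10 h t * \<bar>exp (shoot h \<beta>2 t) - exp (shoot h \<beta>1 t)\<bar>"
      using a_coef_bounds(1)[OF h t] by (intro mult_left_mono) auto
    also have "\<dots> \<le> a_max h * (exp \<beta>2 * \<bar>?d t\<bar>)"
      using a_coef_bounds[OF h t] shoot_le[OF h t, of \<beta>1] shoot_le[OF h t, of \<beta>2] \<beta> a_max_pos[OF h]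
      by (intro mult_mono exp_diff_le) auto
    also have "\<dots> = L * \<bar>?d t\<bar>" by (simp add: L_def)
    also have "\<dots> \<le> L * (exp (1 + L) * d0)"
      using shoot_lipschitz[OF h less_imp_le[OF \<beta>] order.refl t] \<beta> L
      by (intro mult_left_mono) (auto simp: L_def d0_def)
    also have "\<dots> \<le> exp (- 2) * (exp 2 * d0)"
      using L \<open>L \<le> 1\<close> d0 by (intro mult_mono) auto
    also have "\<dots> = d0" by (simp flip: mult.assoc exp_add)
    finally show ?thesis .
  qed
  have d': "- (d0 / 10) \<le> ?d' t" if t: "0 < t" "t < 1" for t
  proof -
    have "0 \<le> t ^ 9 * ?d' t + d0 * t ^ 10 / 10"
    proof (rule limit_le_of_deriv_nonneg[where g="\<lambda>t. t ^ 9 * ?d' t + d0 * t ^ 10 / 10" and g'="\<lambda>t. t ^ 9 * (d0 - ?q t)" and R=1])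
      show "((\<lambda>t. t ^ 9 * ?d' t + d0 * t ^ 10 / 10) \<longlongrightarrow> 0) (at_right 0)"
        by (auto intro!: tendsto_eq_intros shoot_tendsto h)
      show "continuous_on {0<..1} (\<lambda>t. t ^ 9 * ?d' t + d0 * t ^ 10 / 10)"
        by (intro continuous_intros continuous_on_subset[OF shoot_cont(2)[OF h]]) auto
      fix t :: real assume t: "0 < t" "t < 1"
      have "((\<lambda>t. t ^ 9 * ?d' t + d0 * t ^ 10 / 10) has_real_derivative
        (t ^ 9 * (- (9 / t * ?d' t) - ?q t) + 9 * t ^ 8 * ?d' t) + d0 * t ^ 9) (at t)"
        by (intro DERIV_add DERIV_power9_mult potential_sol_diff(2)[OF shoot_sol[OF h] shoot_sol[OF h] t])
           (auto intro!: derivative_eq_intros)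
      moreover have "(t ^ 9 * (- (9 / t * ?d' t) - ?q t) + 9 * t ^ 8 * ?d' t) + d0 * t ^ 9 = t ^ 9 * (d0 - ?q t)"
        using t by (simp add: field_simps power_eq_if)
      ultimately show "((\<lambda>t. t ^ 9 * ?d' t + d0 * t ^ 10 / 10) has_real_derivative t ^ 9 * (d0 - ?q t)) (at t)" by simp
      show "0 \<le> t ^ 9 * (d0 - ?q t)" using q[of t] t by simp
    qed (use t in auto)
    then have "0 \<le> t ^ 9 * (?d' t + d0 * t / 10)" by (simp add: algebra_simps power_eq_if)
    then have "0 \<le> ?d' t + d0 * t / 10" using t by (simp only: zero_le_mult_iff) auto
    moreover have "d0 * t \<le> d0" using d0 t by (simp add: mult_left_le)
    ultimately show ?thesis by linarith
  qed
  have "?d 0 + d0 / 10 * 0 \<le> ?d r + d0 / 10 * r"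
  proof (rule DERIV_nonneg_imp_increasing_open[where f="\<lambda>r. ?d r + d0 / 10 * r"])
    show "\<exists>y. ((\<lambda>r. ?d r + d0 / 10 * r) has_real_derivative y) (at t) \<and> 0 \<le> y" if t: "0 < t" "t < r" for t
    proof (intro exI conjI)
      show "((\<lambda>r. ?d r + d0 / 10 * r) has_real_derivative ?d' t + d0 / 10 * 1) (at t)"
        using t r by (intro DERIV_add DERIV_cmult DERIV_ident potential_sol_diff(1)[OF shoot_sol[OF h] shoot_sol[OF h]]) auto
      show "0 \<le> ?d' t + d0 / 10 * 1" using d'[of t] t r by simp
    qed
    show "continuous_on {0..r} (\<lambda>r. ?d r + d0 / 10 * r)"
      by (intro continuous_intros continuous_on_subset[OF shoot_cont(1)[OF h]]) (use r in auto)
  qed (use r in auto)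
  moreover have "d0 / 10 * r \<le> d0 / 10" using r d0 by (simp add: mult_left_le)
  moreover have "?d 0 = d0" by (simp add: shoot_0[OF h] d0_def)
  ultimately show ?thesis using d0 by linarith
qed

text \<open>At an interior contact point the difference has a minimum, so its derivative vanishes
  too, and unique continuation towards 0 makes it vanish near 0, where it is close to \<beta>2 -
  \<beta>1 > 0.\<close>

lemma shoot_no_touching:
  assumes "\<beta>1 < \<beta>2" and r0: "0 < r0" "r0 < 1" and z: "shoot h \<beta>2 r0 = shoot h \<beta>1 r0"
    and min: "\<And>r. r \<in> {0..1} \<Longrightarrow> shoot h \<beta>1 r \<le> shoot h \<beta>2 r"
  shows False
proof -
  let ?d = "\<lambda>r. shoot h \<beta>2 r - shoot h \<beta>1 r" and ?d' = "\<lambda>r. shoot' h \<beta>2 r - shoot' h \<beta>1 r"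
  let ?q = "\<lambda>t. a_coef 10 h t * (exp (shoot h \<beta>2 t) - exp (shoot h \<beta>1 t))"
  define L where "L = a_max h * exp \<beta>2"
  have L: "0 \<le> L" using less_imp_le[OF a_max_pos[OF h]] by (simp add: L_def)
  have "?d' r0 = 0"
  proof (rule DERIV_local_min[OF potential_sol_diff(1)[OF shoot_sol[OF h] shoot_sol[OF h] r0]])
    show "0 < min r0 (1 - r0)" using r0 by simp
    show "\<forall>y. \<bar>r0 - y\<bar> < min r0 (1 - r0) \<longrightarrow> ?d r0 \<le> ?d y"
    proof (intro allI impI)
      fix y assume "\<bar>r0 - y\<bar> < min r0 (1 - r0)"
      then have "y \<in> {0..1}" by (auto simp: abs_if split: if_splits)
      then show "?d r0 \<le> ?d y" using min[of y] z by simp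
    qed
  qed
  have "?d \<rho> = 0" if \<rho>: "0 < \<rho>" "\<rho> \<le> r0" for \<rho>
  proof (rule energy_backward[where d="?d" and d'="?d'" and q="?q", OF \<rho> L])
    fix t assume t: "\<rho> < t" "t < r0"
    then have t1: "t \<in> {0..1}" "0 < t" "t < 1" using \<rho> r0 by auto
    show "(?d has_real_derivative ?d' t) (at t)" "(?d' has_real_derivative - (9 / t * ?d' t) - ?q t) (at t)"
      using potential_sol_diff[OF shoot_sol[OF h] shoot_sol[OF h] t1(2,3)] by blast+
    have "\<bar>?q t\<bar> = a_coef 10 h t * \<bar>exp (shoot h \<beta>2 t) - exp (shoot h \<beta>1 t)\<bar>"
      using a_coef_bounds(1)[OF h t1(1)] by (simp add: abs_mult)
    also have "\<dots> \<le> a_max h * (exp \<beta>2 * \<bar>?d t\<bar>)"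
      using a_coef_bounds[OF h t1(1)] shoot_le[OF h t1(1), of \<beta>1] shoot_le[OF h t1(1), of \<beta>2] assms(1) a_max_pos[OF h]
      by (intro mult_mono exp_diff_le) auto
    finally show "\<bar>?q t\<bar> \<le> L * \<bar>?d t\<bar>" by (simp add: L_def mult.assoc)
  qed (use \<rho> r0 z \<open>?d' r0 = 0\<close> in \<open>auto intro!: continuous_intros continuous_on_subset[OF shoot_cont(1)[OF h]] continuous_on_subset[OF shoot_cont(2)[OF h]]\<close>)
  then have "\<forall>\<^sub>F r in at_right 0. ?d r = 0"
    using r0 by (auto simp: eventually_at_right_field intro!: exI[of _ r0])
  moreover have "\<forall>\<^sub>F r in at_right 0. 0 < ?d r"
    using tendsto_diff[OF shoot_tendsto(1)[OF h] shoot_tendsto(1)[OF h]] assms(1) by (intro order_tendstoD(1)) auto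
  ultimately have "\<forall>\<^sub>F r in at_right (0::real). False" by eventually_elim simp
  then show False by simp
qed

text \<open>Continuity method. Both initial values are lowered by s, and m(s) is the minimum of the
  difference over [0, 1]. If the claim failed, m would pass from m(0) <= 0 to m(S) >= 0 and vanish
  at some s, where the graphs touch without crossing. Contact at r = 0 is excluded by \<beta>1 <
  \<beta>2, at r = 1 by the assumption on the boundary values, and in between by unique
  continuation.\<close>

lemma shoot_less_shoot_of_boundary:
  assumes bd: "\<And>\<beta>1 \<beta>2. \<beta>1 < \<beta>2 \<Longrightarrow> shoot h \<beta>1 1 < shoot h \<beta>2 1"
    and \<beta>: "\<beta>1 < \<beta>2" and r: "r \<in> {0..1}"
  shows "shoot h \<beta>1 r < shoot h \<beta>2 r"
proof (rule ccontr)
  assume not: "\<not> ?thesis"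
  define D where "D s r = shoot h (\<beta>2 - s) r - shoot h (\<beta>1 - s) r" for s r
  have Dc: "continuous_on {0..1} (D s)" for s
    unfolding D_def by (intro continuous_intros shoot_cont h)
  have "\<exists>x\<in>{0..1}. \<forall>r\<in>{0..1}. D s x \<le> D s r" for s
    by (rule continuous_attains_inf[OF _ _ Dc]) auto
  then obtain x where x: "\<And>s. x s \<in> {0..1}" "\<And>s r. r \<in> {0..1} \<Longrightarrow> D s (x s) \<le> D s r" by metis
  define m where "m s = D s (x s)" for s
  \<comment> \<open>S brings \<open>a_max h * exp (\<beta>2 - S)\<close> down to at most exp(-2). C
    is twice the Lipschitz constant in the initial value, as \<open>D\<close> involves two
    solutions.\<close>
  define S where "S = max 0 (\<beta>2 + 2 + ln (a_max h))"
  define C where "C = 2 * exp (1 + a_max h * exp \<beta>2)"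
  have lip: "D s r \<le> D s' r + C * \<bar>s - s'\<bar>" if "0 \<le> s" "0 \<le> s'" "r \<in> {0..1}" for s s' r
    using shoot_lipschitz[OF h, of "\<beta>2 - s" \<beta>2 "\<beta>2 - s'" r] shoot_lipschitz[OF h, of "\<beta>1 - s" \<beta>2 "\<beta>1 - s'" r] that \<beta>
    by (simp add: D_def C_def)
  have "C-lipschitz_on {0..S} m"
  proof (rule lipschitz_onI)
    fix s s' assume s: "s \<in> {0..S}" "s' \<in> {0..S}"
    have "m s \<le> m s' + C * \<bar>s - s'\<bar>"
      using x(2)[OF x(1), of s s'] lip[OF _ _ x(1), of s s' s'] s by (simp add: m_def)
    moreover have "m s' \<le> m s + C * \<bar>s - s'\<bar>"
      using x(2)[OF x(1), of s' s] lip[OF _ _ x(1), of s' s s] s by (simp add: m_def abs_minus_commute)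
    ultimately show "dist (m s) (m s') \<le> C * dist s s'" by (simp add: dist_real_def)
  qed (simp add: C_def)
  then have "continuous_on {0..S} m" by (rule lipschitz_on_continuous_on)
  moreover have "m 0 \<le> 0" using x(2)[OF r, of 0] not by (simp add: m_def D_def)
  moreover have "0 \<le> m S"
  proof -
    have "a_max h * exp (\<beta>2 - S) = exp (\<beta>2 + ln (a_max h) - S)"
      using a_max_pos[OF h] by (simp add: exp_add exp_diff)
    also have "\<dots> \<le> exp (- 2)" by (simp add: S_def)
    finally show ?thesis
      using shoot_less_shoot_small[of "\<beta>1 - S" "\<beta>2 - S" "x S"] \<beta> x(1)[of S] by (simp add: m_def D_def)
  qed
  ultimately have "\<exists>s\<ge>0. s \<le> S \<and> m s = 0" by (intro IVT') (auto simp: S_def)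
  then obtain s where s: "0 \<le> s" "m s = 0" by blast
  have "x s \<noteq> 0" using s(2) \<beta> by (auto simp: m_def D_def shoot_0[OF h])
  moreover have "x s \<noteq> 1" using s(2) bd[of "\<beta>1 - s" "\<beta>2 - s"] \<beta> by (auto simp: m_def D_def)
  ultimately have xs: "0 < x s" "x s < 1" using x(1)[of s] by auto
  show False
  proof (rule shoot_no_touching[OF _ xs])
    show "\<beta>1 - s < \<beta>2 - s" using \<beta> by simp
    show "shoot h (\<beta>2 - s) (x s) = shoot h (\<beta>1 - s) (x s)" using s(2) by (simp add: m_def D_def)
    show "shoot h (\<beta>1 - s) r \<le> shoot h (\<beta>2 - s) r" if "r \<in> {0..1}" for r
      using x(2)[OF that, of s] s(2) by (simp add: m_def D_def)
  qed
qed

text \<open>The solutions increase with \<beta> and converge to \<open>V_sing\<close>, so none can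
  exceed it; comparison with \<beta> + 1 makes the inequality strict. Unlike in the Sturm
  comparison, h may be larger than \<open>bes_zero\<close>.\<close>

lemma type_II_shoot_less_V_sing:
  assumes "type_II 10 (a_coef 10 h)" and r: "0 < r" "r \<le> 1"
  shows "shoot h \<beta> r < V_sing h r"
proof -
  note less = shoot_less_shoot_of_boundary[OF type_II_shoot_mono[OF assms(1)]]
  have "shoot h \<beta>' r \<le> V_sing h r" for \<beta>'
  proof (rule ccontr)
    assume n: "\<not> ?thesis"
    define \<epsilon> where "\<epsilon> = (shoot h \<beta>' r - V_sing h r) / 2"
    have \<epsilon>: "0 < \<epsilon>" using n by (simp add: \<epsilon>_def)
    obtain B where B: "\<And>\<beta> s. \<beta> \<ge> B \<Longrightarrow> s \<in> {r..1} \<Longrightarrow> \<bar>shoot h \<beta> s - V_sing h s\<bar> \<le> \<epsilon>"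
      using shoot_converges_uniformly[OF h r \<epsilon>] by blast
    have "shoot h \<beta>' r < shoot h (max B (\<beta>' + 1)) r" using r by (intro less) auto
    then show False using B[of "max B (\<beta>' + 1)" r] r \<epsilon> by (simp add: \<epsilon>_def)
  qed
  from this[of "\<beta> + 1"] less[of \<beta> "\<beta> + 1" r] r show ?thesis by simp
qed

text \<open>Picone's identity with y = V - v > 0, where V = \<open>V_sing\<close> and - (r^9 y')' =
  r^7 (16 + h r^2) (1 - exp(-y)). For large \<beta> one has y <= \<epsilon> on [\<rho>, 1], so the
  right side is at least (1 - \<epsilon>) r^7 (16 + h r^2) y: up to the factor 1 - \<epsilon>, y is
  a positive supersolution of the linearised equation. Then \<epsilon> tends to 0.\<close>

lemma type_II_picone:
  assumes t2: "type_II 10 (a_coef 10 h)" and \<rho>: "0 < \<rho>" "\<rho> < 1"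
    and \<xi>: "\<And>t. \<rho> < t \<Longrightarrow> t < 1 \<Longrightarrow> (\<xi> has_real_derivative \<xi>' t) (at t)"
    and c: "continuous_on {\<rho>..1} \<xi>" "continuous_on {\<rho>..1} \<xi>'" and z: "\<xi> \<rho> = 0" "\<xi> 1 = 0"
  shows "integral {\<rho>..1} (\<lambda>r. r ^ 9 * ((16 / r\<^sup>2 + h) * (\<xi> r)\<^sup>2)) \<le> integral {\<rho>..1} (\<lambda>r. r ^ 9 * (\<xi>' r)\<^sup>2)"
proof -
  let ?P = "\<lambda>r. r ^ 9 * ((16 / r\<^sup>2 + h) * (\<xi> r)\<^sup>2)" and ?E = "\<lambda>r. r ^ 9 * (\<xi>' r)\<^sup>2"
  have Pc: "?P integrable_on {\<rho>..1}" and Ec: "?E integrable_on {\<rho>..1}"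
    by (intro integrable_continuous_interval continuous_intros c; use \<rho> in auto)+
  have key: "(1 - \<epsilon>) * integral {\<rho>..1} ?P \<le> integral {\<rho>..1} ?E" if \<epsilon>: "0 < \<epsilon>" "\<epsilon> < 1" for \<epsilon>
  proof -
    obtain \<beta> where \<beta>: "\<And>r. r \<in> {\<rho>..1} \<Longrightarrow> \<bar>shoot h \<beta> r - V_sing h r\<bar> \<le> \<epsilon>"
      using shoot_converges_uniformly[OF h \<rho>(1) less_imp_le[OF \<rho>(2)] \<epsilon>(1)] by blast
    let ?y = "\<lambda>r. V_sing h r - shoot h \<beta> r" and ?y' = "\<lambda>r. V_sing' h r - shoot' h \<beta> r"
    have y: "0 < ?y r" "?y r \<le> \<epsilon>" if "r \<in> {\<rho>..1}" for r
      using \<beta>[OF that] type_II_shoot_less_V_sing[OF t2, of r \<beta>] that \<rho> by auto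
    \<comment> \<open>The boundary term of Picone's identity; it vanishes at both ends because \<xi>
      does.\<close>
    define G where "G r = (\<xi> r)\<^sup>2 * (r ^ 9 * ?y' r) / ?y r" for r
    define G' where "G' r = r ^ 9 * (2 * \<xi> r * \<xi>' r * ?y' r / ?y r - (\<xi> r * ?y' r / ?y r)\<^sup>2)
       - r ^ 7 * (16 + h * r\<^sup>2) * (\<xi> r)\<^sup>2 * ((1 - exp (- ?y r)) / ?y r)" for r
    have "(G has_real_derivative G' t) (at t)" if t: "\<rho> < t" "t < 1" for t
    proof -
      have t1: "0 < t" "t < 1" using t \<rho> by auto
      have yt: "?y t \<noteq> 0" using y[of t] t by auto
      have d1: "(?y has_real_derivative ?y' t) (at t)"
        by (rule potential_sol_diff(1)[OF shoot_sol[OF h] V_sing_sol t1])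
      have "((\<lambda>r. - (r ^ 9 * (shoot' h \<beta> r - V_sing' h r))) has_real_derivative
        - (t ^ 7 * (16 + h * t\<^sup>2) * (1 - exp (shoot h \<beta> t - V_sing h t)))) (at t)"
        by (intro DERIV_minus shoot_V_sing_flux[OF h t1])
      moreover have "(\<lambda>r. - (r ^ 9 * (shoot' h \<beta> r - V_sing' h r))) = (\<lambda>r. r ^ 9 * ?y' r)"
        by (auto simp: algebra_simps)
      ultimately have d2: "((\<lambda>r. r ^ 9 * ?y' r) has_real_derivative - (t ^ 7 * (16 + h * t\<^sup>2) * (1 - exp (- ?y t)))) (at t)"
        by simp
      have sq: "((\<lambda>r. (\<xi> r)\<^sup>2) has_real_derivative 2 * \<xi> t * \<xi>' t) (at t)"
        using DERIV_power[OF \<xi>[OF t], of 2] by (simp add: mult_ac)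
      have "(G has_real_derivative
        ((2 * \<xi> t * \<xi>' t * (t ^ 9 * ?y' t) + - (t ^ 7 * (16 + h * t\<^sup>2) * (1 - exp (- ?y t))) * (\<xi> t)\<^sup>2) * ?y t
          - (\<xi> t)\<^sup>2 * (t ^ 9 * ?y' t) * ?y' t) / (?y t * ?y t)) (at t)"
        unfolding G_def by (intro DERIV_divide DERIV_mult d1 d2 sq yt)
      moreover have "((2 * \<xi> t * \<xi>' t * (t ^ 9 * Y') + - (t ^ 7 * (16 + h * t\<^sup>2) * (1 - e)) * (\<xi> t)\<^sup>2) * Y
          - (\<xi> t)\<^sup>2 * (t ^ 9 * Y') * Y') / (Y * Y) =
          t ^ 9 * (2 * \<xi> t * \<xi>' t * Y' / Y - (\<xi> t * Y' / Y)\<^sup>2) - t ^ 7 * (16 + h * t\<^sup>2) * (\<xi> t)\<^sup>2 * ((1 - e) / Y)"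
        if "Y \<noteq> 0" for Y Y' e
        using that by (simp add: field_simps power2_eq_square)
      from this[OF yt, of "?y' t" "exp (- ?y t)"] have "((2 * \<xi> t * \<xi>' t * (t ^ 9 * ?y' t) + - (t ^ 7 * (16 + h * t\<^sup>2) * (1 - exp (- ?y t))) * (\<xi> t)\<^sup>2) * ?y t
          - (\<xi> t)\<^sup>2 * (t ^ 9 * ?y' t) * ?y' t) / (?y t * ?y t) = G' t" unfolding G'_def .
      ultimately show ?thesis by simp
    qed
    moreover have "continuous_on {\<rho>..1} G"
      unfolding G_def using y(1)
      by (intro continuous_intros c continuous_on_subset[OF shoot_cont'(1)[OF h]] continuous_on_subset[OF shoot_cont'(2)[OF h]]
          continuous_on_subset[OF V_sing_cont(1)[OF h]] continuous_on_subset[OF V_sing_cont(2)[OF h]]) (use \<rho> y(1) in force)+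
    ultimately have "(G' has_integral G 1 - G \<rho>) {\<rho>..1}"
      using \<rho> by (intro fundamental_theorem_of_calculus_interior) (auto simp flip: has_real_derivative_iff_has_vector_derivative)
    then have "(G' has_integral 0) {\<rho>..1}" using z by (simp add: G_def)
    moreover have "((\<lambda>r. ?E r - (1 - \<epsilon>) * ?P r) has_integral integral {\<rho>..1} ?E - (1 - \<epsilon>) * integral {\<rho>..1} ?P) {\<rho>..1}"
      by (intro has_integral_diff has_integral_mult_right integrable_integral Pc Ec)
    ultimately have "0 \<le> integral {\<rho>..1} ?E - (1 - \<epsilon>) * integral {\<rho>..1} ?P"
    proof (rule has_integral_le)
      fix r assume r: "r \<in> {\<rho>..1}"
      then have r0: "0 < r" "r \<le> 1" using \<rho> by auto
      have "2 * \<xi> r * \<xi>' r * ?y' r / ?y r - (\<xi> r * ?y' r / ?y r)\<^sup>2 \<le> (\<xi>' r)\<^sup>2"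
        using zero_le_power2[of "\<xi>' r - \<xi> r * ?y' r / ?y r"] by (simp add: power2_diff algebra_simps)
      then have 1: "r ^ 9 * (2 * \<xi> r * \<xi>' r * ?y' r / ?y r - (\<xi> r * ?y' r / ?y r)\<^sup>2) \<le> ?E r"
        using r0 by (intro mult_left_mono) auto
      \<comment> \<open>This holds because 1 - exp(-y) >= y exp(-y) and exp(-y) >= 1 - y >= 1 -
        \<epsilon>.\<close>
      have "1 - \<epsilon> \<le> (1 - exp (- ?y r)) / ?y r"
      proof -
        have "1 + ?y r \<le> exp (?y r)" by (rule exp_ge_add_one_self)
        then have "exp (- ?y r) * (1 + ?y r) \<le> exp (- ?y r) * exp (?y r)" by (intro mult_left_mono) auto
        then have "exp (- ?y r) * ?y r \<le> 1 - exp (- ?y r)" by (simp add: algebra_simps flip: exp_add)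
        moreover have "1 - \<epsilon> \<le> exp (- ?y r)" using y[OF r] exp_ge_add_one_self[of "- ?y r"] by linarith
        then have "(1 - \<epsilon>) * ?y r \<le> exp (- ?y r) * ?y r"
          using y[OF r] by (intro mult_right_mono) auto
        ultimately show ?thesis using y(1)[OF r] by (simp only: pos_le_divide_eq)
      qed
      then have "r ^ 7 * (16 + h * r\<^sup>2) * (\<xi> r)\<^sup>2 * (1 - \<epsilon>) \<le> r ^ 7 * (16 + h * r\<^sup>2) * (\<xi> r)\<^sup>2 * ((1 - exp (- ?y r)) / ?y r)"
        using potential_weight_pos(1)[OF h, of r] r0 by (intro mult_left_mono) auto
      moreover have "r ^ 7 * (16 + h * r\<^sup>2) * (\<xi> r)\<^sup>2 * (1 - \<epsilon>) = (1 - \<epsilon>) * ?P r"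
        using r0 by (simp add: field_simps power_eq_if)
      ultimately show "G' r \<le> ?E r - (1 - \<epsilon>) * ?P r" using 1 unfolding G'_def by linarith
    qed
    then show ?thesis by simp
  qed
  have "((\<lambda>\<epsilon>. (1 - \<epsilon>) * integral {\<rho>..1} ?P) \<longlongrightarrow> (1 - 0) * integral {\<rho>..1} ?P) (at_right 0)"
    by (intro tendsto_intros)
  then have "(1 - 0) * integral {\<rho>..1} ?P \<le> integral {\<rho>..1} ?E"
    by (rule tendsto_upperbound) (auto simp: eventually_at_right_field intro!: exI[of _ 1] key)
  then show ?thesis by simp
qed

end

section \<open>Weak gradients\<close>

lemma AE_lebesgue_on_iff:
  assumes "\<Omega> \<in> sets borel"
  shows "(AE x in lebesgue_on \<Omega>. P x) \<longleftrightarrow> (AE x in lborel. x \<in> \<Omega> \<longrightarrow> P x)"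
  using assms by (simp add: AE_restrict_space_iff AE_completion_iff)

lemma nn_integral_lebesgue_on:
  assumes "\<Omega> \<in> sets borel"
  shows "nn_integral (lebesgue_on \<Omega>) f = (\<integral>\<^sup>+x. f x * indicator \<Omega> x \<partial>lborel)"
  using assms by (simp add: nn_integral_restrict_space nn_integral_completion)

lemma integral_lebesgue_on_borel:
  fixes f :: "'a::euclidean_space \<Rightarrow> real"
  assumes [measurable]: "\<Omega> \<in> sets borel" "f \<in> borel_measurable borel"
  shows "integral\<^sup>L (lebesgue_on \<Omega>) f = (\<integral>x. indicator \<Omega> x * f x \<partial>lborel)"
  by (subst integral_restrict_space) (auto simp: integral_completion)

lemma integrable_lebesgue_on_borel:
  fixes f :: "'a::euclidean_space \<Rightarrow> real"
  assumes [measurable]: "\<Omega> \<in> sets borel" "f \<in> borel_measurable borel"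
  shows "integrable (lebesgue_on \<Omega>) f \<longleftrightarrow> integrable lborel (\<lambda>x. indicator \<Omega> x * f x)"
  by (subst integrable_restrict_space) (auto simp: integrable_completion)

lemma integrable_compact_support:
  fixes f :: "'a::euclidean_space \<Rightarrow> real"
  assumes "continuous_on UNIV f" "\<And>x. R < norm x \<Longrightarrow> f x = 0"
  shows "integrable lborel f"
proof -
  have "integrable lborel (\<lambda>x. indicator (cball 0 R) x *\<^sub>R f x)"
    by (intro borel_integrable_compact continuous_on_subset[OF assms(1)]) auto
  moreover have "(\<lambda>x. indicator (cball 0 R) x *\<^sub>R f x) = f"
    using assms(2) by (auto simp: indicator_def fun_eq_iff not_le)
  ultimately show ?thesis by simp
qed

lemma partial_derivative_eq_0:
  assumes "open S" "x \<in> S" "\<And>y. y \<in> S \<Longrightarrow> f y = 0"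
  shows "partial_derivative b f x = 0"
  using partial_derivative_cong_open[OF assms(1,2), of f "\<lambda>_. 0" b] assms(3)
    partial_derivative_eq[of "\<lambda>_. 0::real" "\<lambda>_. 0" x b] by simp

lemma Ck_on_partial_continuous:
  assumes "Ck_on (Suc 0) S f" "b \<in> Basis" shows "continuous_on S (partial_derivative b f)"
  using assms by simp

lemma continuous_on_bounded_cball:
  fixes f :: "'a::euclidean_space \<Rightarrow> real"
  assumes "continuous_on UNIV f" shows "\<exists>C. \<forall>x\<in>cball 0 R. \<bar>f x\<bar> \<le> C"
proof -
  have "compact (f ` cball 0 R)" by (intro compact_continuous_image continuous_on_subset[OF assms]) auto
  then have "bounded (f ` cball 0 R)" by (rule compact_imp_bounded)
  then show ?thesis by (simp add: bounded_iff)
qed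

lemma integral_translate:
  fixes F :: "'a::euclidean_space \<Rightarrow> real"
  assumes [measurable]: "F \<in> borel_measurable borel"
  shows "(\<integral>x. F (c + x) \<partial>lborel) = integral\<^sup>L lborel F"
proof -
  have "integral\<^sup>L lborel F = integral\<^sup>L (distr lborel borel ((+) c)) F" by (simp add: lborel_distr_plus)
  also have "\<dots> = (\<integral>x. F (c + x) \<partial>lborel)" by (rule integral_distr) simp_all
  finally show ?thesis by simp
qed

text \<open>The integral of a difference quotient vanishes by translation invariance.\<close>

lemma integral_partial_derivative_eq_0:
  fixes F :: "'a::euclidean_space \<Rightarrow> real"
  assumes C1: "Ck_on (Suc 0) UNIV F" and R: "\<And>x. R < norm x \<Longrightarrow> F x = 0" and b: "b \<in> Basis"
  shows "(\<integral>x. partial_derivative b F x \<partial>lborel) = 0" "integrable lborel (partial_derivative b F)"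
proof -
  let ?g = "partial_derivative b F"
  have gc: "continuous_on UNIV ?g" by (rule Ck_on_partial_continuous[OF C1 b])
  have Fc: "continuous_on UNIV F" by (rule Ck_on_continuous[OF C1])
  have [measurable]: "F \<in> borel_measurable borel" "?g \<in> borel_measurable borel"
    using gc Fc by (auto intro: borel_measurable_continuous_onI)
  have g0: "?g x = 0" if "R < norm x" for x
  proof (rule partial_derivative_eq_0)
    show "open {x::'a. R < norm x}" by (intro open_Collect_less continuous_intros)
  qed (use that R in auto)
  show ig: "integrable lborel ?g" by (rule integrable_compact_support[OF gc g0])
  have iF: "integrable lborel F" by (rule integrable_compact_support[OF Fc R])
  obtain C0 where C0: "\<And>x. x \<in> cball 0 R \<Longrightarrow> \<bar>?g x\<bar> \<le> C0"
    using continuous_on_bounded_cball[OF gc] by blast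
  define C where "C = max 0 C0"
  have C: "\<bar>?g x\<bar> \<le> C" "0 \<le> C" for x
    using C0[of x] g0[of x] by (cases "norm x \<le> R"; auto simp: C_def not_le)+
  define e where "e n = 1 / real (Suc n)" for n
  have e: "0 < e n" "e n \<le> 1" for n by (auto simp: e_def)
  have line: "((\<lambda>t. F (x + t *\<^sub>R b)) has_real_derivative ?g (x + t *\<^sub>R b)) (at t)" for x t
    using C1 by (intro partial_derivative_line) auto
  define D where "D n x = (F (e n *\<^sub>R b + x) - F x) / e n" for n x
  have [measurable]: "D n \<in> borel_measurable borel" for n unfolding D_def by simp
  have "(\<lambda>n. integral\<^sup>L lborel (D n)) \<longlonglongrightarrow> integral\<^sup>L lborel ?g"
  proof (rule integral_dominated_convergence)
    show "integrable lborel (\<lambda>x::'a. indicator (cball 0 (R + 1)) x *\<^sub>R C)"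
      by (intro borel_integrable_compact) auto
    show "AE x in lborel. (\<lambda>n. D n x) \<longlonglongrightarrow> ?g x"
    proof (rule AE_I2)
      fix x :: 'a
      have "((\<lambda>t. (F (x + t *\<^sub>R b) - F (x + 0 *\<^sub>R b)) / (t - 0)) \<longlongrightarrow> ?g (x + 0 *\<^sub>R b)) (at 0)"
        using line[of x 0] by (simp add: has_field_derivative_iff)
      moreover have "filterlim e (at 0) sequentially"
        unfolding filterlim_at using e(1) LIMSEQ_inverse_real_of_nat by (auto simp: e_def[abs_def] inverse_eq_divide less_imp_neq[symmetric])
      ultimately have "(\<lambda>n. (F (x + e n *\<^sub>R b) - F (x + 0 *\<^sub>R b)) / (e n - 0)) \<longlonglongrightarrow> ?g (x + 0 *\<^sub>R b)"
        by (rule filterlim_compose)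
      then show "(\<lambda>n. D n x) \<longlonglongrightarrow> ?g x" by (simp add: D_def add.commute)
    qed
    show "AE x in lborel. norm (D n x) \<le> indicator (cball 0 (R + 1)) x *\<^sub>R C" for n
    proof (rule AE_I2)
      fix x :: 'a
      obtain z where z: "0 < z" "z < e n" "F (x + e n *\<^sub>R b) - F (x + 0 *\<^sub>R b) = (e n - 0) * ?g (x + z *\<^sub>R b)"
        using MVT2[OF e(1)[of n], of "\<lambda>t. F (x + t *\<^sub>R b)" "\<lambda>t. ?g (x + t *\<^sub>R b)"] line by blast
      then have D: "D n x = ?g (x + z *\<^sub>R b)" using e(1)[of n] by (simp add: D_def add.commute)
      show "norm (D n x) \<le> indicator (cball 0 (R + 1)) x *\<^sub>R C"
      proof (cases "norm x \<le> R + 1")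
        case True then show ?thesis using C(1) by (simp add: D)
      next
        case False
        have "norm x \<le> norm (x + z *\<^sub>R b) + norm (z *\<^sub>R b)" using norm_triangle_ineq4[of "x + z *\<^sub>R b" "z *\<^sub>R b"] by simp
        also have "norm (z *\<^sub>R b) \<le> 1" using b z e(2)[of n] by simp
        finally have "R < norm (x + z *\<^sub>R b)" using False by simp
        then show ?thesis using g0 by (simp add: D C)
      qed
    qed
  qed simp_all
  moreover have "integral\<^sup>L lborel (D n) = 0" for n
  proof -
    have "integrable lborel (\<lambda>x. F (e n *\<^sub>R b + x))"
    proof (rule integrable_compact_support)
      show "continuous_on UNIV (\<lambda>x. F (e n *\<^sub>R b + x))"
        by (intro continuous_on_compose2[OF Fc] continuous_intros) auto
      show "F (e n *\<^sub>R b + x) = 0" if "R + 1 < norm x" for x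
      proof (rule R)
        have "norm x \<le> norm (e n *\<^sub>R b + x) + norm (e n *\<^sub>R b)" using norm_triangle_ineq4[of "e n *\<^sub>R b + x" "e n *\<^sub>R b"] by simp
        also have "norm (e n *\<^sub>R b) \<le> 1" using b e[of n] by simp
        finally show "R < norm (e n *\<^sub>R b + x)" using that by simp
      qed
    qed
    then show ?thesis using iF by (simp add: D_def[abs_def] integral_translate)
  qed
  ultimately show "(\<integral>x. ?g x \<partial>lborel) = 0" by (simp add: LIMSEQ_const_iff)
qed

lemma integration_by_parts_partial:
  fixes f g :: "'a::euclidean_space \<Rightarrow> real"
  assumes f: "Ck_on (Suc 0) UNIV f" and g: "Ck_on (Suc 0) UNIV g" and R: "\<And>x. R < norm x \<Longrightarrow> f x = 0" and b: "b \<in> Basis"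
  shows "(\<integral>x. f x * partial_derivative b g x \<partial>lborel) = - (\<integral>x. partial_derivative b f x * g x \<partial>lborel)"
proof -
  have pd: "partial_derivative b (\<lambda>x. f x * g x) = (\<lambda>x. f x * partial_derivative b g x + partial_derivative b f x * g x)"
    using partial_derivative_eq[OF has_derivative_mult[OF Ck_on_has_derivative[OF f UNIV_I] Ck_on_has_derivative[OF g UNIV_I]]]
    by (simp add: partial_derivative_def fun_eq_iff)
  have f0: "partial_derivative b f x = 0" if "R < norm x" for x
  proof (rule partial_derivative_eq_0)
    show "open {x::'a. R < norm x}" by (intro open_Collect_less continuous_intros)
  qed (use that R in auto)
  have c: "continuous_on UNIV f" "continuous_on UNIV g" "continuous_on UNIV (partial_derivative b f)" "continuous_on UNIV (partial_derivative b g)"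
    using Ck_on_continuous[OF f] Ck_on_continuous[OF g] Ck_on_partial_continuous[OF f b] Ck_on_partial_continuous[OF g b] by auto
  have "0 = (\<integral>x. f x * partial_derivative b g x + partial_derivative b f x * g x \<partial>lborel)"
    using integral_partial_derivative_eq_0(1)[OF Ck_on_mult[OF open_UNIV f g], of R b] R b by (simp add: pd)
  also have "\<dots> = (\<integral>x. f x * partial_derivative b g x \<partial>lborel) + (\<integral>x. partial_derivative b f x * g x \<partial>lborel)"
    using R f0 by (intro Bochner_Integration.integral_add integrable_compact_support[of _ R] continuous_intros c) auto
  finally show ?thesis by simp
qed

lemma test_function_Ck: "test_function \<Omega> \<phi> \<Longrightarrow> Ck_on k UNIV \<phi>"
  by (simp add: test_function_def)

lemma test_function_cont:
  assumes "test_function \<Omega> \<phi>"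
  shows "continuous_on UNIV \<phi>" "b \<in> Basis \<Longrightarrow> continuous_on UNIV (partial_derivative b \<phi>)" "continuous_on UNIV (gradient \<phi>)"
proof -
  show "continuous_on UNIV \<phi>" using Ck_on_continuous[OF test_function_Ck[OF assms]] .
  show *: "continuous_on UNIV (partial_derivative b \<phi>)" if "b \<in> Basis" for b
    using Ck_on_partial_continuous[OF test_function_Ck[OF assms] that] .
  show "continuous_on UNIV (gradient \<phi>)" unfolding gradient_def[abs_def] by (intro continuous_intros *)
qed

lemma test_function_bounded_support:
  assumes "test_function \<Omega> \<phi>"
  obtains R where "\<And>x. R < norm x \<Longrightarrow> \<phi> x = 0"
proof -
  have "bounded (closure {x. \<phi> x \<noteq> 0})" using assms by (auto simp: test_function_def dest: compact_imp_bounded)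
  then obtain R where "\<And>x. x \<in> closure {x. \<phi> x \<noteq> 0} \<Longrightarrow> norm x \<le> R" by (auto simp: bounded_iff)
  then have "\<phi> x = 0" if "R < norm x" for x using that closure_subset by force
  then show ?thesis by (rule that)
qed

lemma test_function_outside:
  assumes "test_function \<Omega> \<phi>" "x \<notin> \<Omega>"
  shows "\<phi> x = 0" "partial_derivative b \<phi> x = 0" "gradient \<phi> x = 0"
proof -
  let ?K = "closure {x. \<phi> x \<noteq> 0}"
  have x: "x \<in> - ?K" using assms by (auto simp: test_function_def)
  have z: "\<phi> y = 0" if "y \<in> - ?K" for y using that closure_subset[of "{x. \<phi> x \<noteq> 0}"] by auto
  show "\<phi> x = 0" using z[OF x] .
  show *: "partial_derivative b \<phi> x = 0" for b by (rule partial_derivative_eq_0[OF _ x z]) auto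
  show "gradient \<phi> x = 0" by (simp add: gradient_def *)
qed

lemma gradient_inner: "b \<in> Basis \<Longrightarrow> gradient f x \<bullet> b = partial_derivative b f x"
  by (simp add: gradient_def inner_sum_left inner_Basis sum.delta if_distrib cong: if_cong)

lemma test_function_square_integrable:
  assumes "test_function \<Omega> \<phi>"
  shows "integrable lborel (\<lambda>x. (\<phi> x)\<^sup>2)" "integrable lborel (\<lambda>x. (norm (gradient \<phi> x))\<^sup>2)"
proof -
  obtain R where R: "\<And>x. R < norm x \<Longrightarrow> \<phi> x = 0" using test_function_bounded_support[OF assms] by blast
  have g: "gradient \<phi> x = 0" if "R < norm x" for x
  proof -
    have "partial_derivative b \<phi> x = 0" for b
    proof (rule partial_derivative_eq_0)
      show "open {x::'a. R < norm x}" by (intro open_Collect_less continuous_intros)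
    qed (use that R in auto)
    then show ?thesis by (simp add: gradient_def)
  qed
  show "integrable lborel (\<lambda>x. (\<phi> x)\<^sup>2)" "integrable lborel (\<lambda>x. (norm (gradient \<phi> x))\<^sup>2)"
    using R g by (auto intro!: integrable_compact_support[of _ R] continuous_intros test_function_cont[OF assms])
qed

lemma test_function_weak_gradient:
  assumes t: "test_function \<Omega> f" and \<Omega>: "open \<Omega>"
  shows "is_weak_gradient \<Omega> f (gradient f)"
proof -
  have [measurable]: "\<Omega> \<in> sets borel" using \<Omega> by simp
  have [measurable]: "f \<in> borel_measurable borel" "gradient f \<in> borel_measurable borel"
    using test_function_cont[OF t] by (auto intro: borel_measurable_continuous_onI)
  have L2: "L2_on \<Omega> f" "L2_on \<Omega> (gradient f)"
  proof -
    have "(\<lambda>x. indicator \<Omega> x * (norm (f x))\<^sup>2) = (\<lambda>x. (f x)\<^sup>2)"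
      "(\<lambda>x. indicator \<Omega> x * (norm (gradient f x))\<^sup>2) = (\<lambda>x. (norm (gradient f x))\<^sup>2)"
      using test_function_outside[OF t] by (auto simp: indicator_def fun_eq_iff)
    then have "integrable (lebesgue_on \<Omega>) (\<lambda>x. (norm (f x))\<^sup>2)" "integrable (lebesgue_on \<Omega>) (\<lambda>x. (norm (gradient f x))\<^sup>2)"
      using test_function_square_integrable[OF t] by (simp_all add: integrable_lebesgue_on_borel)
    then show "L2_on \<Omega> f" "L2_on \<Omega> (gradient f)"
      unfolding L2_on_def by (auto intro!: measurable_restrict_space1 measurable_completion)
  qed
  moreover have "(\<integral>x. f x * partial_derivative b \<phi> x \<partial>lebesgue_on \<Omega>) = - (\<integral>x. (gradient f x \<bullet> b) * \<phi> x \<partial>lebesgue_on \<Omega>)"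
    if \<phi>: "test_function \<Omega> \<phi>" and b: "b \<in> Basis" for \<phi> b
  proof -
    have [measurable]: "\<phi> \<in> borel_measurable borel" "partial_derivative b \<phi> \<in> borel_measurable borel"
      using test_function_cont[OF \<phi>] b by (auto intro: borel_measurable_continuous_onI)
    have [measurable]: "partial_derivative b f \<in> borel_measurable borel"
      using test_function_cont[OF t] b by (auto intro: borel_measurable_continuous_onI)
    obtain R where R: "\<And>x. R < norm x \<Longrightarrow> f x = 0" using test_function_bounded_support[OF t] by blast
    have ibp: "(\<integral>x. f x * partial_derivative b \<phi> x \<partial>lborel) = - (\<integral>x. partial_derivative b f x * \<phi> x \<partial>lborel)"
      by (rule integration_by_parts_partial[OF test_function_Ck[OF t] test_function_Ck[OF \<phi>] R b])
    have "(\<integral>x. f x * partial_derivative b \<phi> x \<partial>lebesgue_on \<Omega>) = (\<integral>x. f x * partial_derivative b \<phi> x \<partial>lborel)"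
      by (subst integral_lebesgue_on_borel) (auto intro!: Bochner_Integration.integral_cong simp: indicator_def test_function_outside[OF t])
    moreover have "(\<integral>x. (gradient f x \<bullet> b) * \<phi> x \<partial>lebesgue_on \<Omega>) = (\<integral>x. partial_derivative b f x * \<phi> x \<partial>lborel)"
      by (subst integral_lebesgue_on_borel)
         (auto intro!: Bochner_Integration.integral_cong simp: indicator_def test_function_outside[OF t] gradient_inner[OF b])
    ultimately show ?thesis using ibp by simp
  qed
  ultimately show ?thesis by (simp add: is_weak_gradient_def)
qed

section \<open>Uniqueness of weak gradients\<close>

definition box_bump :: "nat \<Rightarrow> 'a::euclidean_space \<Rightarrow> 'a \<Rightarrow> 'a \<Rightarrow> real" where
  "box_bump n l u x = flat (real n * (1 - x \<bullet> x) - 1) *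
     (\<Prod>b\<in>Basis. flat (real n * ((x \<bullet> b - l \<bullet> b) * (u \<bullet> b - x \<bullet> b)) - 1))"

lemma box_bump_bounds: "0 \<le> box_bump n l u x" "box_bump n l u x \<le> 1"
  unfolding box_bump_def
  by (auto intro!: mult_nonneg_nonneg prod_nonneg mult_le_one prod_le_1 simp: flat_bounds)

text \<open>The shift by -1 in the first factor keeps the support inside the closed set where n (1 -
  |x|^2) >= 1, a compact subset of the open ball.\<close>

lemma box_bump_test_function: "test_function (ball 0 1) (box_bump n l u)"
  unfolding test_function_def
proof (intro conjI allI)
  have flat_comp: "Ck_on k UNIV (\<lambda>x::'a. flat (f x))" if "Ck_on k UNIV f" for k f
    by (rule Ck_on_compose[OF _ open_UNIV that Ck_on_flat]) auto
  show "Ck_on k UNIV (box_bump n l u)" for k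
    unfolding box_bump_def[abs_def]
    by (intro Ck_on_mult Ck_on_prod flat_comp Ck_on_diff) simp_all
  have sub: "{x. box_bump n l u x \<noteq> 0} \<subseteq> {x. 1 \<le> real n * (1 - x \<bullet> x)}"
    using flat_bounds(4) by (auto simp: box_bump_def not_le) (meson diff_ge_0_iff_ge linear)
  have "closed {x::'a. 1 \<le> real n * (1 - x \<bullet> x)}" by (intro closed_Collect_le continuous_intros)
  then have cl: "closure {x. box_bump n l u x \<noteq> 0} \<subseteq> {x. 1 \<le> real n * (1 - x \<bullet> x)}"
    using sub by (rule closure_minimal[rotated])
  have "{x::'a. 1 \<le> real n * (1 - x \<bullet> x)} \<subseteq> ball 0 1"
  proof
    fix x :: 'a assume "x \<in> {x. 1 \<le> real n * (1 - x \<bullet> x)}"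
    then have "0 < real n * (1 - x \<bullet> x)" by simp
    then have "x \<bullet> x < 1" by (simp add: zero_less_mult_iff)
    then show "x \<in> ball 0 1" by (simp add: norm_lt_square)
  qed
  with cl show c: "closure {x. box_bump n l u x \<noteq> 0} \<subseteq> ball 0 1" by blast
  show "compact (closure {x. box_bump n l u x \<noteq> 0})"
    using c bounded_subset[OF bounded_ball] by (auto simp: compact_eq_bounded_closed)
qed

lemma flat_tendsto_step: "(\<lambda>n. flat (real n * y - 1)) \<longlonglongrightarrow> (if 0 < y then 1 else 0)"
proof (cases "0 < y")
  case True
  have "filterlim (\<lambda>n. real n * y) at_top sequentially"
    by (rule filterlim_at_top_mult_tendsto_pos[OF tendsto_const True filterlim_real_sequentially])
  from filterlim_tendsto_add_at_top[OF tendsto_const[of "-1"] this]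
  have "filterlim (\<lambda>n. real n * y - 1) at_top sequentially" by simp
  moreover have "(flat \<longlongrightarrow> 1) at_top"
  proof -
    have "((\<lambda>x::real. exp (- (1 / x))) \<longlongrightarrow> exp (- 0)) at_top"
      by (intro tendsto_intros tendsto_divide_0[OF tendsto_const] filterlim_ident[THEN filterlim_at_top_imp_at_infinity])
    then have "((\<lambda>x::real. exp (- (1 / x))) \<longlongrightarrow> 1) at_top" by simp
    then show ?thesis
      by (rule Lim_transform_eventually) (auto simp: flat_def eventually_at_top_linorder intro!: exI[of _ 1])
  qed
  ultimately have "(\<lambda>n. flat (real n * y - 1)) \<longlonglongrightarrow> 1" by (rule filterlim_compose[rotated])
  then show ?thesis using True by simp
next
  case False
  then have "flat (real n * y - 1) = 0" for n
    by (intro flat_bounds(4)) (simp add: mult_nonneg_nonpos order_trans[of _ 0])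
  then show ?thesis using False by simp
qed

lemma box_bump_tendsto:
  assumes "\<And>b. b \<in> Basis \<Longrightarrow> l \<bullet> b \<le> u \<bullet> b"
  shows "(\<lambda>n. box_bump n l u x) \<longlonglongrightarrow> indicator (box l u \<inter> ball 0 1) x"
proof -
  have "(\<lambda>n. box_bump n l u x) \<longlonglongrightarrow> (if 0 < 1 - x \<bullet> x then 1 else 0) *
     (\<Prod>b\<in>Basis. if 0 < (x \<bullet> b - l \<bullet> b) * (u \<bullet> b - x \<bullet> b) then 1 else 0)"
    unfolding box_bump_def by (intro tendsto_intros flat_tendsto_step)
  moreover have "(0 < (x \<bullet> b - l \<bullet> b) * (u \<bullet> b - x \<bullet> b)) \<longleftrightarrow> l \<bullet> b < x \<bullet> b \<and> x \<bullet> b < u \<bullet> b" if "b \<in> Basis" for b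
    using assms[OF that] by (auto simp: zero_less_mult_iff)
  then have "(\<Prod>b\<in>Basis. if 0 < (x \<bullet> b - l \<bullet> b) * (u \<bullet> b - x \<bullet> b) then 1 else 0) = (indicator (box l u) x :: real)"
    by (auto simp: indicator_def mem_box prod_zero_iff intro!: prod.neutral)
  moreover have "(if 0 < 1 - x \<bullet> x then 1 else 0) = (indicator (ball 0 1) x :: real)"
    by (simp add: indicator_def norm_lt_square)
  ultimately show ?thesis by (simp add: indicator_inter_arith mult.commute)
qed

text \<open>The positive and the negative part of k are densities of finite measures that agree on
  open boxes, a generator stable under intersection. So the measures and their densities agree, and
  max 0 k = max 0 (-k) forces k = 0.\<close>

lemma AE_zero_of_box_integrals:
  fixes k :: "'a::euclidean_space \<Rightarrow> real"
  assumes k: "integrable lborel k"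
    and box: "\<And>l u. (\<And>b. b \<in> Basis \<Longrightarrow> l \<bullet> b \<le> u \<bullet> b) \<Longrightarrow> (\<integral>x. indicator (box l u) x * k x \<partial>lborel) = 0"
  shows "AE x in lborel. k x = 0"
proof -
  have [measurable]: "k \<in> borel_measurable borel" using k by simp
  let ?p = "\<lambda>x. ennreal (max 0 (k x))" and ?m = "\<lambda>x. ennreal (max 0 (- k x))"
  have ip: "integrable lborel (\<lambda>x. max 0 (k x))" "integrable lborel (\<lambda>x. max 0 (- k x))"
    using k by auto
  have fin: "(\<integral>\<^sup>+x. ?p x \<partial>lborel) \<noteq> \<infinity>"
    using ip(1) by (simp add: nn_integral_eq_integral)
  have eqb: "emeasure (density lborel ?p) (box l u) = emeasure (density lborel ?m) (box l u)" for l u :: 'a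
  proof (cases "box l u = {}")
    case False
    then have lu: "l \<bullet> b \<le> u \<bullet> b" if "b \<in> Basis" for b using that by (auto simp: box_ne_empty intro: less_imp_le)
    have ib: "integrable lborel (\<lambda>x. indicator (box l u) x * max 0 (k x))" "integrable lborel (\<lambda>x. indicator (box l u) x * max 0 (- k x))"
      using ip integrable_mult_indicator[of "box l u" lborel] by (auto simp: real_scaleR_def[symmetric] simp del: real_scaleR_def)
    have "(\<integral>x. indicator (box l u) x * max 0 (k x) \<partial>lborel) - (\<integral>x. indicator (box l u) x * max 0 (- k x) \<partial>lborel)
       = (\<integral>x. indicator (box l u) x * k x \<partial>lborel)"
      by (subst Bochner_Integration.integral_diff[symmetric, OF ib]) (auto intro!: Bochner_Integration.integral_cong simp: indicator_def)
    then have eq: "(\<integral>x. indicator (box l u) x * max 0 (k x) \<partial>lborel) = (\<integral>x. indicator (box l u) x * max 0 (- k x) \<partial>lborel)"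
      using box[OF lu] by simp
    have "emeasure (density lborel ?p) (box l u) = (\<integral>\<^sup>+x. ennreal (indicator (box l u) x * max 0 (k x)) \<partial>lborel)"
      by (subst emeasure_density) (auto intro!: nn_integral_cong simp: indicator_def)
    moreover have "emeasure (density lborel ?m) (box l u) = (\<integral>\<^sup>+x. ennreal (indicator (box l u) x * max 0 (- k x)) \<partial>lborel)"
      by (subst emeasure_density) (auto intro!: nn_integral_cong simp: indicator_def)
    ultimately show ?thesis using eq ib by (simp add: nn_integral_eq_integral)
  qed simp
  have "density lborel ?p = density lborel ?m"
  proof (rule measure_eqI_generator_eq)
    let ?E = "range (\<lambda>(a, b). box a b::'a set)"
    show "Int_stable ?E" by (auto simp: Int_stable_def box_Int_box)
    show "?E \<subseteq> Pow UNIV" "sets (density lborel ?p) = sigma_sets UNIV ?E" "sets (density lborel ?m) = sigma_sets UNIV ?E"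
      by (simp_all add: borel_eq_box)
    let ?A = "\<lambda>n::nat. box (- (real n *\<^sub>R One)) (real n *\<^sub>R One) :: 'a set"
    show "range ?A \<subseteq> ?E" "(\<Union>i. ?A i) = UNIV" unfolding UN_box_eq_UNIV by auto
    show "emeasure (density lborel ?p) (?A i) \<noteq> \<infinity>" for i
    proof -
      have "emeasure (density lborel ?p) (?A i) \<le> (\<integral>\<^sup>+x. ?p x \<partial>lborel)"
        by (subst emeasure_density) (auto intro!: nn_integral_mono simp: indicator_def)
      then show ?thesis using fin by (auto simp: top_unique)
    qed
    show "emeasure (density lborel ?p) X = emeasure (density lborel ?m) X" if "X \<in> ?E" for X
      using that eqb by auto
  qed
  then have "AE x in lborel. ?p x = ?m x"
    by (subst (asm) finite_density_unique) (use fin in auto)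
  then show ?thesis
    by eventually_elim (auto simp: max_def split: if_splits)
qed

lemma finite_measure_lebesgue_on_ball: "finite_measure (lebesgue_on (ball (0::'a::euclidean_space) 1))"
  using emeasure_lborel_ball_finite[of "0::'a" 1]
  by (intro finite_measureI) (simp add: emeasure_restrict_space emeasure_completion)

lemma L2_on_integrable:
  fixes g :: "'a::euclidean_space \<Rightarrow> 'b::euclidean_space"
  assumes "L2_on (ball 0 1) g"
  shows "integrable (lebesgue_on (ball 0 1)) g"
proof -
  interpret finite_measure "lebesgue_on (ball (0::'a) 1)" by (rule finite_measure_lebesgue_on_ball)
  have m: "g \<in> borel_measurable (lebesgue_on (ball 0 1))" "integrable (lebesgue_on (ball 0 1)) (\<lambda>x. (norm (g x))\<^sup>2)"
    using assms by (auto simp: L2_on_def)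
  show ?thesis
  proof (rule Bochner_Integration.integrable_bound[OF _ m(1)])
    show "integrable (lebesgue_on (ball 0 1)) (\<lambda>x. 1 + (norm (g x))\<^sup>2)" using m(2) by auto
    have "norm y \<le> 1 + (norm y)\<^sup>2" for y :: 'b
      using sum_squares_bound[of "norm y" 1] by (simp add: power2_eq_square) (smt (verit) norm_ge_zero)
    then show "AE x in lebesgue_on (ball 0 1). norm (g x) \<le> norm (1 + (norm (g x))\<^sup>2)" by simp
  qed
qed

text \<open>The bumps converge boundedly to the indicator of a box intersected with the ball, so k
  integrates to 0 over every box. Since k is only Lebesgue measurable, a Borel version
  \<open>k0\<close> of its extension by zero is used.\<close>

lemma fundamental_lemma_ball:
  fixes k :: "'a::euclidean_space \<Rightarrow> real"
  assumes k: "integrable (lebesgue_on (ball 0 1)) k"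
    and z: "\<And>\<phi>. test_function (ball 0 1) \<phi> \<Longrightarrow> (\<integral>x. k x * \<phi> x \<partial>lebesgue_on (ball 0 1)) = 0"
  shows "AE x in lebesgue_on (ball 0 1). k x = 0"
proof -
  let ?B = "ball (0::'a) 1"
  have "integrable lebesgue (\<lambda>x. indicator ?B x *\<^sub>R k x)"
    using k by (subst (asm) integrable_restrict_space) auto
  then have m: "(\<lambda>x. indicator ?B x * k x) \<in> borel_measurable (completion lborel)" and il: "integrable lebesgue (\<lambda>x. indicator ?B x * k x)"
    by auto
  obtain k0 where k0[measurable]: "k0 \<in> borel_measurable lborel" and eq: "AE x in lborel. indicator ?B x * k x = k0 x"
    using completion_ex_borel_measurable_real[OF m] by blast
  have eq': "AE x in lebesgue. indicator ?B x * k x = k0 x" using eq by (simp add: AE_completion_iff)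
  have k0l: "k0 \<in> borel_measurable lebesgue" using k0 by (intro measurable_completion) simp
  have "integrable lebesgue k0" using il eq' by (subst integrable_cong_AE[symmetric, OF m k0l]) auto
  then have ik0: "integrable lborel k0" by (simp add: integrable_completion)
  have "AE x in lborel. k0 x = 0"
  proof (rule AE_zero_of_box_integrals[OF ik0])
    fix l u :: 'a assume lu: "\<And>b. b \<in> Basis \<Longrightarrow> l \<bullet> b \<le> u \<bullet> b"
    have bm[measurable]: "box_bump n l u \<in> borel_measurable borel" for n
      using test_function_cont(1)[OF box_bump_test_function] by (rule borel_measurable_continuous_onI)
    have zero: "(\<integral>x. k0 x * box_bump n l u x \<partial>lborel) = 0" for n
    proof -
      have "(\<integral>x. k0 x * box_bump n l u x \<partial>lborel) = (\<integral>x. k0 x * box_bump n l u x \<partial>lebesgue)"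
        by (simp add: integral_completion)
      also have "\<dots> = (\<integral>x. indicator ?B x *\<^sub>R (k x * box_bump n l u x) \<partial>lebesgue)"
      proof (rule integral_cong_AE)
        have "box_bump n l u \<in> borel_measurable lebesgue" by (intro measurable_completion) simp
        then show "(\<lambda>x. indicator ?B x *\<^sub>R (k x * box_bump n l u x)) \<in> borel_measurable lebesgue"
          using borel_measurable_times[OF m] by (simp add: mult.assoc)
        show "AE x in lebesgue. k0 x * box_bump n l u x = indicator ?B x *\<^sub>R (k x * box_bump n l u x)"
          using eq' by eventually_elim (simp add: mult.assoc[symmetric])
      qed (intro borel_measurable_times k0l measurable_completion; simp)
      also have "\<dots> = (\<integral>x. k x * box_bump n l u x \<partial>lebesgue_on ?B)" by (subst integral_restrict_space) auto
      also have "\<dots> = 0" by (rule z[OF box_bump_test_function])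
      finally show ?thesis .
    qed
    have "(\<lambda>n. \<integral>x. k0 x * box_bump n l u x \<partial>lborel) \<longlonglongrightarrow> (\<integral>x. k0 x * indicator (box l u \<inter> ?B) x \<partial>lborel)"
    proof (rule integral_dominated_convergence[where w="\<lambda>x. \<bar>k0 x\<bar>"])
      show "AE x in lborel. (\<lambda>n. k0 x * box_bump n l u x) \<longlonglongrightarrow> k0 x * indicator (box l u \<inter> ?B) x"
        by (intro AE_I2 tendsto_intros box_bump_tendsto lu)
      show "AE x in lborel. norm (k0 x * box_bump n l u x) \<le> \<bar>k0 x\<bar>" for n
        using box_bump_bounds[of n l u] by (intro AE_I2) (simp add: abs_mult mult_left_le)
    qed (use ik0 in \<open>auto intro!: borel_measurable_times borel_measurable_indicator\<close>)
    then have "(\<integral>x. k0 x * indicator (box l u \<inter> ?B) x \<partial>lborel) = 0" by (simp add: zero LIMSEQ_const_iff)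
    moreover have "(\<integral>x. k0 x * indicator (box l u \<inter> ?B) x \<partial>lborel) = (\<integral>x. indicator (box l u) x * k0 x \<partial>lborel)"
      by (rule integral_cong_AE) (use eq in \<open>auto elim!: eventually_mono simp: indicator_def split: if_splits\<close>)
    ultimately show "(\<integral>x. indicator (box l u) x * k0 x \<partial>lborel) = 0" by simp
  qed
  then show ?thesis using eq by (subst AE_lebesgue_on_iff) (auto elim!: eventually_elim2 simp: indicator_def)
qed

text \<open>Needed to exchange the chosen \<open>weak_gradient\<close> of a test function for its
  classical gradient. Each component of the difference is integrable, the ball having finite
  measure, and orthogonal to all test functions.\<close>

lemma weak_gradient_unique:
  fixes f :: "'a::euclidean_space \<Rightarrow> real"
  assumes g1: "is_weak_gradient (ball 0 1) f g1" and g2: "is_weak_gradient (ball 0 1) f g2"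
  shows "AE x in lebesgue_on (ball 0 1). g1 x = g2 x"
proof -
  let ?M = "lebesgue_on (ball (0::'a) 1)"
  have i: "integrable ?M g1" "integrable ?M g2" using g1 g2 by (auto simp: is_weak_gradient_def intro: L2_on_integrable)
  have "AE x in ?M. (g1 x - g2 x) \<bullet> b = 0" if b: "b \<in> Basis" for b
  proof (rule fundamental_lemma_ball)
    show "integrable ?M (\<lambda>x. (g1 x - g2 x) \<bullet> b)" using i by auto
    fix \<phi> :: "'a \<Rightarrow> real" assume \<phi>: "test_function (ball 0 1) \<phi>"
    have c: "continuous_on UNIV \<phi>" by (rule test_function_cont[OF \<phi>])
    have [measurable]: "\<phi> \<in> borel_measurable ?M"
      by (intro measurable_restrict_space1 measurable_completion) (simp add: borel_measurable_continuous_onI c)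
    obtain C where C: "\<And>x. \<bar>\<phi> x\<bar> \<le> C"
    proof -
      obtain C where C: "\<And>x. x \<in> cball 0 1 \<Longrightarrow> \<bar>\<phi> x\<bar> \<le> C"
        using continuous_on_bounded_cball[OF c] by blast
      have "\<bar>\<phi> x\<bar> \<le> max 0 C" for x
        using C[of x] test_function_outside(1)[OF \<phi>, of x] by (cases "x \<in> ball 0 1") auto
      then show ?thesis by (rule that)
    qed
    have ii: "integrable ?M (\<lambda>x. (g x \<bullet> b) * \<phi> x)" if "integrable ?M g" for g :: "'a \<Rightarrow> 'a"
    proof (rule Bochner_Integration.integrable_bound[where f="\<lambda>x. C * norm (g x)"])
      have [measurable]: "g \<in> borel_measurable ?M" using that by simp
      show "(\<lambda>x. (g x \<bullet> b) * \<phi> x) \<in> borel_measurable ?M" by simp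
      have "\<bar>g x \<bullet> b\<bar> * \<bar>\<phi> x\<bar> \<le> norm (g x) * C" for x
        using Basis_le_norm[OF b, of "g x"] C[of x] by (intro mult_mono) auto
      moreover have "0 \<le> C" using C[of 0] by simp
      ultimately show "AE x in ?M. norm ((g x \<bullet> b) * \<phi> x) \<le> norm (C * norm (g x))"
        by (intro AE_I2) (simp add: abs_mult mult.commute)
    qed (use that in auto)
    have "(\<integral>x. f x * partial_derivative b \<phi> x \<partial>?M) = - (\<integral>x. (g1 x \<bullet> b) * \<phi> x \<partial>?M)"
      "(\<integral>x. f x * partial_derivative b \<phi> x \<partial>?M) = - (\<integral>x. (g2 x \<bullet> b) * \<phi> x \<partial>?M)"
      using g1 g2 \<phi> b unfolding is_weak_gradient_def by blast+
    then have "(\<integral>x. (g1 x \<bullet> b) * \<phi> x \<partial>?M) = (\<integral>x. (g2 x \<bullet> b) * \<phi> x \<partial>?M)" by simp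
    then show "(\<integral>x. ((g1 x - g2 x) \<bullet> b) * \<phi> x \<partial>?M) = 0"
      using ii[OF i(1)] ii[OF i(2)] by (simp add: inner_diff_left left_diff_distrib)
  qed
  then have "AE x in ?M. \<forall>b\<in>Basis. (g1 x - g2 x) \<bullet> b = 0"
    by (intro AE_finite_allI) auto
  then show ?thesis by eventually_elim (auto simp: euclidean_eq_iff[of "g1 _"] inner_diff_left)
qed

section \<open>Polar coordinates\<close>

lemma nn_integral_scaleR:
  fixes g :: "'a::euclidean_space \<Rightarrow> ennreal"
  assumes [measurable]: "g \<in> borel_measurable borel" and c: "0 < c"
  shows "(\<integral>\<^sup>+x. g x \<partial>lborel) = ennreal (c ^ DIM('a)) * (\<integral>\<^sup>+x. g (c *\<^sub>R x) \<partial>lborel)"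
proof -
  let ?D = "distr lborel borel (\<lambda>x::'a. 0 + c *\<^sub>R x)"
  have eq: "lborel = density ?D (\<lambda>_. ennreal (\<bar>c\<bar> ^ DIM('a)))"
    by (rule lborel_affine) (use c in auto)
  have "nn_integral lborel g = nn_integral (density ?D (\<lambda>_. ennreal (\<bar>c\<bar> ^ DIM('a)))) g"
    by (subst eq[symmetric]) (rule refl)
  also have "\<dots> = (\<integral>\<^sup>+x. ennreal (\<bar>c\<bar> ^ DIM('a)) * g x \<partial>?D)" by (rule nn_integral_density) auto
  also have "\<dots> = (\<integral>\<^sup>+x. ennreal (\<bar>c\<bar> ^ DIM('a)) * g (0 + c *\<^sub>R x) \<partial>lborel)" by (rule nn_integral_distr) auto
  also have "\<dots> = ennreal (\<bar>c\<bar> ^ DIM('a)) * (\<integral>\<^sup>+x. g (0 + c *\<^sub>R x) \<partial>lborel)"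
    by (rule nn_integral_cmult) measurable
  also have "\<dots> = ennreal (c ^ DIM('a)) * (\<integral>\<^sup>+x. g (c *\<^sub>R x) \<partial>lborel)"
    using c by (simp only: add_0_left abs_of_pos)
  finally show ?thesis .
qed

lemma nn_integral_power_tail:
  assumes "0 < (a::real)" "0 < n"
  shows "(\<integral>\<^sup>+\<tau>. ennreal (real n / \<tau> ^ (n + 1)) * indicator {a..} \<tau> \<partial>lborel) = ennreal (1 / a ^ n)"
proof -
  have "(\<integral>\<^sup>+\<tau>. ennreal (real n / \<tau> ^ (n + 1)) * indicator {a..} \<tau> \<partial>lborel) = ennreal (0 - (- (1 / a ^ n)))"
  proof (rule nn_integral_FTC_atLeast)
    show "((\<lambda>x. - (1 / x ^ n)) has_real_derivative real n / x ^ (n + 1)) (at x)" if "a \<le> x" for x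
    proof -
      obtain m where m: "n = Suc m" using assms(2) by (cases n) auto
      have x: "x \<noteq> 0" using that assms by auto
      have "((\<lambda>x. - (1 / x ^ n)) has_real_derivative - ((0 * x ^ n - 1 * (real n * x ^ (n - 1))) / (x ^ n * x ^ n))) (at x)"
        using x by (intro DERIV_minus DERIV_divide DERIV_const) (auto intro!: derivative_eq_intros)
      moreover have "- ((0 * x ^ n - 1 * (real n * x ^ (n - 1))) / (x ^ n * x ^ n)) = real n / x ^ (n + 1)"
        using x unfolding m by simp
      ultimately show ?thesis by simp
    qed
    have "filterlim (\<lambda>x::real. x ^ n) at_infinity at_top"
      using assms by (intro filterlim_at_top_imp_at_infinity filterlim_pow_at_top filterlim_ident)
    then have "((\<lambda>x::real. 1 / x ^ n) \<longlongrightarrow> 0) at_top" by (intro tendsto_divide_0[OF tendsto_const])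
    from tendsto_minus[OF this] show "((\<lambda>x::real. - (1 / x ^ n)) \<longlongrightarrow> 0) at_top" by simp
  qed (use assms in auto)
  then show ?thesis by simp
qed

lemma AE_lborel_neq_0: "AE x::'a::euclidean_space in lborel. x \<noteq> 0"
  by (rule AE_lborel_singleton)

text \<open>Directions are sampled by \<open>sgn y\<close> with \<open>y\<close> uniform in the unit ball, which replaces the surface
  measure of the sphere. Substituting \<open>r = norm y * \<tau>\<close> and applying Tonelli with the dilation \<open>y \<mapsto> \<tau> y\<close>
  reduces the formula to \<open>\<integral>\<tau>\<ge>norm x. n / \<tau>\<^sup>n\<^sup>+\<^sup>1 = 1 / norm x\<^sup>n\<close>.\<close>

theorem nn_integral_polar:
  fixes f :: "'a::euclidean_space \<Rightarrow> ennreal"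
  assumes [measurable]: "f \<in> borel_measurable borel"
  defines "n \<equiv> DIM('a)"
  shows "(\<integral>\<^sup>+x. f x \<partial>lborel) = (\<integral>\<^sup>+y. indicator (ball 0 1) y *
    (\<integral>\<^sup>+r. indicator {0<..} r * ennreal (real n * r ^ (n - 1)) * f (r *\<^sub>R sgn y) \<partial>lborel) \<partial>lborel)"
proof -
  let ?B = "ball (0::'a) 1"
  have [measurable]: "?B \<in> sets borel" by simp
  have n: "0 < n" by (simp add: n_def)
  have pw: "z ^ n = z * z ^ (n - 1)" for z :: real using n by (cases n) auto
  have step: "(\<integral>\<^sup>+r. indicator {0<..} r * ennreal (real n * r ^ (n - 1)) * f (r *\<^sub>R sgn y) \<partial>lborel)
    = (\<integral>\<^sup>+\<tau>. indicator {0<..} \<tau> * ennreal (real n * \<tau> ^ (n - 1) * norm y ^ n) * f (\<tau> *\<^sub>R y) \<partial>lborel)" if "y \<noteq> 0" for y :: 'a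
  proof -
    have y: "0 < norm y" using that by simp
    have "(\<integral>\<^sup>+r. indicator {0<..} r * ennreal (real n * r ^ (n - 1)) * f (r *\<^sub>R sgn y) \<partial>lborel)
      = \<bar>norm y\<bar> * (\<integral>\<^sup>+\<tau>. indicator {0<..} (0 + norm y * \<tau>) * ennreal (real n * (0 + norm y * \<tau>) ^ (n - 1)) * f ((0 + norm y * \<tau>) *\<^sub>R sgn y) \<partial>lborel)"
      by (rule nn_integral_real_affine) (use y in auto)
    also have "\<dots> = (\<integral>\<^sup>+\<tau>. ennreal (norm y) * (indicator {0<..} (0 + norm y * \<tau>) * ennreal (real n * (0 + norm y * \<tau>) ^ (n - 1)) * f ((0 + norm y * \<tau>) *\<^sub>R sgn y)) \<partial>lborel)"
      by (subst nn_integral_cmult) auto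
    also have "\<dots> = (\<integral>\<^sup>+\<tau>. indicator {0<..} \<tau> * ennreal (real n * \<tau> ^ (n - 1) * norm y ^ n) * f (\<tau> *\<^sub>R y) \<partial>lborel)"
    proof (rule nn_integral_cong)
      fix \<tau> :: real
      have e: "(0 + norm y * \<tau>) *\<^sub>R sgn y = \<tau> *\<^sub>R y" using y by (simp add: sgn_div_norm)
      have i: "indicator {0<..} (0 + norm y * \<tau>) = (indicator {0<..} \<tau> :: ennreal)"
        using y by (simp add: indicator_def zero_less_mult_iff)
      have "ennreal (norm y) * ennreal (real n * (0 + norm y * \<tau>) ^ (n - 1)) = ennreal (real n * \<tau> ^ (n - 1) * norm y ^ n)" if "0 < \<tau>"
      proof -
        have "norm y * (real n * (0 + norm y * \<tau>) ^ (n - 1)) = real n * \<tau> ^ (n - 1) * norm y ^ n"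
          by (simp only: add_0_left power_mult_distrib pw mult_ac)
        then show ?thesis using that by (subst ennreal_mult[symmetric]) simp_all
      qed
      then show "ennreal (norm y) * (indicator {0<..} (0 + norm y * \<tau>) * ennreal (real n * (0 + norm y * \<tau>) ^ (n - 1)) * f ((0 + norm y * \<tau>) *\<^sub>R sgn y))
        = indicator {0<..} \<tau> * ennreal (real n * \<tau> ^ (n - 1) * norm y ^ n) * f (\<tau> *\<^sub>R y)"
        unfolding e i by (cases "0 < \<tau>") (simp_all flip: mult.assoc)
    qed
    finally show ?thesis .
  qed
  have "(\<integral>\<^sup>+y. indicator ?B y * (\<integral>\<^sup>+r. indicator {0<..} r * ennreal (real n * r ^ (n - 1)) * f (r *\<^sub>R sgn y) \<partial>lborel) \<partial>lborel)
    = (\<integral>\<^sup>+y. indicator ?B y * (\<integral>\<^sup>+\<tau>. indicator {0<..} \<tau> * ennreal (real n * \<tau> ^ (n - 1) * norm y ^ n) * f (\<tau> *\<^sub>R y) \<partial>lborel) \<partial>lborel)"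
    by (rule nn_integral_cong_AE, rule eventually_mono[OF AE_lborel_neq_0]) (simp only: step not_False_eq_True)
  also have "\<dots> = (\<integral>\<^sup>+y. (\<integral>\<^sup>+\<tau>. indicator ?B y * (indicator {0<..} \<tau> * ennreal (real n * \<tau> ^ (n - 1) * norm y ^ n) * f (\<tau> *\<^sub>R y)) \<partial>lborel) \<partial>lborel)"
    by (intro nn_integral_cong nn_integral_cmult[symmetric]) measurable
  also have "\<dots> = (\<integral>\<^sup>+\<tau>. (\<integral>\<^sup>+y. indicator ?B y * (indicator {0<..} \<tau> * ennreal (real n * \<tau> ^ (n - 1) * norm y ^ n) * f (\<tau> *\<^sub>R y)) \<partial>lborel) \<partial>lborel)"
    by (rule lborel_pair.Fubini') measurable
  also have "\<dots> = (\<integral>\<^sup>+\<tau>. (\<integral>\<^sup>+x. indicator {0<..} \<tau> * (indicator {x. norm x < \<tau>} x * (ennreal (real n / \<tau> ^ (n + 1)) * (ennreal (norm x ^ n) * f x))) \<partial>lborel) \<partial>lborel)"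
  proof (rule nn_integral_cong)
    fix \<tau> :: real
    show "(\<integral>\<^sup>+y. indicator ?B y * (indicator {0<..} \<tau> * ennreal (real n * \<tau> ^ (n - 1) * norm y ^ n) * f (\<tau> *\<^sub>R y)) \<partial>lborel)
      = (\<integral>\<^sup>+x. indicator {0<..} \<tau> * (indicator {x. norm x < \<tau>} x * (ennreal (real n / \<tau> ^ (n + 1)) * (ennreal (norm x ^ n) * f x))) \<partial>lborel)"
    proof (cases "0 < \<tau>")
      case True
      have "(\<integral>\<^sup>+x. indicator {0<..} \<tau> * (indicator {x. norm x < \<tau>} x * (ennreal (real n / \<tau> ^ (n + 1)) * (ennreal (norm x ^ n) * f x))) \<partial>lborel)
        = ennreal (\<tau> ^ n) * (\<integral>\<^sup>+y. indicator {0<..} \<tau> * (indicator {x. norm x < \<tau>} (\<tau> *\<^sub>R y) * (ennreal (real n / \<tau> ^ (n + 1)) * (ennreal (norm (\<tau> *\<^sub>R y) ^ n) * f (\<tau> *\<^sub>R y)))) \<partial>lborel)"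
        unfolding n_def by (rule nn_integral_scaleR[OF _ True]) measurable
      also have "\<dots> = (\<integral>\<^sup>+y. ennreal (\<tau> ^ n) * (indicator {0<..} \<tau> * (indicator {x. norm x < \<tau>} (\<tau> *\<^sub>R y) * (ennreal (real n / \<tau> ^ (n + 1)) * (ennreal (norm (\<tau> *\<^sub>R y) ^ n) * f (\<tau> *\<^sub>R y))))) \<partial>lborel)"
        by (rule nn_integral_cmult[symmetric]) measurable
      also have "\<dots> = (\<integral>\<^sup>+y. indicator ?B y * (indicator {0<..} \<tau> * ennreal (real n * \<tau> ^ (n - 1) * norm y ^ n) * f (\<tau> *\<^sub>R y)) \<partial>lborel)"
      proof (rule nn_integral_cong)
        fix y :: 'a
        have "indicator {x. norm x < \<tau>} (\<tau> *\<^sub>R y) = (indicator ?B y :: ennreal)"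
          using True by (simp add: indicator_def)
        moreover have "ennreal (\<tau> ^ n) * (ennreal (real n / \<tau> ^ (n + 1)) * ennreal (norm (\<tau> *\<^sub>R y) ^ n)) = ennreal (real n * \<tau> ^ (n - 1) * norm y ^ n)"
        proof -
          have "\<tau> ^ n * (real n / \<tau> ^ (n + 1) * norm (\<tau> *\<^sub>R y) ^ n) = real n * \<tau> ^ (n - 1) * norm y ^ n"
          proof -
            have "\<tau> ^ n * (real n / \<tau> ^ (n + 1) * norm (\<tau> *\<^sub>R y) ^ n) = real n * (\<tau> ^ n * \<tau> ^ n / \<tau> ^ (n + 1)) * norm y ^ n"
              using True by (simp add: power_mult_distrib)
            also have "\<tau> ^ n * \<tau> ^ n / \<tau> ^ (n + 1) = \<tau> ^ (n - 1)" using True by (simp add: pw)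
            finally show ?thesis .
          qed
          then show ?thesis using True by (simp flip: ennreal_mult)
        qed
        ultimately show "ennreal (\<tau> ^ n) * (indicator {0<..} \<tau> * (indicator {x. norm x < \<tau>} (\<tau> *\<^sub>R y) * (ennreal (real n / \<tau> ^ (n + 1)) * (ennreal (norm (\<tau> *\<^sub>R y) ^ n) * f (\<tau> *\<^sub>R y)))))
          = indicator ?B y * (indicator {0<..} \<tau> * ennreal (real n * \<tau> ^ (n - 1) * norm y ^ n) * f (\<tau> *\<^sub>R y))"
        proof -
          have "a * (i * (j * (b * (c * F)))) = j * (i * (a * (b * c)) * F)" for a b c i j F :: ennreal
            by (simp only: mult_ac)
          then show ?thesis
            using \<open>indicator {x. norm x < \<tau>} (\<tau> *\<^sub>R y) = (indicator ?B y :: ennreal)\<close>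
              \<open>ennreal (\<tau> ^ n) * (ennreal (real n / \<tau> ^ (n + 1)) * ennreal (norm (\<tau> *\<^sub>R y) ^ n)) = ennreal (real n * \<tau> ^ (n - 1) * norm y ^ n)\<close>
            by (simp only:)
        qed
      qed
      finally show ?thesis by simp
    qed simp
  qed
  also have "\<dots> = (\<integral>\<^sup>+x. (\<integral>\<^sup>+\<tau>. indicator {0<..} \<tau> * (indicator {x. norm x < \<tau>} x * (ennreal (real n / \<tau> ^ (n + 1)) * (ennreal (norm x ^ n) * f x))) \<partial>lborel) \<partial>lborel)"
  proof (rule lborel_pair.Fubini'[symmetric])
    have [measurable]: "{z \<in> space (lborel \<Otimes>\<^sub>M lborel). norm (snd z :: 'a) < fst z} \<in> sets (lborel \<Otimes>\<^sub>M lborel)" by measurable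
    have "(\<lambda>z. indicator {x. norm x < fst z} (snd z) :: ennreal) = indicator {z::real \<times> 'a. norm (snd z) < fst z}"
      by (auto simp: indicator_def)
    moreover have "indicator {z::real \<times> 'a. norm (snd z) < fst z} \<in> borel_measurable (lborel \<Otimes>\<^sub>M lborel)"
      by (intro borel_measurable_indicator) (use \<open>{z \<in> space (lborel \<Otimes>\<^sub>M lborel). norm (snd z) < fst z} \<in> sets (lborel \<Otimes>\<^sub>M lborel)\<close> in \<open>simp add: space_pair_measure\<close>)
    ultimately have [measurable]: "(\<lambda>z. indicator {x. norm x < fst z} (snd z :: 'a) :: ennreal) \<in> borel_measurable (lborel \<Otimes>\<^sub>M lborel)"
      by simp
    show "(\<lambda>(\<tau>, x). indicator {0<..} \<tau> * (indicator {x. norm x < \<tau>} x * (ennreal (real n / \<tau> ^ (n + 1)) * (ennreal (norm x ^ n) * f x)))) \<in> borel_measurable (lborel \<Otimes>\<^sub>M lborel)"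
      unfolding split_beta by measurable
  qed
  also have "\<dots> = (\<integral>\<^sup>+x. f x \<partial>lborel)"
  proof (rule nn_integral_cong_AE)
    show "AE x in lborel. (\<integral>\<^sup>+\<tau>. indicator {0<..} \<tau> * (indicator {x. norm x < \<tau>} x * (ennreal (real n / \<tau> ^ (n + 1)) * (ennreal (norm x ^ n) * f x))) \<partial>lborel) = f x"
      using AE_lborel_neq_0
    proof eventually_elim
      fix x :: 'a assume "x \<noteq> 0"
      then have x: "0 < norm x" by simp
      have "(\<integral>\<^sup>+\<tau>. indicator {0<..} \<tau> * (indicator {x. norm x < \<tau>} x * (ennreal (real n / \<tau> ^ (n + 1)) * (ennreal (norm x ^ n) * f x))) \<partial>lborel)
        = (\<integral>\<^sup>+\<tau>. (ennreal (real n / \<tau> ^ (n + 1)) * indicator {norm x..} \<tau>) * (ennreal (norm x ^ n) * f x) \<partial>lborel)"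
      proof (rule nn_integral_cong_AE)
        show "AE \<tau> in lborel. indicator {0<..} \<tau> * (indicator {x. norm x < \<tau>} x * (ennreal (real n / \<tau> ^ (n + 1)) * (ennreal (norm x ^ n) * f x)))
          = (ennreal (real n / \<tau> ^ (n + 1)) * indicator {norm x..} \<tau>) * (ennreal (norm x ^ n) * f x)"
          using AE_lborel_singleton[of "norm x"]
        proof eventually_elim
          fix \<tau> :: real assume \<tau>: "\<tau> \<noteq> norm x"
          show "indicator {0<..} \<tau> * (indicator {x. norm x < \<tau>} x * (ennreal (real n / \<tau> ^ (n + 1)) * (ennreal (norm x ^ n) * f x)))
          = (ennreal (real n / \<tau> ^ (n + 1)) * indicator {norm x..} \<tau>) * (ennreal (norm x ^ n) * f x)"
          proof (cases "norm x < \<tau>")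
            case True
            then have "0 < \<tau>" using x by linarith
            then show ?thesis using True by (simp add: mult.assoc)
          qed (use \<tau> in simp)
        qed
      qed
      also have "\<dots> = ennreal (1 / norm x ^ n) * (ennreal (norm x ^ n) * f x)"
        by (subst nn_integral_multc) (use nn_integral_power_tail[OF x n] in auto)
      also have "\<dots> = ennreal (1 / norm x ^ n * norm x ^ n) * f x"
      proof -
        have "ennreal (1 / norm x ^ n * norm x ^ n) = ennreal (1 / norm x ^ n) * ennreal (norm x ^ n)"
          by (rule ennreal_mult) auto
        then show ?thesis by (simp only: mult.assoc)
      qed
      also have "\<dots> = f x" using x by simp
      finally show "(\<integral>\<^sup>+\<tau>. indicator {0<..} \<tau> * (indicator {x. norm x < \<tau>} x * (ennreal (real n / \<tau> ^ (n + 1)) * (ennreal (norm x ^ n) * f x))) \<partial>lborel) = f x" .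
    qed
  qed
  finally show ?thesis by simp
qed

text \<open>Polar coordinates let non-radial test functions be treated ray by ray, so that no
  expansion in spherical harmonics is needed.\<close>

lemma nn_integral_ray_mono:
  fixes A B :: "'a::euclidean_space \<Rightarrow> ennreal"
  assumes [measurable]: "A \<in> borel_measurable borel" "B \<in> borel_measurable borel"
    and le: "\<And>y. norm y = 1 \<Longrightarrow> (\<integral>\<^sup>+r. indicator {0<..} r * ennreal (r ^ (DIM('a) - 1)) * A (r *\<^sub>R y) \<partial>lborel)
      \<le> (\<integral>\<^sup>+r. indicator {0<..} r * ennreal (r ^ (DIM('a) - 1)) * B (r *\<^sub>R y) \<partial>lborel)"
  shows "nn_integral lborel A \<le> nn_integral lborel B"
proof -
  have *: "(\<integral>\<^sup>+r. indicator {0<..} r * ennreal (real DIM('a) * r ^ (DIM('a) - 1)) * C (r *\<^sub>R y) \<partial>lborel)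
     = ennreal (real DIM('a)) * (\<integral>\<^sup>+r. indicator {0<..} r * ennreal (r ^ (DIM('a) - 1)) * C (r *\<^sub>R y) \<partial>lborel)"
    if [measurable]: "C \<in> borel_measurable borel" for C :: "'a \<Rightarrow> ennreal" and y :: 'a
    by (subst nn_integral_cmult[symmetric])
       (auto intro!: nn_integral_cong simp: indicator_def ennreal_mult mult.assoc)
  show ?thesis
    unfolding nn_integral_polar[OF assms(1)] nn_integral_polar[OF assms(2)]
    unfolding *[OF assms(1)] *[OF assms(2)]
  proof (rule nn_integral_mono_AE)
    show "AE y::'a in lborel. indicator (ball 0 1) y * (ennreal (real DIM('a)) * (\<integral>\<^sup>+r. indicator {0<..} r * ennreal (r ^ (DIM('a) - 1)) * A (r *\<^sub>R sgn y) \<partial>lborel))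
      \<le> indicator (ball 0 1) y * (ennreal (real DIM('a)) * (\<integral>\<^sup>+r. indicator {0<..} r * ennreal (r ^ (DIM('a) - 1)) * B (r *\<^sub>R sgn y) \<partial>lborel))"
      using AE_lborel_neq_0
    proof eventually_elim
      fix y :: 'a assume "y \<noteq> 0"
      then show "indicator (ball 0 1) y * (ennreal (real DIM('a)) * (\<integral>\<^sup>+r. indicator {0<..} r * ennreal (r ^ (DIM('a) - 1)) * A (r *\<^sub>R sgn y) \<partial>lborel))
      \<le> indicator (ball 0 1) y * (ennreal (real DIM('a)) * (\<integral>\<^sup>+r. indicator {0<..} r * ennreal (r ^ (DIM('a) - 1)) * B (r *\<^sub>R sgn y) \<partial>lborel))"
        by (intro mult_left_mono le) (simp_all add: norm_sgn)
    qed
  qed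
qed

definition sphere_area :: "'a::euclidean_space itself \<Rightarrow> real" where
  "sphere_area _ = real DIM('a) * measure lborel (ball (0::'a) 1)"

lemma sphere_area_pos: "0 < sphere_area TYPE('a::euclidean_space)"
  using content_ball_pos[of 1 "0::'a"] by (simp add: sphere_area_def)

lemma nn_integral_radial:
  fixes g :: "real \<Rightarrow> ennreal"
  assumes [measurable]: "g \<in> borel_measurable borel"
  shows "(\<integral>\<^sup>+(x::'a::euclidean_space). g (norm x) \<partial>lborel) =
    ennreal (sphere_area TYPE('a)) * (\<integral>\<^sup>+r. indicator {0<..} r * ennreal (r ^ (DIM('a) - 1)) * g r \<partial>lborel)"
proof -
  let ?I = "\<integral>\<^sup>+r. indicator {0<..} r * ennreal (r ^ (DIM('a) - 1)) * g r \<partial>lborel"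
  have "(\<integral>\<^sup>+(x::'a). g (norm x) \<partial>lborel) = (\<integral>\<^sup>+(y::'a). indicator (ball 0 1) y *
    (\<integral>\<^sup>+r. indicator {0<..} r * ennreal (real DIM('a) * r ^ (DIM('a) - 1)) * g (norm (r *\<^sub>R sgn y)) \<partial>lborel) \<partial>lborel)"
    by (rule nn_integral_polar) measurable
  also have "\<dots> = (\<integral>\<^sup>+(y::'a). indicator (ball 0 1) y * (ennreal (real DIM('a)) * ?I) \<partial>lborel)"
  proof (rule nn_integral_cong_AE)
    show "AE y::'a in lborel. indicator (ball 0 1) y *
      (\<integral>\<^sup>+r. indicator {0<..} r * ennreal (real DIM('a) * r ^ (DIM('a) - 1)) * g (norm (r *\<^sub>R sgn y)) \<partial>lborel)
      = indicator (ball 0 1) y * (ennreal (real DIM('a)) * ?I)"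
      using AE_lborel_neq_0
    proof eventually_elim
      fix y :: 'a assume "y \<noteq> 0"
      then have "(\<integral>\<^sup>+r. indicator {0<..} r * ennreal (real DIM('a) * r ^ (DIM('a) - 1)) * g (norm (r *\<^sub>R sgn y)) \<partial>lborel)
         = ennreal (real DIM('a)) * ?I"
        by (subst nn_integral_cmult[symmetric])
           (auto intro!: nn_integral_cong simp: indicator_def ennreal_mult mult.assoc norm_sgn)
      then show "indicator (ball 0 1) y *
      (\<integral>\<^sup>+r. indicator {0<..} r * ennreal (real DIM('a) * r ^ (DIM('a) - 1)) * g (norm (r *\<^sub>R sgn y)) \<partial>lborel)
      = indicator (ball 0 1) y * (ennreal (real DIM('a)) * ?I)" by simp
    qed
  qed
  also have "\<dots> = emeasure lborel (ball (0::'a) 1) * (ennreal (real DIM('a)) * ?I)"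
    by (subst nn_integral_multc) (auto intro!: borel_measurable_indicator)
  also have "emeasure lborel (ball (0::'a) 1) = ennreal (measure lborel (ball (0::'a) 1))"
    by (rule emeasure_eq_ennreal_measure) (use emeasure_lborel_ball_finite[of "0::'a" 1] in auto)
  finally show ?thesis by (simp add: sphere_area_def ennreal_mult mult_ac)
qed

lemma AE_radial_iff:
  assumes S: "S \<in> sets borel" and null: "AE r in lborel. 0 < r \<longrightarrow> r \<notin> S"
  shows "AE x::'a::euclidean_space in lborel. norm x \<notin> S"
proof -
  have [measurable]: "S \<in> sets borel" by fact
  have "(\<integral>\<^sup>+(x::'a). indicator S (norm x) \<partial>lborel) = ennreal (sphere_area TYPE('a)) *
     (\<integral>\<^sup>+r. indicator {0<..} r * ennreal (r ^ (DIM('a) - 1)) * indicator S r \<partial>lborel)"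
    by (rule nn_integral_radial) measurable
  also have "(\<integral>\<^sup>+r. indicator {0<..} r * ennreal (r ^ (DIM('a) - 1)) * indicator S r \<partial>lborel) = (\<integral>\<^sup>+(r::real). 0 \<partial>lborel)"
    by (rule nn_integral_cong_AE) (use null in eventually_elim, auto simp: indicator_def)
  finally have "(\<integral>\<^sup>+(x::'a). indicator S (norm x) \<partial>lborel) = 0" by simp
  then have "AE x::'a in lborel. indicator S (norm x) = (0::ennreal)"
    by (subst (asm) nn_integral_0_iff_AE) auto
  then show ?thesis by eventually_elim (auto simp: indicator_def split: if_splits)
qed

text \<open>The given g need not be measurable. By polar coordinates almost every ray meets the
  exceptional null set in a null set of radii; the restriction of f to one such ray is a Borel
  profile, and a null set of radii is null in space.\<close>

lemma radial_representative:
  fixes f :: "'a::euclidean_space \<Rightarrow> real"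
  assumes f[measurable]: "f \<in> borel_measurable borel" and g: "AE x in lborel. f x = g (norm x)"
  obtains g' where "g' \<in> borel_measurable borel" "AE x::'a in lborel. f x = g' (norm x)"
proof -
  obtain Z where Z: "Z \<in> null_sets lborel" "{x \<in> space lborel. f x \<noteq> g (norm x)} \<subseteq> Z"
    using g unfolding eventually_ae_filter by auto
  then have [measurable]: "Z \<in> sets borel" by auto
  have "0 = (\<integral>\<^sup>+x. indicator Z x \<partial>lborel)" using Z(1) by auto
  also have "\<dots> = (\<integral>\<^sup>+(y::'a). indicator (ball 0 1) y *
    (\<integral>\<^sup>+r. indicator {0<..} r * ennreal (real DIM('a) * r ^ (DIM('a) - 1)) * indicator Z (r *\<^sub>R sgn y) \<partial>lborel) \<partial>lborel)"
    by (rule nn_integral_polar) measurable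
  finally have "AE y::'a in lborel. indicator (ball 0 1) y *
    (\<integral>\<^sup>+r. indicator {0<..} r * ennreal (real DIM('a) * r ^ (DIM('a) - 1)) * indicator Z (r *\<^sub>R sgn y) \<partial>lborel) = 0"
  proof (subst (asm) eq_commute, subst (asm) nn_integral_0_iff_AE)
    show "(\<lambda>y::'a. indicator (ball 0 1) y *
      (\<integral>\<^sup>+r. indicator {0<..} r * ennreal (real DIM('a) * r ^ (DIM('a) - 1)) * indicator Z (r *\<^sub>R sgn y) \<partial>lborel)) \<in> borel_measurable lborel"
    proof (intro borel_measurable_times_ennreal lborel.borel_measurable_nn_integral)
      show "(\<lambda>(y::'a, r). indicator {0<..} r * ennreal (real DIM('a) * r ^ (DIM('a) - 1)) * indicator Z (r *\<^sub>R sgn y)) \<in> borel_measurable (lborel \<Otimes>\<^sub>M lborel)"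
        unfolding split_beta by measurable
    qed (auto intro!: borel_measurable_indicator)
  qed
  then have ae: "AE y::'a in lborel. y \<noteq> 0 \<and> (y \<in> ball 0 1 \<longrightarrow>
    (\<integral>\<^sup>+r. indicator {0<..} r * ennreal (real DIM('a) * r ^ (DIM('a) - 1)) * indicator Z (r *\<^sub>R sgn y) \<partial>lborel) = 0)"
    using AE_lborel_neq_0 by eventually_elim (auto simp: indicator_def)
  have "\<exists>y. y \<in> ball (0::'a) 1 \<and> y \<noteq> 0 \<and>
    (\<integral>\<^sup>+r. indicator {0<..} r * ennreal (real DIM('a) * r ^ (DIM('a) - 1)) * indicator Z (r *\<^sub>R sgn y) \<partial>lborel) = 0"
  proof (rule ccontr)
    assume n: "\<not> ?thesis"
    from ae have "AE y::'a in lborel. y \<notin> ball 0 1" by (rule eventually_mono) (use n in blast)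
    then have "emeasure lborel (ball (0::'a) 1) = 0"
      using AE_iff_measurable[of "ball (0::'a) 1" lborel "\<lambda>y. y \<notin> ball 0 1"] by (auto simp: ball_def)
    then show False using content_ball_pos[of 1 "0::'a"] by (simp add: measure_def)
  qed
  then obtain y where y: "y \<noteq> 0"
    "(\<integral>\<^sup>+r. indicator {0<..} r * ennreal (real DIM('a) * r ^ (DIM('a) - 1)) * indicator Z (r *\<^sub>R sgn y) \<partial>lborel) = 0" by blast
  define e where "e = sgn y"
  have e: "norm e = 1" using y by (simp add: e_def norm_sgn)
  have [measurable]: "(\<lambda>r. r *\<^sub>R e) \<in> borel_measurable borel" by simp
  define S where "S = (\<lambda>r. r *\<^sub>R e) -` Z"
  have S: "S \<in> sets borel" unfolding S_def
    using measurable_sets[of "\<lambda>r. r *\<^sub>R e" borel borel Z] by simp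
  have "AE r in lborel. indicator {0<..} r * ennreal (real DIM('a) * r ^ (DIM('a) - 1)) * indicator Z (r *\<^sub>R sgn y) = 0"
    using y(2) by (subst (asm) nn_integral_0_iff_AE) measurable
  then have "AE r in lborel. 0 < r \<longrightarrow> r \<notin> S"
  proof eventually_elim
    fix r :: real assume "indicator {0<..} r * ennreal (real DIM('a) * r ^ (DIM('a) - 1)) * indicator Z (r *\<^sub>R sgn y) = 0"
    then show "0 < r \<longrightarrow> r \<notin> S" by (auto simp: indicator_def S_def e_def split: if_splits)
  qed
  from AE_radial_iff[OF S this] have nS: "AE x::'a in lborel. norm x \<notin> S" .
  have "AE x in lborel. x \<notin> Z" by (rule AE_not_in[OF Z(1)])
  then have "AE x in lborel. f x = f (norm x *\<^sub>R e)"
    using nS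
  proof eventually_elim
    fix x assume x: "x \<notin> Z" "norm x \<notin> S"
    have "f z = g (norm z)" if "z \<notin> Z" for z using Z(2) that by auto
    from this[of x] this[of "norm x *\<^sub>R e"] x show "f x = f (norm x *\<^sub>R e)" using e by (simp add: S_def)
  qed
  moreover have "(\<lambda>r. f (r *\<^sub>R e)) \<in> borel_measurable borel" by measurable
  ultimately show ?thesis by (rule that[rotated])
qed

section \<open>The quadratic form at the singular solution\<close>

lemma distr_norm:
  "distr (lborel :: 'a::euclidean_space measure) borel norm =
    density lborel (\<lambda>r. ennreal (indicator {0<..} r * (sphere_area TYPE('a) * r ^ (DIM('a) - 1))))"
proof (rule measure_eqI)
  fix S assume "S \<in> sets (distr (lborel :: 'a measure) borel norm)"
  then have [measurable]: "S \<in> sets borel" by simp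
  have "emeasure (distr (lborel :: 'a measure) borel norm) S = emeasure lborel (norm -` S :: 'a set)"
    by (subst emeasure_distr) auto
  also have "\<dots> = (\<integral>\<^sup>+(x::'a). indicator (norm -` S) x \<partial>lborel)"
    by (rule nn_integral_indicator[symmetric]) (use measurable_sets[of norm "borel :: 'a measure" borel S] in simp)
  also have "\<dots> = (\<integral>\<^sup>+(x::'a). indicator S (norm x) \<partial>lborel)"
    by (intro nn_integral_cong) (simp add: indicator_def)
  also have "\<dots> = ennreal (sphere_area TYPE('a)) * (\<integral>\<^sup>+r. indicator {0<..} r * ennreal (r ^ (DIM('a) - 1)) * indicator S r \<partial>lborel)"
    by (rule nn_integral_radial) measurable
  also have "\<dots> = (\<integral>\<^sup>+r. ennreal (sphere_area TYPE('a)) * (indicator {0<..} r * ennreal (r ^ (DIM('a) - 1)) * indicator S r) \<partial>lborel)"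
    by (rule nn_integral_cmult[symmetric]) measurable
  also have "\<dots> = (\<integral>\<^sup>+r. ennreal (indicator {0<..} r * (sphere_area TYPE('a) * r ^ (DIM('a) - 1))) * indicator S r \<partial>lborel)"
    using sphere_area_pos[where 'a='a] by (intro nn_integral_cong) (simp add: indicator_def ennreal_mult)
  also have "\<dots> = emeasure (density lborel (\<lambda>r. ennreal (indicator {0<..} r * (sphere_area TYPE('a) * r ^ (DIM('a) - 1))))) S"
    by (rule emeasure_density[symmetric]) measurable
  finally show "emeasure (distr (lborel :: 'a measure) borel norm) S =
    emeasure (density lborel (\<lambda>r. ennreal (indicator {0<..} r * (sphere_area TYPE('a) * r ^ (DIM('a) - 1))))) S" .
qed simp

lemma radial_integral:
  fixes g :: "real \<Rightarrow> real"
  assumes [measurable]: "g \<in> borel_measurable borel"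
  shows "integrable lborel (\<lambda>x::'a::euclidean_space. g (norm x)) \<longleftrightarrow>
      integrable lborel (\<lambda>r. indicator {0<..} r * (r ^ (DIM('a) - 1) * g r))" (is ?int)
    and "(\<integral>(x::'a). g (norm x) \<partial>lborel) = sphere_area TYPE('a) * (\<integral>r. indicator {0<..} r * (r ^ (DIM('a) - 1) * g r) \<partial>lborel)" (is ?eq)
proof -
  let ?s = "sphere_area TYPE('a)"
  let ?w = "\<lambda>r. indicator {0<..} r * (?s * r ^ (DIM('a) - 1))"
  have s: "0 < ?s" by (rule sphere_area_pos)
  have w: "AE r in lborel. 0 \<le> ?w r" using s by (intro AE_I2) (auto simp: indicator_def)
  have e: "?w r *\<^sub>R g r = ?s * (indicator {0<..} r * (r ^ (DIM('a) - 1) * g r))" for r by simp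
  have "integrable lborel (\<lambda>x::'a. g (norm x)) \<longleftrightarrow> integrable (distr (lborel :: 'a measure) borel norm) g"
    by (rule integrable_distr_eq[symmetric]) auto
  also have "\<dots> \<longleftrightarrow> integrable lborel (\<lambda>r. ?w r *\<^sub>R g r)"
    unfolding distr_norm by (rule integrable_density[OF _ _ w]) measurable
  finally show ?int unfolding e using s by simp
  have "(\<integral>(x::'a). g (norm x) \<partial>lborel) = integral\<^sup>L (distr (lborel :: 'a measure) borel norm) g"
    by (rule integral_distr[symmetric]) auto
  also have "\<dots> = (\<integral>r. ?w r *\<^sub>R g r \<partial>lborel)"
    unfolding distr_norm by (rule integral_density[OF _ _ w]) measurable
  finally show ?eq unfolding e by simp
qed

lemma weak_gradient_is_weak_gradient:
  assumes "f \<in> H1 \<Omega>" shows "is_weak_gradient \<Omega> f (weak_gradient \<Omega> f)"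
  using assms someI_ex[of "is_weak_gradient \<Omega> f"] by (auto simp: H1_def weak_gradient_def)

lemma test_function_weak_gradient_AE:
  fixes f :: "'a::euclidean_space \<Rightarrow> real"
  assumes t: "test_function (ball 0 1) f"
  shows "f \<in> H1 (ball 0 1)" "AE x in lebesgue_on (ball 0 1). weak_gradient (ball 0 1) f x = gradient f x"
proof -
  have w: "is_weak_gradient (ball 0 1) f (gradient f)" by (rule test_function_weak_gradient[OF t open_ball])
  then show H: "f \<in> H1 (ball 0 1)" by (auto simp: H1_def)
  show "AE x in lebesgue_on (ball 0 1). weak_gradient (ball 0 1) f x = gradient f x"
    by (rule weak_gradient_unique[OF weak_gradient_is_weak_gradient[OF H] w])
qed

lemma test_function_H10:
  fixes f :: "'a::euclidean_space \<Rightarrow> real"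
  assumes t: "test_function (ball 0 1) f"
  shows "f \<in> H10 (ball 0 1)"
proof -
  let ?M = "lebesgue_on (ball (0::'a) 1)" and ?W = "weak_gradient (ball 0 1) f"
  have "AE x in ?M. (norm (gradient f x - ?W x))\<^sup>2 = 0"
    using test_function_weak_gradient_AE(2)[OF t] by eventually_elim simp
  then have "(\<integral>x. (norm (gradient f x - ?W x))\<^sup>2 \<partial>?M) = 0" by (rule integral_eq_zero_AE)
  then show ?thesis
    unfolding H10_def using test_function_weak_gradient_AE(1)[OF t] t by (auto intro!: exI[of _ "\<lambda>_. f"])
qed

lemma test_function_gradient_integral:
  fixes f :: "'a::euclidean_space \<Rightarrow> real"
  assumes t: "test_function (ball 0 1) f"
  shows "(\<integral>x. (norm (weak_gradient (ball 0 1) f x))\<^sup>2 \<partial>lebesgue_on (ball 0 1)) = (\<integral>x. (norm (gradient f x))\<^sup>2 \<partial>lborel)"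
proof -
  let ?M = "lebesgue_on (ball (0::'a) 1)" and ?W = "weak_gradient (ball 0 1) f"
  have [measurable]: "?W \<in> borel_measurable ?M"
    using weak_gradient_is_weak_gradient[OF test_function_weak_gradient_AE(1)[OF t]]
    by (simp add: is_weak_gradient_def L2_on_def)
  have b: "gradient f \<in> borel_measurable borel"
    using test_function_cont(3)[OF t] by (rule borel_measurable_continuous_onI)
  have [measurable]: "gradient f \<in> borel_measurable ?M"
    using test_function_weak_gradient[OF t open_ball] by (simp add: is_weak_gradient_def L2_on_def)
  have "(\<integral>x. (norm (?W x))\<^sup>2 \<partial>?M) = (\<integral>x. (norm (gradient f x))\<^sup>2 \<partial>?M)"
  proof (rule integral_cong_AE)
    show "AE x in ?M. (norm (?W x))\<^sup>2 = (norm (gradient f x))\<^sup>2"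
      using test_function_weak_gradient_AE(2)[OF t] by eventually_elim simp
  qed measurable
  also have "\<dots> = (\<integral>x. indicator (ball 0 1) x * (norm (gradient f x))\<^sup>2 \<partial>lborel)"
    by (rule integral_lebesgue_on_borel) (use b in auto)
  also have "\<dots> = (\<integral>x. (norm (gradient f x))\<^sup>2 \<partial>lborel)"
    using test_function_outside(3)[OF t] by (intro Bochner_Integration.integral_cong) (auto simp: indicator_def)
  finally show ?thesis .
qed

lemma lambda_a_exp_U:
  fixes x :: "'a::euclidean_space"
  assumes N: "DIM('a) = N" "3 \<le> N" and x: "x \<noteq> 0"
  shows "lambda_sing N h * a_coef N h (norm x) * exp (U_sing h x) = 2 * (real N - 2) / (norm x)\<^sup>2 + h"
proof -
  let ?r = "norm x"
  have r: "0 < ?r" using x by simp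
  have e: "exp (- (2 * ln ?r)) = 1 / ?r\<^sup>2" using r by (simp only: exp_minus exp_double) (simp add: inverse_eq_divide)
  have U: "U_sing h x = h / (2 * real N) + - (2 * ln ?r) + - (h / (2 * real N) * ?r\<^sup>2)"
    by (simp add: U_sing_def N(1))
  have 1: "exp (- (h / (2 * real N))) * exp (h / (2 * real N)) = 1" "exp (h / (2 * real N) * ?r\<^sup>2) * exp (- (h / (2 * real N) * ?r\<^sup>2)) = 1"
    by (simp_all flip: exp_add)
  have "lambda_sing N h * a_coef N h ?r * exp (U_sing h x)
    = 2 * (real N - 2) * (1 + h / (2 * (real N - 2)) * ?r\<^sup>2) * (1 / ?r\<^sup>2) *
      (exp (- (h / (2 * real N))) * exp (h / (2 * real N))) * (exp (h / (2 * real N) * ?r\<^sup>2) * exp (- (h / (2 * real N) * ?r\<^sup>2)))"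
    unfolding lambda_sing_def a_coef_def U exp_add e by (simp only: mult_ac)
  also have "\<dots> = 2 * (real N - 2) * (1 + h / (2 * (real N - 2)) * ?r\<^sup>2) * (1 / ?r\<^sup>2)"
    unfolding 1 by simp
  also have "\<dots> = 2 * (real N - 2) / ?r\<^sup>2 + h"
    using r N(2) by (simp add: field_simps)
  finally show ?thesis .
qed

lemma AE_lebesgue_on_neq_0: "AE x::'a::euclidean_space in lebesgue_on (ball 0 1). x \<noteq> 0"
  using AE_lborel_neq_0 by (subst AE_lebesgue_on_iff) (auto elim: eventually_mono)

text \<open>The two integrands differ only at the origin, by a multiple of an indicator that changes
  neither measurability nor the integral; if they are not measurable, both integrals are 0 by
  convention. So \<xi> can be arbitrary.\<close>

lemma integral_potential:
  fixes \<xi> :: "'a::euclidean_space \<Rightarrow> real"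
  assumes N: "DIM('a) = N" "3 \<le> N"
  shows "(\<integral>x. lambda_sing N h * a_coef N h (norm x) * exp (U_sing h x) * (\<xi> x)\<^sup>2 \<partial>lebesgue_on (ball 0 1)) =
    (\<integral>x. (2 * (real N - 2) / (norm x)\<^sup>2 + h) * (\<xi> x)\<^sup>2 \<partial>lebesgue_on (ball 0 1))"
proof -
  let ?M = "lebesgue_on (ball (0::'a) 1)"
  \<comment> \<open>At the origin the default values ln 0 = 0 and division by 0 equal to 0 apply,
    whence the correction term.\<close>
  have "lambda_sing N h * a_coef N h (norm x) * exp (U_sing h x) * (\<xi> x)\<^sup>2 = (2 * (real N - 2) / (norm x)\<^sup>2 + h) * (\<xi> x)\<^sup>2 +
    indicator {0} x * (lambda_sing N h * a_coef N h 0 * exp (U_sing h (0::'a)) - h) * (\<xi> 0)\<^sup>2" for x :: 'a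
  proof (cases "x = 0")
    case False
    then show ?thesis by (simp only: lambda_a_exp_U[OF N False]) simp
  qed (simp add: algebra_simps)
  moreover have "(\<integral>x. f x + indicator {0} x * c \<partial>?M) = (\<integral>x. f x \<partial>?M)" for f :: "'a \<Rightarrow> real" and c
  proof (cases "f \<in> borel_measurable ?M")
    case [measurable]: True
    have [measurable]: "(indicator {0} :: 'a \<Rightarrow> real) \<in> borel_measurable ?M"
      by (intro measurable_restrict_space1 measurable_completion) (auto intro!: borel_measurable_indicator)
    show ?thesis
    proof (rule integral_cong_AE)
      show "AE x in ?M. f x + indicator {0} x * c = f x" using AE_lebesgue_on_neq_0 by eventually_elim simp
    qed measurable
  next
    case False
    have i: "(indicator {0} :: 'a \<Rightarrow> real) \<in> borel_measurable ?M"
      by (intro measurable_restrict_space1 measurable_completion) (auto intro!: borel_measurable_indicator)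
    have "(\<lambda>x. f x + indicator {0} x * c) \<notin> borel_measurable ?M"
    proof
      assume "(\<lambda>x. f x + indicator {0} x * c) \<in> borel_measurable ?M"
      then have "(\<lambda>x. (f x + indicator {0} x * c) - indicator {0} x * c) \<in> borel_measurable ?M"
        using i by (intro borel_measurable_diff borel_measurable_times) auto
      then show False using False by simp
    qed
    then show ?thesis using False
      by (metis (no_types, lifting) borel_measurable_integrable not_integrable_integral_eq)
  qed
  ultimately show ?thesis by (simp only: mult.assoc)
qed

text \<open>The extra term allows for test inequalities that hold only up to the distance from \<open>\<xi>\<close>.\<close>

lemma H10_form_nonneg:
  fixes \<xi> :: "'a::euclidean_space \<Rightarrow> real"
  assumes N: "DIM('a) = N" "3 \<le> N" and h: "- 2 * (real N - 2) < h" and hc: "h \<le> c" "0 \<le> c" and K: "0 \<le> K"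
    and \<xi>: "\<xi> \<in> H10 (ball 0 1)"
    and test: "\<And>\<phi>. test_function (ball 0 1) \<phi> \<Longrightarrow>
      (\<integral>\<^sup>+x. ennreal ((2 * (real N - 2) / (norm x)\<^sup>2 + c) * (\<phi> x)\<^sup>2) \<partial>lebesgue_on (ball 0 1)) \<le>
      (\<integral>\<^sup>+x. ennreal ((norm (gradient \<phi> x))\<^sup>2) \<partial>lebesgue_on (ball 0 1)) +
      ennreal K * (\<integral>\<^sup>+x. ennreal ((\<phi> x - \<xi> x)\<^sup>2) \<partial>lebesgue_on (ball 0 1))"
  shows "0 \<le> Q_form (lambda_sing N h) (a_coef N h) (U_sing h) \<xi>"
proof -
  let ?M = "lebesgue_on (ball (0::'a) 1)" and ?W = "weak_gradient (ball 0 1) \<xi>"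
  define P where "P x = 2 * (real N - 2) / (norm x)\<^sup>2 + c" for x :: 'a
  have P0: "0 \<le> P x" for x using N hc by (simp add: P_def)
  have H1: "\<xi> \<in> H1 (ball 0 1)" using \<xi> by (simp add: H10_def)
  have wg: "is_weak_gradient (ball 0 1) \<xi> ?W" by (rule weak_gradient_is_weak_gradient[OF H1])
  have [measurable]: "\<xi> \<in> borel_measurable ?M" "?W \<in> borel_measurable ?M"
    using wg by (auto simp: is_weak_gradient_def L2_on_def)
  have i2: "integrable ?M (\<lambda>x. (\<xi> x)\<^sup>2)" "integrable ?M (\<lambda>x. (norm (?W x))\<^sup>2)"
    using wg by (auto simp: is_weak_gradient_def L2_on_def)
  obtain \<phi> where \<phi>: "\<And>n::nat. test_function (ball 0 1) (\<phi> n)" and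
    lim: "(\<lambda>n. (\<integral>x. (\<phi> n x - \<xi> x)\<^sup>2 \<partial>?M) + (\<integral>x. (norm (gradient (\<phi> n) x - ?W x))\<^sup>2 \<partial>?M)) \<longlonglongrightarrow> 0"
    using \<xi> unfolding H10_def by blast
  have t: "L2_on (ball 0 1) (\<phi> n)" "L2_on (ball 0 1) (gradient (\<phi> n))" for n
    using test_function_weak_gradient[OF \<phi> open_ball] by (auto simp: is_weak_gradient_def)
  have [measurable]: "\<phi> n \<in> borel_measurable ?M" "gradient (\<phi> n) \<in> borel_measurable ?M" for n
    using t by (auto simp: L2_on_def)
  have it: "integrable ?M (\<lambda>x. (\<phi> n x)\<^sup>2)" "integrable ?M (\<lambda>x. (norm (gradient (\<phi> n) x))\<^sup>2)" for n
    using t[of n] by (auto simp: L2_on_def)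
  have sq: "(norm (u - v))\<^sup>2 \<le> 2 * (norm u)\<^sup>2 + 2 * (norm v)\<^sup>2" for u v :: "'b::real_inner"
    using zero_le_power2[of "norm (u + v)"] by (simp add: power2_norm_eq_inner inner_simps inner_commute)
  have id1: "integrable ?M (\<lambda>x. (\<phi> n x - \<xi> x)\<^sup>2)" for n
  proof (rule Bochner_Integration.integrable_bound)
    show "integrable ?M (\<lambda>x. 2 * (\<phi> n x)\<^sup>2 + 2 * (\<xi> x)\<^sup>2)" using i2 it by auto
    show "AE x in ?M. norm ((\<phi> n x - \<xi> x)\<^sup>2) \<le> norm (2 * (\<phi> n x)\<^sup>2 + 2 * (\<xi> x)\<^sup>2)"
      using sq[of "\<phi> n _" "\<xi> _"] by (intro AE_I2) simp
  qed measurable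
  have id2: "integrable ?M (\<lambda>x. (norm (gradient (\<phi> n) x - ?W x))\<^sup>2)" for n
  proof (rule Bochner_Integration.integrable_bound)
    show "integrable ?M (\<lambda>x. 2 * (norm (gradient (\<phi> n) x))\<^sup>2 + 2 * (norm (?W x))\<^sup>2)" using i2 it by auto
    show "AE x in ?M. norm ((norm (gradient (\<phi> n) x - ?W x))\<^sup>2) \<le> norm (2 * (norm (gradient (\<phi> n) x))\<^sup>2 + 2 * (norm (?W x))\<^sup>2)"
      using sq by (intro AE_I2) simp
  qed measurable
  define e1 where "e1 n = (\<integral>x. (\<phi> n x - \<xi> x)\<^sup>2 \<partial>?M)" for n
  define e2 where "e2 n = (\<integral>x. (norm (gradient (\<phi> n) x - ?W x))\<^sup>2 \<partial>?M)" for n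
  have e: "0 \<le> e1 n" "0 \<le> e2 n" for n by (auto simp: e1_def e2_def)
  have e1: "e1 \<longlonglongrightarrow> 0"
    by (rule tendsto_sandwich[OF _ _ tendsto_const lim]) (use e in \<open>auto simp: e1_def e2_def\<close>)
  have e2: "e2 \<longlonglongrightarrow> 0"
    by (rule tendsto_sandwich[OF _ _ tendsto_const lim]) (use e in \<open>auto simp: e1_def e2_def\<close>)
  \<comment> \<open>The weight P is unbounded, so convergence in L^2 does not pass to the potential
    term directly; an almost everywhere convergent subsequence and Fatou's lemma give the inequality
    in the direction that is needed.\<close>
  have "\<exists>s::nat \<Rightarrow> nat. strict_mono s \<and> (AE x in ?M. (\<lambda>n. (\<phi> (s n) x - \<xi> x)\<^sup>2) \<longlonglongrightarrow> 0)"
    by (rule tendsto_L1_AE_subseq[OF id1]) (use e1 in \<open>simp add: e1_def[abs_def]\<close>)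
  then obtain s :: "nat \<Rightarrow> nat" where s: "strict_mono s" "AE x in ?M. (\<lambda>n. (\<phi> (s n) x - \<xi> x)\<^sup>2) \<longlonglongrightarrow> 0" by blast
  define W where "W = (\<integral>x. (norm (?W x))\<^sup>2 \<partial>?M)"
  have W: "0 \<le> W" by (simp add: W_def)
  have main: "(\<integral>\<^sup>+x. ennreal (P x * (\<xi> x)\<^sup>2) \<partial>?M) \<le> ennreal ((1 + \<delta>) * W + \<delta>)" if \<delta>: "0 < \<delta>" for \<delta>
  proof -
    have [measurable]: "P \<in> borel_measurable ?M"
      unfolding P_def[abs_def] by (intro measurable_restrict_space1 measurable_completion) measurable
    have "(\<integral>\<^sup>+x. ennreal (P x * (\<xi> x)\<^sup>2) \<partial>?M) = (\<integral>\<^sup>+x. liminf (\<lambda>n. ennreal (P x * (\<phi> (s n) x)\<^sup>2)) \<partial>?M)"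
    proof (rule nn_integral_cong_AE)
      show "AE x in ?M. ennreal (P x * (\<xi> x)\<^sup>2) = liminf (\<lambda>n. ennreal (P x * (\<phi> (s n) x)\<^sup>2))"
        using s(2)
      proof eventually_elim
        fix x assume "(\<lambda>n. (\<phi> (s n) x - \<xi> x)\<^sup>2) \<longlonglongrightarrow> 0"
        then have "(\<lambda>n. sqrt ((\<phi> (s n) x - \<xi> x)\<^sup>2)) \<longlonglongrightarrow> sqrt 0" by (rule tendsto_real_sqrt)
        then have "(\<lambda>n. \<phi> (s n) x - \<xi> x) \<longlonglongrightarrow> 0" by (simp add: tendsto_rabs_zero_iff)
        then have "(\<lambda>n. \<phi> (s n) x) \<longlonglongrightarrow> \<xi> x" by (simp add: LIM_zero_iff)
        then have "(\<lambda>n. ennreal (P x * (\<phi> (s n) x)\<^sup>2)) \<longlonglongrightarrow> ennreal (P x * (\<xi> x)\<^sup>2)"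
          by (intro tendsto_ennrealI tendsto_intros)
        then show "ennreal (P x * (\<xi> x)\<^sup>2) = liminf (\<lambda>n. ennreal (P x * (\<phi> (s n) x)\<^sup>2))"
          using lim_imp_Liminf[OF trivial_limit_sequentially] by metis
      qed
    qed
    also have "\<dots> \<le> liminf (\<lambda>n. \<integral>\<^sup>+x. ennreal (P x * (\<phi> (s n) x)\<^sup>2) \<partial>?M)"
      by (rule nn_integral_liminf) measurable
    also have "\<dots> \<le> limsup (\<lambda>n. \<integral>\<^sup>+x. ennreal (P x * (\<phi> (s n) x)\<^sup>2) \<partial>?M)"
      by (rule Liminf_le_Limsup) simp
    also have "\<dots> \<le> ennreal ((1 + \<delta>) * W + \<delta>)"
    proof (rule Limsup_bounded)
      have "(\<lambda>n. (1 + 1 / \<delta>) * e2 (s n) + K * e1 (s n)) \<longlonglongrightarrow> (1 + 1 / \<delta>) * 0 + K * 0"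
        using LIMSEQ_subseq_LIMSEQ[OF e1 s(1)] LIMSEQ_subseq_LIMSEQ[OF e2 s(1)]
        by (intro tendsto_intros) (simp_all add: o_def)
      then have "\<forall>\<^sub>F n in sequentially. (1 + 1 / \<delta>) * e2 (s n) + K * e1 (s n) < \<delta>"
        using \<delta> by (intro order_tendstoD) auto
      then show "\<forall>\<^sub>F n in sequentially. (\<integral>\<^sup>+x. ennreal (P x * (\<phi> (s n) x)\<^sup>2) \<partial>?M) \<le> ennreal ((1 + \<delta>) * W + \<delta>)"
      proof eventually_elim
        fix n assume n: "(1 + 1 / \<delta>) * e2 (s n) + K * e1 (s n) < \<delta>"
        have "(\<integral>\<^sup>+x. ennreal (P x * (\<phi> (s n) x)\<^sup>2) \<partial>?M) \<le>
          (\<integral>\<^sup>+x. ennreal ((norm (gradient (\<phi> (s n)) x))\<^sup>2) \<partial>?M) + ennreal K * (\<integral>\<^sup>+x. ennreal ((\<phi> (s n) x - \<xi> x)\<^sup>2) \<partial>?M)"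
          unfolding P_def by (rule test[OF \<phi>])
        also have "(\<integral>\<^sup>+x. ennreal ((norm (gradient (\<phi> (s n)) x))\<^sup>2) \<partial>?M) = ennreal (\<integral>x. (norm (gradient (\<phi> (s n)) x))\<^sup>2 \<partial>?M)"
          by (rule nn_integral_eq_integral[OF it(2)]) auto
        also have "(\<integral>\<^sup>+x. ennreal ((\<phi> (s n) x - \<xi> x)\<^sup>2) \<partial>?M) = ennreal (e1 (s n))"
          unfolding e1_def by (rule nn_integral_eq_integral[OF id1]) auto
        also have "ennreal (\<integral>x. (norm (gradient (\<phi> (s n)) x))\<^sup>2 \<partial>?M) + ennreal K * ennreal (e1 (s n))
          = ennreal ((\<integral>x. (norm (gradient (\<phi> (s n)) x))\<^sup>2 \<partial>?M) + K * e1 (s n))"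
          using K e by (subst ennreal_plus) (auto simp: ennreal_mult)
        also have "\<dots> \<le> ennreal ((1 + \<delta>) * W + \<delta>)"
        proof (rule ennreal_leI)
          \<comment> \<open>Young's inequality in the form |u + v|^2 <= (1 + \<delta>) |v|^2 + (1 +
            1/\<delta>) |u|^2, where u is the gradient error, which tends to 0 in L^2 while \<delta>
            is fixed.\<close>
          have pt: "(norm (gradient (\<phi> (s n)) x))\<^sup>2 \<le> (1 + \<delta>) * (norm (?W x))\<^sup>2 + (1 + 1 / \<delta>) * (norm (gradient (\<phi> (s n)) x - ?W x))\<^sup>2" for x
          proof -
            define u where "u = gradient (\<phi> (s n)) x - ?W x"
            define v where "v = ?W x"
            have "norm (u + v) \<le> norm u + norm v" by (rule norm_triangle_ineq)
            then have "(norm (u + v))\<^sup>2 \<le> (norm u + norm v)\<^sup>2" by (intro power_mono) auto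
            also have "\<dots> = (norm u)\<^sup>2 + (norm v)\<^sup>2 + 2 * (norm u / sqrt \<delta>) * (sqrt \<delta> * norm v)"
              using \<delta> by (simp add: power2_sum)
            also have "\<dots> \<le> (norm u)\<^sup>2 + (norm v)\<^sup>2 + ((norm u / sqrt \<delta>)\<^sup>2 + (sqrt \<delta> * norm v)\<^sup>2)"
              by (intro add_left_mono sum_squares_bound)
            also have "\<dots> = (1 + \<delta>) * (norm v)\<^sup>2 + (1 + 1 / \<delta>) * (norm u)\<^sup>2"
              using \<delta> by (simp add: power_divide power_mult_distrib algebra_simps)
            finally show ?thesis by (simp add: u_def v_def)
          qed
          have "(\<integral>x. (norm (gradient (\<phi> (s n)) x))\<^sup>2 \<partial>?M) \<le> (\<integral>x. (1 + \<delta>) * (norm (?W x))\<^sup>2 + (1 + 1 / \<delta>) * (norm (gradient (\<phi> (s n)) x - ?W x))\<^sup>2 \<partial>?M)"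
            using pt by (intro integral_mono Bochner_Integration.integrable_add integrable_mult_right it i2 id2) auto
          also have "\<dots> = (1 + \<delta>) * W + (1 + 1 / \<delta>) * e2 (s n)"
            unfolding W_def e2_def by (subst Bochner_Integration.integral_add) (use i2 id2 in auto)
          finally show "(\<integral>x. (norm (gradient (\<phi> (s n)) x))\<^sup>2 \<partial>?M) + K * e1 (s n) \<le> (1 + \<delta>) * W + \<delta>"
            using n by linarith
        qed
        finally show "(\<integral>\<^sup>+x. ennreal (P x * (\<phi> (s n) x)\<^sup>2) \<partial>?M) \<le> ennreal ((1 + \<delta>) * W + \<delta>)" .
      qed
    qed
    finally show ?thesis .
  qed
  have "((\<lambda>\<delta>. ennreal ((1 + \<delta>) * W + \<delta>)) \<longlongrightarrow> ennreal ((1 + 0) * W + 0)) (at_right 0)"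
    by (intro tendsto_ennrealI tendsto_intros)
  then have "(\<integral>\<^sup>+x. ennreal (P x * (\<xi> x)\<^sup>2) \<partial>?M) \<le> ennreal ((1 + 0) * W + 0)"
    by (rule tendsto_lowerbound) (auto simp: eventually_at_right_field intro!: exI[of _ 1] main)
  moreover have "(\<integral>\<^sup>+x. ennreal ((2 * (real N - 2) / (norm x)\<^sup>2 + h) * (\<xi> x)\<^sup>2) \<partial>?M) \<le> (\<integral>\<^sup>+x. ennreal (P x * (\<xi> x)\<^sup>2) \<partial>?M)"
    unfolding P_def using hc by (intro nn_integral_mono ennreal_leI mult_right_mono) auto
  ultimately have "(\<integral>\<^sup>+x. ennreal ((2 * (real N - 2) / (norm x)\<^sup>2 + h) * (\<xi> x)\<^sup>2) \<partial>?M) \<le> ennreal W" by simp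
  from integral_real_bounded[OF W this] show ?thesis
    unfolding Q_form_def integral_potential[OF N] W_def by simp
qed

section \<open>One-dimensional Hardy and Poincare inequalities\<close>

lemma integral_deriv_eq_0_le:
  fixes T :: "real \<Rightarrow> real"
  assumes ab: "a \<le> b" and T: "\<And>t. t \<in> {a..b} \<Longrightarrow> (T has_real_derivative T' t) (at t)" and z: "T b = T a"
    and P: "P integrable_on {a..b}" and E: "E integrable_on {a..b}"
    and le: "\<And>t. t \<in> {a..b} \<Longrightarrow> P t + T' t \<le> E t"
  shows "integral {a..b} P \<le> integral {a..b} E"
proof -
  have "(T' has_integral (T b - T a)) {a..b}"
    by (rule fundamental_theorem_of_calculus[OF ab])
       (use T in \<open>auto simp flip: has_real_derivative_iff_has_vector_derivative intro: has_field_derivative_at_within\<close>)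
  then have "((\<lambda>t. P t + T' t) has_integral (integral {a..b} P + 0)) {a..b}"
    using z by (intro has_integral_add integrable_integral P) simp
  from has_integral_le[OF this integrable_integral[OF E] le] show ?thesis by simp
qed

text \<open>Picone's identity for \<open>w = r\<^sup>4 g\<close> and the radial solution \<open>bes (c r\<^sup>2)\<close>.\<close>

lemma ray_hardy:
  fixes g :: "real \<Rightarrow> real"
  assumes c: "c \<le> bes_zero" "0 \<le> c" and g: "\<And>t. (g has_real_derivative g' t) (at t)" and g': "continuous_on UNIV g'" and z: "g 1 = 0"
  shows "integral {0..1} (\<lambda>r. 16 * r ^ 7 * (g r)\<^sup>2 + c * (r ^ 9 * (g r)\<^sup>2)) \<le> integral {0..1} (\<lambda>r. r ^ 9 * (g' r)\<^sup>2)"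
proof -
  have gc: "continuous_on S g" for S
    using DERIV_isCont[OF g] by (simp add: continuous_at_imp_continuous_on)
  have g'c: "continuous_on S g'" for S by (rule continuous_on_subset[OF g']) auto
  have less: "integral {0..1} (\<lambda>r. 16 * r ^ 7 * (g r)\<^sup>2 + c * (r ^ 9 * (g r)\<^sup>2)) \<le> integral {0..1} (\<lambda>r. r ^ 9 * (g' r)\<^sup>2)"
    if c: "c < bes_zero" "0 \<le> c" for c
  proof -
    define f where "f r = bes (c * r\<^sup>2)" for r
    define f' where "f' r = 2 * c * r * bes1 (c * r\<^sup>2)" for r
    define f'' where "f'' r = 2 * c * bes1 (c * r\<^sup>2) + 4 * c\<^sup>2 * r\<^sup>2 * bes2 (c * r\<^sup>2)" for r
    have f: "(f has_real_derivative f' r) (at r)" for r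
      unfolding f_def f'_def by (auto intro!: derivative_eq_intros)
    have f': "(f' has_real_derivative f'' r) (at r)" for r
      unfolding f'_def f''_def by (auto intro!: derivative_eq_intros simp: power2_eq_square)
    have ode: "f' t + t * f'' t = - (c * t * f t)" for t
    proof -
      have "t * f'' t + f' t + c * t * f t = 4 * c * t * ((c * t\<^sup>2) * bes2 (c * t\<^sup>2) + bes1 (c * t\<^sup>2) + bes (c * t\<^sup>2) / 4)"
        unfolding f_def f'_def f''_def by (simp add: algebra_simps power2_eq_square)
      then show ?thesis by (simp add: bes_ode)
    qed
    have fpos: "0 < f t" if "t \<in> {0..1}" for t
    proof -
      have "c * t\<^sup>2 \<le> c * 1" using c that by (intro mult_left_mono power_le_one) auto
      then show ?thesis unfolding f_def using c by (intro bes_pos) linarith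
    qed
    \<comment> \<open>Hardy's substitution: w = r^4 g turns r^9 g'^2 - 16 r^7 g^2 into r w'^2 minus
      the derivative of 4 w^2.\<close>
    define w where "w r = r ^ 4 * g r" for r
    define w' where "w' r = 4 * r ^ 3 * g r + r ^ 4 * g' r" for r
    have w: "(w has_real_derivative w' t) (at t)" for t
      unfolding w_def w'_def by (auto intro!: derivative_eq_intros g)
    define p where "p r = f' r / f r" for r
    \<comment> \<open>The boundary term of Picone's identity together with the exact derivative left
      over by the substitution; what remains of the difference of the integrands is r (w' - w
      f'/f)^2.\<close>
    define T where "T r = (w r)\<^sup>2 * (r * f' r / f r) - 4 * (w r)\<^sup>2" for r
    define T' where "T' r = 2 * w r * w' r * (r * p r) - (w r)\<^sup>2 * (c * r + r * (p r)\<^sup>2) - 8 * w r * w' r" for r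
    show ?thesis
    proof (rule integral_deriv_eq_0_le[where T=T and T'=T'])
      fix t :: real assume t: "t \<in> {0..1}"
      have ft: "f t \<noteq> 0" using fpos[OF t] by simp
      have s: "((\<lambda>r. r * f' r / f r) has_real_derivative - (c * t + t * (p t)\<^sup>2)) (at t)"
      proof -
        have "((\<lambda>r. r * f' r / f r) has_real_derivative ((1 * f' t + f'' t * t) * f t - t * f' t * f' t) / (f t * f t)) (at t)"
          by (intro DERIV_divide DERIV_mult DERIV_ident f f' ft)
        moreover have "((1 * f' t + f'' t * t) * f t - t * f' t * f' t) / (f t * f t) = - (c * t + t * (p t)\<^sup>2)"
        proof -
          have "1 * f' t + f'' t * t = - (c * t * f t)" using ode[of t] by (simp add: mult.commute)
          then show ?thesis using ft by (simp add: p_def field_simps power2_eq_square)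
        qed
        ultimately show ?thesis by simp
      qed
      have w2: "((\<lambda>r. (w r)\<^sup>2) has_real_derivative 2 * w t * w' t) (at t)"
        using DERIV_power[OF w[of t], of 2] by (simp add: mult_ac)
      have "(T has_real_derivative (2 * w t * w' t * (t * f' t / f t) + - (c * t + t * (p t)\<^sup>2) * (w t)\<^sup>2) - 4 * (2 * w t * w' t)) (at t)"
        unfolding T_def by (intro DERIV_diff DERIV_mult DERIV_cmult w2 s)
      then show "(T has_real_derivative T' t) (at t)"
        by (simp add: T'_def p_def algebra_simps)
      have "t ^ 9 * (g' t)\<^sup>2 - (16 * t ^ 7 * (g t)\<^sup>2 + c * (t ^ 9 * (g t)\<^sup>2)) - T' t = t * (w' t - w t * p t)\<^sup>2"
        unfolding T'_def w_def w'_def by (simp add: algebra_simps power2_eq_square power_numeral_reduce)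
      moreover have "0 \<le> t * (w' t - w t * p t)\<^sup>2" using t by simp
      ultimately show "16 * t ^ 7 * (g t)\<^sup>2 + c * (t ^ 9 * (g t)\<^sup>2) + T' t \<le> t ^ 9 * (g' t)\<^sup>2" by linarith
    next
      show "T 1 = T 0" using z by (simp add: T_def w_def)
    qed (intro integrable_continuous_interval continuous_intros gc g'c | simp)+
  qed
  show ?thesis
  proof (cases "c = bes_zero")
    case False
    then show ?thesis using less c by simp
  next
    \<comment> \<open>For c = \<open>bes_zero\<close> the comparison function vanishes at r = 1 and
      cannot be divided by; this case is the limit of c increasing to
      \<open>bes_zero\<close>.\<close>
    case True
    let ?A = "integral {0..1} (\<lambda>r. 16 * r ^ 7 * (g r)\<^sup>2)" and ?B = "integral {0..1} (\<lambda>r. r ^ 9 * (g r)\<^sup>2)"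
      and ?E = "integral {0..1} (\<lambda>r. r ^ 9 * (g' r)\<^sup>2)"
    have split: "integral {0..1} (\<lambda>r. 16 * r ^ 7 * (g r)\<^sup>2 + c * (r ^ 9 * (g r)\<^sup>2)) = ?A + c * ?B" for c
      by (subst Henstock_Kurzweil_Integration.integral_add) (intro integrable_continuous_interval continuous_intros gc | simp)+
    have "((\<lambda>c. ?A + c * ?B) \<longlongrightarrow> ?A + bes_zero * ?B) (at_left bes_zero)" by (intro tendsto_intros)
    then have "?A + bes_zero * ?B \<le> ?E"
      by (rule tendsto_upperbound)
         (use bes_zero_pos less split in \<open>auto simp: eventually_at_left_field intro!: exI[of _ 0]\<close>)
    then show ?thesis using split True by simp
  qed
qed

text \<open>The function (r^2 - a^2) (w - w(b))^2 vanishes at both ends, so its derivative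
  integrates to 0 and Young's inequality does the rest. Because r^2 - a^2 <= 2 r (b - a), the weight
  r survives and the constant stays uniform down to a = 0.\<close>

lemma interval_poincare:
  fixes w :: "real \<Rightarrow> real"
  assumes ab: "0 \<le> a" "a \<le> b" and w: "\<And>t. (w has_real_derivative w' t) (at t)" and w': "continuous_on UNIV w'"
  shows "integral {a..b} (\<lambda>r. r * (w r - w b)\<^sup>2) \<le> 4 * (b - a)\<^sup>2 * integral {a..b} (\<lambda>r. r * (w' r)\<^sup>2)"
proof -
  have wc: "continuous_on S w" for S
    using DERIV_isCont[OF w] by (simp add: continuous_at_imp_continuous_on)
  have w'c: "continuous_on S w'" for S by (rule continuous_on_subset[OF w']) auto
  have "integral {a..b} (\<lambda>r. r * (w r - w b)\<^sup>2 / 2) \<le> integral {a..b} (\<lambda>r. 2 * (b - a)\<^sup>2 * (r * (w' r)\<^sup>2))"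
  proof (rule integral_deriv_eq_0_le[where T="\<lambda>r. - ((r\<^sup>2 - a\<^sup>2) / 2 * (w r - w b)\<^sup>2)" and
        T'="\<lambda>r. - (r * (w r - w b)\<^sup>2 + (r\<^sup>2 - a\<^sup>2) * (w r - w b) * w' r)", OF ab(2)])
    fix t assume t: "t \<in> {a..b}"
    show "((\<lambda>r. - ((r\<^sup>2 - a\<^sup>2) / 2 * (w r - w b)\<^sup>2)) has_real_derivative - (t * (w t - w b)\<^sup>2 + (t\<^sup>2 - a\<^sup>2) * (w t - w b) * w' t)) (at t)"
      by (auto intro!: derivative_eq_intros w simp: field_simps power2_eq_square)
    let ?y = "w t - w b" and ?l = "b - a"
    have "- ((t\<^sup>2 - a\<^sup>2) * ?y * w' t) \<le> t * (?y\<^sup>2 / 2 + 2 * ?l\<^sup>2 * (w' t)\<^sup>2)"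
    proof -
      have "(t\<^sup>2 - a\<^sup>2) = (t - a) * (t + a)" by (simp add: power2_eq_square algebra_simps)
      also have "\<dots> \<le> ?l * (2 * t)" using t ab by (intro mult_mono) auto
      finally have "(t\<^sup>2 - a\<^sup>2) * (\<bar>?y\<bar> * \<bar>w' t\<bar>) \<le> ?l * (2 * t) * (\<bar>?y\<bar> * \<bar>w' t\<bar>)" by (intro mult_right_mono) auto
      also have "\<dots> = t * ((2 * \<bar>?y\<bar> * (2 * ?l * \<bar>w' t\<bar>)) / 2)" by simp
      also have "\<dots> \<le> t * ((\<bar>?y\<bar>\<^sup>2 + (2 * ?l * \<bar>w' t\<bar>)\<^sup>2) / 2)"
        using t ab by (intro mult_left_mono divide_right_mono sum_squares_bound) auto
      also have "(2 * ?l * \<bar>w' t\<bar>)\<^sup>2 = 4 * ?l\<^sup>2 * (w' t)\<^sup>2" by (simp only: power_mult_distrib power2_abs) simp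
      also have "t * ((\<bar>?y\<bar>\<^sup>2 + 4 * ?l\<^sup>2 * (w' t)\<^sup>2) / 2) = t * (?y\<^sup>2 / 2 + 2 * ?l\<^sup>2 * (w' t)\<^sup>2)"
        by (simp add: add_divide_distrib)
      finally have A: "(t\<^sup>2 - a\<^sup>2) * (\<bar>?y\<bar> * \<bar>w' t\<bar>) \<le> t * (?y\<^sup>2 / 2 + 2 * ?l\<^sup>2 * (w' t)\<^sup>2)" .
      have "0 \<le> t\<^sup>2 - a\<^sup>2" using t ab by (simp add: power_mono)
      then have "- ((t\<^sup>2 - a\<^sup>2) * ?y * w' t) \<le> (t\<^sup>2 - a\<^sup>2) * (\<bar>?y\<bar> * \<bar>w' t\<bar>)"
        using abs_ge_minus_self[of "(t\<^sup>2 - a\<^sup>2) * ?y * w' t"] by (simp add: abs_mult mult.assoc)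
      then show ?thesis using A by linarith
    qed
    then show "t * (w t - w b)\<^sup>2 / 2 + - (t * (w t - w b)\<^sup>2 + (t\<^sup>2 - a\<^sup>2) * (w t - w b) * w' t) \<le> 2 * (b - a)\<^sup>2 * (t * (w' t)\<^sup>2)"
      by (simp add: algebra_simps)
  qed (intro integrable_continuous_interval continuous_intros wc w'c | simp)+
  then show ?thesis by simp
qed

text \<open>Let m be the weighted mean of w. Subtracting m is optimal among constants, so the left
  side exceeds the first integral by at most m^2 times the total weight. As W has mean 0, m is also
  the mean of w - W, and Cauchy-Schwarz bounds that excess by the second integral.\<close>

lemma weighted_mean_bound:
  fixes w :: "real \<Rightarrow> real"
  assumes ab: "0 \<le> a" "a < b" and w: "continuous_on {a..b} w"
    and W: "(\<lambda>r. r * W r) integrable_on {a..b}" "integral {a..b} (\<lambda>r. r * W r) = 0"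
      "(\<lambda>r. r * (w r - W r)\<^sup>2) integrable_on {a..b}"
  shows "integral {a..b} (\<lambda>r. r * (w r)\<^sup>2) \<le>
    integral {a..b} (\<lambda>r. r * (w r - k)\<^sup>2) + integral {a..b} (\<lambda>r. r * (w r - W r)\<^sup>2)"
proof -
  define S where "S = (b\<^sup>2 - a\<^sup>2) / 2"
  have "a\<^sup>2 < b\<^sup>2" using ab by (intro power_strict_mono) auto
  then have S: "0 < S" by (simp add: S_def)
  have "((\<lambda>r. r) has_integral (b\<^sup>2 / 2 - a\<^sup>2 / 2)) {a..b}"
    using ab by (intro fundamental_theorem_of_calculus)
      (auto intro!: derivative_eq_intros simp flip: has_real_derivative_iff_has_vector_derivative)
  then have r: "((\<lambda>r. r) has_integral S) {a..b}" by (simp add: S_def diff_divide_distrib)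
  define m where "m = integral {a..b} (\<lambda>r. r * w r) / S"
  have rw: "((\<lambda>r. r * w r) has_integral (m * S)) {a..b}"
  proof -
    have "(\<lambda>r. r * w r) integrable_on {a..b}" by (intro integrable_continuous_interval continuous_intros w)
    then show ?thesis using S by (simp add: m_def integrable_integral)
  qed
  have rW: "((\<lambda>r. r * W r) has_integral 0) {a..b}" using W(1,2) by (metis integrable_integral)
  have rw2: "((\<lambda>r. r * (w r)\<^sup>2) has_integral integral {a..b} (\<lambda>r. r * (w r)\<^sup>2)) {a..b}"
    by (intro integrable_integral integrable_continuous_interval continuous_intros w)
  have "((\<lambda>r. r * (w r)\<^sup>2 - 2 * k * (r * w r) + k\<^sup>2 * r) has_integral
     (integral {a..b} (\<lambda>r. r * (w r)\<^sup>2) - 2 * k * (m * S) + k\<^sup>2 * S)) {a..b}"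
    by (intro has_integral_add has_integral_diff has_integral_mult_right rw rw2 r)
  moreover have "(\<lambda>r. r * (w r)\<^sup>2 - 2 * k * (r * w r) + k\<^sup>2 * r) = (\<lambda>r. r * (w r - k)\<^sup>2)"
    by (auto simp: power2_diff algebra_simps)
  ultimately have 1: "integral {a..b} (\<lambda>r. r * (w r - k)\<^sup>2) = integral {a..b} (\<lambda>r. r * (w r)\<^sup>2) - 2 * k * (m * S) + k\<^sup>2 * S"
    by (simp add: integral_unique)
  have "0 \<le> integral {a..b} (\<lambda>r. r * (w r - W r)\<^sup>2) - 2 * m * (m * S - 0) + m\<^sup>2 * S"
  proof (rule has_integral_nonneg)
    show "((\<lambda>r. r * (w r - W r)\<^sup>2 - 2 * m * (r * w r - r * W r) + m\<^sup>2 * r) has_integral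
      (integral {a..b} (\<lambda>r. r * (w r - W r)\<^sup>2) - 2 * m * (m * S - 0) + m\<^sup>2 * S)) {a..b}"
      by (intro has_integral_add has_integral_diff has_integral_mult_right rw rW r integrable_integral W(3))
    fix t assume "t \<in> {a..b}"
    then have "0 \<le> t * (w t - W t - m)\<^sup>2" using ab by simp
    then show "0 \<le> t * (w t - W t)\<^sup>2 - 2 * m * (t * w t - t * W t) + m\<^sup>2 * t"
      by (simp add: power2_eq_square algebra_simps)
  qed
  then have 2: "m\<^sup>2 * S \<le> integral {a..b} (\<lambda>r. r * (w r - W r)\<^sup>2)" by (simp add: power2_eq_square algebra_simps)
  have "0 \<le> S * (k - m)\<^sup>2" using S by simp
  then show ?thesis using 1 2 by (simp add: power2_eq_square algebra_simps)
qed

lemma integral_split_uniform: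
  fixes f :: "real \<Rightarrow> real"
  assumes f: "f integrable_on {0..1}" and M: "0 < M"
  shows "integral {0..1} f = (\<Sum>i<M. integral {real i / real M..real (Suc i) / real M} f)"
proof -
  have "integral {0..real k / real M} f = (\<Sum>i<k. integral {real i / real M..real (Suc i) / real M} f)" if "k \<le> M" for k
    using that
  proof (induction k)
    case (Suc k)
    have "integral {0..real k / real M} f + integral {real k / real M..real (Suc k) / real M} f = integral {0..real (Suc k) / real M} f"
      using Suc.prems M by (intro Henstock_Kurzweil_Integration.integral_combine integrable_on_subinterval[OF f])
        (auto simp: divide_right_mono)
    then show ?case using Suc by simp
  qed simp
  from this[of M] show ?thesis using M by simp
qed

text \<open>After the substitution w = r^4 g the Hardy part drops out. On each of M equal
  subintervals the Poincare constant 4/M^2 lets r w'^2 absorb c r w^2 as soon as 4 c <= M^2. The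
  means vanish for G and not for g, and the last term is the price.\<close>

lemma ray_poincare:
  fixes g :: "real \<Rightarrow> real"
  assumes M: "0 < M" "0 \<le> c" "4 * c \<le> (real M)\<^sup>2"
    and g: "\<And>t. (g has_real_derivative g' t) (at t)" and g': "continuous_on UNIV g'" and z: "g 1 = 0"
    and G: "(\<lambda>r. r ^ 5 * G r) integrable_on {0..1}" "(\<lambda>r. r ^ 9 * (g r - G r)\<^sup>2) integrable_on {0..1}"
      "\<And>i. i < M \<Longrightarrow> integral {real i / real M..real (Suc i) / real M} (\<lambda>r. r ^ 5 * G r) = 0"
  shows "integral {0..1} (\<lambda>r. 16 * r ^ 7 * (g r)\<^sup>2 + c * (r ^ 9 * (g r)\<^sup>2)) \<le>
    integral {0..1} (\<lambda>r. r ^ 9 * (g' r)\<^sup>2) + c * integral {0..1} (\<lambda>r. r ^ 9 * (g r - G r)\<^sup>2)"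
proof -
  have gc: "continuous_on S g" for S
    using DERIV_isCont[OF g] by (simp add: continuous_at_imp_continuous_on)
  have g'c: "continuous_on S g'" for S by (rule continuous_on_subset[OF g']) auto
  define w where "w r = r ^ 4 * g r" for r
  define w' where "w' r = 4 * r ^ 3 * g r + r ^ 4 * g' r" for r
  have w: "(w has_real_derivative w' t) (at t)" for t
    unfolding w_def w'_def by (auto intro!: derivative_eq_intros g)
  have wc: "continuous_on S w" "continuous_on S w'" for S
    unfolding w_def[abs_def] w'_def[abs_def] by (intro continuous_intros gc g'c)+
  define W where "W r = r ^ 4 * G r" for r
  have rW: "(\<lambda>r. r * W r) = (\<lambda>r. r ^ 5 * G r)" by (auto simp: W_def power_numeral_reduce)
  have rwW: "(\<lambda>r. r * (w r - W r)\<^sup>2) = (\<lambda>r. r ^ 9 * (g r - G r)\<^sup>2)"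
    by (auto simp: w_def W_def power2_eq_square power_numeral_reduce algebra_simps)
  have i1: "(\<lambda>r. r * (w r)\<^sup>2) integrable_on {0..1}" "(\<lambda>r. r * (w' r)\<^sup>2) integrable_on {0..1}"
    by (intro integrable_continuous_interval continuous_intros wc)+
  have int: "integral {0..1} (\<lambda>r. r * (w r)\<^sup>2) \<le> 4 / (real M)\<^sup>2 * integral {0..1} (\<lambda>r. r * (w' r)\<^sup>2) + integral {0..1} (\<lambda>r. r * (w r - W r)\<^sup>2)"
  proof -
    have "integral {real i / real M..real (Suc i) / real M} (\<lambda>r. r * (w r)\<^sup>2) \<le>
      4 / (real M)\<^sup>2 * integral {real i / real M..real (Suc i) / real M} (\<lambda>r. r * (w' r)\<^sup>2) +
      integral {real i / real M..real (Suc i) / real M} (\<lambda>r. r * (w r - W r)\<^sup>2)" if i: "i < M" for i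
    proof -
      let ?a = "real i / real M" and ?b = "real (Suc i) / real M"
      have ab: "0 \<le> ?a" "?a < ?b" "?b - ?a = 1 / real M" using M by (auto simp: divide_strict_right_mono diff_divide_distrib[symmetric])
      have sub: "{?a..?b} \<subseteq> {0..1}" using i M by (auto simp: divide_le_eq_1 order_trans[OF ab(1)] intro: order_trans)
      have "integral {?a..?b} (\<lambda>r. r * (w r)\<^sup>2) \<le> integral {?a..?b} (\<lambda>r. r * (w r - w ?b)\<^sup>2) + integral {?a..?b} (\<lambda>r. r * (w r - W r)\<^sup>2)"
        by (rule weighted_mean_bound[OF ab(1,2) wc(1)])
           (use G(3)[OF i] integrable_on_subinterval[OF G(1) sub] integrable_on_subinterval[OF G(2) sub] in \<open>simp_all only: rW rwW\<close>)
      also have "integral {?a..?b} (\<lambda>r. r * (w r - w ?b)\<^sup>2) \<le> 4 * (?b - ?a)\<^sup>2 * integral {?a..?b} (\<lambda>r. r * (w' r)\<^sup>2)"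
        by (rule interval_poincare[OF ab(1) less_imp_le[OF ab(2)] w wc(2)])
      also have "4 * (?b - ?a)\<^sup>2 = 4 / (real M)\<^sup>2" unfolding ab(3) by (simp add: power_divide)
      finally show ?thesis by simp
    qed
    then have "(\<Sum>i<M. integral {real i / real M..real (Suc i) / real M} (\<lambda>r. r * (w r)\<^sup>2)) \<le>
      (\<Sum>i<M. 4 / (real M)\<^sup>2 * integral {real i / real M..real (Suc i) / real M} (\<lambda>r. r * (w' r)\<^sup>2) +
      integral {real i / real M..real (Suc i) / real M} (\<lambda>r. r * (w r - W r)\<^sup>2))"
      by (intro sum_mono) auto
    then show ?thesis
      using G(2) rwW by (simp only: integral_split_uniform[OF i1(1) M(1)] integral_split_uniform[OF i1(2) M(1)]
          integral_split_uniform[OF G(2) M(1)] sum.distrib sum_distrib_left)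
  qed
  have "c * (4 / (real M)\<^sup>2) \<le> 1" using M by (simp add: divide_le_eq)
  moreover have "0 \<le> integral {0..1} (\<lambda>r. r * (w' r)\<^sup>2)" by (intro integral_nonneg i1) auto
  ultimately have "c * (4 / (real M)\<^sup>2) * integral {0..1} (\<lambda>r. r * (w' r)\<^sup>2) \<le> 1 * integral {0..1} (\<lambda>r. r * (w' r)\<^sup>2)"
    by (rule mult_right_mono)
  moreover have "c * integral {0..1} (\<lambda>r. r * (w r)\<^sup>2) \<le> c * (4 / (real M)\<^sup>2 * integral {0..1} (\<lambda>r. r * (w' r)\<^sup>2) + integral {0..1} (\<lambda>r. r * (w r - W r)\<^sup>2))"
    using int M(2) by (rule mult_left_mono)
  ultimately have A: "c * integral {0..1} (\<lambda>r. r * (w r)\<^sup>2) \<le> integral {0..1} (\<lambda>r. r * (w' r)\<^sup>2) + c * integral {0..1} (\<lambda>r. r ^ 9 * (g r - G r)\<^sup>2)"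
    unfolding rwW by (simp add: algebra_simps)
  have B: "integral {0..1} (\<lambda>r. 16 * r ^ 7 * (g r)\<^sup>2 + r * (w' r)\<^sup>2) \<le> integral {0..1} (\<lambda>r. r ^ 9 * (g' r)\<^sup>2)"
  proof (rule integral_deriv_eq_0_le[where T="\<lambda>r. - (4 * (w r)\<^sup>2)" and T'="\<lambda>r. - (8 * w r * w' r)"])
    fix t :: real assume t: "t \<in> {0..1}"
    show "((\<lambda>r. - (4 * (w r)\<^sup>2)) has_real_derivative - (8 * w t * w' t)) (at t)"
      by (auto intro!: derivative_eq_intros w)
    show "16 * t ^ 7 * (g t)\<^sup>2 + t * (w' t)\<^sup>2 + - (8 * w t * w' t) \<le> t ^ 9 * (g' t)\<^sup>2"
      unfolding w_def w'_def by (simp add: algebra_simps power2_eq_square power_numeral_reduce)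
  next
    show "- (4 * (w 1)\<^sup>2) = - (4 * (w 0)\<^sup>2)" using z by (simp add: w_def)
  qed (intro integrable_continuous_interval continuous_intros gc g'c wc | simp)+
  have i7: "(\<lambda>r. 16 * r ^ 7 * (g r)\<^sup>2) integrable_on {0..1}"
    by (intro integrable_continuous_interval continuous_intros gc)
  have "integral {0..1} (\<lambda>r. 16 * r ^ 7 * (g r)\<^sup>2 + c * (r * (w r)\<^sup>2)) = integral {0..1} (\<lambda>r. 16 * r ^ 7 * (g r)\<^sup>2) + c * integral {0..1} (\<lambda>r. r * (w r)\<^sup>2)"
    by (subst Henstock_Kurzweil_Integration.integral_add) (intro integrable_continuous_interval continuous_intros gc wc | simp)+
  moreover have "integral {0..1} (\<lambda>r. 16 * r ^ 7 * (g r)\<^sup>2 + r * (w' r)\<^sup>2) = integral {0..1} (\<lambda>r. 16 * r ^ 7 * (g r)\<^sup>2) + integral {0..1} (\<lambda>r. r * (w' r)\<^sup>2)"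
    using i7 i1 by (subst Henstock_Kurzweil_Integration.integral_add) auto
  moreover have "r * (w r)\<^sup>2 = r ^ 9 * (g r)\<^sup>2" for r by (simp add: w_def power2_eq_square power_numeral_reduce)
  ultimately show ?thesis using A B by simp
qed

section \<open>Upper bounds for the Morse index\<close>

lemma nn_integral_unit_interval:
  fixes f :: "real \<Rightarrow> real"
  assumes [measurable]: "f \<in> borel_measurable borel" and pos: "\<And>r. r \<in> {0..1} \<Longrightarrow> 0 \<le> f r" and f: "f integrable_on {0..1}"
  shows "(\<integral>\<^sup>+r. indicator {0<..<1} r * ennreal (f r) \<partial>lborel) = ennreal (integral {0..1} f)"
proof -
  have "AE r in lborel. r \<noteq> 0 \<and> r \<noteq> (1::real)"
    using AE_lborel_singleton[of "0::real"] AE_lborel_singleton[of "1::real"] by eventually_elim simp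
  then have "(\<integral>\<^sup>+r. indicator {0<..<1} r * ennreal (f r) \<partial>lborel) = (\<integral>\<^sup>+r. ennreal (indicator {0..1} r * f r) \<partial>lborel)"
    by (intro nn_integral_cong_AE, elim eventually_mono) (auto simp: indicator_def)
  also have "\<dots> = ennreal (integral {0..1} f)"
  proof (rule nn_integral_has_integral_lborel)
    have "(f has_integral integral {0..1} f) {0..1}" using f by (rule integrable_integral)
    then have "((\<lambda>r. if r \<in> {0..1} then f r else 0) has_integral integral {0..1} f) UNIV"
      by (simp only: has_integral_restrict_UNIV)
    moreover have "(\<lambda>r. if r \<in> {0..1} then f r else 0) = (\<lambda>r. indicator {0..1} r * f r)" by (auto simp: indicator_def)
    ultimately show "((\<lambda>r. indicator {0..1} r * f r) has_integral integral {0..1} f) UNIV" by simp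
  qed (use pos in \<open>auto simp: indicator_def\<close>)
  finally show ?thesis .
qed

lemma integrable_on_unit_interval:
  fixes f :: "real \<Rightarrow> real"
  assumes "integrable lborel (\<lambda>r. indicator {0<..<1} r * f r)"
  shows "f integrable_on {0..1}"
    and "integral {0..1} f = (\<integral>r. indicator {0<..<1} r * f r \<partial>lborel)"
proof -
  have "((\<lambda>r. indicator {0<..<1} r * f r) has_integral (\<integral>r. indicator {0<..<1} r * f r \<partial>lborel)) UNIV"
    by (rule has_integral_integral_lborel[OF assms])
  moreover have "(\<lambda>r. indicator {0<..<1} r * f r) = (\<lambda>r. if r \<in> {0<..<1} then f r else 0)" by (auto simp: indicator_def)
  ultimately have "((\<lambda>r. if r \<in> {0<..<1} then f r else 0) has_integral (\<integral>r. indicator {0<..<1} r * f r \<partial>lborel)) UNIV"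
    by (simp only:)
  then have "(f has_integral (\<integral>r. indicator {0<..<1} r * f r \<partial>lborel)) {0<..<1}"
    by (simp only: has_integral_restrict_UNIV)
  then have "(f has_integral (\<integral>r. indicator {0<..<1} r * f r \<partial>lborel)) {0..1}"
    using has_integral_Icc_iff_Ioo by blast
  then show "f integrable_on {0..1}" "integral {0..1} f = (\<integral>r. indicator {0<..<1} r * f r \<partial>lborel)"
    by (auto simp: integral_unique)
qed

lemma ray_derivative:
  fixes \<phi> :: "'a::euclidean_space \<Rightarrow> real"
  assumes "test_function \<Omega> \<phi>"
  shows "((\<lambda>r. \<phi> (r *\<^sub>R y)) has_real_derivative gradient \<phi> (t *\<^sub>R y) \<bullet> y) (at t)"
    and "continuous_on UNIV (\<lambda>r. gradient \<phi> (r *\<^sub>R y) \<bullet> y)"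
proof -
  let ?D = "frechet_derivative \<phi> (at (t *\<^sub>R y))"
  have D: "(\<phi> has_derivative ?D) (at (t *\<^sub>R y))" using Ck_on_has_derivative[OF test_function_Ck[OF assms]] by blast
  have lin: "linear ?D" using has_derivative_linear[OF D] .
  have "((\<lambda>r. r *\<^sub>R y) has_derivative (\<lambda>h. h *\<^sub>R y)) (at t)" by (auto intro!: derivative_eq_intros)
  from has_derivative_compose[OF this D] have "((\<lambda>r. \<phi> (r *\<^sub>R y)) has_derivative (\<lambda>h. ?D (h *\<^sub>R y))) (at t)" .
  moreover have "?D (h *\<^sub>R y) = (gradient \<phi> (t *\<^sub>R y) \<bullet> y) * h" for h
  proof -
    have "?D y = ?D (\<Sum>b\<in>Basis. (y \<bullet> b) *\<^sub>R b)" by (simp add: euclidean_representation)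
    also have "\<dots> = (\<Sum>b\<in>Basis. (y \<bullet> b) * ?D b)" by (simp add: linear_sum[OF lin] linear_scale[OF lin])
    also have "\<dots> = gradient \<phi> (t *\<^sub>R y) \<bullet> y"
      by (simp add: gradient_def inner_sum_left partial_derivative_def inner_commute[of y] mult.commute)
    finally show ?thesis by (simp add: linear_scale[OF lin] mult.commute)
  qed
  ultimately show "((\<lambda>r. \<phi> (r *\<^sub>R y)) has_real_derivative gradient \<phi> (t *\<^sub>R y) \<bullet> y) (at t)"
    by (simp add: has_field_derivative_def mult.commute[of _ "gradient \<phi> (t *\<^sub>R y) \<bullet> y"])
  show "continuous_on UNIV (\<lambda>r. gradient \<phi> (r *\<^sub>R y) \<bullet> y)"
    by (intro continuous_intros continuous_on_compose2[OF test_function_cont(3)[OF assms]]) auto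
qed

lemma sets_ball_norm: "ball (0::'a::euclidean_space) 1 \<in> sets borel" by simp

text \<open>The derivative along a ray is at most the length of the gradient, so the one-dimensional
  inequality can be integrated over all rays. When K > 0 and the distance from g to G along a ray is
  infinite, there is nothing to show; therefore \<open>ray\<close> may presuppose that it is finite
  or that K = 0.\<close>

lemma hardy_transfer:
  fixes \<phi> :: "'a::euclidean_space \<Rightarrow> real"
  assumes N: "DIM('a) = 10" and \<phi>: "test_function (ball 0 1) \<phi>" and c: "0 \<le> c" and K: "0 \<le> K"
    and G[measurable]: "G \<in> borel_measurable borel"
    and ray: "\<And>g g'. (\<And>t. (g has_real_derivative g' t) (at t)) \<Longrightarrow> continuous_on UNIV g' \<Longrightarrow> g 1 = 0 \<Longrightarrow>
      (\<lambda>r. r ^ 9 * (g r - G r)\<^sup>2) integrable_on {0..1} \<or> K = 0 \<Longrightarrow>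
      integral {0..1} (\<lambda>r. 16 * r ^ 7 * (g r)\<^sup>2 + c * (r ^ 9 * (g r)\<^sup>2)) \<le>
      integral {0..1} (\<lambda>r. r ^ 9 * (g' r)\<^sup>2) + K * integral {0..1} (\<lambda>r. r ^ 9 * (g r - G r)\<^sup>2)"
  shows "(\<integral>\<^sup>+x. ennreal ((2 * (real 10 - 2) / (norm x)\<^sup>2 + c) * (\<phi> x)\<^sup>2) \<partial>lebesgue_on (ball 0 1)) \<le>
      (\<integral>\<^sup>+x. ennreal ((norm (gradient \<phi> x))\<^sup>2) \<partial>lebesgue_on (ball 0 1)) +
      ennreal K * (\<integral>\<^sup>+x. ennreal ((\<phi> x - G (norm x))\<^sup>2) \<partial>lebesgue_on (ball 0 1))"
proof -
  let ?B = "ball (0::'a) 1"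
  have [measurable]: "?B \<in> sets borel" by simp
  have [measurable]: "\<phi> \<in> borel_measurable borel" "gradient \<phi> \<in> borel_measurable borel"
    using test_function_cont[OF \<phi>] by (auto intro: borel_measurable_continuous_onI)
  define E1 where "E1 x = ennreal ((norm (gradient \<phi> x))\<^sup>2) * indicator ?B x" for x
  define E2 where "E2 x = ennreal ((\<phi> x - G (norm x))\<^sup>2) * indicator ?B x" for x
  define P where "P x = ennreal ((2 * (real 10 - 2) / (norm x)\<^sup>2 + c) * (\<phi> x)\<^sup>2) * indicator ?B x" for x
  have [measurable]: "E1 \<in> borel_measurable borel" "E2 \<in> borel_measurable borel" "P \<in> borel_measurable borel"
    unfolding E1_def[abs_def] E2_def[abs_def] P_def[abs_def] by measurable
  have "nn_integral lborel P \<le> (\<integral>\<^sup>+x. E1 x + ennreal K * E2 x \<partial>lborel)"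
  proof (rule nn_integral_ray_mono)
    fix y :: 'a assume y: "norm y = 1"
    define g where "g r = \<phi> (r *\<^sub>R y)" for r
    define g' where "g' r = gradient \<phi> (r *\<^sub>R y) \<bullet> y" for r
    have g: "(g has_real_derivative g' t) (at t)" for t
      unfolding g_def g'_def by (rule ray_derivative(1)[OF \<phi>])
    have g'c: "continuous_on UNIV g'" unfolding g'_def by (rule ray_derivative(2)[OF \<phi>])
    have gc: "continuous_on S g" for S using DERIV_isCont[OF g] by (simp add: continuous_at_imp_continuous_on)
    have g'c': "continuous_on S g'" for S by (rule continuous_on_subset[OF g'c]) auto
    have [measurable]: "g \<in> borel_measurable borel" "g' \<in> borel_measurable borel"
      using gc g'c by (auto intro: borel_measurable_continuous_onI)
    have g1: "g 1 = 0" unfolding g_def by (rule test_function_outside(1)[OF \<phi>]) (simp add: y)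
    have iB: "indicator {0<..} r * (indicator ?B (r *\<^sub>R y) :: ennreal) = indicator {0<..<1} r" for r :: real
      using y by (auto simp: indicator_def)
    have L: "(\<integral>\<^sup>+r. indicator {0<..} r * ennreal (r ^ (DIM('a) - 1)) * P (r *\<^sub>R y) \<partial>lborel)
      = ennreal (integral {0..1} (\<lambda>r. 16 * r ^ 7 * (g r)\<^sup>2 + c * (r ^ 9 * (g r)\<^sup>2)))"
    proof -
      have "indicator {0<..} r * ennreal (r ^ (DIM('a) - 1)) * P (r *\<^sub>R y)
        = indicator {0<..<1} r * ennreal (16 * r ^ 7 * (g r)\<^sup>2 + c * (r ^ 9 * (g r)\<^sup>2))" for r
      proof (cases "0 < r")
        case True
        have "ennreal (r ^ 9) * ennreal ((2 * (real 10 - 2) / (norm (r *\<^sub>R y))\<^sup>2 + c) * (\<phi> (r *\<^sub>R y))\<^sup>2)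
          = ennreal (r ^ 9 * ((2 * (real 10 - 2) / (norm (r *\<^sub>R y))\<^sup>2 + c) * (\<phi> (r *\<^sub>R y))\<^sup>2))"
          using True c by (intro ennreal_mult[symmetric]) auto
        also have "r ^ 9 * ((2 * (real 10 - 2) / (norm (r *\<^sub>R y))\<^sup>2 + c) * (\<phi> (r *\<^sub>R y))\<^sup>2) = 16 * r ^ 7 * (g r)\<^sup>2 + c * (r ^ 9 * (g r)\<^sup>2)"
          using True y by (simp add: g_def field_simps power2_eq_square power_numeral_reduce)
        finally show ?thesis using True iB[of r] unfolding P_def N by (simp add: mult_ac)
      qed (simp add: indicator_def)
      then have "(\<integral>\<^sup>+r. indicator {0<..} r * ennreal (r ^ (DIM('a) - 1)) * P (r *\<^sub>R y) \<partial>lborel)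
        = (\<integral>\<^sup>+r. indicator {0<..<1} r * ennreal (16 * r ^ 7 * (g r)\<^sup>2 + c * (r ^ 9 * (g r)\<^sup>2)) \<partial>lborel)" by simp
      also have "\<dots> = ennreal (integral {0..1} (\<lambda>r. 16 * r ^ 7 * (g r)\<^sup>2 + c * (r ^ 9 * (g r)\<^sup>2)))"
        using c by (intro nn_integral_unit_interval integrable_continuous_interval continuous_intros gc) auto
      finally show ?thesis .
    qed
    have R1: "ennreal (integral {0..1} (\<lambda>r. r ^ 9 * (g' r)\<^sup>2)) \<le> (\<integral>\<^sup>+r. indicator {0<..} r * ennreal (r ^ (DIM('a) - 1)) * E1 (r *\<^sub>R y) \<partial>lborel)"
    proof -
      have "ennreal (integral {0..1} (\<lambda>r. r ^ 9 * (g' r)\<^sup>2)) = (\<integral>\<^sup>+r. indicator {0<..<1} r * ennreal (r ^ 9 * (g' r)\<^sup>2) \<partial>lborel)"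
        by (intro nn_integral_unit_interval[symmetric] integrable_continuous_interval continuous_intros g'c') auto
      also have "\<dots> \<le> (\<integral>\<^sup>+r. indicator {0<..} r * ennreal (r ^ (DIM('a) - 1)) * E1 (r *\<^sub>R y) \<partial>lborel)"
      proof (rule nn_integral_mono)
        fix r :: real
        have "\<bar>g' r\<bar> \<le> norm (gradient \<phi> (r *\<^sub>R y))"
          unfolding g'_def using Cauchy_Schwarz_ineq2[of "gradient \<phi> (r *\<^sub>R y)" y] y by simp
        then have "(g' r)\<^sup>2 \<le> (norm (gradient \<phi> (r *\<^sub>R y)))\<^sup>2" by (metis abs_ge_zero power2_abs power_mono)
        then have "ennreal (r ^ 9 * (g' r)\<^sup>2) \<le> ennreal (r ^ 9) * ennreal ((norm (gradient \<phi> (r *\<^sub>R y)))\<^sup>2)" if "0 < r"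
          using that by (subst ennreal_mult[symmetric]) (auto intro!: ennreal_leI mult_left_mono)
        then show "indicator {0<..<1} r * ennreal (r ^ 9 * (g' r)\<^sup>2) \<le> indicator {0<..} r * ennreal (r ^ (DIM('a) - 1)) * E1 (r *\<^sub>R y)"
          using y unfolding E1_def N by (auto simp: indicator_def)
      qed
      finally show ?thesis .
    qed
    have R2: "(\<integral>\<^sup>+r. indicator {0<..} r * ennreal (r ^ (DIM('a) - 1)) * E2 (r *\<^sub>R y) \<partial>lborel)
      = (\<integral>\<^sup>+r. ennreal (indicator {0<..<1} r * (r ^ 9 * (g r - G r)\<^sup>2)) \<partial>lborel)"
    proof (rule nn_integral_cong)
      fix r :: real
      show "indicator {0<..} r * ennreal (r ^ (DIM('a) - 1)) * E2 (r *\<^sub>R y) = ennreal (indicator {0<..<1} r * (r ^ 9 * (g r - G r)\<^sup>2))"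
        using y unfolding E2_def N g_def by (auto simp: indicator_def ennreal_mult)
    qed
    have RR: "(\<integral>\<^sup>+r. indicator {0<..} r * ennreal (r ^ (DIM('a) - 1)) * (E1 (r *\<^sub>R y) + ennreal K * E2 (r *\<^sub>R y)) \<partial>lborel)
      = (\<integral>\<^sup>+r. indicator {0<..} r * ennreal (r ^ (DIM('a) - 1)) * E1 (r *\<^sub>R y) \<partial>lborel) +
        ennreal K * (\<integral>\<^sup>+r. indicator {0<..} r * ennreal (r ^ (DIM('a) - 1)) * E2 (r *\<^sub>R y) \<partial>lborel)"
    proof -
      have "(\<integral>\<^sup>+r. indicator {0<..} r * ennreal (r ^ (DIM('a) - 1)) * (E1 (r *\<^sub>R y) + ennreal K * E2 (r *\<^sub>R y)) \<partial>lborel)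
        = (\<integral>\<^sup>+r. indicator {0<..} r * ennreal (r ^ (DIM('a) - 1)) * E1 (r *\<^sub>R y) + ennreal K * (indicator {0<..} r * ennreal (r ^ (DIM('a) - 1)) * E2 (r *\<^sub>R y)) \<partial>lborel)"
        by (intro nn_integral_cong) (simp add: distrib_left mult_ac)
      then show ?thesis by (simp add: nn_integral_add nn_integral_cmult)
    qed
    show "(\<integral>\<^sup>+r. indicator {0<..} r * ennreal (r ^ (DIM('a) - 1)) * P (r *\<^sub>R y) \<partial>lborel)
      \<le> (\<integral>\<^sup>+r. indicator {0<..} r * ennreal (r ^ (DIM('a) - 1)) * (E1 (r *\<^sub>R y) + ennreal K * E2 (r *\<^sub>R y)) \<partial>lborel)"
    proof (cases "K = 0")
      case True
      then show ?thesis unfolding RR L using ray[OF g g'c g1] R1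
        by (auto intro: order_trans[OF ennreal_leI])
    next
      case False
      show ?thesis
      proof (cases "(\<integral>\<^sup>+r. ennreal (indicator {0<..<1} r * (r ^ 9 * (g r - G r)\<^sup>2)) \<partial>lborel) = \<infinity>")
        case True
        then show ?thesis unfolding RR R2 using False K by (simp add: ennreal_mult_top)
      next
        case fin: False
        have "integrable lborel (\<lambda>r. indicator {0<..<1} r * (r ^ 9 * (g r - G r)\<^sup>2))"
          by (rule integrableI_nonneg) (use fin in \<open>auto simp: indicator_def less_top\<close>)
        note i = integrable_on_unit_interval[OF this]
        have "(\<integral>\<^sup>+r. ennreal (indicator {0<..<1} r * (r ^ 9 * (g r - G r)\<^sup>2)) \<partial>lborel) = (\<integral>\<^sup>+r. indicator {0<..<1} r * ennreal (r ^ 9 * (g r - G r)\<^sup>2) \<partial>lborel)"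
          by (intro nn_integral_cong) (auto simp: indicator_def)
        also have "\<dots> = ennreal (integral {0..1} (\<lambda>r. r ^ 9 * (g r - G r)\<^sup>2))"
          by (intro nn_integral_unit_interval i(1)) auto
        finally have e2: "(\<integral>\<^sup>+r. ennreal (indicator {0<..<1} r * (r ^ 9 * (g r - G r)\<^sup>2)) \<partial>lborel) = ennreal (integral {0..1} (\<lambda>r. r ^ 9 * (g r - G r)\<^sup>2))" .
        have n: "0 \<le> integral {0..1} (\<lambda>r. r ^ 9 * (g r - G r)\<^sup>2)" "0 \<le> integral {0..1} (\<lambda>r. r ^ 9 * (g' r)\<^sup>2)"
          using i(1) by (auto intro!: integral_nonneg integrable_continuous_interval continuous_intros g'c')
        have "ennreal (integral {0..1} (\<lambda>r. 16 * r ^ 7 * (g r)\<^sup>2 + c * (r ^ 9 * (g r)\<^sup>2)))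
          \<le> ennreal (integral {0..1} (\<lambda>r. r ^ 9 * (g' r)\<^sup>2) + K * integral {0..1} (\<lambda>r. r ^ 9 * (g r - G r)\<^sup>2))"
          using ray[OF g g'c g1] i(1) by (intro ennreal_leI) auto
        also have "\<dots> = ennreal (integral {0..1} (\<lambda>r. r ^ 9 * (g' r)\<^sup>2)) + ennreal K * ennreal (integral {0..1} (\<lambda>r. r ^ 9 * (g r - G r)\<^sup>2))"
          using n K by (simp add: ennreal_mult)
        also have "\<dots> \<le> (\<integral>\<^sup>+r. indicator {0<..} r * ennreal (r ^ (DIM('a) - 1)) * E1 (r *\<^sub>R y) \<partial>lborel) + ennreal K * ennreal (integral {0..1} (\<lambda>r. r ^ 9 * (g r - G r)\<^sup>2))"
          by (intro add_right_mono R1)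
        finally show ?thesis unfolding RR R2 L e2 .
      qed
    qed
  qed measurable
  also have "\<dots> = nn_integral lborel E1 + ennreal K * nn_integral lborel E2"
    by (simp add: nn_integral_add nn_integral_cmult)
  finally show ?thesis
    unfolding nn_integral_lebesgue_on[OF sets_ball_norm] E1_def E2_def P_def .
qed

lemma stable_H10:
  fixes \<xi> :: "'a::euclidean_space \<Rightarrow> real"
  assumes N: "DIM('a) = 10" and h: "- 16 < h" "h \<le> bes_zero" and \<xi>: "\<xi> \<in> H10 (ball 0 1)"
  shows "0 \<le> Q_form (lambda_sing 10 h) (a_coef 10 h) (U_sing h) \<xi>"
proof (rule H10_form_nonneg[where c="max 0 h" and K=0, OF N])
  fix \<phi> :: "'a \<Rightarrow> real" assume \<phi>: "test_function (ball 0 1) \<phi>"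
  have "(\<integral>\<^sup>+x. ennreal ((2 * (real 10 - 2) / (norm x)\<^sup>2 + max 0 h) * (\<phi> x)\<^sup>2) \<partial>lebesgue_on (ball 0 1)) \<le>
      (\<integral>\<^sup>+x. ennreal ((norm (gradient \<phi> x))\<^sup>2) \<partial>lebesgue_on (ball 0 1)) +
      ennreal 0 * (\<integral>\<^sup>+x. ennreal ((\<phi> x - (\<lambda>_. 0) (norm x))\<^sup>2) \<partial>lebesgue_on (ball 0 1))"
    using ray_hardy[of "max 0 h"] h bes_zero_pos by (intro hardy_transfer[OF N \<phi>]) auto
  then show "(\<integral>\<^sup>+x. ennreal ((2 * (real 10 - 2) / (norm x)\<^sup>2 + max 0 h) * (\<phi> x)\<^sup>2) \<partial>lebesgue_on (ball 0 1)) \<le>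
      (\<integral>\<^sup>+x. ennreal ((norm (gradient \<phi> x))\<^sup>2) \<partial>lebesgue_on (ball 0 1)) +
      ennreal 0 * (\<integral>\<^sup>+x. ennreal ((\<phi> x - \<xi> x)\<^sup>2) \<partial>lebesgue_on (ball 0 1))" by simp
qed (use h \<xi> in auto)

text \<open>Three changes of representative: the extension by zero, a Borel version of it, and a
  Borel radial profile of that. The integrability is that of \<xi>^2 written in polar
  coordinates.\<close>

lemma H10_rad_profile:
  fixes \<xi> :: "'a::euclidean_space \<Rightarrow> real"
  assumes "\<xi> \<in> H10_rad"
  obtains G where "G \<in> borel_measurable borel" "AE x in lebesgue_on (ball 0 1). \<xi> x = G (norm x)"
    "integrable lborel (\<lambda>r. indicator {0<..<1} r * (r ^ (DIM('a) - 1) * (G r)\<^sup>2))"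
proof -
  let ?B = "ball (0::'a) 1" and ?M = "lebesgue_on (ball (0::'a) 1)"
  have H: "\<xi> \<in> H10 ?B" and "\<exists>g. AE x in ?M. \<xi> x = g (norm x)" using assms by (auto simp: H10_rad_def)
  then obtain g where g: "AE x in ?M. \<xi> x = g (norm x)" by blast
  have L2: "L2_on ?B \<xi>" using H by (auto simp: H10_def H1_def is_weak_gradient_def)
  then have \<xi>m: "\<xi> \<in> borel_measurable ?M" and \<xi>2: "integrable ?M (\<lambda>x. (\<xi> x)\<^sup>2)" by (auto simp: L2_on_def)
  have "(\<lambda>x. indicator ?B x * \<xi> x) \<in> borel_measurable (completion lborel)"
    using \<xi>m by (subst (asm) borel_measurable_restrict_space_iff) (auto simp: mult.commute)
  from completion_ex_borel_measurable_real[OF this]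
  obtain f where f[measurable]: "f \<in> borel_measurable lborel" and fe: "AE x in lborel. indicator ?B x * \<xi> x = f x" by blast
  have "AE x in lborel. x \<in> ?B \<longrightarrow> \<xi> x = g (norm x)" using g by (simp add: AE_lebesgue_on_iff)
  then have "AE x in lborel. f x = (if norm x < 1 then g (norm x) else 0)"
    using fe by eventually_elim (auto simp: indicator_def split: if_splits)
  then obtain G where G[measurable]: "G \<in> borel_measurable borel" and Ge: "AE x::'a in lborel. f x = G (norm x)"
    using radial_representative[of f "\<lambda>r. if r < 1 then g r else 0"] f by auto
  have e: "AE x in ?M. \<xi> x = G (norm x)"
    unfolding AE_lebesgue_on_iff[OF sets_ball_norm] using fe Ge by eventually_elim (auto simp: indicator_def)
  have [measurable]: "?B \<in> sets borel" by simp
  have "integrable ?M (\<lambda>x. (G (norm x))\<^sup>2)"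
  proof (subst integrable_cong_AE[symmetric, where f="\<lambda>x. (\<xi> x)\<^sup>2"])
    show "(\<lambda>x. (\<xi> x)\<^sup>2) \<in> borel_measurable ?M" using \<xi>m by measurable
    show "(\<lambda>x::'a. (G (norm x))\<^sup>2) \<in> borel_measurable ?M"
      by (intro measurable_restrict_space1 measurable_completion) measurable
    show "AE x in ?M. (\<xi> x)\<^sup>2 = (G (norm x))\<^sup>2" using e by eventually_elim simp
  qed (rule \<xi>2)
  then have "integrable lborel (\<lambda>x::'a. indicator ?B x * (G (norm x))\<^sup>2)"
    by (subst (asm) integrable_lebesgue_on_borel) measurable
  moreover have "(\<lambda>x::'a. indicator ?B x * (G (norm x))\<^sup>2) = (\<lambda>x. (\<lambda>r. indicator {..<1} r * (G r)\<^sup>2) (norm x))"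
    by (auto simp: indicator_def)
  ultimately have "integrable lborel (\<lambda>x::'a. (\<lambda>r. indicator {..<1} r * (G r)\<^sup>2) (norm x))" by simp
  then have "integrable lborel (\<lambda>r. indicator {0<..} r * (r ^ (DIM('a) - 1) * (indicator {..<1} r * (G r)\<^sup>2)))"
    by (subst (asm) radial_integral(1)) measurable
  moreover have "(\<lambda>r. indicator {0<..} r * (r ^ (DIM('a) - 1) * (indicator {..<1} r * (G r)\<^sup>2))) = (\<lambda>r. indicator {0<..<1} r * (r ^ (DIM('a) - 1) * (G r)\<^sup>2))"
    by (auto simp: indicator_def)
  ultimately have "integrable lborel (\<lambda>r. indicator {0<..<1} r * (r ^ (DIM('a) - 1) * (G r)\<^sup>2))" by simp
  with G e show ?thesis by (rule that)
qed

text \<open>In dimension 10 the weight |x|^(-4) turns the volume element r^9 dr into r^5 dr. For a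
  radial function with profile G this is, up to a constant factor, the integral of r^5 G over a
  subinterval, whose vanishing \<open>ray_poincare\<close> asks for.\<close>

definition shell_mean :: "nat \<Rightarrow> nat \<Rightarrow> ('a::euclidean_space \<Rightarrow> real) \<Rightarrow> real" where
  "shell_mean M i \<xi> = (\<integral>x. indicator {real i / real M..real (Suc i) / real M} (norm x) / (norm x) ^ 4 * \<xi> x \<partial>lebesgue_on (ball 0 1))"

text \<open>The weight |x|^(-4) is square integrable on the ball, as r^9 r^(-8) = r, so its product
  with an L^2 function is integrable. Without this the shell means would not be additive.\<close>

lemma shell_weight_integrable:
  fixes \<xi> :: "'a::euclidean_space \<Rightarrow> real"
  assumes N: "DIM('a) = 10" and \<xi>: "L2_on (ball 0 1) \<xi>" and I: "I \<in> sets borel"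
  shows "integrable (lebesgue_on (ball 0 1)) (\<lambda>x. indicator I (norm x) / (norm x) ^ 4 * \<xi> x)"
proof -
  let ?M = "lebesgue_on (ball (0::'a) 1)"
  have [measurable]: "I \<in> sets borel" "ball (0::'a) 1 \<in> sets borel" using I by auto
  have [measurable]: "\<xi> \<in> borel_measurable ?M" using \<xi> by (simp add: L2_on_def)
  have [measurable]: "(\<lambda>x::'a. norm x) \<in> borel_measurable ?M"
    by (intro measurable_restrict_space1 measurable_completion) measurable
  have "integrable lborel (\<lambda>r::real. indicator {0<..} r * (r ^ (DIM('a) - 1) * (indicator {..<1} r / r ^ 8)))"
  proof -
    have "integrable lborel (\<lambda>r::real. indicator {0..1} r *\<^sub>R r)"
      by (intro borel_integrable_compact continuous_intros) auto
    then have "integrable lborel (\<lambda>r::real. indicator {0<..<1} r * r)"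
      by (rule Bochner_Integration.integrable_bound) (auto simp: indicator_def)
    moreover have "(\<lambda>r::real. indicator {0<..} r * (r ^ (DIM('a) - 1) * (indicator {..<1} r / r ^ 8))) = (\<lambda>r. indicator {0<..<1} r * r)"
      by (auto simp: indicator_def N power_numeral_reduce)
    ultimately show ?thesis by simp
  qed
  then have "integrable lborel (\<lambda>x::'a. (\<lambda>r. indicator {..<1} r / r ^ 8) (norm x))"
    by (subst radial_integral(1)) measurable
  moreover have "(\<lambda>x::'a. (\<lambda>r. indicator {..<1} r / r ^ 8) (norm x)) = (\<lambda>x. indicator (ball 0 1) x * (1 / norm x ^ 8))"
    by (auto simp: indicator_def)
  ultimately have i8: "integrable ?M (\<lambda>x. 1 / norm x ^ 8)"
    by (subst integrable_lebesgue_on_borel) auto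
  show ?thesis
  proof (rule Bochner_Integration.integrable_bound)
    show "integrable ?M (\<lambda>x. 1 / norm x ^ 8 + (\<xi> x)\<^sup>2)" using i8 \<xi> by (auto simp: L2_on_def)
    show "AE x in ?M. norm (indicator I (norm x) / norm x ^ 4 * \<xi> x) \<le> norm (1 / norm x ^ 8 + (\<xi> x)\<^sup>2)"
    proof (rule AE_I2)
      fix x :: 'a
      have "2 * (1 / norm x ^ 4) * \<bar>\<xi> x\<bar> \<le> (1 / norm x ^ 4)\<^sup>2 + \<bar>\<xi> x\<bar>\<^sup>2" by (rule sum_squares_bound)
      also have "\<dots> = 1 / norm x ^ 8 + (\<xi> x)\<^sup>2" by (simp add: power_divide flip: power_mult)
      finally have "2 * (1 / norm x ^ 4 * \<bar>\<xi> x\<bar>) \<le> 1 / norm x ^ 8 + (\<xi> x)\<^sup>2" by simp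
      moreover have "0 \<le> 1 / norm x ^ 4 * \<bar>\<xi> x\<bar>" by simp
      ultimately have "1 / norm x ^ 4 * \<bar>\<xi> x\<bar> \<le> 1 / norm x ^ 8 + (\<xi> x)\<^sup>2" by linarith
      moreover have "norm (indicator I (norm x) / norm x ^ 4 * \<xi> x) \<le> 1 / norm x ^ 4 * \<bar>\<xi> x\<bar>"
        by (simp add: indicator_def abs_mult)
      ultimately show "norm (indicator I (norm x) / norm x ^ 4 * \<xi> x) \<le> norm (1 / norm x ^ 8 + (\<xi> x)\<^sup>2)" by simp
    qed
  qed measurable
qed

text \<open>The conditions bind \<xi>, not the test functions that approximate it in
  \<open>H10\<close>. So the ray inequality is used with the distance from \<phi> to the profile of
  \<xi> as an error term, which disappears in the limit.\<close>

lemma H10_form_nonneg_of_shell_means: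
  fixes \<xi> :: "'a::euclidean_space \<Rightarrow> real"
  assumes N: "DIM('a) = 10" and h: "- 16 < h" and M: "0 < M" "4 * max 0 h \<le> (real M)\<^sup>2" and \<xi>: "\<xi> \<in> H10_rad"
    and z: "\<And>i. i < M \<Longrightarrow> shell_mean M i \<xi> = 0"
  shows "0 \<le> Q_form (lambda_sing 10 h) (a_coef 10 h) (U_sing h) \<xi>"
proof -
  let ?M = "lebesgue_on (ball (0::'a) 1)"
  obtain G where G[measurable]: "G \<in> borel_measurable borel" and e: "AE x in ?M. \<xi> x = G (norm x)"
    and G2: "integrable lborel (\<lambda>r. indicator {0<..<1} r * (r ^ (DIM('a) - 1) * (G r)\<^sup>2))"
    by (rule H10_rad_profile[OF \<xi>])
  have \<xi>H: "\<xi> \<in> H10 (ball 0 1)" using \<xi> by (simp add: H10_rad_def)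
  have L2: "L2_on (ball 0 1) \<xi>" using \<xi>H by (auto simp: H10_def H1_def is_weak_gradient_def)
  have [measurable]: "ball (0::'a) 1 \<in> sets borel" by simp
  have [measurable]: "\<xi> \<in> borel_measurable ?M" using L2 by (simp add: L2_on_def)
  have [measurable]: "(\<lambda>x::'a. norm x) \<in> borel_measurable ?M"
    by (intro measurable_restrict_space1 measurable_completion) measurable
  have i5: "integrable lborel (\<lambda>r. indicator {0<..<1} r * (r ^ 5 * G r))"
  proof (rule Bochner_Integration.integrable_bound)
    have "integrable lborel (\<lambda>r::real. indicator {0..1} r *\<^sub>R r)" by (intro borel_integrable_compact continuous_intros) auto
    then show "integrable lborel (\<lambda>r::real. indicator {0..1} r *\<^sub>R r + indicator {0<..<1} r * (r ^ (DIM('a) - 1) * (G r)\<^sup>2))"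
      using G2 by auto
    show "AE r in lborel. norm (indicator {0<..<1} r * (r ^ 5 * G r)) \<le> norm (indicator {0..1} r *\<^sub>R r + indicator {0<..<1} r * (r ^ (DIM('a) - 1) * (G r)\<^sup>2))"
    proof (rule AE_I2)
      fix r :: real
      have "r ^ 5 * \<bar>G r\<bar> \<le> r + r ^ 9 * (G r)\<^sup>2" if "0 < r"
      proof -
        have "r * (2 * 1 * (r ^ 4 * \<bar>G r\<bar>)) \<le> r * (1\<^sup>2 + (r ^ 4 * \<bar>G r\<bar>)\<^sup>2)"
          using that by (intro mult_left_mono sum_squares_bound) auto
        also have "\<dots> = r + r ^ 9 * (G r)\<^sup>2" by (simp add: power_mult_distrib algebra_simps power_numeral_reduce)
        finally have "2 * (r ^ 5 * \<bar>G r\<bar>) \<le> r + r ^ 9 * (G r)\<^sup>2" by (simp add: power_numeral_reduce mult.assoc)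
        moreover have "0 \<le> r ^ 5 * \<bar>G r\<bar>" using that by simp
        ultimately show ?thesis by linarith
      qed
      then show "norm (indicator {0<..<1} r * (r ^ 5 * G r)) \<le> norm (indicator {0..1} r *\<^sub>R r + indicator {0<..<1} r * (r ^ (DIM('a) - 1) * (G r)\<^sup>2))"
        by (auto simp: indicator_def N abs_mult)
    qed
  qed measurable
  note G5 = integrable_on_unit_interval(1)[OF i5]
  have Gz: "integral {real i / real M..real (Suc i) / real M} (\<lambda>r. r ^ 5 * G r) = 0" if i: "i < M" for i
  proof -
    let ?I = "{real i / real M..real (Suc i) / real M}"
    have sub: "?I \<subseteq> {0..1}" using i M by (auto simp: divide_le_eq_1 intro: order_trans)
    have "0 = shell_mean M i \<xi>" using z[OF i] by simp
    also have "\<dots> = (\<integral>x. indicator ?I (norm x) / (norm x) ^ 4 * G (norm x) \<partial>?M)"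
      unfolding shell_mean_def
    proof (rule integral_cong_AE)
      show "AE x in ?M. indicator ?I (norm x) / (norm x) ^ 4 * \<xi> x = indicator ?I (norm x) / (norm x) ^ 4 * G (norm x)"
        using e by eventually_elim simp
    qed measurable
    also have "\<dots> = (\<integral>(x::'a). indicator (ball 0 1) x * (indicator ?I (norm x) / (norm x) ^ 4 * G (norm x)) \<partial>lborel)"
      by (rule integral_lebesgue_on_borel) measurable
    also have "\<dots> = (\<integral>(x::'a). (\<lambda>r. indicator {..<1} r * (indicator ?I r / r ^ 4 * G r)) (norm x) \<partial>lborel)"
      by (intro Bochner_Integration.integral_cong) (auto simp: indicator_def)
    also have "\<dots> = sphere_area TYPE('a) * (\<integral>r. indicator {0<..} r * (r ^ (DIM('a) - 1) * (indicator {..<1} r * (indicator ?I r / r ^ 4 * G r))) \<partial>lborel)"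
      by (rule radial_integral(2)) measurable
    also have "(\<lambda>r. indicator {0<..} r * (r ^ (DIM('a) - 1) * (indicator {..<1} r * (indicator ?I r / r ^ 4 * G r)))) = (\<lambda>r. indicator {0<..<1} r * (indicator ?I r * (r ^ 5 * G r)))"
      by (auto simp: indicator_def N power_numeral_reduce)
    finally have "(\<integral>r. indicator {0<..<1} r * (indicator ?I r * (r ^ 5 * G r)) \<partial>lborel) = 0"
      using sphere_area_pos[where 'a='a] by simp
    moreover have "integrable lborel (\<lambda>r. indicator {0<..<1} r * (indicator ?I r * (r ^ 5 * G r)))"
      by (rule Bochner_Integration.integrable_bound[OF i5]) (auto simp: indicator_def)
    ultimately have "integral {0..1} (\<lambda>r. indicator ?I r * (r ^ 5 * G r)) = 0"
      using integrable_on_unit_interval(2) by metis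
    moreover have "(\<lambda>r. indicator ?I r * (r ^ 5 * G r)) = (\<lambda>r. if r \<in> ?I then r ^ 5 * G r else 0)" by (auto simp: indicator_def)
    ultimately have "integral {0..1} (\<lambda>r. if r \<in> ?I then r ^ 5 * G r else 0) = 0" by (simp only:)
    moreover have "integral {0..1} (\<lambda>r. if r \<in> ?I then r ^ 5 * G r else 0) = integral ?I (\<lambda>r. r ^ 5 * G r)"
      by (simp only: integral_restrict_Int Int_absorb2[OF sub])
    ultimately show ?thesis by (simp only:)
  qed
  show ?thesis
  proof (rule H10_form_nonneg[where c="max 0 h" and K="max 0 h", OF N])
    fix \<phi> :: "'a \<Rightarrow> real" assume \<phi>: "test_function (ball 0 1) \<phi>"
    have "(\<integral>\<^sup>+x. ennreal ((2 * (real 10 - 2) / (norm x)\<^sup>2 + max 0 h) * (\<phi> x)\<^sup>2) \<partial>?M) \<le>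
      (\<integral>\<^sup>+x. ennreal ((norm (gradient \<phi> x))\<^sup>2) \<partial>?M) + ennreal (max 0 h) * (\<integral>\<^sup>+x. ennreal ((\<phi> x - G (norm x))\<^sup>2) \<partial>?M)"
    proof (rule hardy_transfer[OF N \<phi> _ _ G])
      fix g g' assume g: "\<And>t. (g has_real_derivative g' t) (at t)" "continuous_on UNIV g'" "g 1 = 0"
        "(\<lambda>r. r ^ 9 * (g r - G r)\<^sup>2) integrable_on {0..1} \<or> max 0 h = 0"
      show "integral {0..1} (\<lambda>r. 16 * r ^ 7 * (g r)\<^sup>2 + max 0 h * (r ^ 9 * (g r)\<^sup>2)) \<le>
        integral {0..1} (\<lambda>r. r ^ 9 * (g' r)\<^sup>2) + max 0 h * integral {0..1} (\<lambda>r. r ^ 9 * (g r - G r)\<^sup>2)"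
      proof (cases "max 0 h = 0")
        case True
        then show ?thesis using ray_hardy[of 0 g g'] g bes_zero_pos by simp
      next
        case False
        with g(4) have int: "(\<lambda>r. r ^ 9 * (g r - G r)\<^sup>2) integrable_on {0..1}" by blast
        show ?thesis by (rule ray_poincare[OF M(1) _ M(2) g(1-3) G5 int Gz]) auto
      qed
    qed auto
    also have "(\<integral>\<^sup>+x. ennreal ((\<phi> x - G (norm x))\<^sup>2) \<partial>?M) = (\<integral>\<^sup>+x. ennreal ((\<phi> x - \<xi> x)\<^sup>2) \<partial>?M)"
      by (rule nn_integral_cong_AE) (use e in eventually_elim, simp)
    finally show "(\<integral>\<^sup>+x. ennreal ((2 * (real 10 - 2) / (norm x)\<^sup>2 + max 0 h) * (\<phi> x)\<^sup>2) \<partial>?M) \<le>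
      (\<integral>\<^sup>+x. ennreal ((norm (gradient \<phi> x))\<^sup>2) \<partial>?M) + ennreal (max 0 h) * (\<integral>\<^sup>+x. ennreal ((\<phi> x - \<xi> x)\<^sup>2) \<partial>?M)" .
  qed (use h \<xi>H in auto)
qed

section \<open>Counting the dimension of negative subspaces\<close>

lemma vector_space_fun_scale: "vector_space (fun_scale :: real \<Rightarrow> ('a \<Rightarrow> real) \<Rightarrow> 'a \<Rightarrow> real)"
  by unfold_locales (auto simp: fun_scale_def fun_eq_iff algebra_simps)

interpretation fun_scale: vector_space "fun_scale :: real \<Rightarrow> ('a \<Rightarrow> real) \<Rightarrow> 'a \<Rightarrow> real"
  by (rule vector_space_fun_scale)

lemma sum_fun_apply: "(\<Sum>i\<in>I. f i) x = (\<Sum>i\<in>I. f i x :: real)"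
  by (induction I rule: infinite_finite_induct) auto

text \<open>The functionals embed X into R^M. In the induction the last functional either vanishes
  on X, or its kernel in X is completed by a single vector e. Linearity is asked on X only, because
  integrals are additive only for integrable functions.\<close>

lemma finite_span_of_functionals:
  fixes X :: "('a \<Rightarrow> real) set"
  assumes "fun_scale.subspace X"
    and "\<And>i x y. i < M \<Longrightarrow> x \<in> X \<Longrightarrow> y \<in> X \<Longrightarrow> l i (x + y) = l i x + (l i y :: real)"
    and "\<And>i c x. i < M \<Longrightarrow> x \<in> X \<Longrightarrow> l i (fun_scale c x) = c * l i x"
    and "\<And>x. x \<in> X \<Longrightarrow> (\<And>i. i < M \<Longrightarrow> l i x = 0) \<Longrightarrow> x = 0"
  shows "\<exists>B. finite B \<and> card B \<le> M \<and> fun_scale.span B = X"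
  using assms
proof (induction M arbitrary: X)
  case 0
  have "x = 0" if "x \<in> X" for x using 0(4)[OF that] by blast
  moreover have "0 \<in> X" using 0(1) by (rule fun_scale.subspace_0)
  ultimately have "X = {0}" by blast
  then show ?case by (intro exI[of _ "{}"]) auto
next
  case (Suc M)
  note sub = Suc.prems(1)
  show ?case
  proof (cases "\<forall>x\<in>X. l M x = 0")
    case True
    have "\<exists>B. finite B \<and> card B \<le> M \<and> fun_scale.span B = X"
    proof (rule Suc.IH[OF sub])
      fix x assume x: "x \<in> X" "\<And>i. i < M \<Longrightarrow> l i x = 0"
      show "x = 0"
      proof (rule Suc.prems(4)[OF x(1)])
        fix i assume "i < Suc M"
        then show "l i x = 0" using x True by (cases "i = M") auto
      qed
    qed (use Suc.prems in auto)
    then show ?thesis using le_SucI by blast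
  next
    case False
    then obtain e where e: "e \<in> X" "l M e \<noteq> 0" by blast
    define X' where "X' = {x \<in> X. l M x = 0}"
    have l0: "l M 0 = 0"
    proof -
      have "l M (fun_scale 0 0) = 0 * l M 0" by (rule Suc.prems(3)[OF lessI fun_scale.subspace_0[OF sub]])
      then show ?thesis by (simp only: fun_scale.scale_zero_left mult_zero_left)
    qed
    have "fun_scale.subspace X'"
    proof (rule fun_scale.subspaceI)
      show "0 \<in> X'" using fun_scale.subspace_0[OF sub] l0 by (simp only: X'_def mem_Collect_eq simp_thms)
      fix x y assume x: "x \<in> X'" and y: "y \<in> X'"
      have "l M (x + y) = l M x + l M y" using x y unfolding X'_def by (intro Suc.prems(2)[OF lessI]; blast)
      moreover have "l M x = 0" "l M y = 0" using x y unfolding X'_def by blast+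
      ultimately have "l M (x + y) = 0" by linarith
      then show "x + y \<in> X'" using fun_scale.subspace_add[OF sub, of x y] x y unfolding X'_def by blast
    next
      fix c x assume x: "x \<in> X'"
      have "l M (fun_scale c x) = c * l M x" using x unfolding X'_def by (intro Suc.prems(3)[OF lessI]; blast)
      moreover have "l M x = 0" using x unfolding X'_def by blast
      ultimately have "l M (fun_scale c x) = 0" by (metis mult_zero_right)
      then show "fun_scale c x \<in> X'" using fun_scale.subspace_scale[OF sub, of x c] x unfolding X'_def by blast
    qed
    then have "\<exists>B. finite B \<and> card B \<le> M \<and> fun_scale.span B = X'"
    proof (rule Suc.IH)
      fix x assume x: "x \<in> X'" "\<And>i. i < M \<Longrightarrow> l i x = 0"
      show "x = 0"
      proof (rule Suc.prems(4))
        show "x \<in> X" using x by (simp add: X'_def)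
        fix i assume "i < Suc M"
        then show "l i x = 0" using x by (cases "i = M") (auto simp: X'_def)
      qed
    qed (use Suc.prems in \<open>auto simp: X'_def\<close>)
    then obtain B where B: "finite B" "card B \<le> M" "fun_scale.span B = X'" by blast
    have "fun_scale.span (insert e B) = X"
    proof
      have "B \<subseteq> X" using B(3) fun_scale.span_superset[of B] by (auto simp: X'_def)
      then show "fun_scale.span (insert e B) \<subseteq> X" using e sub by (intro fun_scale.span_minimal) auto
      show "X \<subseteq> fun_scale.span (insert e B)"
      proof
        fix x assume x: "x \<in> X"
        define c d where "c = l M x / l M e" and "d = - c"
        have ce: "fun_scale d e \<in> X" by (rule fun_scale.subspace_scale[OF sub e(1)])
        define y where "y = x + fun_scale d e"
        have yX: "y \<in> X" unfolding y_def by (rule fun_scale.subspace_add[OF sub x ce])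
        have "l M y = l M x + l M (fun_scale d e)" unfolding y_def by (rule Suc.prems(2)[OF lessI x ce])
        moreover have "l M (fun_scale d e) = d * l M e" by (rule Suc.prems(3)[OF lessI e(1)])
        moreover have "d * l M e = - l M x" using e(2) by (simp add: d_def c_def)
        ultimately have "l M y = 0" by linarith
        then have "y \<in> fun_scale.span B" using yX by (simp add: B(3) X'_def)
        then have 1: "y \<in> fun_scale.span (insert e B)"
          using fun_scale.span_mono[of B "insert e B"] by auto
        have 2: "fun_scale c e \<in> fun_scale.span (insert e B)"
          by (intro fun_scale.span_scale fun_scale.span_base) simp
        have "y + fun_scale c e = x" by (simp add: y_def d_def fun_scale_def fun_eq_iff)
        then show "x \<in> fun_scale.span (insert e B)" using fun_scale.span_add[OF 1 2] by metis
      qed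
    qed
    moreover have "finite (insert e B)" "card (insert e B) \<le> Suc M"
      using B by (auto simp: card_insert_if)
    ultimately show ?thesis by blast
  qed
qed

lemma fun_edim_le:
  assumes "finite B" "card B \<le> M" "fun_scale.span B = X"
  shows "fun_edim X \<le> enat M"
proof -
  have "fun_scale.dim X \<le> card B" using assms by (intro fun_scale.dim_le_card) auto
  then show ?thesis using assms by (auto simp: fun_edim_def)
qed

text \<open>In a subspace where the form is negative, a common zero of the functionals must be 0, so
  the dimension is at most their number.\<close>

lemma morse_index_le:
  fixes U :: "'a::euclidean_space \<Rightarrow> real"
  assumes add: "\<And>i x y. i < M \<Longrightarrow> x \<in> H10_rad \<Longrightarrow> y \<in> H10_rad \<Longrightarrow> l i (x + y) = l i x + (l i y :: real)"
    and scale: "\<And>i c x. i < M \<Longrightarrow> x \<in> H10_rad \<Longrightarrow> l i (fun_scale c x) = c * l i x"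
    and nn: "\<And>\<xi>. \<xi> \<in> H10_rad \<Longrightarrow> (\<And>i. i < M \<Longrightarrow> l i \<xi> = 0) \<Longrightarrow> 0 \<le> Q_form lam a U \<xi>"
  shows "morse_index lam a U \<le> enat M"
  unfolding morse_index_def
proof (rule Sup_least)
  fix d assume "d \<in> {fun_edim X |X. module.subspace fun_scale X \<and> X \<subseteq> H10_rad \<and> (\<forall>\<xi>\<in>X - {0}. Q_form lam a U \<xi> < 0)}"
  then obtain X where X: "d = fun_edim X" "fun_scale.subspace X" "X \<subseteq> H10_rad" "\<And>\<xi>. \<xi> \<in> X - {0} \<Longrightarrow> Q_form lam a U \<xi> < 0"
    by auto
  have "\<exists>B. finite B \<and> card B \<le> M \<and> fun_scale.span B = X"
  proof (rule finite_span_of_functionals[OF X(2)])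
    fix x assume x: "x \<in> X" "\<And>i. i < M \<Longrightarrow> l i x = 0"
    show "x = 0" using nn[of x] X(3,4) x by force
  next
    fix i x y assume "i < M" "x \<in> X" "y \<in> X"
    then show "l i (x + y) = l i x + l i y" using add[of i x y] X(3) by blast
  next
    fix i c x assume "i < M" "x \<in> X"
    then show "l i (fun_scale c x) = c * l i x" using scale[of i x c] X(3) by blast
  qed
  then show "d \<le> enat M" using fun_edim_le X(1) by blast
qed

lemma morse_index_ge:
  fixes U :: "'a::euclidean_space \<Rightarrow> real"
  assumes B: "finite B" "\<not> fun_scale.dependent B" "fun_scale.span B \<subseteq> H10_rad"
    and neg: "\<And>\<xi>. \<xi> \<in> fun_scale.span B \<Longrightarrow> \<xi> \<noteq> 0 \<Longrightarrow> Q_form lam a U \<xi> < 0"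
  shows "enat (card B) \<le> morse_index lam a U"
proof -
  have "fun_edim (fun_scale.span B) = enat (card B)"
    using B fun_scale.dim_eq_card_independent[OF B(2)] by (auto simp: fun_edim_def)
  moreover have "fun_edim (fun_scale.span B) \<le> morse_index lam a U"
    unfolding morse_index_def by (rule Sup_upper) (use B neg fun_scale.subspace_span in auto)
  ultimately show ?thesis by simp
qed

theorem morse_index_finite:
  assumes N: "DIM('a::euclidean_space) = 10" and h: "- 16 < h"
  shows "morse_index (lambda_sing 10 h) (a_coef 10 h) (U_sing h :: 'a \<Rightarrow> real) < \<infinity>"
proof -
  \<comment> \<open>The summand 1 ensures M >= 1, hence M^2 >= M >= 4 max 0 h.\<close>
  obtain M :: nat where "4 * max 0 h + 1 \<le> real M" using real_arch_simple by blast
  then have M1: "1 \<le> real M" "4 * max 0 h \<le> real M" by auto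
  then have "real M * 1 \<le> real M * real M" by (intro mult_left_mono) auto
  then have "4 * max 0 h \<le> (real M)\<^sup>2" using M1 unfolding power2_eq_square by linarith
  moreover have "0 < M" using M1 by simp
  ultimately have M: "0 < M" "4 * max 0 h \<le> (real M)\<^sup>2" by blast+
  have L2: "L2_on (ball 0 1) \<xi>" if "\<xi> \<in> H10_rad" for \<xi> :: "'a \<Rightarrow> real"
    using that by (auto simp: H10_rad_def H10_def H1_def is_weak_gradient_def)
  have "morse_index (lambda_sing 10 h) (a_coef 10 h) (U_sing h :: 'a \<Rightarrow> real) \<le> enat M"
  proof (rule morse_index_le[where l="shell_mean M"])
    fix i and x y :: "'a \<Rightarrow> real" assume "x \<in> H10_rad" "y \<in> H10_rad"
    then show "shell_mean M i (x + y) = shell_mean M i x + shell_mean M i y"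
      unfolding shell_mean_def plus_fun_apply distrib_left
      by (intro Bochner_Integration.integral_add shell_weight_integrable N L2) auto
  next
    fix i c and x :: "'a \<Rightarrow> real"
    have "shell_mean M i (fun_scale c x) = (\<integral>z. c * (indicator {real i / real M..real (Suc i) / real M} (norm z) / (norm z) ^ 4 * x z) \<partial>lebesgue_on (ball 0 1))"
      unfolding shell_mean_def fun_scale_def by (intro Bochner_Integration.integral_cong) auto
    also have "\<dots> = c * shell_mean M i x" unfolding shell_mean_def by (rule integral_mult_right_zero)
    finally show "shell_mean M i (fun_scale c x) = c * shell_mean M i x" .
  qed (rule H10_form_nonneg_of_shell_means[OF N h M])
  then show ?thesis using enat_ord_code(4) order_le_less_trans by blast
qed

theorem morse_index_zero:
  assumes N: "DIM('a::euclidean_space) = 10" and h: "- 16 < h" "h \<le> bes_zero"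
  shows "morse_index (lambda_sing 10 h) (a_coef 10 h) (U_sing h :: 'a \<Rightarrow> real) = 0"
    and "stable_solution (lambda_sing 10 h) (a_coef 10 h) (U_sing h :: 'a \<Rightarrow> real)"
proof -
  have "morse_index (lambda_sing 10 h) (a_coef 10 h) (U_sing h :: 'a \<Rightarrow> real) \<le> enat 0"
    by (rule morse_index_le[where l="\<lambda>_ _. 0"]) (use stable_H10[OF N h] in \<open>auto simp: H10_rad_def\<close>)
  then show "morse_index (lambda_sing 10 h) (a_coef 10 h) (U_sing h :: 'a \<Rightarrow> real) = 0" by (simp add: enat_0)
  show "stable_solution (lambda_sing 10 h) (a_coef 10 h) (U_sing h :: 'a \<Rightarrow> real)"
    unfolding stable_solution_def using stable_H10[OF N h] test_function_H10 by blast
qed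

section \<open>Energies of compactly supported radial test functions\<close>

definition radial_energy :: "nat \<Rightarrow> real \<Rightarrow> real \<Rightarrow> (real \<Rightarrow> real) \<Rightarrow> real" where
  "radial_energy N h \<rho> g = integral {\<rho>..1} (\<lambda>r. r ^ (N - 1) *
     (4 * r\<^sup>2 * (deriv g (r\<^sup>2))\<^sup>2 - (2 * (real N - 2) / r\<^sup>2 + h) * (g (r\<^sup>2))\<^sup>2))"

text \<open>Profiles are functions of s = r^2, so that g(|x|^2) inherits smoothness without
  conditions at the origin and has gradient 2 g'(s) x. The scales differ: \<rho> is a radius,
  \<sigma> a value of s.\<close>

definition radial_profile :: "real \<Rightarrow> real \<Rightarrow> (real \<Rightarrow> real) \<Rightarrow> bool" where
  "radial_profile \<rho> \<sigma> g \<longleftrightarrow> (\<forall>k. Ck_on k UNIV g) \<and> (\<forall>s. s \<le> \<rho>\<^sup>2 \<longrightarrow> g s = 0) \<and> (\<forall>s. \<sigma> \<le> s \<longrightarrow> g s = 0)"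

lemma radial_profile_deriv:
  assumes "radial_profile \<rho> \<sigma> g"
  shows "(g has_real_derivative deriv g s) (at s)" "continuous_on S g" "continuous_on S (deriv g)"
    and "s < \<rho>\<^sup>2 \<Longrightarrow> deriv g s = 0" "\<sigma> < s \<Longrightarrow> deriv g s = 0"
proof -
  have C: "Ck_on k UNIV g" for k using assms by (simp add: radial_profile_def)
  show d: "(g has_real_derivative deriv g s) (at s)" for s by (rule Ck_on_real_deriv(2)[OF C open_UNIV UNIV_I])
  show "continuous_on S g" by (rule continuous_on_subset[OF Ck_on_continuous[OF C]]) auto
  show "continuous_on S (deriv g)"
    by (rule continuous_on_subset[OF Ck_on_continuous[OF Ck_on_real_deriv(1)[OF C open_UNIV]]]) auto
  have z: "deriv g s = 0" if "open T" "s \<in> T" "\<And>t. t \<in> T \<Longrightarrow> g t = 0" for T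
    using partial_derivative_real[OF d[of s]] partial_derivative_eq_0[where f=g and b=1, OF that(1,2)] that(3) by simp
  have g0: "\<And>t. t \<le> \<rho>\<^sup>2 \<Longrightarrow> g t = 0" "\<And>t. \<sigma> \<le> t \<Longrightarrow> g t = 0"
    using assms unfolding radial_profile_def by blast+
  show "s < \<rho>\<^sup>2 \<Longrightarrow> deriv g s = 0"
    by (rule z[of "{..<\<rho>\<^sup>2}"]) (simp_all only: open_lessThan lessThan_iff g0 less_imp_le)
  show "\<sigma> < s \<Longrightarrow> deriv g s = 0"
    by (rule z[of "{\<sigma><..}"]) (simp_all only: open_greaterThan greaterThan_iff g0 less_imp_le)
qed

lemma radial_profile_test_function:
  assumes g: "radial_profile \<rho> \<sigma> g" and \<sigma>: "\<sigma> < 1"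
  shows "test_function (ball (0::'a::euclidean_space) 1) (\<lambda>x. g (x \<bullet> x))"
  unfolding test_function_def
proof (intro conjI allI)
  show "Ck_on k UNIV (\<lambda>x::'a. g (x \<bullet> x))" for k
    using g unfolding radial_profile_def by (intro Ck_on_compose[OF open_UNIV open_UNIV Ck_on_norm_sq[OF open_UNIV]] UNIV_I) blast
  have sub: "{x::'a. g (x \<bullet> x) \<noteq> 0} \<subseteq> {x. x \<bullet> x \<le> \<sigma>}"
    using g unfolding radial_profile_def using linear by blast
  have "closed {x::'a. x \<bullet> x \<le> \<sigma>}" by (intro closed_Collect_le continuous_intros)
  with sub have "closure {x::'a. g (x \<bullet> x) \<noteq> 0} \<subseteq> {x. x \<bullet> x \<le> \<sigma>}" by (rule closure_minimal)
  also have "\<dots> \<subseteq> ball 0 1" using \<sigma> by (auto simp: norm_lt_square)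
  finally show c: "closure {x::'a. g (x \<bullet> x) \<noteq> 0} \<subseteq> ball 0 1" .
  show "compact (closure {x::'a. g (x \<bullet> x) \<noteq> 0})"
    using bounded_subset[OF bounded_ball c] by (simp add: compact_eq_bounded_closed)
qed

lemma integral_annulus:
  fixes f :: "real \<Rightarrow> real"
  assumes \<rho>: "0 < \<rho>" and f: "continuous_on {\<rho>..1} f" and z: "\<And>r. 0 < r \<Longrightarrow> r \<notin> {\<rho>..1} \<Longrightarrow> f r = 0"
  shows "(\<integral>r. indicator {0<..} r * f r \<partial>lborel) = integral {\<rho>..1} f"
proof -
  have i: "integrable lborel (\<lambda>r. indicator {\<rho>..1} r *\<^sub>R f r)" by (rule borel_integrable_compact[OF compact_Icc f])
  have "(\<integral>r. indicator {0<..} r * f r \<partial>lborel) = (\<integral>r. indicator {\<rho>..1} r *\<^sub>R f r \<partial>lborel)"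
    using \<rho> z by (intro Bochner_Integration.integral_cong) (auto simp: indicator_def)
  also have "\<dots> = integral {\<rho>..1} f"
    using set_borel_integral_eq_integral(2)[of "{\<rho>..1}" f] i by (simp add: set_integrable_def set_lebesgue_integral_def)
  finally show ?thesis .
qed

lemma Q_form_radial_profile:
  fixes g :: "real \<Rightarrow> real"
  assumes N: "DIM('a::euclidean_space) = N" "3 \<le> N" and g: "radial_profile \<rho> \<sigma> g" and \<rho>: "0 < \<rho>" and \<sigma>: "\<sigma> < 1"
  shows "(\<lambda>x::'a. g (x \<bullet> x)) \<in> H10_rad"
    and "Q_form (lambda_sing N h) (a_coef N h) (U_sing h) (\<lambda>x::'a. g (x \<bullet> x)) = sphere_area TYPE('a) * radial_energy N h \<rho> g"
proof -
  let ?\<xi> = "\<lambda>x::'a. g (x \<bullet> x)"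
  note d = radial_profile_deriv[OF g]
  have [measurable]: "g \<in> borel_measurable borel" "deriv g \<in> borel_measurable borel"
    using d(2,3) by (auto intro: borel_measurable_continuous_onI)
  have t: "test_function (ball 0 1) ?\<xi>" by (rule radial_profile_test_function[OF g \<sigma>])
  have "AE x in lebesgue_on (ball 0 1). ?\<xi> x = (\<lambda>r. g (r\<^sup>2)) (norm x)"
    by (rule AE_I2) (simp add: dot_square_norm)
  then show "?\<xi> \<in> H10_rad" using test_function_H10[OF t] unfolding H10_rad_def by (auto intro!: exI[of _ "\<lambda>r. g (r\<^sup>2)"])
  have grad: "gradient ?\<xi> x = (2 * deriv g (x \<bullet> x)) *\<^sub>R x" for x
  proof -
    have p: "partial_derivative b ?\<xi> x = 2 * deriv g (x \<bullet> x) * (x \<bullet> b)" for b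
      using partial_derivative_eq[OF partial_derivative_radial[of g "deriv g (x \<bullet> x)" 1 x]] d(1) by simp
    have "(\<Sum>b\<in>Basis. (2 * deriv g (x \<bullet> x) * (x \<bullet> b)) *\<^sub>R b) = (2 * deriv g (x \<bullet> x)) *\<^sub>R (\<Sum>b\<in>Basis. (x \<bullet> b) *\<^sub>R b)"
      by (simp add: scaleR_sum_right)
    then show ?thesis unfolding gradient_def p by (simp add: euclidean_representation)
  qed
  let ?F1 = "\<lambda>r. 4 * r\<^sup>2 * (deriv g (r\<^sup>2))\<^sup>2" and ?F2 = "\<lambda>r. (2 * (real N - 2) / r\<^sup>2 + h) * (g (r\<^sup>2))\<^sup>2"
  have out: "g (r\<^sup>2) = 0 \<and> deriv g (r\<^sup>2) = 0" if "0 < r" "r \<notin> {\<rho>..1}" for r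
  proof (cases "r < \<rho>")
    case True
    then have "r\<^sup>2 < \<rho>\<^sup>2" using that by (intro power_strict_mono) auto
    then show ?thesis using d(4) g by (auto simp: radial_profile_def)
  next
    case False
    then have "1\<^sup>2 < r\<^sup>2" using that by (intro power_strict_mono) auto
    then show ?thesis using d(5)[of "r\<^sup>2"] g \<sigma> by (auto simp: radial_profile_def)
  qed
  have c: "continuous_on {\<rho>..1} (\<lambda>r. r ^ (N - 1) * ?F1 r)" "continuous_on {\<rho>..1} (\<lambda>r. r ^ (N - 1) * ?F2 r)"
    by (intro continuous_intros continuous_on_compose2[OF d(2)[of UNIV]] continuous_on_compose2[OF d(3)[of UNIV]]; use \<rho> in auto)+
  have "(\<integral>x. (norm (weak_gradient (ball 0 1) ?\<xi> x))\<^sup>2 \<partial>lebesgue_on (ball 0 1)) = (\<integral>x. (norm (gradient ?\<xi> x))\<^sup>2 \<partial>lborel)"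
    by (rule test_function_gradient_integral[OF t])
  also have "\<dots> = (\<integral>(x::'a). ?F1 (norm x) \<partial>lborel)"
  proof (intro Bochner_Integration.integral_cong refl)
    show "(norm (gradient ?\<xi> x))\<^sup>2 = ?F1 (norm x)" for x
      unfolding grad by (simp add: dot_square_norm power_mult_distrib)
  qed
  also have "\<dots> = sphere_area TYPE('a) * (\<integral>r. indicator {0<..} r * (r ^ (N - 1) * ?F1 r) \<partial>lborel)"
    unfolding N(1)[symmetric] by (rule radial_integral(2)) measurable
  also have "(\<integral>r. indicator {0<..} r * (r ^ (N - 1) * ?F1 r) \<partial>lborel) = integral {\<rho>..1} (\<lambda>r. r ^ (N - 1) * ?F1 r)"
    by (rule integral_annulus[OF \<rho> c(1)]) (use out in auto)
  finally have A: "(\<integral>x. (norm (weak_gradient (ball 0 1) ?\<xi> x))\<^sup>2 \<partial>lebesgue_on (ball 0 1)) = sphere_area TYPE('a) * integral {\<rho>..1} (\<lambda>r. r ^ (N - 1) * ?F1 r)" .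
  have "(\<integral>x. lambda_sing N h * a_coef N h (norm x) * exp (U_sing h x) * (?\<xi> x)\<^sup>2 \<partial>lebesgue_on (ball 0 1)) =
    (\<integral>(x::'a). (2 * (real N - 2) / (norm x)\<^sup>2 + h) * (?\<xi> x)\<^sup>2 \<partial>lebesgue_on (ball 0 1))"
    by (rule integral_potential[OF N])
  also have "\<dots> = (\<integral>(x::'a). indicator (ball 0 1) x * ((2 * (real N - 2) / (norm x)\<^sup>2 + h) * (?\<xi> x)\<^sup>2) \<partial>lborel)"
    by (rule integral_lebesgue_on_borel) measurable
  also have "\<dots> = (\<integral>(x::'a). ?F2 (norm x) \<partial>lborel)"
    using test_function_outside(1)[OF t] by (intro Bochner_Integration.integral_cong) (auto simp: dot_square_norm indicator_def)
  also have "\<dots> = sphere_area TYPE('a) * (\<integral>r. indicator {0<..} r * (r ^ (N - 1) * ?F2 r) \<partial>lborel)"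
    unfolding N(1)[symmetric] by (rule radial_integral(2)) measurable
  also have "(\<integral>r. indicator {0<..} r * (r ^ (N - 1) * ?F2 r) \<partial>lborel) = integral {\<rho>..1} (\<lambda>r. r ^ (N - 1) * ?F2 r)"
    by (rule integral_annulus[OF \<rho> c(2)]) (use out in auto)
  finally have B: "(\<integral>x. lambda_sing N h * a_coef N h (norm x) * exp (U_sing h x) * (?\<xi> x)\<^sup>2 \<partial>lebesgue_on (ball 0 1)) =
    sphere_area TYPE('a) * integral {\<rho>..1} (\<lambda>r. r ^ (N - 1) * ?F2 r)" .
  have "radial_energy N h \<rho> g = integral {\<rho>..1} (\<lambda>r. r ^ (N - 1) * ?F1 r) - integral {\<rho>..1} (\<lambda>r. r ^ (N - 1) * ?F2 r)"
    unfolding radial_energy_def right_diff_distrib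
    by (rule Henstock_Kurzweil_Integration.integral_diff) (use c in \<open>auto intro: integrable_continuous_interval\<close>)
  then show "Q_form (lambda_sing N h) (a_coef N h) (U_sing h) ?\<xi> = sphere_area TYPE('a) * radial_energy N h \<rho> g"
    unfolding Q_form_def A B by (simp add: right_diff_distrib)
qed

text \<open>Disjoint supports make the form diagonal: the energy of a combination is the sum of the
  squared coefficients times the single energies. Independence follows by evaluation at a point
  where only one of the profiles is non-zero.\<close>

lemma morse_index_ge_disjoint_profiles:
  assumes N: "DIM('a::euclidean_space) = N" "3 \<le> N" and \<rho>: "0 < \<rho>" and \<sigma>: "\<sigma> < 1"
    and g: "\<And>i. i < n \<Longrightarrow> radial_profile \<rho> \<sigma> (g i)" and neg: "\<And>i. i < n \<Longrightarrow> radial_energy N h \<rho> (g i) < 0"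
    and disj: "\<And>i j s. i < n \<Longrightarrow> j < n \<Longrightarrow> i \<noteq> j \<Longrightarrow> g i s * g j s = 0"
      "\<And>i j s. i < n \<Longrightarrow> j < n \<Longrightarrow> i \<noteq> j \<Longrightarrow> deriv (g i) s * deriv (g j) s = 0"
  shows "enat n \<le> morse_index (lambda_sing N h) (a_coef N h) (U_sing h :: 'a \<Rightarrow> real)"
proof -
  let ?w = "\<lambda>i x::'a. g i (x \<bullet> x)"
  have comb: "(\<lambda>x. \<Sum>i<n. c i * ?w i x) \<in> H10_rad \<and>
     ((\<exists>i<n. c i \<noteq> 0) \<longrightarrow> Q_form (lambda_sing N h) (a_coef N h) (U_sing h) (\<lambda>x. \<Sum>i<n. c i * ?w i x) < 0)" for c
  proof -
    define G where "G s = (\<Sum>i<n. c i * g i s)" for s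
    have G: "radial_profile \<rho> \<sigma> G"
      unfolding radial_profile_def G_def
      using g by (auto simp: radial_profile_def intro!: Ck_on_sum Ck_on_mult)
    have dG: "deriv G s = (\<Sum>i<n. c i * deriv (g i) s)" for s
    proof (rule DERIV_imp_deriv)
      show "(G has_real_derivative (\<Sum>i<n. c i * deriv (g i) s)) (at s)"
        unfolding G_def by (intro DERIV_sum DERIV_cmult radial_profile_deriv(1)[OF g]) auto
    qed
    have sq: "(\<Sum>i<n. c i * f i)\<^sup>2 = (\<Sum>i<n. (c i)\<^sup>2 * (f i)\<^sup>2)"
      if "\<And>i j. i < n \<Longrightarrow> j < n \<Longrightarrow> i \<noteq> j \<Longrightarrow> f i * f j = 0" for f :: "nat \<Rightarrow> real"
    proof -
      have "(\<Sum>i<n. c i * f i)\<^sup>2 = (\<Sum>i<n. \<Sum>j<n. (c i * f i) * (c j * f j))"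
        by (simp add: power2_eq_square sum_product)
      also have "\<dots> = (\<Sum>i<n. \<Sum>j<n. if j = i then (c i)\<^sup>2 * (f i)\<^sup>2 else 0)"
      proof (intro sum.cong refl)
        fix i j assume "i \<in> {..<n}" "j \<in> {..<n}"
        then show "(c i * f i) * (c j * f j) = (if j = i then (c i)\<^sup>2 * (f i)\<^sup>2 else 0)"
          using that[of i j] by (auto simp: power2_eq_square)
      qed
      also have "\<dots> = (\<Sum>i<n. (c i)\<^sup>2 * (f i)\<^sup>2)" by simp
      finally show ?thesis .
    qed
    have G2: "(G s)\<^sup>2 = (\<Sum>i<n. (c i)\<^sup>2 * (g i s)\<^sup>2)" "(deriv G s)\<^sup>2 = (\<Sum>i<n. (c i)\<^sup>2 * (deriv (g i) s)\<^sup>2)" for s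
      unfolding dG G_def by (intro sq disj; assumption)+
    let ?E = "\<lambda>i r. r ^ (N - 1) * (4 * r\<^sup>2 * (deriv (g i) (r\<^sup>2))\<^sup>2 - (2 * (real N - 2) / r\<^sup>2 + h) * (g i (r\<^sup>2))\<^sup>2)"
    have Ei: "?E i integrable_on {\<rho>..1}" if "i < n" for i
      by (intro integrable_continuous_interval continuous_intros continuous_on_compose2[OF radial_profile_deriv(2)[OF g[OF that], of UNIV]]
          continuous_on_compose2[OF radial_profile_deriv(3)[OF g[OF that], of UNIV]]; use \<rho> in auto)
    have "radial_energy N h \<rho> G = integral {\<rho>..1} (\<lambda>r. \<Sum>i<n. (c i)\<^sup>2 * ?E i r)"
      unfolding radial_energy_def G2
      by (intro arg_cong2[where f=integral] refl ext) (simp add: sum_distrib_left sum_subtractf right_diff_distrib mult_ac)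
    also have "\<dots> = (\<Sum>i<n. (c i)\<^sup>2 * radial_energy N h \<rho> (g i))"
      unfolding radial_energy_def using Ei
      by (subst integral_sum) (auto intro!: integrable_on_mult_right)
    finally have en: "radial_energy N h \<rho> G = (\<Sum>i<n. (c i)\<^sup>2 * radial_energy N h \<rho> (g i))" .
    have Gx: "(\<lambda>x. \<Sum>i<n. c i * ?w i x) = (\<lambda>x::'a. G (x \<bullet> x))" by (simp add: G_def)
    have "radial_energy N h \<rho> G < 0" if "\<exists>i<n. c i \<noteq> 0"
    proof -
      obtain i where i: "i < n" "c i \<noteq> 0" using \<open>\<exists>i<n. c i \<noteq> 0\<close> by blast
      have "(\<Sum>i<n. (c i)\<^sup>2 * radial_energy N h \<rho> (g i)) < (\<Sum>i<n. 0)"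
      proof (rule sum_strict_mono_ex1)
        show "\<forall>i\<in>{..<n}. (c i)\<^sup>2 * radial_energy N h \<rho> (g i) \<le> 0"
        proof
          fix i assume "i \<in> {..<n}"
          then have "radial_energy N h \<rho> (g i) \<le> 0" using neg[of i] by simp
          then show "(c i)\<^sup>2 * radial_energy N h \<rho> (g i) \<le> 0" by (intro mult_nonneg_nonpos) auto
        qed
        show "\<exists>i\<in>{..<n}. (c i)\<^sup>2 * radial_energy N h \<rho> (g i) < 0"
          using neg[OF i(1)] i by (intro bexI[of _ i] mult_pos_neg) auto
      qed simp
      then show ?thesis by (simp add: en)
    qed
    then show ?thesis
      unfolding Gx using Q_form_radial_profile[OF N G \<rho> \<sigma>] sphere_area_pos[where 'a='a]
      by (auto intro: mult_pos_neg)
  qed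
  have ne: "\<exists>s. g i s \<noteq> 0" if "i < n" for i
  proof (rule ccontr)
    assume "\<not> ?thesis"
    then have z: "g i s = 0" for s by simp
    then have "deriv (g i) s = 0" for s by (intro DERIV_imp_deriv) (simp add: fun_eq_iff[THEN iffD2, of "g i" "\<lambda>_. 0"])
    then show False using neg[OF that] z by (simp add: radial_energy_def)
  qed
  have coeff0: "c i = 0" if cz: "(\<lambda>x. \<Sum>i<n. c i * ?w i x) = 0" and i: "i < n" for c i
  proof -
    obtain s where s: "g i s \<noteq> 0" using ne[OF i] by blast
    have s0: "0 < s" using s g[OF i] \<rho> by (auto simp: radial_profile_def) (meson less_le_trans linorder_not_le order_le_less zero_less_power)
    obtain b :: 'a where b: "b \<in> Basis" using nonempty_Basis by blast
    define x where "x = sqrt s *\<^sub>R b"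
    have "x \<bullet> x = s" using b s0 by (simp add: x_def)
    then have "(\<Sum>j<n. c j * g j s) = 0" using fun_cong[OF cz, of x] by simp
    moreover have "(\<Sum>j<n. c j * g j s) = c i * g i s"
    proof -
      have "c j * g j s = 0" if j: "j < n" "j \<noteq> i" for j using disj(1)[OF j(1) i j(2), of s] s by simp
      then have "(\<Sum>j<n. c j * g j s) = (\<Sum>j\<in>{i}. c j * g j s)"
        using i by (intro sum.mono_neutral_right) auto
      then show ?thesis by simp
    qed
    ultimately show ?thesis using s by simp
  qed
  have inj: "inj_on ?w {..<n}"
  proof (rule inj_onI)
    fix i j assume ij: "i \<in> {..<n}" "j \<in> {..<n}" "?w i = ?w j"
    show "i = j"
    proof (rule ccontr)
      assume "i \<noteq> j"
      have "(\<lambda>x. \<Sum>k<n. (if k = i then 1 else if k = j then -1 else 0) * ?w k x) = 0"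
      proof
        fix x
        have "(\<Sum>k<n. (if k = i then 1 else if k = j then -1 else 0) * ?w k x) = (\<Sum>k\<in>{i, j}. (if k = i then 1 else if k = j then -1 else 0) * ?w k x)"
          using ij by (intro sum.mono_neutral_right) auto
        then show "(\<Sum>k<n. (if k = i then 1 else if k = j then -1 else 0) * ?w k x) = 0 x"
          using \<open>i \<noteq> j\<close> fun_cong[OF ij(3), of x] by simp
      qed
      from coeff0[OF this, of i] show False using ij by simp
    qed
  qed
  let ?B = "?w ` {..<n}"
  have lin: "(\<Sum>v\<in>?B. fun_scale (u v) v) = (\<lambda>x. \<Sum>i<n. u (?w i) * ?w i x)" for u
    by (simp add: sum.reindex[OF inj] fun_eq_iff sum_fun_apply fun_scale_def)
  have span: "\<exists>u. \<xi> = (\<lambda>x. \<Sum>i<n. u (?w i) * ?w i x)" if "\<xi> \<in> fun_scale.span ?B" for \<xi>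
    using that fun_scale.span_finite[of ?B] lin by auto
  have "enat (card ?B) \<le> morse_index (lambda_sing N h) (a_coef N h) (U_sing h :: 'a \<Rightarrow> real)"
  proof (rule morse_index_ge)
    show "\<not> fun_scale.dependent ?B"
    proof
      assume "fun_scale.dependent ?B"
      then obtain u v where uv: "v \<in> ?B" "u v \<noteq> 0" "(\<Sum>v\<in>?B. fun_scale (u v) v) = 0"
        using fun_scale.dependent_finite[of ?B] by auto
      then obtain i where "i < n" "v = ?w i" by auto
      then show False using coeff0[OF uv(3)[unfolded lin], of i] uv(2) by simp
    qed
    show "fun_scale.span ?B \<subseteq> H10_rad"
    proof
      fix \<xi> assume "\<xi> \<in> fun_scale.span ?B"
      then obtain u where u: "\<xi> = (\<lambda>x. \<Sum>i<n. u (?w i) * ?w i x)" using span by meson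
      show "\<xi> \<in> H10_rad" unfolding u by (rule conjunct1[OF comb])
    qed
    fix \<xi> assume \<xi>: "\<xi> \<in> fun_scale.span ?B" "\<xi> \<noteq> 0"
    obtain u where u: "\<xi> = (\<lambda>x. \<Sum>i<n. u (?w i) * ?w i x)" using span[OF \<xi>(1)] by (elim exE)
    have "\<exists>i<n. u (?w i) \<noteq> 0"
    proof (rule ccontr)
      assume "\<not> ?thesis"
      then have "\<xi> = 0" unfolding u by (auto simp: fun_eq_iff)
      then show False using \<xi>(2) by simp
    qed
    then show "Q_form (lambda_sing N h) (a_coef N h) (U_sing h) \<xi> < 0" unfolding u by (rule mp[OF conjunct2[OF comb]])
  qed auto
  then show ?thesis by (simp add: card_image[OF inj])
qed

section \<open>Negative directions\<close>

text \<open>The open sets I and the complement of C cover the line, and on each of them the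
  extension agrees with a function of class C^k.\<close>

lemma Ck_on_extend_zero:
  fixes f :: "real \<Rightarrow> real"
  assumes "open I" "closed C" "C \<subseteq> I" "Ck_on k I f" "\<And>x. x \<in> I \<Longrightarrow> x \<notin> C \<Longrightarrow> f x = 0"
  shows "Ck_on k UNIV (\<lambda>x. if x \<in> I then f x else 0)"
proof -
  let ?g = "\<lambda>x. if x \<in> I then f x else 0"
  have "Ck_on k I ?g" using Ck_on_cong[OF assms(1), of f ?g k] assms(4) by simp
  moreover have "Ck_on k (- C) ?g"
    using Ck_on_cong[of "- C" "\<lambda>_. 0" ?g k] Ck_on_const[of "- C" k 0] assms(2,5) by (simp add: open_Compl)
  ultimately have "Ck_on k (I \<union> - C) ?g" using assms(1,2) by (intro Ck_on_Un) auto
  moreover have "I \<union> - C = UNIV" using assms(3) by auto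
  ultimately show ?thesis by simp
qed

lemma continuous_on_Icc_bounded:
  fixes f :: "real \<Rightarrow> real"
  assumes "continuous_on {a..b} f" shows "\<exists>B. \<forall>x\<in>{a..b}. \<bar>f x\<bar> \<le> B"
  using compact_imp_bounded[OF compact_continuous_image[OF assms compact_Icc]] by (auto simp: bounded_iff)

definition bump :: "real \<Rightarrow> real" where
  "bump z = flat (1 - z\<^sup>2)"

lemma Ck_on_bump: "Ck_on k UNIV bump"
  unfolding bump_def[abs_def]
  by (rule Ck_on_compose[OF open_UNIV open_UNIV _ Ck_on_flat])
     (auto simp: power2_eq_square intro!: Ck_on_diff Ck_on_mult)

lemma DERIV_bump: "(bump has_real_derivative deriv bump z) (at z)"
  by (rule Ck_on_real_deriv(2)[OF Ck_on_bump open_UNIV UNIV_I])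

lemma continuous_on_bump: "continuous_on S bump" "continuous_on S (deriv bump)"
  by (rule continuous_on_subset[OF Ck_on_continuous[OF Ck_on_bump]], simp)
     (rule continuous_on_subset[OF Ck_on_continuous[OF Ck_on_real_deriv(1)[OF Ck_on_bump open_UNIV]]], simp)

lemma bump_eq_0: assumes "1 \<le> \<bar>z\<bar>" shows "bump z = 0" "deriv bump z = 0"
proof -
  have nn: "0 \<le> bump y" for y by (simp add: bump_def flat_bounds)
  show z: "bump z = 0" using assms abs_square_le_1[of z] power_mono[of 1 "\<bar>z\<bar>" 2] by (simp add: bump_def flat_bounds)
  show "deriv bump z = 0" by (rule DERIV_local_min[OF DERIV_bump zero_less_one]) (simp add: z nn)
qed

lemma bump_ge: assumes "\<bar>z\<bar> \<le> 1 / 2" shows "flat (3 / 4) \<le> bump z"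
proof -
  have "z\<^sup>2 \<le> (1 / 2)\<^sup>2" using assms abs_le_square_iff[of z "1 / 2"] by simp
  then have "3 / 4 \<le> 1 - z\<^sup>2" by (simp add: power2_eq_square)
  moreover then have "1 / (1 - z\<^sup>2) \<le> 1 / (3 / 4)" by (intro divide_left_mono) auto
  ultimately show ?thesis by (simp add: bump_def flat_def)
qed

text \<open>The bound has the shape of the derivative of arctan. Composed with an increasing
  \<theta>, the cut-off error then integrates to at most a multiple of \<pi>, however long the range
  of \<theta> is.\<close>

lemma deriv_bump_bound: obtains L where "0 < L" "\<And>z. (deriv bump z)\<^sup>2 \<le> L / (1 + z\<^sup>2)"
proof -
  obtain B where B: "\<And>z. z \<in> {-1..1} \<Longrightarrow> \<bar>deriv bump z\<bar> \<le> B"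
    using continuous_on_Icc_bounded[OF continuous_on_bump(2)] by blast
  show thesis
  proof (rule that[of "2 * B\<^sup>2 + 1"])
    show "0 < 2 * B\<^sup>2 + 1" using zero_le_power2[of B] by linarith
    show "(deriv bump z)\<^sup>2 \<le> (2 * B\<^sup>2 + 1) / (1 + z\<^sup>2)" for z
    proof (cases "\<bar>z\<bar> \<le> 1")
      case True
      then have "\<bar>deriv bump z\<bar> \<le> B" by (intro B) auto
      then have "(deriv bump z)\<^sup>2 \<le> B\<^sup>2" using abs_le_square_iff[of "deriv bump z" B] by linarith
      moreover have "z\<^sup>2 \<le> 1" using True by (simp add: abs_square_le_1)
      then have "(deriv bump z)\<^sup>2 * (1 + z\<^sup>2) \<le> (deriv bump z)\<^sup>2 * 2" by (intro mult_left_mono) auto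
      ultimately have "(deriv bump z)\<^sup>2 * (1 + z\<^sup>2) \<le> 2 * B\<^sup>2 + 1" by linarith
      moreover have "0 < 1 + z\<^sup>2" using zero_le_power2[of z] by linarith
      ultimately show ?thesis by (simp add: pos_le_divide_eq)
    next
      case False
      then have "deriv bump z = 0" by (intro bump_eq_0) simp
      then show ?thesis using zero_le_power2[of z] zero_le_power2[of B] by simp
    qed
  qed
qed

text \<open>The substitution \<open>g(r\<^sup>2) = r\<^bsup>-(N-2)/2\<^esup> \<phi>(r\<^sup>2)\<close> turns the Hardy term into \<open>(N-2)(10-N)/4\<close>,
  up to the derivative of \<open>((N-2)/2) \<phi>(r\<^sup>2)\<^sup>2\<close>.\<close>

lemma energy_density_substitution:
  assumes N: "3 \<le> N" and r: "0 < r" and I: "open I" "r\<^sup>2 \<in> I"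
    and g: "\<And>s. s \<in> I \<Longrightarrow> g s = exp (- ((real N - 2) / 4 * ln s)) * \<phi> s"
    and \<phi>: "(\<phi> has_real_derivative \<phi>') (at (r\<^sup>2))"
  shows "r ^ (N - 1) * (4 * r\<^sup>2 * (deriv g (r\<^sup>2))\<^sup>2 - (2 * (real N - 2) / r\<^sup>2 + h) * (g (r\<^sup>2))\<^sup>2)
    = 4 * r ^ 3 * \<phi>'\<^sup>2 - (real N - 2) * (10 - real N) / 4 * (\<phi> (r\<^sup>2))\<^sup>2 / r - h * r * (\<phi> (r\<^sup>2))\<^sup>2
      - 2 * (real N - 2) * r * \<phi> (r\<^sup>2) * \<phi>'"
proof -
  define m where "m = real N - 2"
  define e where "e = exp (- (m / 4 * ln (r\<^sup>2)))"
  define p where "p = \<phi> (r\<^sup>2)"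
  have r2: "0 < r\<^sup>2" using r by simp
  have "((\<lambda>s. exp (- (m / 4 * ln s)) * \<phi> s) has_real_derivative e * (\<phi>' - m / (4 * r\<^sup>2) * p)) (at (r\<^sup>2))"
    by (rule derivative_eq_intros refl \<phi> r2)+ (use r in \<open>simp add: e_def p_def field_simps\<close>)
  then have "(g has_real_derivative e * (\<phi>' - m / (4 * r\<^sup>2) * p)) (at (r\<^sup>2))"
    by (rule has_field_derivative_transform_within_open[OF _ I]) (simp add: g m_def)
  then have d: "deriv g (r\<^sup>2) = e * (\<phi>' - m / (4 * r\<^sup>2) * p)" by (rule DERIV_imp_deriv)
  have gr: "g (r\<^sup>2) = e * p" using g[OF I(2)] by (simp add: e_def p_def m_def)
  have e2: "r ^ (N - 1) * e\<^sup>2 = r"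
  proof -
    have "ln (r\<^sup>2) = 2 * ln r" using r by (simp add: ln_realpow)
    then have "e\<^sup>2 = exp (- (m * ln r))" by (simp add: e_def power2_eq_square flip: exp_add)
    also have "m * ln r = ln (r ^ (N - 2))" using r N by (simp add: m_def ln_realpow of_nat_diff)
    also have "exp (- \<dots>) = inverse (r ^ (N - 2))" using r by (simp only: exp_minus exp_ln zero_less_power)
    finally have "e\<^sup>2 = inverse (r ^ (N - 2))" .
    moreover have "r ^ (N - 1) = r * r ^ (N - 2)"
      using N by (metis Suc_diff_le Suc_numeral Suc_leD diff_Suc_Suc numeral_2_eq_2 numeral_3_eq_3 One_nat_def power_Suc)
    ultimately show ?thesis using r by simp
  qed
  have "r ^ (N - 1) * (4 * r\<^sup>2 * (e * (\<phi>' - m / (4 * r\<^sup>2) * p))\<^sup>2 - (2 * m / r\<^sup>2 + h) * (e * p)\<^sup>2)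
    = (r ^ (N - 1) * e\<^sup>2) * (4 * r\<^sup>2 * (\<phi>' - m / (4 * r\<^sup>2) * p)\<^sup>2 - (2 * m / r\<^sup>2 + h) * p\<^sup>2)"
  proof -
    have "r ^ (N - 1) * (4 * r\<^sup>2 * (e * q)\<^sup>2 - w * (e * p)\<^sup>2) = (r ^ (N - 1) * e\<^sup>2) * (4 * r\<^sup>2 * q\<^sup>2 - w * p\<^sup>2)" for q w
      by (simp add: power_mult_distrib algebra_simps)
    then show ?thesis .
  qed
  also have "\<dots> = 4 * r ^ 3 * \<phi>'\<^sup>2 - m * (8 - m) / 4 * p\<^sup>2 / r - h * r * p\<^sup>2 - 2 * m * r * p * \<phi>'"
    unfolding e2 using r by (simp add: field_simps power2_eq_square power3_eq_cube)
  also have "8 - m = 10 - real N" by (simp add: m_def)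
  finally show ?thesis unfolding d gr by (simp add: m_def p_def)
qed

lemma integral_le_boundary:
  fixes T :: "real \<Rightarrow> real"
  assumes ab: "a \<le> b" and T: "\<And>t. t \<in> {a..b} \<Longrightarrow> (T has_real_derivative T' t) (at t)"
    and E: "E integrable_on {a..b}" and P: "P integrable_on {a..b}"
    and le: "\<And>t. t \<in> {a..b} \<Longrightarrow> E t \<le> T' t - P t"
  shows "integral {a..b} E \<le> T b - T a - integral {a..b} P"
proof -
  have "(T' has_integral (T b - T a)) {a..b}"
    using T by (intro fundamental_theorem_of_calculus[OF ab]) (auto simp flip: has_real_derivative_iff_has_vector_derivative intro: has_field_derivative_at_within)
  then have D: "((\<lambda>t. T' t - P t) has_integral (T b - T a - integral {a..b} P)) {a..b}"
    using P by (intro has_integral_diff integrable_integral)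
  show ?thesis using has_integral_le[OF integrable_integral[OF E] D] le by blast
qed


text \<open>After reduction to the disc, the ground state b gives the form the value
  (\<open>bes_zero\<close> - h) times a positive integral, but r^(-4) b is singular at 0 and not
  compactly supported in the ball. It is multiplied by bump(\<theta>) with \<theta> varying slowly
  in ln s near 0: a point of the plane has zero capacity, so this cut-off is cheap, and at s = 1 the
  linear decay of b pays for it. The cost is of order \<epsilon> while the gain stays bounded
  below.\<close>

lemma destabilizing_profile:
  assumes h: "bes_zero < h"
  obtains \<rho> \<sigma> g where "0 < \<rho>" "\<rho> < 1" "\<sigma> < 1" "radial_profile \<rho> \<sigma> g" "radial_energy 10 h \<rho> g < 0"
proof -
  define b b' where "b s = bes (bes_zero * s)" and "b' s = bes_zero * bes1 (bes_zero * s)" for s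
  have db: "(b has_real_derivative b' s) (at s)" for s
    unfolding b_def b'_def by (auto intro!: derivative_eq_intros bes_derivs)
  have db': "(b' has_real_derivative bes_zero * (bes_zero * bes2 (bes_zero * s))) (at s)" for s
    unfolding b'_def by (auto intro!: derivative_eq_intros bes_derivs)
  have ode: "s * (bes_zero * (bes_zero * bes2 (bes_zero * s))) = - (bes_zero * b s / 4) - b' s" for s
  proof -
    have "bes_zero * (bes_zero * s * bes2 (bes_zero * s) + bes1 (bes_zero * s) + bes (bes_zero * s) / 4) = 0"
      by (simp add: bes_ode)
    then show ?thesis unfolding b_def b'_def by (simp add: algebra_simps)
  qed
  have b1: "b 1 = 0" by (simp add: b_def bes_bes_zero)
  have bpos: "0 < b s" if "s < 1" for s
    using that bes_zero_pos bes_pos[of "bes_zero * s"] by (simp add: b_def)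
  have cb: "continuous_on S b" "continuous_on S b'" for S
    using DERIV_isCont[OF db] DERIV_isCont[OF db'] by (auto intro: continuous_at_imp_continuous_on)
  obtain C where C: "0 < C" "\<And>s. 0 \<le> s \<Longrightarrow> s \<le> 1 \<Longrightarrow> \<bar>b s\<bar> \<le> C * (1 - s)"
  proof -
    obtain B where B: "\<And>s. s \<in> {0..1} \<Longrightarrow> \<bar>b' s\<bar> \<le> B"
      using continuous_on_Icc_bounded[OF cb(2)] by blast
    show thesis
    proof (rule that[of "\<bar>B\<bar> + 1"])
      fix s :: real assume s: "0 \<le> s" "s \<le> 1"
      show "\<bar>b s\<bar> \<le> (\<bar>B\<bar> + 1) * (1 - s)"
      proof (cases "s = 1")
        case False
        then have "s < 1" using s by simp
        then have "\<exists>z. s < z \<and> z < 1 \<and> b 1 - b s = (1 - s) * b' z" by (rule MVT2) (rule db)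
        then obtain z where z: "s < z" "z < 1" "b 1 - b s = (1 - s) * b' z" by (elim exE conjE)
        have "b s = - ((1 - s) * b' z)" using z(3) b1 by simp
        then have "\<bar>b s\<bar> = (1 - s) * \<bar>b' z\<bar>" using s by (simp add: abs_mult)
        also have "\<dots> \<le> (1 - s) * (\<bar>B\<bar> + 1)" using B[of z] z s by (intro mult_left_mono) auto
        finally show ?thesis by (simp add: mult.commute)
      qed (use b1 in simp)
    qed simp
  qed
  obtain m where m: "0 < m" "\<And>s. 1 / 4 \<le> s \<Longrightarrow> s \<le> 9 / 16 \<Longrightarrow> m \<le> b s"
  proof -
    obtain z where "z \<in> {1 / 4..9 / 16}" "\<forall>y\<in>{1 / 4..9 / 16}. b z \<le> b y"
      using continuous_attains_inf[OF compact_Icc _ cb(1), of "1 / 4" "9 / 16"] by auto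
    then show thesis using that[of "b z"] bpos[of z] by auto
  qed
  obtain L where L: "0 < L" "\<And>z. (deriv bump z)\<^sup>2 \<le> L / (1 + z\<^sup>2)" using deriv_bump_bound by blast
  \<comment> \<open>Lower bound for the gain: on 1/2 <= r <= 3/4, of length 1/4, one has r >= 1/2,
    the cut-off is at least \<open>flat (3 / 4)\<close> and b is at least m.\<close>
  define \<delta> where "\<delta> = (h - bes_zero) * (flat (3 / 4))\<^sup>2 * m\<^sup>2 / 8"
  have \<delta>: "0 < \<delta>" using h m flat_bounds(3)[of "3 / 4"] by (simp add: \<delta>_def)
  \<comment> \<open>1/6 keeps |\<theta>| <= 1/2 on that interval, where |ln s + 1/(1 - s)| <= 3; the
    other bound makes the total cost 2 \<epsilon> C^2 L \<pi> at most \<delta>/2.\<close>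
  define \<epsilon> where "\<epsilon> = min (1 / 6) (\<delta> / (4 * C\<^sup>2 * L * pi))"
  have \<epsilon>: "0 < \<epsilon>" "\<epsilon> \<le> 1 / 6" using \<delta> C L by (simp_all add: \<epsilon>_def)
  have \<epsilon>\<delta>: "2 * \<epsilon> * C\<^sup>2 * L * pi < \<delta>"
  proof -
    have "\<epsilon> \<le> \<delta> / (4 * C\<^sup>2 * L * pi)" by (simp add: \<epsilon>_def)
    then have "\<epsilon> * (4 * C\<^sup>2 * L * pi) \<le> \<delta>" using C L by (simp add: pos_le_divide_eq)
    then show ?thesis using \<delta> by (simp add: mult_ac)
  qed

  \<comment> \<open>\<theta> increases from minus to plus infinity on (0, 1). The growth 1/(1 - s)^2
    of its derivative at s = 1 is affordable because |b| <= C (1 - s), which gives s \<theta>' b^2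
    <= \<epsilon> C^2.\<close>
  define \<theta> \<theta>' where "\<theta> s = \<epsilon> * (ln s + inverse (1 - s))" and "\<theta>' s = \<epsilon> * (1 / s + 1 / (1 - s)\<^sup>2)" for s
  have d\<theta>: "(\<theta> has_real_derivative \<theta>' s) (at s)" if "0 < s" "s < 1" for s
    unfolding \<theta>_def \<theta>'_def using that by (auto intro!: derivative_eq_intros simp: field_simps power2_eq_square)
  \<comment> \<open>Thresholds beyond which |\<theta>| >= 1, so that the cut-off vanishes. 1/4 and
    9/16 are the squares of 1/2 and 3/4, the ends of the interval that yields the gain.\<close>
  define a c where "a = min (1 / 4) (exp (- 2 - 1 / \<epsilon>))" and "c = max (9 / 16) (1 - 1 / (1 + 1 / \<epsilon>))"
  have a: "0 < a" "a \<le> 1 / 4" by (auto simp: a_def)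
  have c: "9 / 16 \<le> c" "c < 1" using \<epsilon> by (auto simp: c_def add_pos_pos)
  have \<theta>a: "\<theta> s \<le> - 1" if "0 < s" "s \<le> a" for s
  proof -
    have "s \<le> exp (- 2 - 1 / \<epsilon>)" "s \<le> 1 / 4" using that by (simp_all add: a_def)
    then have "ln s \<le> - 2 - 1 / \<epsilon>" "inverse (1 - s) \<le> 2"
      using that ln_mono[of s "exp (- 2 - 1 / \<epsilon>)"] by (simp_all add: field_simps)
    then have "ln s + inverse (1 - s) \<le> - (1 / \<epsilon>)" by linarith
    then have "\<epsilon> * (ln s + inverse (1 - s)) \<le> \<epsilon> * - (1 / \<epsilon>)" using \<epsilon> by (intro mult_left_mono) auto
    then show ?thesis using \<epsilon> by (simp add: \<theta>_def)
  qed
  have \<theta>c: "1 \<le> \<theta> s" if "c \<le> s" "s < 1" for s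
  proof -
    have s: "9 / 16 \<le> s" "1 - s \<le> 1 / (1 + 1 / \<epsilon>)" using that by (simp_all add: c_def)
    have p: "0 < 1 + 1 / \<epsilon>" using \<epsilon> by (simp add: add_pos_pos)
    have "(1 - s) * (1 + 1 / \<epsilon>) \<le> 1" using s(2) p by (simp add: pos_le_divide_eq)
    then have "1 + 1 / \<epsilon> \<le> inverse (1 - s)" using that by (simp add: inverse_eq_divide pos_le_divide_eq mult.commute)
    moreover have "1 - 1 / s \<le> ln s" using ln_le_minus_one[of "1 / s"] s by (simp add: ln_div)
    moreover have "1 / s \<le> 2" using s by (simp add: field_simps)
    ultimately have "1 / \<epsilon> \<le> ln s + inverse (1 - s)" by linarith
    then have "\<epsilon> * (1 / \<epsilon>) \<le> \<epsilon> * (ln s + inverse (1 - s))" using \<epsilon> by (intro mult_left_mono) auto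
    then show ?thesis using \<epsilon> by (simp add: \<theta>_def)
  qed

  define \<phi> where "\<phi> s = bump (\<theta> s) * b s" for s
  define g where "g s = (if s \<in> {0<..<1} then exp (- ((real 10 - 2) / 4 * ln s)) * \<phi> s else 0)" for s
  have \<phi>0: "\<phi> s = 0" if "s \<in> {0<..<1}" "s \<le> a \<or> c \<le> s" for s
  proof -
    have "1 \<le> \<bar>\<theta> s\<bar>" using that \<theta>a[of s] \<theta>c[of s] by auto
    then show ?thesis by (simp add: \<phi>_def bump_eq_0)
  qed
  have Ck: "Ck_on k UNIV g" for k
    unfolding g_def
  proof (rule Ck_on_extend_zero[where C="{a..c}"])
    have o: "open {0<..<1::real}" by simp
    have ln': "Ck_on k {0<..<1} ln" by (rule Ck_on_subset[OF Ck_on_ln]) auto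
    have inv: "Ck_on k {0<..<1} (\<lambda>s. inverse (1 - s :: real))"
      by (rule Ck_on_compose[OF o _ _ Ck_on_inverse])
         (auto intro!: Ck_on_diff open_Collect_neq continuous_intros)
    have "Ck_on k {0<..<1} \<theta>" unfolding \<theta>_def[abs_def] by (intro Ck_on_mult Ck_on_add Ck_on_const o ln' inv)
    then have 1: "Ck_on k {0<..<1} (\<lambda>s. bump (\<theta> s))" by (rule Ck_on_compose[OF o open_UNIV _ Ck_on_bump]) simp
    have "Ck_on k {0<..<1} (\<lambda>s. - ((real 10 - 2) / 4 * ln s))" by (intro Ck_on_minus Ck_on_mult Ck_on_const o ln')
    then have 2: "Ck_on k {0<..<1} (\<lambda>s. exp (- ((real 10 - 2) / 4 * ln s)))"
      by (rule Ck_on_compose[OF o open_UNIV _ Ck_on_exp]) simp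
    have 3: "Ck_on k {0<..<1} b" unfolding b_def[abs_def]
      by (rule Ck_on_compose[OF o open_UNIV _ Ck_on_bes]) (auto intro!: Ck_on_mult)
    show "Ck_on k {0<..<1} (\<lambda>s. exp (- ((real 10 - 2) / 4 * ln s)) * \<phi> s)"
      unfolding \<phi>_def by (intro Ck_on_mult o 1 2 3)
    show "exp (- ((real 10 - 2) / 4 * ln s)) * \<phi> s = 0" if "s \<in> {0<..<1}" "s \<notin> {a..c}" for s
      using \<phi>0[OF that(1)] that(2) by auto
  qed (use a c in auto)
  define \<rho> where "\<rho> = sqrt a"
  have \<rho>: "0 < \<rho>" "\<rho>\<^sup>2 = a" using a by (simp_all add: \<rho>_def)
  have \<rho>2: "\<rho> \<le> 1 / 2" by (rule power2_le_imp_le) (use a \<rho> in \<open>auto simp: power_divide\<close>)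
  have gp: "radial_profile \<rho> c g"
    unfolding radial_profile_def \<rho>(2) using Ck \<phi>0 by (auto simp: g_def)

  define d where "d = sqrt c"
  have d: "0 < d" "d\<^sup>2 = c" "d < 1" using c by (simp_all add: d_def)
  have d2: "3 / 4 \<le> d" by (rule power2_le_imp_le) (use c d in \<open>auto simp: power_divide\<close>)
  let ?E = "\<lambda>r. r ^ (10 - 1) * (4 * r\<^sup>2 * (deriv g (r\<^sup>2))\<^sup>2 - (2 * (real 10 - 2) / r\<^sup>2 + h) * (g (r\<^sup>2))\<^sup>2)"
  let ?P = "\<lambda>r. (h - bes_zero) * (r * (bump (\<theta> (r\<^sup>2)))\<^sup>2 * (b (r\<^sup>2))\<^sup>2)"
  have sq: "0 < r\<^sup>2" "r\<^sup>2 < 1" if "r \<in> {\<rho>..d}" for r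
    using that \<rho> d power_mono[of r d 2] c by auto
  have cE: "continuous_on {\<rho>..1} ?E"
    using \<rho> by (intro continuous_intros continuous_on_compose2[OF radial_profile_deriv(3)[OF gp, of UNIV]]
        continuous_on_compose2[OF radial_profile_deriv(2)[OF gp, of UNIV]]) auto
  have cP: "continuous_on {\<rho>..d} ?P"
  proof -
    have "continuous_on {0<..<1} \<theta>"
      using DERIV_isCont[OF d\<theta>] by (auto intro!: continuous_at_imp_continuous_on)
    then have "continuous_on {\<rho>..d} (\<lambda>r. \<theta> (r\<^sup>2))"
      by (rule continuous_on_compose2) (use sq in \<open>auto intro!: continuous_intros\<close>)
    then show ?thesis
      by (intro continuous_intros continuous_on_compose2[OF continuous_on_bump(1)[of UNIV]] continuous_on_compose2[OF cb(1)[of UNIV]]) auto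
  qed
  \<comment> \<open>The exact derivative inside the energy density: the first term of
    \<open>S\<close> comes from the equation of the ground state, the second from the Hardy
    substitution.\<close>
  define S S' where "S s = 2 * s * (bump (\<theta> s))\<^sup>2 * b s * b' s - 4 * (bump (\<theta> s))\<^sup>2 * (b s)\<^sup>2"
    and "S' s = 4 * s * bump (\<theta> s) * (deriv bump (\<theta> s) * \<theta>' s) * b s * b' s + 2 * s * (bump (\<theta> s))\<^sup>2 * (b' s)\<^sup>2
      - bes_zero * (bump (\<theta> s))\<^sup>2 * (b s)\<^sup>2 / 2 - 8 * bump (\<theta> s) * (deriv bump (\<theta> s) * \<theta>' s) * (b s)\<^sup>2
      - 8 * (bump (\<theta> s))\<^sup>2 * b s * b' s" for s
  have dk: "((\<lambda>s. bump (\<theta> s)) has_real_derivative deriv bump (\<theta> s) * \<theta>' s) (at s)" if "0 < s" "s < 1" for s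
    by (rule DERIV_chain2[OF DERIV_bump d\<theta>[OF that]])
  have dS: "(S has_real_derivative S' s) (at s)" if "0 < s" "s < 1" for s
  proof -
    let ?b2 = "bes_zero * (bes_zero * bes2 (bes_zero * s))"
    have "(S has_real_derivative (2 * (bump (\<theta> s))\<^sup>2 * b s * b' s
        + 4 * s * bump (\<theta> s) * (deriv bump (\<theta> s) * \<theta>' s) * b s * b' s
        + 2 * s * (bump (\<theta> s))\<^sup>2 * (b' s)\<^sup>2 + 2 * (bump (\<theta> s))\<^sup>2 * b s * (s * ?b2)
        - 8 * bump (\<theta> s) * (deriv bump (\<theta> s) * \<theta>' s) * (b s)\<^sup>2 - 8 * (bump (\<theta> s))\<^sup>2 * b s * b' s)) (at s)"
      unfolding S_def[abs_def]
      by (rule derivative_eq_intros refl dk[OF that] db db')+ (simp add: algebra_simps power2_eq_square)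
    then show ?thesis unfolding ode by (rule DERIV_cong) (simp add: S'_def algebra_simps power2_eq_square)
  qed
  let ?K = "2 * \<epsilon> * C\<^sup>2 * L"
  \<comment> \<open>The arctan term dominates the error caused by the cut-off.\<close>
  let ?T = "\<lambda>r. S (r\<^sup>2) + ?K * arctan (\<theta> (r\<^sup>2))"
  let ?T' = "\<lambda>r. S' (r\<^sup>2) * (2 * r) + ?K * (inverse (1 + (\<theta> (r\<^sup>2))\<^sup>2) * (\<theta>' (r\<^sup>2) * (2 * r)))"
  have sqd: "((\<lambda>r. r\<^sup>2) has_real_derivative 2 * r) (at r)" for r :: real
    by (auto intro!: derivative_eq_intros)
  have dT: "(?T has_real_derivative ?T' r) (at r)" if "r \<in> {\<rho>..d}" for r
    by (intro DERIV_add DERIV_cmult DERIV_chain2[OF dS sqd] DERIV_chain2[OF DERIV_arctan DERIV_chain2[OF d\<theta> sqd]] sq that)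
  have le: "?E r \<le> ?T' r - ?P r" if r: "r \<in> {\<rho>..d}" for r
  proof -
    let ?s = "r\<^sup>2"
    define k k' t t' x x' where "k = bump (\<theta> ?s)" and "k' = deriv bump (\<theta> ?s)" and "t = \<theta> ?s" and "t' = \<theta>' ?s"
      and "x = b ?s" and "x' = b' ?s"
    note defs = k_def k'_def t_def t'_def x_def x'_def
    have r0: "0 < r" using r \<rho> by simp
    note s = sq[OF r]
    have "(\<phi> has_real_derivative k' * t' * x + k * x') (at ?s)"
      unfolding \<phi>_def[abs_def] defs by (rule DERIV_cong[OF DERIV_mult[OF dk[OF s] db]]) (simp add: algebra_simps)
    then have "?E r = 4 * r ^ 3 * (k' * t' * x + k * x')\<^sup>2 - (real 10 - 2) * (10 - real 10) / 4 * (\<phi> ?s)\<^sup>2 / r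
        - h * r * (\<phi> ?s)\<^sup>2 - 2 * (real 10 - 2) * r * \<phi> ?s * (k' * t' * x + k * x')"
      by (intro energy_density_substitution[where I="{0<..<1}"]) (use r0 s in \<open>auto simp: g_def\<close>)
    also have "\<phi> ?s = k * x" by (simp add: \<phi>_def defs)
    finally have E: "?E r = 4 * r ^ 3 * (k' * t' * x + k * x')\<^sup>2 - h * r * (k * x)\<^sup>2 - 16 * r * (k * x) * (k' * t' * x + k * x')"
      by simp
    have S'r: "S' ?s = 4 * ?s * k * (k' * t') * x * x' + 2 * ?s * k\<^sup>2 * x'\<^sup>2 - bes_zero * k\<^sup>2 * x\<^sup>2 / 2
        - 8 * k * (k' * t') * x\<^sup>2 - 8 * k\<^sup>2 * x * x'"
      by (simp add: S'_def defs)
    \<comment> \<open>Ground state representation: besides the exact derivative and the gain, only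
      the term quadratic in the derivative k' of the cut-off is left.\<close>
    have split: "?E r = S' ?s * (2 * r) - (h - bes_zero) * (r * k\<^sup>2 * x\<^sup>2) + 4 * r ^ 3 * k'\<^sup>2 * t'\<^sup>2 * x\<^sup>2"
      unfolding E S'r by (simp add: algebra_simps power2_eq_square power3_eq_cube)
    have t'0: "0 \<le> t'" using s \<epsilon> by (simp add: t'_def \<theta>'_def)
    have x2: "?s * t' * x\<^sup>2 \<le> \<epsilon> * C\<^sup>2"
    proof -
      have "\<bar>x\<bar> \<le> C * (1 - ?s)" using C(2)[of ?s] s by (simp add: x_def)
      then have "x\<^sup>2 \<le> (C * (1 - ?s))\<^sup>2" using abs_le_square_iff[of x "C * (1 - ?s)"] by linarith
      then have "?s * t' * x\<^sup>2 \<le> ?s * t' * (C * (1 - ?s))\<^sup>2" using s t'0 by (intro mult_left_mono) auto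
      also have "\<dots> = \<epsilon> * C\<^sup>2 * ((1 - ?s)\<^sup>2 + ?s)"
      proof -
        have "?s * t' * (1 - ?s)\<^sup>2 = \<epsilon> * ((1 - ?s)\<^sup>2 + ?s)" using s unfolding t'_def \<theta>'_def
          by (simp add: divide_simps)
        moreover have "?s * t' * (C * (1 - ?s))\<^sup>2 = C\<^sup>2 * (?s * t' * (1 - ?s)\<^sup>2)" by (simp only: power_mult_distrib mult_ac)
        ultimately show ?thesis by simp
      qed
      also have "\<dots> \<le> \<epsilon> * C\<^sup>2 * 1"
      proof (rule mult_left_mono)
        have "(1 - y)\<^sup>2 + y = 1 - y * (1 - y)" for y :: real by (simp add: power2_eq_square algebra_simps)
        moreover have "0 \<le> ?s * (1 - ?s)" using s by (intro mult_nonneg_nonneg) auto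
        ultimately show "(1 - ?s)\<^sup>2 + ?s \<le> 1" by simp
      qed (use \<epsilon> in simp)
      finally show ?thesis by simp
    qed
    have "4 * r ^ 3 * k'\<^sup>2 * t'\<^sup>2 * x\<^sup>2 = (4 * r * t' * k'\<^sup>2) * (?s * t' * x\<^sup>2)"
      by (simp add: power2_eq_square power3_eq_cube algebra_simps)
    also have "\<dots> \<le> (4 * r * t' * k'\<^sup>2) * (\<epsilon> * C\<^sup>2)" using x2 r0 t'0 by (intro mult_left_mono) auto
    also have "\<dots> = (4 * r * t' * (\<epsilon> * C\<^sup>2)) * k'\<^sup>2" by simp
    also have "\<dots> \<le> (4 * r * t' * (\<epsilon> * C\<^sup>2)) * (L / (1 + t\<^sup>2))"
      using r0 t'0 \<epsilon> L(2)[of t] by (intro mult_left_mono) (auto simp: k'_def t_def)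
    also have "\<dots> = ?K * (inverse (1 + t\<^sup>2) * (t' * (2 * r)))" by (simp add: divide_inverse)
    finally show ?thesis unfolding split by (simp add: defs)
  qed
  have iE: "?E integrable_on {\<rho>..d}" using cE \<rho> d by (intro integrable_continuous_interval continuous_on_subset[OF cE]) auto
  have iP: "?P integrable_on {\<rho>..d}" by (intro integrable_continuous_interval cP)
  have "radial_energy 10 h \<rho> g = integral {\<rho>..d} ?E"
  proof -
    have z: "?E r = 0" if "r \<in> {d..1} - {d}" for r
    proof -
      have "d\<^sup>2 < r\<^sup>2" using that d by (intro power_strict_mono) auto
      then have "c < r\<^sup>2" using d by simp
      then have "deriv g (r\<^sup>2) = 0" "g (r\<^sup>2) = 0" using radial_profile_deriv(5)[OF gp] gp by (auto simp: radial_profile_def)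
      then show ?thesis by simp
    qed
    have "integral {d..1} ?E = integral {d..1} (\<lambda>_. 0)"
      by (rule integral_spike[OF negligible_sing[of d]]) (simp only: z)
    moreover have "integral {\<rho>..d} ?E + integral {d..1} ?E = integral {\<rho>..1} ?E"
      by (rule Henstock_Kurzweil_Integration.integral_combine) (use \<rho>2 d2 d integrable_continuous_interval[OF cE] in auto)
    ultimately show ?thesis by (simp add: radial_energy_def)
  qed
  also have "\<dots> \<le> ?T d - ?T \<rho> - integral {\<rho>..d} ?P"
    by (rule integral_le_boundary[OF _ dT iE iP le]) (use \<rho>2 d2 in auto)
  finally have "radial_energy 10 h \<rho> g \<le> ?T d - ?T \<rho> - integral {\<rho>..d} ?P" .
  moreover have "?T d - ?T \<rho> \<le> ?K * pi"
  proof -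
    have "bump (\<theta> c) = 0" "bump (\<theta> a) = 0" using \<theta>c[of c] \<theta>a[of a] a c by (auto intro!: bump_eq_0)
    then have "S c = 0" "S a = 0" by (simp_all add: S_def)
    then have "?T d - ?T \<rho> = ?K * (arctan (\<theta> c) - arctan (\<theta> a))" using \<rho> d by (simp add: algebra_simps)
    also have "\<dots> \<le> ?K * pi"
      using arctan_ubound[of "\<theta> c"] arctan_lbound[of "\<theta> a"] \<epsilon> L by (intro mult_left_mono) auto
    finally show ?thesis .
  qed
  moreover have "\<delta> \<le> integral {\<rho>..d} ?P"
  proof -
    have "\<delta> = integral {1 / 2..3 / 4} (\<lambda>r::real. (h - bes_zero) * (1 / 2 * (flat (3 / 4))\<^sup>2 * m\<^sup>2))"
      by (simp add: \<delta>_def)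
    also have "\<dots> \<le> integral {1 / 2..3 / 4} ?P"
    proof (rule integral_le)
      show "?P integrable_on {1 / 2..3 / 4}"
        using \<rho>2 d2 by (intro integrable_continuous_interval continuous_on_subset[OF cP]) auto
      fix r :: real assume r: "r \<in> {1 / 2..3 / 4}"
      have s: "1 / 4 \<le> r\<^sup>2" "r\<^sup>2 \<le> 9 / 16"
        using r power_mono[of "1 / 2" r 2] power_mono[of r "3 / 4" 2] by (simp_all add: power2_eq_square)
      have "\<bar>ln (r\<^sup>2) + inverse (1 - r\<^sup>2)\<bar> \<le> 3"
      proof -
        have "ln (r\<^sup>2) \<le> r\<^sup>2 - 1" using r by (intro ln_le_minus_one) auto
        then have "ln (r\<^sup>2) \<le> 0" using s by simp
        moreover have "1 - 1 / r\<^sup>2 \<le> ln (r\<^sup>2)" using ln_le_minus_one[of "1 / r\<^sup>2"] r by (auto simp: ln_div)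
        moreover have "1 / r\<^sup>2 \<le> 4" using s r by (auto simp: divide_simps)
        moreover have "inverse (1 - r\<^sup>2) \<le> 3" "0 \<le> inverse (1 - r\<^sup>2)" using s by (auto simp: field_simps)
        ultimately show ?thesis by linarith
      qed
      then have "\<epsilon> * \<bar>ln (r\<^sup>2) + inverse (1 - r\<^sup>2)\<bar> \<le> 1 / 6 * 3" using \<epsilon> by (intro mult_mono) auto
      then have "\<bar>\<theta> (r\<^sup>2)\<bar> \<le> 1 / 2" using \<epsilon> by (simp add: \<theta>_def abs_mult)
      then have "flat (3 / 4) \<le> bump (\<theta> (r\<^sup>2))" by (rule bump_ge)
      then have "(flat (3 / 4))\<^sup>2 \<le> (bump (\<theta> (r\<^sup>2)))\<^sup>2" by (rule power_mono) (rule flat_bounds)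
      moreover have "m\<^sup>2 \<le> (b (r\<^sup>2))\<^sup>2" using m(2)[OF s] m(1) by (intro power_mono) auto
      ultimately show "(h - bes_zero) * (1 / 2 * (flat (3 / 4))\<^sup>2 * m\<^sup>2) \<le> ?P r"
        using r h by (intro mult_left_mono mult_mono) auto
    qed auto
    also have "\<dots> \<le> integral {\<rho>..d} ?P"
    proof (rule integral_subset_le)
      show "?P integrable_on {1 / 2..3 / 4}"
        using \<rho>2 d2 by (intro integrable_continuous_interval continuous_on_subset[OF cP]) auto
      show "\<forall>r\<in>{\<rho>..d}. 0 \<le> ?P r" using \<rho> h by auto
    qed (use iP \<rho>2 d2 in auto)
    finally show ?thesis .
  qed
  ultimately have "radial_energy 10 h \<rho> g < 0" using \<epsilon>\<delta> by linarith
  moreover have "\<rho> < 1" using \<rho>2 by simp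
  ultimately show thesis using that \<rho> c gp by blast
qed


text \<open>In the variable z = \<epsilon> ln s + const the energy of a bump k(z) is 1/(2
  \<epsilon>) times the integral of 4 \<epsilon>^2 k'^2 - D k^2, up to the term with h; the Hardy
  defect D is positive because N <= 9. For small \<epsilon> this is negative, and translates of the
  bump in z, all placed close to the origin, give as many disjoint profiles as desired.\<close>

lemma negative_profiles:
  fixes n :: nat
  assumes N: "3 \<le> N" "N \<le> 9"
  obtains \<rho> \<sigma> g where "0 < \<rho>" "\<sigma> < 1"
    and "\<And>i. i < n \<Longrightarrow> radial_profile \<rho> \<sigma> (g i)" "\<And>i. i < n \<Longrightarrow> radial_energy N h \<rho> (g i) < 0"
    and "\<And>i j s. i < n \<Longrightarrow> j < n \<Longrightarrow> i \<noteq> j \<Longrightarrow> g i s * g j s = 0"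
    and "\<And>i j s. i < n \<Longrightarrow> j < n \<Longrightarrow> i \<noteq> j \<Longrightarrow> deriv (g i) s * deriv (g j) s = 0"
proof -
  define D where "D = (real N - 2) * (10 - real N) / 4"
  have D: "0 < D" using N by (simp add: D_def)
  \<comment> \<open>For s <= s0 the term with h costs at most half of the Hardy defect D.\<close>
  define s0 where "s0 = min (1 / 2) (D / (2 * (\<bar>h\<bar> + 1)))"
  have "0 < s0" using D by (simp add: s0_def)
  moreover have "s0 \<le> 1 / 2" unfolding s0_def by (rule min.cobounded1)
  ultimately have s0: "0 < s0" "s0 \<le> 1 / 2" by auto
  have hs0: "- h * s \<le> D / 2" if "0 < s" "s \<le> s0" for s
  proof -
    have "s \<le> D / (2 * (\<bar>h\<bar> + 1))" using that(2) unfolding s0_def by linarith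
    then have "s * (2 * (\<bar>h\<bar> + 1)) \<le> D" by (simp add: pos_le_divide_eq)
    moreover have "- h * s \<le> (\<bar>h\<bar> + 1) * s" using that by (intro mult_right_mono) auto
    ultimately show ?thesis by (simp add: algebra_simps)
  qed
  define I K where "I = integral {-1..1} (\<lambda>z. (bump z)\<^sup>2)" and "K = integral {-1..1} (\<lambda>z. (deriv bump z)\<^sup>2)"
  have K: "0 \<le> K" unfolding K_def
    by (intro Henstock_Kurzweil_Integration.integral_nonneg integrable_continuous_interval continuous_intros continuous_on_bump) auto
  have "0 \<le> I" unfolding I_def
    by (intro Henstock_Kurzweil_Integration.integral_nonneg integrable_continuous_interval continuous_intros continuous_on_bump) auto
  moreover have "I \<noteq> 0"
  proof
    assume "I = 0"
    then have "(bump 0)\<^sup>2 = 0"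
      unfolding I_def by (subst (asm) integral_eq_0_iff) (auto intro!: continuous_intros continuous_on_bump)
    then show False using bump_ge[of 0] flat_bounds(3)[of "3 / 4"] by simp
  qed
  ultimately have I: "0 < I" by simp
  \<comment> \<open>Makes 4 \<epsilon>^2 K at most D I/4, half of what the remaining D/2
    yields.\<close>
  define \<epsilon> where "\<epsilon> = sqrt (D * I / (16 * (K + 1)))"
  have \<epsilon>: "0 < \<epsilon>" using D I K by (simp add: \<epsilon>_def)
  have \<epsilon>2: "\<epsilon>\<^sup>2 = D * I / (16 * (K + 1))" using D I K by (simp add: \<epsilon>_def)
  define F where "F z = 4 * \<epsilon>\<^sup>2 * (deriv bump z)\<^sup>2 - D / 2 * (bump z)\<^sup>2" for z
  have cF: "continuous_on S F" for S unfolding F_def by (intro continuous_intros continuous_on_bump)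
  define J where "J = integral {-1..1} F"
  have J: "J < 0"
  proof -
    have "J = 4 * \<epsilon>\<^sup>2 * K - D / 2 * I"
      unfolding J_def F_def K_def I_def
      by (subst Henstock_Kurzweil_Integration.integral_diff)
         (auto intro!: integrable_continuous_interval continuous_intros continuous_on_bump)
    also have "\<dots> \<le> 4 * (D * I / (16 * (K + 1))) * (K + 1) - D / 2 * I"
      unfolding \<epsilon>2 using D I K by (intro diff_right_mono mult_left_mono) auto
    also have "\<dots> = - (D * I / 4)" using K by (simp add: field_simps)
    finally show ?thesis using mult_pos_pos[OF D I] by linarith
  qed
  have JF: "integral {\<alpha>..\<beta>} F = J" if "\<alpha> \<le> - 1" "1 \<le> \<beta>" for \<alpha> \<beta>
  proof (rule integral_unique, rule has_integral_on_superset)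
    show "(F has_integral J) {-1..1}"
      unfolding J_def by (intro integrable_integral integrable_continuous_interval cF)
    show "F z = 0" if "z \<notin> {-1..1}" for z
    proof -
      have "1 \<le> \<bar>z\<bar>" using that by (auto simp: abs_le_iff not_le)
      then show ?thesis by (simp add: F_def bump_eq_0)
    qed
  qed (use that in auto)

  \<comment> \<open>The spacing 3 exceeds the length 2 of the support of \<open>bump\<close>; the
    offset 2 - \<epsilon> ln s0 pushes all supports into s < s0.\<close>
  define c where "c i = 3 * real i + 2 - \<epsilon> * ln s0" for i :: nat
  have els0: "\<epsilon> * ln s0 \<le> 0" using \<epsilon> s0 by (intro mult_nonneg_nonpos) auto
  have c1: "1 \<le> c i" for i using els0 by (simp add: c_def)
  define \<theta> where "\<theta> i s = \<epsilon> * ln s + c i" for i s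
  \<comment> \<open>Solves \<theta> = -1 at s = \<rho>^2 for the index n. Indices i < n have smaller
    offsets, so their bumps vanish for s <= \<rho>^2.\<close>
  define \<rho> where "\<rho> = exp ((- 1 - c n) / (2 * \<epsilon>))"
  have \<rho>: "0 < \<rho>" by (simp add: \<rho>_def)
  have \<rho>1: "\<rho> \<le> 1" using c1[of n] \<epsilon> by (simp add: \<rho>_def divide_nonpos_pos)
  have ln\<rho>: "ln (\<rho>\<^sup>2) = (- 1 - c n) / \<epsilon>" using \<rho> \<epsilon> by (simp add: ln_realpow) (simp add: \<rho>_def field_simps)
  have \<theta>\<rho>: "\<theta> i s \<le> - 1" if "i < n" "0 < s" "s \<le> \<rho>\<^sup>2" for i s
  proof -
    have "ln s \<le> (- 1 - c n) / \<epsilon>" using that ln_mono[of s "\<rho>\<^sup>2"] ln\<rho> by simp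
    then have "\<epsilon> * ln s \<le> - 1 - c n" using \<epsilon> by (simp add: pos_le_divide_eq mult.commute)
    moreover have "c i \<le> c n" using that by (simp add: c_def)
    ultimately show ?thesis by (simp add: \<theta>_def)
  qed
  have \<theta>s0: "1 \<le> \<theta> i s" if "s0 \<le> s" for i s
  proof -
    have "\<epsilon> * ln s0 \<le> \<epsilon> * ln s" using that s0 \<epsilon> by (intro mult_left_mono ln_mono) auto
    then show ?thesis by (simp add: \<theta>_def c_def)
  qed
  define \<phi> where "\<phi> i s = bump (\<theta> i s)" for i s
  define g where "g i s = (if s \<in> {0<..} then exp (- ((real N - 2) / 4 * ln s)) * \<phi> i s else 0)" for i s
  have d\<phi>: "(\<phi> i has_real_derivative deriv bump (\<theta> i s) * (\<epsilon> / s)) (at s)" if "0 < s" for i s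
    unfolding \<phi>_def[abs_def] by (rule DERIV_chain2[OF DERIV_bump]) (use that in \<open>auto simp: \<theta>_def intro!: derivative_eq_intros\<close>)
  have \<phi>0: "\<phi> i s = 0" if "i < n" "0 < s" "s \<le> \<rho>\<^sup>2 \<or> s0 \<le> s" for i s
    using that \<theta>\<rho>[of i s] \<theta>s0[of s i] by (auto simp: \<phi>_def intro!: bump_eq_0)
  have gp: "radial_profile \<rho> s0 (g i)" if i: "i < n" for i
  proof -
    have "Ck_on k UNIV (g i)" for k
      unfolding g_def
    proof (rule Ck_on_extend_zero[where C="{\<rho>\<^sup>2..s0}"])
      have o: "open ({0<..} :: real set)" by simp
      have "Ck_on k {0<..} (\<theta> i)" unfolding \<theta>_def by (intro Ck_on_mult Ck_on_add Ck_on_const o Ck_on_ln)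
      then have 1: "Ck_on k {0<..} (\<phi> i)" unfolding \<phi>_def by (rule Ck_on_compose[OF o open_UNIV _ Ck_on_bump]) simp
      have "Ck_on k {0<..} (\<lambda>s. - ((real N - 2) / 4 * ln s))" by (intro Ck_on_minus Ck_on_mult Ck_on_const o Ck_on_ln)
      then have "Ck_on k {0<..} (\<lambda>s. exp (- ((real N - 2) / 4 * ln s)))"
        by (rule Ck_on_compose[OF o open_UNIV _ Ck_on_exp]) simp
      then show "Ck_on k {0<..} (\<lambda>s. exp (- ((real N - 2) / 4 * ln s)) * \<phi> i s)" by (intro Ck_on_mult o 1)
      show "exp (- ((real N - 2) / 4 * ln s)) * \<phi> i s = 0" if "s \<in> {0<..}" "s \<notin> {\<rho>\<^sup>2..s0}" for s
        using \<phi>0[OF i, of s] that by auto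
      show "{\<rho>\<^sup>2..s0} \<subseteq> {0<..}" using \<rho> by (auto intro: less_le_trans[of 0 "\<rho>\<^sup>2"])
    qed auto
    then show ?thesis unfolding radial_profile_def using \<phi>0[OF i] by (auto simp: g_def)
  qed
  have inactive: "g i s = 0 \<and> deriv (g i) s = 0" if i: "i < n" and s: "s \<le> 0 \<or> 1 \<le> \<bar>\<theta> i s\<bar>" for i s
  proof (cases "0 < s")
    case False
    then have "s < \<rho>\<^sup>2" using \<rho> by (meson linorder_not_less order_le_less_trans zero_less_power)
    then show ?thesis using radial_profile_deriv(4)[OF gp[OF i]] False by (simp add: g_def)
  next
    case True
    then have z: "\<phi> i s = 0" "deriv bump (\<theta> i s) = 0" using s by (auto simp: \<phi>_def bump_eq_0)
    have "((\<lambda>s. exp (- ((real N - 2) / 4 * ln s)) * \<phi> i s) has_real_derivative 0) (at s)"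
      by (rule derivative_eq_intros refl d\<phi> True)+ (simp add: z)
    then have "(g i has_real_derivative 0) (at s)"
      by (rule has_field_derivative_transform_within_open[of _ _ _ "{0<..}"]) (use True in \<open>auto simp: g_def\<close>)
    then show ?thesis using z by (simp add: DERIV_imp_deriv g_def)
  qed
  have disj: "(g i s = 0 \<and> deriv (g i) s = 0) \<or> (g j s = 0 \<and> deriv (g j) s = 0)"
    if "i < n" "j < n" "i \<noteq> j" for i j s
  proof (rule ccontr)
    assume "\<not> ?thesis"
    then have "\<bar>\<theta> i s\<bar> < 1" "\<bar>\<theta> j s\<bar> < 1" using inactive[of i s] inactive[of j s] that by fastforce+
    then have "\<bar>\<theta> i s - \<theta> j s\<bar> < 2" by linarith
    moreover have "\<theta> i s - \<theta> j s = 3 * (real i - real j)" by (simp add: \<theta>_def c_def)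
    ultimately have "3 * \<bar>real i - real j\<bar> < 2" by (simp add: abs_mult)
    moreover have "1 \<le> \<bar>real i - real j\<bar>" using that(3) by linarith
    moreover have False if "3 * d < 2" "1 \<le> d" for d :: real using that by linarith
    ultimately show False by blast
  qed
  have neg: "radial_energy N h \<rho> (g i) < 0" if i: "i < n" for i
  proof -
    let ?E = "\<lambda>r. r ^ (N - 1) * (4 * r\<^sup>2 * (deriv (g i) (r\<^sup>2))\<^sup>2 - (2 * (real N - 2) / r\<^sup>2 + h) * (g i (r\<^sup>2))\<^sup>2)"
    let ?P = "\<lambda>r. - (F (\<theta> i (r\<^sup>2)) / r)"
    let ?T = "\<lambda>r. - ((real N - 2) / 2 * (\<phi> i (r\<^sup>2))\<^sup>2)"
    let ?T' = "\<lambda>r. - (2 * (real N - 2) * \<epsilon> * \<phi> i (r\<^sup>2) * deriv bump (\<theta> i (r\<^sup>2)) / r)"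
    have d\<theta>: "((\<lambda>r. \<theta> i (r\<^sup>2)) has_real_derivative 2 * \<epsilon> / r) (at r)" if "0 < r" for r
      unfolding \<theta>_def using that by (auto intro!: derivative_eq_intros simp: field_simps power2_eq_square)
    have iE: "?E integrable_on {\<rho>..1}"
      using \<rho> by (intro integrable_continuous_interval continuous_intros
          continuous_on_compose2[OF radial_profile_deriv(3)[OF gp[OF i], of UNIV]]
          continuous_on_compose2[OF radial_profile_deriv(2)[OF gp[OF i], of UNIV]]) auto
    have iP: "(?P has_integral - (J / (2 * \<epsilon>))) {\<rho>..1}"
    proof -
      have mono: "\<theta> i (x\<^sup>2) \<le> \<theta> i (y\<^sup>2)" if "\<rho> \<le> x" "x \<le> y" for x y
      proof -
        have "ln (x\<^sup>2) \<le> ln (y\<^sup>2)" using that \<rho> by (intro ln_mono power_mono) auto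
        then show ?thesis using \<epsilon> by (simp add: \<theta>_def)
      qed
      \<comment> \<open>The substitution z = \<theta>(r^2), dz = (2 \<epsilon>/r) dr; the image
        interval contains [-1, 1], so the full integral J appears.\<close>
      have "((\<lambda>r. (2 * \<epsilon> / r) *\<^sub>R F (\<theta> i (r\<^sup>2))) has_integral (integral {\<theta> i (\<rho>\<^sup>2)..\<theta> i (1\<^sup>2)} F)) {\<rho>..1}"
      proof (rule has_integral_substitution[where g="\<lambda>r. \<theta> i (r\<^sup>2)"])
        show "(\<lambda>r. \<theta> i (r\<^sup>2)) ` {\<rho>..1} \<subseteq> {\<theta> i (\<rho>\<^sup>2)..\<theta> i (1\<^sup>2)}" using mono by fastforce
        show "((\<lambda>r. \<theta> i (r\<^sup>2)) has_real_derivative 2 * \<epsilon> / r) (at r within {\<rho>..1})" if "r \<in> {\<rho>..1}" for r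
          using d\<theta>[of r] that \<rho> by (auto intro: has_field_derivative_at_within)
        show "\<theta> i (\<rho>\<^sup>2) \<le> \<theta> i (1\<^sup>2)" by (rule mono[OF order_refl \<rho>1])
      qed (use \<rho>1 cF in auto)
      also have "integral {\<theta> i (\<rho>\<^sup>2)..\<theta> i (1\<^sup>2)} F = J"
        using \<theta>\<rho>[OF i, of "\<rho>\<^sup>2"] \<theta>s0[of 1 i] \<rho> s0 by (intro JF) auto
      finally have "((\<lambda>r. - (1 / (2 * \<epsilon>)) * ((2 * \<epsilon> / r) *\<^sub>R F (\<theta> i (r\<^sup>2)))) has_integral - (1 / (2 * \<epsilon>)) * J) {\<rho>..1}"
        by (rule has_integral_mult_right)
      then show ?thesis using \<epsilon> by simp
    qed
    have "integral {\<rho>..1} ?E \<le> ?T 1 - ?T \<rho> - integral {\<rho>..1} ?P"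
    proof (rule integral_le_boundary[OF \<rho>1 _ iE, where T="?T" and T'="?T'"])
      show "?P integrable_on {\<rho>..1}" using iP by blast
      fix r assume "r \<in> {\<rho>..1}"
      then have r: "0 < r" using \<rho> by simp
      define k k' where "k = \<phi> i (r\<^sup>2)" and "k' = deriv bump (\<theta> i (r\<^sup>2))"
      have "((\<lambda>r. \<phi> i (r\<^sup>2)) has_real_derivative k' * (2 * \<epsilon> / r)) (at r)"
        unfolding \<phi>_def k'_def by (rule DERIV_chain2[OF DERIV_bump d\<theta>[OF r]])
      then show "(?T has_real_derivative ?T' r) (at r)"
        by (auto intro!: derivative_eq_intros simp: k'_def)
      have "?E r = 4 * r ^ 3 * (k' * (\<epsilon> / r\<^sup>2))\<^sup>2 - (real N - 2) * (10 - real N) / 4 * (\<phi> i (r\<^sup>2))\<^sup>2 / r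
          - h * r * (\<phi> i (r\<^sup>2))\<^sup>2 - 2 * (real N - 2) * r * \<phi> i (r\<^sup>2) * (k' * (\<epsilon> / r\<^sup>2))"
        using N r d\<phi>[of "r\<^sup>2" i] by (intro energy_density_substitution[where I="{0<..}"]) (auto simp: g_def k'_def)
      also have "\<dots> = (4 * \<epsilon>\<^sup>2 * k'\<^sup>2 - D * k\<^sup>2 + (- h * r\<^sup>2) * k\<^sup>2) / r + ?T' r"
        using r unfolding D_def k_def[symmetric] k'_def[symmetric] by (simp add: field_simps power2_eq_square power3_eq_cube)
      also have "\<dots> \<le> F (\<theta> i (r\<^sup>2)) / r + ?T' r"
      proof -
        have "(- h * r\<^sup>2) * k\<^sup>2 \<le> D / 2 * k\<^sup>2"
        proof (cases "r\<^sup>2 \<le> s0")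
          case True
          then show ?thesis using r hs0[of "r\<^sup>2"] by (intro mult_right_mono) auto
        next
          case False
          then have "k = 0" using r \<phi>0[OF i, of "r\<^sup>2"] by (simp add: k_def)
          then show ?thesis by simp
        qed
        then have "4 * \<epsilon>\<^sup>2 * k'\<^sup>2 - D * k\<^sup>2 + (- h * r\<^sup>2) * k\<^sup>2 \<le> F (\<theta> i (r\<^sup>2))"
          by (simp add: F_def k_def k'_def \<phi>_def)
        then show ?thesis using r by (simp add: divide_right_mono)
      qed
      finally show "?E r \<le> ?T' r - ?P r" by simp
    qed
    also have "integral {\<rho>..1} ?P = - (J / (2 * \<epsilon>))" using iP by (rule integral_unique)
    finally have "integral {\<rho>..1} ?E \<le> ?T 1 - ?T \<rho> - - (J / (2 * \<epsilon>))" .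
    moreover have "\<phi> i (\<rho>\<^sup>2) = 0" "\<phi> i (1\<^sup>2) = 0" using \<phi>0[OF i] \<rho> s0 by auto
    ultimately have "radial_energy N h \<rho> (g i) \<le> J / (2 * \<epsilon>)" by (simp add: radial_energy_def)
    then show ?thesis using J \<epsilon> by (meson divide_neg_pos le_less_trans mult_pos_pos zero_less_numeral)
  qed
  show thesis
  proof (rule that[of \<rho> s0 g])
    fix i j s assume ij: "i < n" "j < n" "i \<noteq> j"
    show "g i s * g j s = 0" "deriv (g i) s * deriv (g j) s = 0" using disj[OF ij, of s] by auto
  qed (use \<rho> s0 gp neg in auto)
qed

section \<open>The main result\<close>

text \<open>For positivity, write u = k (1 - r^2) - 2 ln r with k = h/(2N) > -1 and use - 2 ln r >=
  1 - r^2. The equation is read off from the formula for the potential at a point of norm r.\<close>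

lemma radial_singular_solution_U_sing:
  assumes N: "DIM('a::euclidean_space) = N" "3 \<le> N" and h: "- 2 * (real N - 2) < h"
  shows "radial_singular_solution (a_coef N h) (lambda_sing N h) (U_sing h :: 'a \<Rightarrow> real)"
proof -
  define k where "k = h / (2 * real N)"
  define u u' u'' where "u r = k - 2 * ln r - k * r\<^sup>2" and "u' r = - 2 / r - 2 * k * r" and "u'' r = 2 / r\<^sup>2 - 2 * k" for r :: real
  have U: "U_sing h x = u (norm x)" for x :: 'a by (simp add: U_sing_def u_def k_def N(1))
  have k: "-1 < k"
  proof -
    have "- (2 * real N) < h" using h by simp
    then show ?thesis using N(2) by (simp add: k_def pos_less_divide_eq)
  qed
  have du: "(u has_real_derivative u' r) (at r within S)" if "0 < r" for r S
    unfolding u_def u'_def using that by (auto intro!: derivative_eq_intros)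
  have du': "(u' has_real_derivative u'' r) (at r within S)" if "0 < r" for r S
    unfolding u'_def u''_def using that by (auto intro!: derivative_eq_intros simp: power2_eq_square)
  have eq: "- (u'' r + (real N - 1) / r * u' r) = lambda_sing N h * a_coef N h r * exp (u r)" if r: "0 < r" for r
  proof -
    obtain b :: 'a where b: "b \<in> Basis" using nonempty_Basis by blast
    then have n: "norm (r *\<^sub>R b) = r" and "r *\<^sub>R b \<noteq> 0" using r by auto
    then have "lambda_sing N h * a_coef N h r * exp (u r) = 2 * (real N - 2) / r\<^sup>2 + h"
      using lambda_a_exp_U[OF N, of "r *\<^sub>R b" h] unfolding U n by simp
    also have "\<dots> = 2 * (real N - 2) / r\<^sup>2 + 2 * real N * k" using N(2) by (simp add: k_def)
    also have "\<dots> = - (u'' r + (real N - 1) / r * u' r)" using r by (simp add: u'_def u''_def field_simps power2_eq_square)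
    finally show ?thesis by simp
  qed
  have pos: "0 < u r" if r: "0 < r" "r < 1" for r
  proof -
    have "r\<^sup>2 < 1" using r by (simp add: power_less_one_iff)
    then have "- (1 - r\<^sup>2) < k * (1 - r\<^sup>2)" using mult_strict_right_mono[OF k, of "1 - r\<^sup>2"] by simp
    moreover have "2 * ln r \<le> r\<^sup>2 - 1" using ln_le_minus_one[of "r\<^sup>2"] r by (simp add: ln_realpow)
    ultimately show ?thesis by (simp add: u_def algebra_simps)
  qed
  have "radial_equation N (lambda_sing N h) (a_coef N h) {0<..1} u"
    unfolding radial_equation_def
  proof (rule exI[of _ u'], rule exI[of _ u''], intro conjI ballI)
    show "continuous_on {0<..1} u''" unfolding u''_def by (intro continuous_intros) auto
  qed (use du du' eq in auto)
  moreover have "0 < lambda_sing N h" using N(2) by (simp add: lambda_sing_def)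
  moreover have "filterlim u at_top (at_right 0)" unfolding u_def[abs_def] by (rule filterlim_minus_ln_at_top)
  ultimately show ?thesis
    unfolding radial_singular_solution_def N(1) using pos U by (intro conjI exI[of _ u]) (auto simp: u_def)
qed

text \<open>A type II diagram would make the linearised form at the singular solution nonnegative on
  functions vanishing at \<rho> and 1, and \<xi>(r) = g(r^2) with the destabilizing profile g
  contradicts this.\<close>

lemma not_type_II:
  assumes h: "-16 < h" "bes_zero < h"
  shows "\<not> type_II 10 (a_coef 10 h)"
proof
  assume t2: "type_II 10 (a_coef 10 h)"
  obtain \<rho> \<sigma> g where \<rho>: "0 < \<rho>" "\<rho> < 1" and \<sigma>: "\<sigma> < 1" and g: "radial_profile \<rho> \<sigma> g" "radial_energy 10 h \<rho> g < 0"
    using destabilizing_profile[OF h(2)] by blast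
  let ?\<xi> = "\<lambda>r. g (r\<^sup>2)" and ?\<xi>' = "\<lambda>r. deriv g (r\<^sup>2) * (2 * r)"
  note D = radial_profile_deriv[OF g(1)]
  have c: "continuous_on {\<rho>..1} ?\<xi>" "continuous_on {\<rho>..1} ?\<xi>'"
    by (intro continuous_intros continuous_on_compose2[OF D(2)[of UNIV]] continuous_on_compose2[OF D(3)[of UNIV]]; simp)+
  have sqd: "((\<lambda>r. r\<^sup>2) has_real_derivative 2 * r) (at r)" for r :: real
    by (auto intro!: derivative_eq_intros)
  have le: "integral {\<rho>..1} (\<lambda>r. r ^ 9 * ((16 / r\<^sup>2 + h) * (?\<xi> r)\<^sup>2)) \<le> integral {\<rho>..1} (\<lambda>r. r ^ 9 * (?\<xi>' r)\<^sup>2)"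
  proof (rule type_II_picone[OF h(1) t2 \<rho> _ c])
    show "(?\<xi> has_real_derivative ?\<xi>' t) (at t)" for t by (rule DERIV_chain2[OF D(1) sqd])
  qed (use g(1) \<sigma> in \<open>auto simp: radial_profile_def\<close>)
  have "radial_energy 10 h \<rho> g = integral {\<rho>..1} (\<lambda>r. r ^ 9 * (?\<xi>' r)\<^sup>2 - r ^ 9 * ((16 / r\<^sup>2 + h) * (?\<xi> r)\<^sup>2))"
    unfolding radial_energy_def by (rule arg_cong[where f="integral {\<rho>..1}"]) (simp add: fun_eq_iff power2_eq_square algebra_simps)
  also have "\<dots> = integral {\<rho>..1} (\<lambda>r. r ^ 9 * (?\<xi>' r)\<^sup>2) - integral {\<rho>..1} (\<lambda>r. r ^ 9 * ((16 / r\<^sup>2 + h) * (?\<xi> r)\<^sup>2))"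
    using \<rho> by (intro Henstock_Kurzweil_Integration.integral_diff integrable_continuous_interval continuous_intros c) auto
  finally show False using le g(2) by linarith
qed

lemma morse_index_pos:
  assumes "DIM('a::euclidean_space) = 10" "bes_zero < h"
  shows "1 \<le> morse_index (lambda_sing 10 h) (a_coef 10 h) (U_sing h :: 'a \<Rightarrow> real)"
proof -
  obtain \<rho> \<sigma> g where "0 < \<rho>" "\<sigma> < 1" "radial_profile \<rho> \<sigma> g" "radial_energy 10 h \<rho> g < 0"
    using destabilizing_profile[OF assms(2)] by blast
  then have "enat 1 \<le> morse_index (lambda_sing 10 h) (a_coef 10 h) (U_sing h :: 'a \<Rightarrow> real)"
    using assms(1) by (intro morse_index_ge_disjoint_profiles[where g="\<lambda>_. g"]) auto
  then show ?thesis by (simp add: one_enat_def)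
qed

lemma morse_index_infinite:
  assumes N: "DIM('a::euclidean_space) = N" "3 \<le> N" "N \<le> 9"
  shows "morse_index (lambda_sing N h) (a_coef N h) (U_sing h :: 'a \<Rightarrow> real) = \<infinity>"
proof -
  have ge: "enat n \<le> morse_index (lambda_sing N h) (a_coef N h) (U_sing h :: 'a \<Rightarrow> real)" for n
  proof -
    obtain \<rho> \<sigma> g where "0 < \<rho>" "\<sigma> < 1"
      and "\<And>i. i < n \<Longrightarrow> radial_profile \<rho> \<sigma> (g i)" "\<And>i. i < n \<Longrightarrow> radial_energy N h \<rho> (g i) < 0"
      and "\<And>i j s. i < n \<Longrightarrow> j < n \<Longrightarrow> i \<noteq> j \<Longrightarrow> g i s * g j s = 0"
      and "\<And>i j s. i < n \<Longrightarrow> j < n \<Longrightarrow> i \<noteq> j \<Longrightarrow> deriv (g i) s * deriv (g j) s = 0"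
      by (rule negative_profiles[OF N(2,3), of n h]) blast
    then show ?thesis by (rule morse_index_ge_disjoint_profiles[OF N(1,2)])
  qed
  show ?thesis
  proof (cases "morse_index (lambda_sing N h) (a_coef N h) (U_sing h :: 'a \<Rightarrow> real)")
    case (enat m)
    then show ?thesis using ge[of "Suc m"] by simp
  qed
qed

theorem theorem1p4:
  fixes N :: nat and h H :: real and U :: "real ^ 'n \<Rightarrow> real"
  assumes "CARD('n) = N" and "3 \<le> N" and "N \<le> 10" and "h > - 2 * (real N - 2)"
  defines "U \<equiv> U_sing h"
    and "H \<equiv> first_dirichlet_eigenvalue (ball 0 1 :: (real ^ 2) set)"
  shows "radial_singular_solution (a_coef N h) (lambda_sing N h) U \<and>
    (N \<le> 9 \<longrightarrow> morse_index (lambda_sing N h) (a_coef N h) U = \<infinity>) \<and>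
    (N = 10 \<and> h \<le> H \<longrightarrow> morse_index (lambda_sing N h) (a_coef N h) U = 0 \<and>
       stable_solution (lambda_sing N h) (a_coef N h) U) \<and>
    (N = 10 \<and> h > H \<longrightarrow> 1 \<le> morse_index (lambda_sing N h) (a_coef N h) U \<and>
       morse_index (lambda_sing N h) (a_coef N h) U < \<infinity>) \<and>
    (N = 10 \<longrightarrow> (type_II N (a_coef N h) \<longleftrightarrow> h \<le> H)) \<and>
    (N = 10 \<longrightarrow> structure_changes_at N (a_coef N) {- 2 * (real N - 2)<..} H)"
proof -
  have N: "DIM(real ^ 'n) = N" using assms(1) by simp
  have H: "H = bes_zero" unfolding H_def by (rule first_dirichlet_eigenvalue_disc) simp
  have type_II: "type_II 10 (a_coef 10 h') \<longleftrightarrow> h' \<le> bes_zero" if "-16 < h'" for h'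
    using type_II_if_stable[OF that] not_type_II[OF that] by (meson not_less)
  have h10: "-16 < h" if "N = 10" using assms(4) that by simp
  have "structure_changes_at 10 (a_coef 10) {-16<..} bes_zero"
    unfolding structure_changes_at_def using type_II bes_zero_pos by auto
  then have "N = 10 \<longrightarrow> structure_changes_at N (a_coef N) {- 2 * (real N - 2)<..} H" by (auto simp: H)
  then show ?thesis
    using radial_singular_solution_U_sing[OF N assms(2,4)] morse_index_infinite[OF N assms(2), of h]
      morse_index_zero[where 'a="real ^ 'n", of h] morse_index_pos[where 'a="real ^ 'n", of h]
      morse_index_finite[where 'a="real ^ 'n", of h] type_II[of h] h10 N
    unfolding U_def H by auto
qed

end
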